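(* The laminations $\mathcal{L}$ in $\mathcal{C}_\pi^\psi$ are described as follows. First, the set $U=R(\mathcal{L})$ can be any (possibly empty) proper open subset of $S^1_\pi$. Next, if $U=\coprod_\alpha I_\alpha$ is the decomposition of $U=R(\mathcal{L})$ into disjoint open intervals (its connected components), then for each $\alpha$ the set of regular objects $X$ of $\mathcal{L}$ with $J(X)\subseteq I_\alpha$ is a sublamination supported by $I_\alpha$, every regular object of $\mathcal{L}$ belongs to one of these sublaminations, and the set of singular objects of $\mathcal{L}$ is as follows: Case 1: if $S^1_\pi\setminus U$ consists of a single point $x$, then $\mathcal{L}$ contains two singular objects at $x$ of opposite sign (a singular pair at $x$) and no other singular objects. Case 2: if $S^1_\pi\setminus U$ consists of exactly two points $x,y$, then $\mathcal{L}$ contains exactly two singular objects, which are either (a) of the same sign, one at each of the points $x,y$, or (b) a singular pair at one of these two points. Case 3: if $S^1_\pi\setminus U$ contains at least three points, then $\mathcal{L}$ contains exactly one singular object at each of the points of $S^1_\pi\setminus U$, all of them have the same sign, and $\mathcal{L}$ contains no other singular objects. Conversely, the sublaminations can be chosen arbitrarily and independently: given any proper open subset $U=\coprod_\alpha I_\alpha$ of $S^1_\pi$, any choice of a sublamination supported by each $I_\alpha$, and any set of singular objects as described in Case 1, 2 or 3 according to the number of points of $S^1_\pi\setminus U$, the union is a lamination of $\mathcal{C}_\pi^\psi$.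
   Context: **The categories.** $R$ is a discrete valuation ring with uniformizer $u$ and residue field $K=R/(u)$ of characteristic $\neq2$. For $0<b\le\pi$ let $\tilde{\mathcal{X}}_b=\{(x,y,\epsilon)\in\mathbb{R}\times\mathbb{R}\times\{+,-\}: |x-y|\le b\}$, with $(x,y,\epsilon)\le(x',y',\epsilon')$ iff $x\le x'$ and $y\le y'$, and automorphism $\sigma(x,y,\epsilon)=(y+\pi,x+\pi,-\epsilon)$. Let $\mathcal{X}_b$ be the set of $\sigma$-orbits, $M(x,y)$ the orbit of $(x,y,+)$ and $M(x,y)'$ the orbit of $(x,y,-)$; thus $M(x,y)'=M(y+\pi,x+\pi)$ and $M(x+2\pi,y+2\pi)=M(x,y)$. For $X,Y,Z\in\mathcal{X}_b$ with representatives $\tilde X,\tilde Y,\tilde Z$ put $c(X,Y,Z)=i+j-k$ where $i,j,k$ are the minimal integers with $\tilde X\le\sigma^i\tilde Y$, $\tilde Y\le\sigma^j\tilde Z$, $\tilde X\le\sigma^k\tilde Z$. Let $\mathcal{F}_b$ be the additive $R$-category of finite direct sums of elements of $\mathcal{X}_b$, where $\mathrm{Hom}(X,Y)=Rf_{XY}$ is free of rank one for $X,Y\in\mathcal{X}_b$ ($f_{XY}$ is the basic morphism), $f_{XX}=\mathrm{id}$ and $f_{YZ}f_{XY}=u^{c(X,Y,Z)}f_{XZ}$. It is known that $\mathcal{F}_b$ has a unique exact structure making it a Frobenius category whose indecomposable projective-injectives are the $M(x,y)$ with $|x-y|=b$. Let $\psi$ be the $R$-linear involution of $\mathcal{F}_b$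 with $\psi M(x,y)=M(x+\pi,y+\pi)$ and $\psi f_{XY}=f_{\psi X,\psi Y}$. Let $\mathcal{F}_b^\psi$ have objects $(X,\xi)$, $\xi:\psi X\to X$ an isomorphism with $\xi\circ\psi\xi=\mathrm{id}$, morphisms $(X,\xi^X)\to(Y,\xi^Y)$ the $f:X\to Y$ with $f\xi^X=\xi^Y\psi f$, and exact sequences those exact in $\mathcal{F}_b$. It is a Frobenius category; its stable category, a triangulated category with shift $[1]$, is $\mathcal{C}_b^\psi$, and $\mathrm{Ext}^1(A,B)=\mathcal{C}_b^\psi(A,B[1])$. **Objects.** $SX=(X\oplus\psi X,\xi)$ with $\xi$ the swap of summands; $E(x,y)=M(x,y-\pi)$; $Z_\epsilon(x)=(M(x,x),\epsilon\zeta)$ for $\epsilon=\pm$, with $\zeta:\psi M(x,x)\to M(x,x)$ the basic isomorphism. The nonzero indecomposable objects of $\mathcal{C}_b^\psi$ are, up to isomorphism, the regular objects $SM(x,y)$ with $0<|x-y|<b$ and the singular objects $Z_\epsilon(x)$ (with sign $\epsilon$). Every regular object of $\mathcal{C}_\pi^\psi$ is isomorphic to some $SE(x,y)$ with $x<y<x+\pi$. **Compatibility.** For $0<b<\pi$, objects $X,Y$ of $\mathcal{C}_b^\psi$ are compatible if $\mathrm{Ext}^1(X,Y)=0=\mathrm{Ext}^1(Y,X)$. Two indecomposable objects of $\mathcal{C}_\pi^\psi$ are compatible if the objects of $\mathcal{C}_b^\psi$ with the same names ($SM(x,y)$ or $Z_\epsilon(x)$) are compatible for all $b<\pi$ sufficiently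 close to $\pi$. **Supports.** $S^1_\pi=\mathbb{R}/\pi\mathbb{Z}$. For a regular object, $J(SE(x,y))\subset S^1_\pi$ is the open interval which is the image of $(x,y)$ if $x<y<x+\pi$, and of $(y,x+2\pi)$ if $x+\pi<y<x+2\pi$. For a singular object, $J(Z_\epsilon(x))$ is the point $x+\pi\mathbb{Z}$; $Z_\epsilon(x)$ is said to be "at" that point. **Laminations.** A lamination in $\mathcal{C}_\pi^\psi$ is a maximal set $\mathcal{L}$ of pairwise compatible nonisomorphic indecomposable objects. $R(\mathcal{L})\subseteq S^1_\pi$ is the union of all $J(X)$ with $X\in\mathcal{L}$ regular. An interval in $S^1_\pi$ is a nonempty connected open proper subset (the image of $(x,y)$ with $x<y\le x+\pi$). A sublamination supported by an interval $I$ is a maximal collection of pairwise compatible nonisomorphic indecomposable regular objects $X$ of $\mathcal{C}_\pi^\psi$ with $J(X)\subseteq I$. Objects are considered up to isomorphism. *)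

theory Defs
  imports "HOL-Analysis.Analysis"
begin

section \<open>Categories, exact structures and stable categories\<close>

text \<open>Hom-sets are only used between objects. A morphism is expected to determine its domain
  and codomain, so that \<open>Comp\<close> and \<open>Add\<close> need no object arguments; \<open>Comp \<C> g f\<close> is
  \<open>g\<close> after \<open>f\<close>.\<close>

record ('o, 'm) addcat =
  Obj :: "'o set"
  Hom :: "'o \<Rightarrow> 'o \<Rightarrow> 'm set"
  Comp :: "'m \<Rightarrow> 'm \<Rightarrow> 'm"
  Ident :: "'o \<Rightarrow> 'm"
  Zero :: "'o \<Rightarrow> 'o \<Rightarrow> 'm"
  Add :: "'m \<Rightarrow> 'm \<Rightarrow> 'm"

definition inverse_pair :: "('o, 'm) addcat \<Rightarrow> 'o \<Rightarrow> 'o \<Rightarrow> 'm \<Rightarrow> 'm \<Rightarrow> bool" where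
  "inverse_pair \<C> X Y f g \<longleftrightarrow> f \<in> Hom \<C> X Y \<and> g \<in> Hom \<C> Y X \<and>
     Comp \<C> g f = Ident \<C> X \<and> Comp \<C> f g = Ident \<C> Y"

definition iso_mor :: "('o, 'm) addcat \<Rightarrow> 'o \<Rightarrow> 'o \<Rightarrow> 'm \<Rightarrow> bool" where
  "iso_mor \<C> X Y f \<longleftrightarrow> (\<exists>g. inverse_pair \<C> X Y f g)"

definition isomorphic :: "('o, 'm) addcat \<Rightarrow> 'o \<Rightarrow> 'o \<Rightarrow> bool" where
  "isomorphic \<C> X Y \<longleftrightarrow> (\<exists>f. iso_mor \<C> X Y f)"

definition zero_object :: "('o, 'm) addcat \<Rightarrow> 'o \<Rightarrow> bool" where
  "zero_object \<C> X \<longleftrightarrow> X \<in> Obj \<C> \<and> Ident \<C> X = Zero \<C> X X"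

definition is_direct_sum :: "('o, 'm) addcat \<Rightarrow> 'o \<Rightarrow> 'o \<Rightarrow> 'o \<Rightarrow> bool" where
  "is_direct_sum \<C> X A B \<longleftrightarrow>
     (\<exists>i1 \<in> Hom \<C> A X. \<exists>i2 \<in> Hom \<C> B X. \<exists>p1 \<in> Hom \<C> X A. \<exists>p2 \<in> Hom \<C> X B.
        Comp \<C> p1 i1 = Ident \<C> A \<and> Comp \<C> p2 i2 = Ident \<C> B \<and>
        Comp \<C> p1 i2 = Zero \<C> B A \<and> Comp \<C> p2 i1 = Zero \<C> A B \<and>
        Add \<C> (Comp \<C> i1 p1) (Comp \<C> i2 p2) = Ident \<C> X)"

definition indecomposable :: "('o, 'm) addcat \<Rightarrow> 'o \<Rightarrow> bool" where
  "indecomposable \<C> X \<longleftrightarrow> X \<in> Obj \<C> \<and> \<not> zero_object \<C> X \<and>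
     (\<forall>A \<in> Obj \<C>. \<forall>B \<in> Obj \<C>. is_direct_sum \<C> X A B \<longrightarrow> zero_object \<C> A \<or> zero_object \<C> B)"

definition kernel_cokernel_pair ::
    "('o, 'm) addcat \<Rightarrow> 'o \<Rightarrow> 'o \<Rightarrow> 'o \<Rightarrow> 'm \<Rightarrow> 'm \<Rightarrow> bool" where
  "kernel_cokernel_pair \<C> A B C i p \<longleftrightarrow>
     i \<in> Hom \<C> A B \<and> p \<in> Hom \<C> B C \<and> Comp \<C> p i = Zero \<C> A C \<and>
     (\<forall>D \<in> Obj \<C>. \<forall>f \<in> Hom \<C> D B. Comp \<C> p f = Zero \<C> D C \<longrightarrow>
        (\<exists>!g. g \<in> Hom \<C> D A \<and> Comp \<C> i g = f)) \<and>
     (\<forall>D \<in> Obj \<C>. \<forall>f \<in> Hom \<C> B D. Comp \<C> f i = Zero \<C> A D \<longrightarrow>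
        (\<exists>!g. g \<in> Hom \<C> C D \<and> Comp \<C> g p = f))"

definition pushout_square ::
    "('o, 'm) addcat \<Rightarrow> 'o \<Rightarrow> 'o \<Rightarrow> 'o \<Rightarrow> 'o \<Rightarrow> 'm \<Rightarrow> 'm \<Rightarrow> 'm \<Rightarrow> 'm \<Rightarrow> bool" where
  "pushout_square \<C> A B A' B' i f i' f' \<longleftrightarrow>
     i \<in> Hom \<C> A B \<and> f \<in> Hom \<C> A A' \<and> i' \<in> Hom \<C> A' B' \<and> f' \<in> Hom \<C> B B' \<and>
     Comp \<C> i' f = Comp \<C> f' i \<and>
     (\<forall>D \<in> Obj \<C>. \<forall>g \<in> Hom \<C> A' D. \<forall>h \<in> Hom \<C> B D. Comp \<C> g f = Comp \<C> h i \<longrightarrow>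
        (\<exists>!k. k \<in> Hom \<C> B' D \<and> Comp \<C> k i' = g \<and> Comp \<C> k f' = h))"

definition pullback_square ::
    "('o, 'm) addcat \<Rightarrow> 'o \<Rightarrow> 'o \<Rightarrow> 'o \<Rightarrow> 'o \<Rightarrow> 'm \<Rightarrow> 'm \<Rightarrow> 'm \<Rightarrow> 'm \<Rightarrow> bool" where
  "pullback_square \<C> B C B' C' p f p' f' \<longleftrightarrow>
     p \<in> Hom \<C> B C \<and> f \<in> Hom \<C> C' C \<and> p' \<in> Hom \<C> B' C' \<and> f' \<in> Hom \<C> B' B \<and>
     Comp \<C> f p' = Comp \<C> p f' \<and>
     (\<forall>D \<in> Obj \<C>. \<forall>g \<in> Hom \<C> D C'. \<forall>h \<in> Hom \<C> D B. Comp \<C> f g = Comp \<C> p h \<longrightarrow>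
        (\<exists>!k. k \<in> Hom \<C> D B' \<and> Comp \<C> p' k = g \<and> Comp \<C> f' k = h))"

definition inflation :: "('m \<times> 'm) set \<Rightarrow> 'm \<Rightarrow> bool" where
  "inflation \<E> i \<longleftrightarrow> (\<exists>p. (i, p) \<in> \<E>)"

definition deflation :: "('m \<times> 'm) set \<Rightarrow> 'm \<Rightarrow> bool" where
  "deflation \<E> p \<longleftrightarrow> (\<exists>i. (i, p) \<in> \<E>)"

text \<open>Quillen's axioms, in the self-dual form of Buehler's survey.\<close>

definition exact_structure :: "('o, 'm) addcat \<Rightarrow> ('m \<times> 'm) set \<Rightarrow> bool" where
  "exact_structure \<C> \<E> \<longleftrightarrow>
     (\<forall>(i, p) \<in> \<E>. \<exists>A \<in> Obj \<C>. \<exists>B \<in> Obj \<C>. \<exists>C \<in> Obj \<C>. kernel_cokernel_pair \<C> A B C i p) \<and>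
     (\<forall>A \<in> Obj \<C>. \<forall>B \<in> Obj \<C>. \<forall>C \<in> Obj \<C>. \<forall>A' \<in> Obj \<C>. \<forall>B' \<in> Obj \<C>. \<forall>C' \<in> Obj \<C>.
        \<forall>i \<in> Hom \<C> A B. \<forall>p \<in> Hom \<C> B C. \<forall>i' \<in> Hom \<C> A' B'. \<forall>p' \<in> Hom \<C> B' C'. \<forall>a b c.
          (i, p) \<in> \<E> \<and> iso_mor \<C> A A' a \<and> iso_mor \<C> B B' b \<and> iso_mor \<C> C C' c \<and>
          Comp \<C> b i = Comp \<C> i' a \<and> Comp \<C> c p = Comp \<C> p' b \<longrightarrow> (i', p') \<in> \<E>) \<and>
     (\<forall>A \<in> Obj \<C>. inflation \<E> (Ident \<C> A) \<and> deflation \<E> (Ident \<C> A)) \<and>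
     (\<forall>A \<in> Obj \<C>. \<forall>B \<in> Obj \<C>. \<forall>C \<in> Obj \<C>. \<forall>f \<in> Hom \<C> A B. \<forall>g \<in> Hom \<C> B C.
        (inflation \<E> f \<and> inflation \<E> g \<longrightarrow> inflation \<E> (Comp \<C> g f)) \<and>
        (deflation \<E> f \<and> deflation \<E> g \<longrightarrow> deflation \<E> (Comp \<C> g f))) \<and>
     (\<forall>A \<in> Obj \<C>. \<forall>B \<in> Obj \<C>. \<forall>A' \<in> Obj \<C>. \<forall>i \<in> Hom \<C> A B. \<forall>f \<in> Hom \<C> A A'.
        inflation \<E> i \<longrightarrow>
        (\<exists>B' \<in> Obj \<C>. \<exists>i' f'. pushout_square \<C> A B A' B' i f i' f' \<and> inflation \<E> i')) \<and>
     (\<forall>B \<in> Obj \<C>. \<forall>C \<in> Obj \<C>. \<forall>C' \<in> Obj \<C>. \<forall>p \<in> Hom \<C> B C. \<forall>f \<in> Hom \<C> C' C.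
        deflation \<E> p \<longrightarrow>
        (\<exists>B' \<in> Obj \<C>. \<exists>p' f'. pullback_square \<C> B C B' C' p f p' f' \<and> deflation \<E> p'))"

definition projective :: "('o, 'm) addcat \<Rightarrow> ('m \<times> 'm) set \<Rightarrow> 'o \<Rightarrow> bool" where
  "projective \<C> \<E> P \<longleftrightarrow> P \<in> Obj \<C> \<and>
     (\<forall>B \<in> Obj \<C>. \<forall>C \<in> Obj \<C>. \<forall>p \<in> Hom \<C> B C. deflation \<E> p \<longrightarrow>
        (\<forall>f \<in> Hom \<C> P C. \<exists>g \<in> Hom \<C> P B. Comp \<C> p g = f))"

definition injective :: "('o, 'm) addcat \<Rightarrow> ('m \<times> 'm) set \<Rightarrow> 'o \<Rightarrow> bool" where
  "injective \<C> \<E> I \<longleftrightarrow> I \<in> Obj \<C> \<and>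
     (\<forall>A \<in> Obj \<C>. \<forall>B \<in> Obj \<C>. \<forall>i \<in> Hom \<C> A B. inflation \<E> i \<longrightarrow>
        (\<forall>f \<in> Hom \<C> A I. \<exists>g \<in> Hom \<C> B I. Comp \<C> g i = f))"

definition frobenius :: "('o, 'm) addcat \<Rightarrow> ('m \<times> 'm) set \<Rightarrow> bool" where
  "frobenius \<C> \<E> \<longleftrightarrow> exact_structure \<C> \<E> \<and>
     (\<forall>A \<in> Obj \<C>. \<exists>P. projective \<C> \<E> P \<and> (\<exists>p \<in> Hom \<C> P A. deflation \<E> p)) \<and>
     (\<forall>A \<in> Obj \<C>. \<exists>I. injective \<C> \<E> I \<and> (\<exists>i \<in> Hom \<C> A I. inflation \<E> i)) \<and>
     (\<forall>A \<in> Obj \<C>. projective \<C> \<E> A \<longleftrightarrow> injective \<C> \<E> A)"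

definition null_mors :: "('o, 'm) addcat \<Rightarrow> ('m \<times> 'm) set \<Rightarrow> 'o \<Rightarrow> 'o \<Rightarrow> 'm set" where
  "null_mors \<C> \<E> X Y = {Comp \<C> g f |f g P.
     projective \<C> \<E> P \<and> injective \<C> \<E> P \<and> f \<in> Hom \<C> X P \<and> g \<in> Hom \<C> P Y}"

definition stable_class :: "('o, 'm) addcat \<Rightarrow> ('m \<times> 'm) set \<Rightarrow> 'm \<Rightarrow> 'm set" where
  "stable_class \<C> \<E> f = {Add \<C> f h |h X Y.
     X \<in> Obj \<C> \<and> Y \<in> Obj \<C> \<and> f \<in> Hom \<C> X Y \<and> h \<in> null_mors \<C> \<E> X Y}"

text \<open>The quotient by the ideal of null morphisms: a morphism is a coset. \<open>Comp\<close> and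
  \<open>Add\<close> are the union of the cosets obtained from all choices of representatives.\<close>

definition stable_category :: "('o, 'm) addcat \<Rightarrow> ('m \<times> 'm) set \<Rightarrow> ('o, 'm set) addcat" where
  "stable_category \<C> \<E> =
     \<lparr> Obj = Obj \<C>,
       Hom = (\<lambda>X Y. stable_class \<C> \<E> ` Hom \<C> X Y),
       Comp = (\<lambda>G F. \<Union>g\<in>G. \<Union>f\<in>F. stable_class \<C> \<E> (Comp \<C> g f)),
       Ident = (\<lambda>X. stable_class \<C> \<E> (Ident \<C> X)),
       Zero = (\<lambda>X Y. stable_class \<C> \<E> (Zero \<C> X Y)),
       Add = (\<lambda>G F. \<Union>g\<in>G. \<Union>f\<in>F. stable_class \<C> \<E> (Add \<C> g f)) \<rparr>"

text \<open>The shift of the triangulated structure: \<open>B[1]\<close> is the cokernel of a chosen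
  inflation of \<open>B\<close> into an injective object.\<close>

definition shift :: "('o, 'm) addcat \<Rightarrow> ('m \<times> 'm) set \<Rightarrow> 'o \<Rightarrow> 'o" where
  "shift \<C> \<E> B = (SOME C. C \<in> Obj \<C> \<and>
     (\<exists>I. injective \<C> \<E> I \<and> (\<exists>i \<in> Hom \<C> B I. \<exists>p \<in> Hom \<C> I C. (i, p) \<in> \<E>)))"

definition Ext1 :: "('o, 'm) addcat \<Rightarrow> ('m \<times> 'm) set \<Rightarrow> 'o \<Rightarrow> 'o \<Rightarrow> 'm set set" where
  "Ext1 \<C> \<E> A B = Hom (stable_category \<C> \<E>) A (shift \<C> \<E> B)"

definition Ext1_vanishes :: "('o, 'm) addcat \<Rightarrow> ('m \<times> 'm) set \<Rightarrow> 'o \<Rightarrow> 'o \<Rightarrow> bool" where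
  "Ext1_vanishes \<C> \<E> A B \<longleftrightarrow> Ext1 \<C> \<E> A B = {Zero (stable_category \<C> \<E>) A (shift \<C> \<E> B)}"


section \<open>Discrete valuation rings\<close>

text \<open>A local principal ideal domain that is not a field, whose maximal ideal is generated
  by \<open>u\<close>.\<close>

definition dvr_uniformizer :: "'r::idom \<Rightarrow> bool" where
  "dvr_uniformizer u \<longleftrightarrow>
     (\<forall>I::'r set. 0 \<in> I \<and> (\<forall>a\<in>I. \<forall>b\<in>I. a + b \<in> I) \<and> (\<forall>a\<in>I. \<forall>r. r * a \<in> I) \<longrightarrow>
        (\<exists>a. I = {r * a |r. True})) \<and>
     u \<noteq> 0 \<and> \<not> u dvd 1 \<and> (\<forall>x. x dvd 1 \<or> u dvd x)"


section \<open>The category of finite direct sums of orbits\<close>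

text \<open>The sign \<open>+\<close> is \<open>True\<close>.\<close>

type_synonym point = "real \<times> real \<times> bool"

definition strip :: "real \<Rightarrow> point set" where
  "strip b = {(x, y, e). \<bar>x - y\<bar> \<le> b}"

definition point_le :: "point \<Rightarrow> point \<Rightarrow> bool" where
  "point_le = (\<lambda>(x, y, e) (x', y', e'). x \<le> x' \<and> y \<le> y')"

definition sigma :: "point \<Rightarrow> point" where
  "sigma = (\<lambda>(x, y, e). (y + pi, x + pi, \<not> e))"

definition sigma_pow :: "int \<Rightarrow> point \<Rightarrow> point" where
  "sigma_pow i = (if 0 \<le> i then sigma ^^ nat i else inv sigma ^^ nat (- i))"

type_synonym orbit = "point set"

definition orbit_of :: "point \<Rightarrow> orbit" where
  "orbit_of t = range (\<lambda>i. sigma_pow i t)"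

definition orbits :: "real \<Rightarrow> orbit set" where
  "orbits b = orbit_of ` strip b"

definition M :: "real \<Rightarrow> real \<Rightarrow> orbit" where
  "M x y = orbit_of (x, y, True)"

definition rep :: "orbit \<Rightarrow> point" where
  "rep X = (SOME t. t \<in> X)"

definition orbit_deg :: "orbit \<Rightarrow> orbit \<Rightarrow> int" where
  "orbit_deg X Y = (LEAST i. point_le (rep X) (sigma_pow i (rep Y)))"

definition orbit_c :: "orbit \<Rightarrow> orbit \<Rightarrow> orbit \<Rightarrow> int" where
  "orbit_c X Y Z = orbit_deg X Y + orbit_deg Y Z - orbit_deg X Z"

text \<open>A morphism \<open>(X, A, Y)\<close> is the matrix of scalars \<open>A i j\<close>: its component from the
  \<open>j\<close>-th summand \<open>X ! j\<close> to the \<open>i\<close>-th summand \<open>Y ! i\<close> is \<open>A i j\<close> times the basic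
  morphism. Entries outside the matrix are 0, so that morphisms are equal iff their components
  are. The integer \<open>orbit_c\<close> is nonnegative by the triangle inequality for \<open>orbit_deg\<close>.\<close>

type_synonym 'r matr = "nat \<Rightarrow> nat \<Rightarrow> 'r"
type_synonym 'r fmor = "orbit list \<times> 'r matr \<times> orbit list"

definition F_cat :: "'r::idom \<Rightarrow> real \<Rightarrow> (orbit list, 'r fmor) addcat" where
  "F_cat u b =
     \<lparr> Obj = {X. set X \<subseteq> orbits b},
       Hom = (\<lambda>X Y. {(X, A, Y) |A. \<forall>i j. A i j \<noteq> 0 \<longrightarrow> i < length Y \<and> j < length X}),
       Comp = (\<lambda>(Y', B, Z) (X, A, Y).
         (X, \<lambda>i k. \<Sum>j<length Y. B i j * A j k * u ^ nat (orbit_c (X ! k) (Y ! j) (Z ! i)), Z)),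
       Ident = (\<lambda>X. (X, \<lambda>i j. if i = j \<and> i < length X then 1 else 0, X)),
       Zero = (\<lambda>X Y. (X, \<lambda>i j. 0, Y)),
       Add = (\<lambda>(X, A, Y) (X', B, Y'). (X, \<lambda>i j. A i j + B i j, Y)) \<rparr>"

definition F_exact :: "'r::idom \<Rightarrow> real \<Rightarrow> ('r fmor \<times> 'r fmor) set \<Rightarrow> bool" where
  "F_exact u b \<E> \<longleftrightarrow> frobenius (F_cat u b) \<E> \<and>
     (\<forall>X \<in> Obj (F_cat u b).
        indecomposable (F_cat u b) X \<and> projective (F_cat u b) \<E> X \<and> injective (F_cat u b) \<E> X \<longleftrightarrow>
        (\<exists>x y. \<bar>x - y\<bar> = b \<and> isomorphic (F_cat u b) X [M x y]))"


section \<open>The involution and its equivariant objects\<close>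

definition psi_orbit :: "orbit \<Rightarrow> orbit" where
  "psi_orbit X = (\<lambda>(x, y, e). (x + pi, y + pi, e)) ` X"

definition psi_obj :: "orbit list \<Rightarrow> orbit list" where
  "psi_obj X = map psi_orbit X"

definition psi_mor :: "'r fmor \<Rightarrow> 'r fmor" where
  "psi_mor = (\<lambda>(X, A, Y). (psi_obj X, A, psi_obj Y))"

type_synonym 'r pobj = "orbit list \<times> 'r fmor"
type_synonym 'r pmor = "'r pobj \<times> 'r matr \<times> 'r pobj"

definition forget :: "'r pmor \<Rightarrow> 'r fmor" where
  "forget = (\<lambda>(X, A, Y). (fst X, A, fst Y))"

definition Fpsi_cat :: "'r::idom \<Rightarrow> real \<Rightarrow> ('r pobj, 'r pmor) addcat" where
  "Fpsi_cat u b =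
     \<lparr> Obj = {(X, \<xi>). X \<in> Obj (F_cat u b) \<and> iso_mor (F_cat u b) (psi_obj X) X \<xi> \<and>
                Comp (F_cat u b) \<xi> (psi_mor \<xi>) = Ident (F_cat u b) X},
       Hom = (\<lambda>X Y. {(X, A, Y) |A. (fst X, A, fst Y) \<in> Hom (F_cat u b) (fst X) (fst Y) \<and>
                Comp (F_cat u b) (fst X, A, fst Y) (snd X) =
                Comp (F_cat u b) (snd Y) (psi_mor (fst X, A, fst Y))}),
       Comp = (\<lambda>g f. (fst f, fst (snd (Comp (F_cat u b) (forget g) (forget f))), snd (snd g))),
       Ident = (\<lambda>X. (X, fst (snd (Ident (F_cat u b) (fst X))), X)),
       Zero = (\<lambda>X Y. (X, \<lambda>i j. 0, Y)),
       Add = (\<lambda>(X, A, Y) (X', B, Y'). (X, \<lambda>i j. A i j + B i j, Y)) \<rparr>"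

definition Fpsi_exact ::
    "'r::idom \<Rightarrow> real \<Rightarrow> ('r fmor \<times> 'r fmor) set \<Rightarrow> ('r pmor \<times> 'r pmor) set" where
  "Fpsi_exact u b \<E> = {(i, p). (forget i, forget p) \<in> \<E> \<and>
     (\<exists>A \<in> Obj (Fpsi_cat u b). \<exists>B \<in> Obj (Fpsi_cat u b). \<exists>C \<in> Obj (Fpsi_cat u b).
        i \<in> Hom (Fpsi_cat u b) A B \<and> p \<in> Hom (Fpsi_cat u b) B C)}"

text \<open>From here on \<open>E b\<close> is the exact structure of \<open>F_cat u b\<close>.\<close>

type_synonym 'r exacts = "real \<Rightarrow> ('r fmor \<times> 'r fmor) set"

definition Cpsi :: "'r::idom \<Rightarrow> 'r exacts \<Rightarrow> real \<Rightarrow> ('r pobj, 'r pmor set) addcat" where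
  "Cpsi u E b = stable_category (Fpsi_cat u b) (Fpsi_exact u b (E b))"

text \<open>\<open>psi_obj (X @ psi_obj X) = psi_obj X @ X\<close> because \<open>psi_orbit\<close> is an involution on orbits;
  the matrix is the block swap.\<close>

definition S_obj :: "orbit list \<Rightarrow> 'r::idom pobj" where
  "S_obj X = (X @ psi_obj X,
     (psi_obj (X @ psi_obj X),
      \<lambda>i j. if (i < length X \<and> j = i + length X) \<or> (j < length X \<and> i = j + length X) then 1 else 0,
      X @ psi_obj X))"

definition SM :: "real \<Rightarrow> real \<Rightarrow> 'r::idom pobj" where
  "SM x y = S_obj [M x y]"

definition SE :: "real \<Rightarrow> real \<Rightarrow> 'r::idom pobj" where
  "SE x y = SM x (y - pi)"

definition Z_obj :: "bool \<Rightarrow> real \<Rightarrow> 'r::idom pobj" where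
  "Z_obj e x = ([M x x],
     (psi_obj [M x x], \<lambda>i j. if i = 0 \<and> j = 0 then (if e then 1 else - 1) else 0, [M x x]))"


section \<open>Compatibility\<close>

definition compatible_at :: "'r::idom \<Rightarrow> 'r exacts \<Rightarrow> real \<Rightarrow> 'r pobj \<Rightarrow> 'r pobj \<Rightarrow> bool" where
  "compatible_at u E b X Y \<longleftrightarrow>
     Ext1_vanishes (Fpsi_cat u b) (Fpsi_exact u b (E b)) X Y \<and>
     Ext1_vanishes (Fpsi_cat u b) (Fpsi_exact u b (E b)) Y X"

text \<open>The named objects are literally the same for all \<open>b\<close>, and they are objects of
  \<open>Cpsi u E b\<close> as soon as \<open>b\<close> is close enough to \<open>pi\<close>.\<close>

definition named_objects :: "'r::idom pobj set" where
  "named_objects = {SM x y |x y. 0 < \<bar>x - y\<bar> \<and> \<bar>x - y\<bar> < pi} \<union> {Z_obj e x |e x. True}"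

definition compatible :: "'r::idom \<Rightarrow> 'r exacts \<Rightarrow> 'r pobj \<Rightarrow> 'r pobj \<Rightarrow> bool" where
  "compatible u E X Y \<longleftrightarrow>
     (\<exists>X' \<in> named_objects. \<exists>Y' \<in> named_objects.
        isomorphic (Cpsi u E pi) X X' \<and> isomorphic (Cpsi u E pi) Y Y' \<and>
        (\<forall>\<^sub>F b in at_left pi. compatible_at u E b X' Y'))"

definition regular :: "'r::idom \<Rightarrow> 'r exacts \<Rightarrow> 'r pobj \<Rightarrow> bool" where
  "regular u E X \<longleftrightarrow> X \<in> Obj (Cpsi u E pi) \<and>
     (\<exists>x y. 0 < \<bar>x - y\<bar> \<and> \<bar>x - y\<bar> < pi \<and> isomorphic (Cpsi u E pi) X (SM x y))"


section \<open>The circle of circumference pi, and supports\<close>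

definition circ :: "real \<Rightarrow> real set" where
  "circ x = range (\<lambda>k::int. x + of_int k * pi)"

definition S1 :: "real set topology" where
  "S1 = topology (\<lambda>U. U \<subseteq> range circ \<and> open (circ -` U))"

lemma openin_S1: "openin S1 U \<longleftrightarrow> U \<subseteq> range circ \<and> open (circ -` U)"
proof -
  have "istopology (\<lambda>U. U \<subseteq> range circ \<and> open (circ -` U))"
    unfolding istopology_def
  proof (rule conjI; intro allI impI)
    fix S T :: "real set set"
    assume "S \<subseteq> range circ \<and> open (circ -` S)" "T \<subseteq> range circ \<and> open (circ -` T)"
    then show "S \<inter> T \<subseteq> range circ \<and> open (circ -` (S \<inter> T))"
      by (simp add: le_infI1 open_Int)
  next
    fix \<K> :: "real set set set"
    assume *: "\<forall>K\<in>\<K>. K \<subseteq> range circ \<and> open (circ -` K)"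
    then have "open (\<Union>K\<in>\<K>. circ -` K)"
      by (intro open_UN) simp
    with * show "\<Union>\<K> \<subseteq> range circ \<and> open (circ -` \<Union>\<K>)"
      by (simp add: vimage_Union Sup_le_iff)
  qed
  then show ?thesis
    by (simp only: S1_def topology_inverse')
qed

lemma topspace_S1: "topspace S1 = range circ"
proof
  show "topspace S1 \<subseteq> range circ"
    using openin_S1 openin_topspace by blast
  have "circ -` range circ = UNIV"
    by blast
  then have "openin S1 (range circ)"
    by (simp only: openin_S1 open_UNIV order_refl simp_thms)
  then show "range circ \<subseteq> topspace S1"
    by (rule openin_subset)
qed

definition circle_interval :: "real set set \<Rightarrow> bool" where
  "circle_interval I \<longleftrightarrow> I \<noteq> {} \<and> I \<noteq> topspace S1 \<and> openin S1 I \<and> connectedin S1 I"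

definition supp :: "'r::idom \<Rightarrow> 'r exacts \<Rightarrow> 'r pobj \<Rightarrow> real set set" where
  "supp u E X = (THE J. \<exists>x y. isomorphic (Cpsi u E pi) X (SE x y) \<and>
     (x < y \<and> y < x + pi \<and> J = circ ` {x<..<y} \<or>
      x + pi < y \<and> y < x + 2 * pi \<and> J = circ ` {y<..<x + 2 * pi}))"

text \<open>\<open>singular_at u E e p X\<close>: \<open>X\<close> is a singular object of sign \<open>e\<close> at the point \<open>p\<close>.\<close>

definition singular_at :: "'r::idom \<Rightarrow> 'r exacts \<Rightarrow> bool \<Rightarrow> real set \<Rightarrow> 'r pobj \<Rightarrow> bool" where
  "singular_at u E e p X \<longleftrightarrow> X \<in> Obj (Cpsi u E pi) \<and>
     (\<exists>x. p = circ x \<and> isomorphic (Cpsi u E pi) X (Z_obj e x))"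

definition singular_pair_at :: "'r::idom \<Rightarrow> 'r exacts \<Rightarrow> real set \<Rightarrow> 'r pobj set \<Rightarrow> bool" where
  "singular_pair_at u E p T \<longleftrightarrow>
     (\<exists>A B. singular_at u E True p A \<and> singular_at u E False p B \<and> T = {A, B})"


section \<open>Laminations\<close>

definition compatible_family :: "'r::idom \<Rightarrow> 'r exacts \<Rightarrow> 'r pobj set \<Rightarrow> bool" where
  "compatible_family u E L \<longleftrightarrow>
     (\<forall>X \<in> L. indecomposable (Cpsi u E pi) X) \<and>
     pairwise (\<lambda>X Y. compatible u E X Y \<and> \<not> isomorphic (Cpsi u E pi) X Y) L"

definition lamination :: "'r::idom \<Rightarrow> 'r exacts \<Rightarrow> 'r pobj set \<Rightarrow> bool" where
  "lamination u E L \<longleftrightarrow> compatible_family u E L \<and>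
     (\<forall>L'. compatible_family u E L' \<and> L \<subseteq> L' \<longrightarrow> L' = L)"

definition regular_objects_in :: "'r::idom \<Rightarrow> 'r exacts \<Rightarrow> real set set \<Rightarrow> 'r pobj set" where
  "regular_objects_in u E I = {X. regular u E X \<and> supp u E X \<subseteq> I}"

definition sublamination ::
    "'r::idom \<Rightarrow> 'r exacts \<Rightarrow> real set set \<Rightarrow> 'r pobj set \<Rightarrow> bool" where
  "sublamination u E I T \<longleftrightarrow> circle_interval I \<and>
     compatible_family u E T \<and> T \<subseteq> regular_objects_in u E I \<and>
     (\<forall>T'. compatible_family u E T' \<and> T' \<subseteq> regular_objects_in u E I \<and> T \<subseteq> T' \<longrightarrow> T' = T)"

definition reg_support :: "'r::idom \<Rightarrow> 'r exacts \<Rightarrow> 'r pobj set \<Rightarrow> real set set" where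
  "reg_support u E L = (\<Union>X \<in> {X \<in> L. regular u E X}. supp u E X)"

definition singular_part :: "'r::idom \<Rightarrow> 'r exacts \<Rightarrow> 'r pobj set \<Rightarrow> 'r pobj set" where
  "singular_part u E L = {X \<in> L. \<exists>e p. singular_at u E e p X}"

definition components_S1 :: "real set set \<Rightarrow> real set set set" where
  "components_S1 U = connected_components_of (subtopology S1 U)"

text \<open>The three cases for the set \<open>T\<close> of singular objects, where \<open>P\<close> is the complement of
  the union of the supports of the regular objects.\<close>

definition singular_cases ::
    "'r::idom \<Rightarrow> 'r exacts \<Rightarrow> real set set \<Rightarrow> 'r pobj set \<Rightarrow> bool" where
  "singular_cases u E P T \<longleftrightarrow>
     (\<forall>x. P = {x} \<longrightarrow> singular_pair_at u E x T) \<and>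
     (\<forall>x y. P = {x, y} \<and> x \<noteq> y \<longrightarrow>
        (\<exists>e A B. singular_at u E e x A \<and> singular_at u E e y B \<and> T = {A, B}) \<or>
        singular_pair_at u E x T \<or> singular_pair_at u E y T) \<and>
     ((\<exists>x \<in> P. \<exists>y \<in> P. \<exists>z \<in> P. x \<noteq> y \<and> y \<noteq> z \<and> x \<noteq> z) \<longrightarrow>
        (\<forall>p \<in> P. \<exists>!X. X \<in> T \<and> (\<exists>e. singular_at u E e p X)) \<and>
        (\<exists>e. \<forall>X \<in> T. \<exists>p \<in> P. singular_at u E e p X))"

end

theory Submission
  imports Defs
begin

text \<open>The degrees \<open>orbit_deg\<close> can be normalized so that they are nonnegative and invariant under
  \<open>psi\<close>. Multiplying every entry of a morphism by the corresponding power of \<open>u\<close> then turns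
  composition into plain matrix multiplication and \<open>psi\<close> into the identity on matrices, so that an
  equivariant object is a matrix \<open>x\<close> with \<open>x * x = 1\<close> and an equivariant map is one that intertwines
  two such matrices. Since 2 is invertible, averaging reduces questions about equivariant maps to
  maps. \<open>Ext\<close> is read off from explicit injective copresentations \<open>X \<rightarrow> I \<oplus> I' \<rightarrow> C\<close> of the orbits,
  and the resulting inequalities have a limit as \<open>b \<rightarrow> pi\<close>: regular objects are open arcs of length
  less than \<open>pi\<close> on the circle, compatible iff no lifts of them cross; a singular object is compatible
  with an arc iff it does not lie on it, and two singular objects are compatible iff they have the
  same sign or lie at the same point.

  It remains to study maximal families of noncrossing arcs and signed points. The arcs cannot cover
  the circle: by compactness some arc would contain an interval of length \<open>pi\<close>. Hence the union of
  the arcs consists of gaps between uncovered points, and by maximality the singular objects either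
  all have one sign and fill the uncovered points, or are the two at a single point, in which case
  there is at most one other uncovered point.\<close>

section \<open>Finitely supported matrices\<close>

text \<open>The exact structure is given by axioms only, so its conflations are not known. What is
  known is which orbits are projective-injective: those on the boundary |x - y| = b of the strip. No
  nonsplit conflation is ever computed. The arguments use that maps into sums of boundary orbits
  extend along inflations, and that a map is stably zero iff it factors through such a sum, which is
  a question about exponents of u in its entries. The explicit copresentations are never identified
  as conflations either; they are compared with the unknown conflation that defines the shift, by
  maps that are mutually inverse up to such factorizations.

  Different values of b serve different purposes. The classification of indecomposable objects and
  their isomorphisms are used at b = pi, whereas Ext is computed for b < pi, where all degrees in
  the relevant rectangles are zero.

  A lamination is a set of objects, not of isomorphism classes. It is encoded by the set of all
  lifts of its arcs and signed points to the real line. Compatibility and maximality then become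
  properties of two periodic sets, with no reference to the category.\<close>

text \<open>Padding with zeros makes the matrices of all sizes one ring without unit, in which
  \<open>idm n\<close> is the identity of size \<open>n\<close>.\<close>

typedef (overloaded) 'a fm = "{A :: nat \<Rightarrow> nat \<Rightarrow> 'a::zero. \<exists>N. \<forall>i j. A i j \<noteq> 0 \<longrightarrow> i < N \<and> j < N}"
  morphisms ent Abs_fm
  by (rule exI[of _ "\<lambda>_ _. 0"]) simp

lemma fm_eqI: "(\<And>i j. ent A i j = ent B i j) \<Longrightarrow> A = B"
  by (metis ent_inject ext)

lemma ent_bound: "\<exists>N. \<forall>i j. N \<le> i \<or> N \<le> j \<longrightarrow> ent A i j = 0"
proof -
  obtain N where "\<forall>i j. ent A i j \<noteq> 0 \<longrightarrow> i < N \<and> j < N"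
    using ent[of A] by auto
  then show ?thesis by (intro exI[of _ N]) (auto simp: not_le[symmetric])
qed

lemma ent_Abs:
  assumes "\<And>i j. N \<le> i \<or> N \<le> j \<Longrightarrow> A i j = 0"
  shows "ent (Abs_fm A) = A"
  by (rule Abs_fm_inverse) (use assms in \<open>auto simp: not_le[symmetric]\<close>)

instantiation fm :: (ring) ring
begin

definition zero_fm :: "'a fm" where "zero_fm = Abs_fm (\<lambda>_ _. 0)"
definition plus_fm :: "'a fm \<Rightarrow> 'a fm \<Rightarrow> 'a fm"
  where "plus_fm A B = Abs_fm (\<lambda>i j. ent A i j + ent B i j)"
definition minus_fm :: "'a fm \<Rightarrow> 'a fm \<Rightarrow> 'a fm"
  where "minus_fm A B = Abs_fm (\<lambda>i j. ent A i j - ent B i j)"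
definition uminus_fm :: "'a fm \<Rightarrow> 'a fm"
  where "uminus_fm A = Abs_fm (\<lambda>i j. - ent A i j)"
text \<open>The sum runs over the finite support of row i of A, so the product does not refer to
  sizes; \<open>ent_mult\<close> replaces the support by any sufficient initial segment.\<close>

definition times_fm :: "'a fm \<Rightarrow> 'a fm \<Rightarrow> 'a fm"
  where "times_fm A B = Abs_fm (\<lambda>i k. \<Sum>j | ent A i j \<noteq> 0. ent A i j * ent B j k)"

lemma ent_zero: "ent 0 i j = (0::'a::ring)"
  unfolding zero_fm_def by (subst ent_Abs[of 0]) auto

lemma ent_add: "ent (A + B) i j = ent A i j + (ent B i j :: 'a)"
proof -
  obtain N N' where "\<forall>i j. N \<le> i \<or> N \<le> j \<longrightarrow> ent A i j = 0" "\<forall>i j. N' \<le> i \<or> N' \<le> j \<longrightarrow> ent B i j = 0"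
    using ent_bound by metis
  then show ?thesis unfolding plus_fm_def by (subst ent_Abs[of "max N N'"]) auto
qed

lemma ent_diff: "ent (A - B) i j = ent A i j - (ent B i j :: 'a)"
proof -
  obtain N N' where "\<forall>i j. N \<le> i \<or> N \<le> j \<longrightarrow> ent A i j = 0" "\<forall>i j. N' \<le> i \<or> N' \<le> j \<longrightarrow> ent B i j = 0"
    using ent_bound by metis
  then show ?thesis unfolding minus_fm_def by (subst ent_Abs[of "max N N'"]) auto
qed

lemma ent_uminus: "ent (- A) i j = - (ent A i j :: 'a)"
proof -
  obtain N where "\<forall>i j. N \<le> i \<or> N \<le> j \<longrightarrow> ent A i j = 0" using ent_bound by metis
  then show ?thesis unfolding uminus_fm_def by (subst ent_Abs[of N]) auto
qed

lemma finite_row: "finite {j. ent A i j \<noteq> (0::'a)}"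
proof -
  obtain N where N: "\<forall>i j. N \<le> i \<or> N \<le> j \<longrightarrow> ent A i j = 0" using ent_bound by metis
  have "{j. ent A i j \<noteq> 0} \<subseteq> {..<N}" using N by (auto simp: not_le[symmetric])
  then show ?thesis by (rule finite_subset) simp
qed

lemma ent_times: "ent (A * B) i k = (\<Sum>j | ent A i j \<noteq> 0. ent A i j * (ent B j k :: 'a))"
proof -
  obtain N N' where "\<forall>i j. N \<le> i \<or> N \<le> j \<longrightarrow> ent A i j = 0" "\<forall>i j. N' \<le> i \<or> N' \<le> j \<longrightarrow> ent B i j = 0"
    using ent_bound by metis
  then show ?thesis unfolding times_fm_def by (subst ent_Abs[of "max N N'"]) auto
qed

lemma ent_mult:
  assumes "\<And>j. n \<le> j \<Longrightarrow> ent A i j * ent B j k = 0"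
  shows "ent (A * B) i k = (\<Sum>j<n. ent A i j * (ent B j k :: 'a))"
proof -
  let ?S = "{j. ent A i j \<noteq> 0} \<union> {..<n}"
  have "ent (A * B) i k = (\<Sum>j\<in>?S. ent A i j * ent B j k)"
    unfolding ent_times by (rule sum.mono_neutral_left) (auto simp: finite_row)
  also have "\<dots> = (\<Sum>j<n. ent A i j * ent B j k)"
    by (rule sum.mono_neutral_right) (use assms in \<open>auto simp: finite_row not_less\<close>)
  finally show ?thesis .
qed

instance
proof
  fix a b c :: "'a fm"
  obtain N where N: "\<And>i j. N \<le> i \<or> N \<le> j \<Longrightarrow> ent a i j = 0" using ent_bound[of a] by metis
  obtain N' where N': "\<And>i j. N' \<le> i \<or> N' \<le> j \<Longrightarrow> ent b i j = 0" using ent_bound[of b] by metis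
  have ab: "ent (a * x) i k = (\<Sum>j<N. ent a i j * ent x j k)" for x i k
    by (rule ent_mult) (simp add: N)
  have bc: "ent (b * x) i k = (\<Sum>j<N'. ent b i j * ent x j k)" for x i k
    by (rule ent_mult) (simp add: N')
  have abc: "ent (a * b * c) i k = (\<Sum>j<N'. ent (a * b) i j * ent c j k)" for i k
    by (rule ent_mult) (simp add: ab N')
  show "a * b * c = a * (b * c)"
    by (rule fm_eqI) (simp only: abc ab bc sum_distrib_left sum_distrib_right mult.assoc, rule sum.swap)
  show "(a + b) * c = a * c + b * c"
  proof (rule fm_eqI)
    fix i k
    have 1: "ent (x * c) i k = (\<Sum>j<max N N'. ent x i j * ent c j k)" if "x \<in> {a, b, a + b}" for x
      by (rule ent_mult) (use that N N' in \<open>auto simp: ent_add\<close>)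
    show "ent ((a + b) * c) i k = ent (a * c + b * c) i k"
      by (simp add: ent_add 1 distrib_right sum.distrib)
  qed
  show "a * (b + c) = a * b + a * c"
    by (rule fm_eqI) (simp add: ab ent_add distrib_left sum.distrib)
  show "a + b + c = a + (b + c)" by (rule fm_eqI) (simp add: ent_add add.assoc)
  show "a + b = b + a" by (rule fm_eqI) (simp add: ent_add add.commute)
  show "0 + a = a" by (rule fm_eqI) (simp add: ent_add ent_zero)
  show "- a + a = 0" by (rule fm_eqI) (simp add: ent_add ent_zero ent_uminus)
  show "a - b = a + - b" by (rule fm_eqI) (simp add: ent_add ent_diff ent_uminus)
qed

end

lemmas ent_simps = ent_zero ent_add ent_diff ent_uminus

lemma ent_sum: "ent (sum f S) i j = (\<Sum>x\<in>S. ent (f x) i j :: 'a::ring)"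
  by (induction S rule: infinite_finite_induct) (simp_all add: ent_simps)

section \<open>Scalar multiples, rectangular blocks and identity matrices\<close>

definition sm :: "'a::comm_ring_1 \<Rightarrow> 'a fm \<Rightarrow> 'a fm" where
  "sm c A = Abs_fm (\<lambda>i j. c * ent A i j)"

lemma ent_sm: "ent (sm c A) i j = c * ent A i j"
proof -
  obtain N where "\<forall>i j. N \<le> i \<or> N \<le> j \<longrightarrow> ent A i j = 0" using ent_bound by metis
  then show ?thesis unfolding sm_def by (subst ent_Abs[of N]) auto
qed

lemma sm_mult_left: "sm c A * B = sm c (A * (B :: 'a::comm_ring_1 fm))"
proof (rule fm_eqI)
  fix i k
  obtain N where N: "\<forall>i j. N \<le> i \<or> N \<le> j \<longrightarrow> ent A i j = 0" using ent_bound by metis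
  have 1: "ent (A * B) i k = (\<Sum>j<N. ent A i j * ent B j k)" by (rule ent_mult) (simp add: N)
  have 2: "ent (sm c A * B) i k = (\<Sum>j<N. ent (sm c A) i j * ent B j k)"
    by (rule ent_mult) (simp add: N ent_sm)
  show "ent (sm c A * B) i k = ent (sm c (A * B)) i k"
    by (simp add: 2 ent_sm 1 sum_distrib_left mult.assoc)
qed

lemma sm_mult_right: "A * sm c B = sm c (A * (B :: 'a::comm_ring_1 fm))"
proof (rule fm_eqI)
  fix i k
  obtain N where N: "\<forall>i j. N \<le> i \<or> N \<le> j \<longrightarrow> ent A i j = 0" using ent_bound by metis
  have 1: "ent (A * X) i k = (\<Sum>j<N. ent A i j * ent X j k)" for X :: "'a fm"
    by (rule ent_mult) (simp add: N)
  show "ent (A * sm c B) i k = ent (sm c (A * B)) i k"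
    by (simp add: ent_sm 1 sum_distrib_left mult_ac)
qed

lemma sm_add: "sm c (A + B) = sm c A + sm c B"
  by (rule fm_eqI) (simp add: ent_sm ent_add distrib_left)

lemma sm_sm: "sm c (sm d A) = sm (c * d) A"
  by (rule fm_eqI) (simp add: ent_sm mult.assoc)

lemma sm_1: "sm 1 A = A"
  by (rule fm_eqI) (simp add: ent_sm)

lemma sm_minus1: "sm (- 1) A = - A"
  by (rule fm_eqI) (simp add: ent_sm ent_simps)

lemma sm_sum_left: "sm (c + d) A = sm c A + sm d A"
  by (rule fm_eqI) (simp add: ent_sm ent_add distrib_right)

definition mk :: "nat \<Rightarrow> nat \<Rightarrow> (nat \<Rightarrow> nat \<Rightarrow> 'a::zero) \<Rightarrow> 'a fm" where
  "mk n m f = Abs_fm (\<lambda>i j. if i < n \<and> j < m then f i j else 0)"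

lemma ent_mk: "ent (mk n m f) i j = (if i < n \<and> j < m then f i j else 0)"
  unfolding mk_def by (subst ent_Abs[of "max n m"]) auto

definition idm :: "nat \<Rightarrow> 'a::zero_neq_one fm" where
  "idm n = mk n n (\<lambda>i j. if i = j then 1 else 0)"

lemma ent_idm: "ent (idm n) i j = (if i < n \<and> i = j then 1 else 0)"
  by (simp add: idm_def ent_mk)

lemma ent_idm_mult: "ent (idm n * A) i j = (if i < n then ent A i j else (0::'a::ring_1))"
proof -
  have "ent (idm n * A) i j = (\<Sum>k<n. ent (idm n) i k * ent A k j)"
    by (rule ent_mult) (auto simp: ent_idm)
  also have "\<dots> = (\<Sum>k<n. if k = i then ent A i j else 0)"
    by (rule sum.cong) (auto simp: ent_idm)
  finally show ?thesis by simp
qed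

lemma ent_mult_idm: "ent (A * idm n) i j = (if j < n then ent A i j else (0::'a::ring_1))"
proof -
  have "ent (A * idm n) i j = (\<Sum>k<n. ent A i k * ent (idm n) k j)"
    by (rule ent_mult) (auto simp: ent_idm)
  also have "\<dots> = (\<Sum>k<n. if k = j then ent A i j else 0)"
    by (rule sum.cong) (auto simp: ent_idm)
  finally show ?thesis by simp
qed

section \<open>Degrees of orbits\<close>

text \<open>The action of the i-th power of \<open>sigma\<close> on the coordinates, without the
  sign: \<open>sigma\<close> swaps them and adds pi, so odd powers swap.\<close>

definition spw :: "int \<Rightarrow> real \<times> real \<Rightarrow> real \<times> real" where
  "spw i p = (if even i then (fst p + of_int i * pi, snd p + of_int i * pi)
              else (snd p + of_int i * pi, fst p + of_int i * pi))"

definition ple :: "real \<times> real \<Rightarrow> real \<times> real \<Rightarrow> bool" where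
  "ple p q \<longleftrightarrow> fst p \<le> fst q \<and> snd p \<le> snd q"

text \<open>The strip for b = pi, the widest one. Each of its points lies below its image under
  \<open>sigma\<close>, so the exponents i with p \<le> \<open>spw i q\<close> form an
  up-set.\<close>

definition wid :: "real \<times> real \<Rightarrow> bool" where
  "wid p \<longleftrightarrow> \<bar>fst p - snd p\<bar> \<le> pi"

definition D :: "real \<times> real \<Rightarrow> real \<times> real \<Rightarrow> int" where
  "D p q = (LEAST i. ple p (spw i q))"

lemma spw_0 [simp]: "spw 0 p = p" by (simp add: spw_def)

lemma spw_add: "spw i (spw j p) = spw (i + j) p"
  by (auto simp: spw_def algebra_simps)

lemma ple_spw [simp]: "ple (spw i p) (spw i q) \<longleftrightarrow> ple p q"
  by (auto simp: spw_def ple_def)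

lemma ple_refl [simp]: "ple p p" by (simp add: ple_def)

lemma ple_trans: "ple p q \<Longrightarrow> ple q r \<Longrightarrow> ple p r" by (auto simp: ple_def)

lemma ple_antisym: "ple p q \<Longrightarrow> ple q p \<Longrightarrow> p = q" by (auto simp: ple_def prod_eq_iff)

lemma wid_spw [simp]: "wid (spw i p) \<longleftrightarrow> wid p"
  by (auto simp: wid_def spw_def)

lemma ple_spw_mono:
  assumes "wid q" "i \<le> j" shows "ple (spw i q) (spw j q)"
proof -
  have "ple q (spw n q)" if "0 \<le> n" for n
  proof (cases "even n")
    case True with that show ?thesis by (simp add: ple_def spw_def)
  next
    case False
    then have "1 \<le> n" using that by (cases "n = 0") auto
    then have n: "pi \<le> of_int n * pi" by simp
    have "fst q \<le> snd q + of_int n * pi" "snd q \<le> fst q + of_int n * pi"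
      using n assms(1) unfolding wid_def by linarith+
    then show ?thesis using False by (simp add: ple_def spw_def)
  qed
  from this[of "j - i"] assms have "ple (spw i q) (spw i (spw (j - i) q))" by simp
  then show ?thesis by (simp add: spw_add)
qed

text \<open>The integers are not well-ordered, so LEAST needs the lower bound L; shifting by L moves
  the question to the naturals.\<close>

lemma int_least_ex:
  fixes P :: "int \<Rightarrow> bool"
  assumes "P m" "\<And>i. P i \<Longrightarrow> L \<le> i"
  shows "P (LEAST i. P i) \<and> (\<forall>i. P i \<longrightarrow> (LEAST i. P i) \<le> i)"
proof -
  define Q where "Q n = P (L + int n)" for n :: nat
  have "Q (nat (m - L))" using assms by (simp add: Q_def)
  then have Q: "Q (LEAST n. Q n)" "\<And>n. Q n \<Longrightarrow> (LEAST n. Q n) \<le> n"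
    by (auto intro: LeastI Least_le)
  let ?l = "L + int (LEAST n. Q n)"
  have "P ?l" using Q(1) by (simp add: Q_def)
  moreover have "?l \<le> i" if "P i" for i
  proof -
    have "Q (nat (i - L))" using that assms(2)[OF that] by (simp add: Q_def)
    from Q(2)[OF this] show ?thesis using assms(2)[OF that] by linarith
  qed
  ultimately have "(LEAST i. P i) = ?l" by (intro Least_equality) auto
  with \<open>P ?l\<close> \<open>\<And>i. P i \<Longrightarrow> ?l \<le> i\<close> show ?thesis by simp
qed

text \<open>Each power of \<open>sigma\<close> raises the coordinate sum by 2 pi, which bounds i
  from below, and large even powers exceed p. As the admissible exponents form an up-set, this
  equivalence determines \<open>D\<close>; the triangle inequality and the behaviour under shifts
  are read off from it.\<close>

lemma D_le_iff:
  assumes "wid q" shows "D p q \<le> i \<longleftrightarrow> ple p (spw i q)"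
proof -
  let ?P = "\<lambda>i. ple p (spw i q)"
  let ?s = "(fst p + snd p - fst q - snd q) / (2 * pi)"
  have lb: "\<lceil>?s\<rceil> \<le> i" if "?P i" for i
  proof -
    have "fst p + snd p \<le> fst q + snd q + 2 * (of_int i * pi)"
      using that by (auto simp: ple_def spw_def split: if_splits)
    then have "?s \<le> of_int i" by (simp add: field_simps)
    then show ?thesis by (simp add: ceiling_le_iff)
  qed
  obtain n where "max (fst p - fst q) (snd p - snd q) < real n * (2 * pi)"
    using reals_Archimedean3[of "2 * pi"] by (meson pi_gt_zero zero_less_mult_iff zero_less_numeral)
  then have "fst p - fst q \<le> of_int (2 * int n) * pi" "snd p - snd q \<le> of_int (2 * int n) * pi"
    by simp_all
  then have "?P (2 * int n)" by (simp add: ple_def spw_def)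
  from int_least_ex[of ?P, OF this lb] have *: "?P (D p q)" "\<And>i. ?P i \<Longrightarrow> D p q \<le> i"
    by (auto simp: D_def)
  show ?thesis
    using *(2) ple_trans[OF *(1) ple_spw_mono[OF assms]] by blast
qed

lemma D_ple: "wid q \<Longrightarrow> ple p (spw (D p q) q)"
  using D_le_iff[of q p "D p q"] by simp

lemma D_eqI:
  assumes "wid q" "\<And>i. ple p (spw i q) \<longleftrightarrow> k \<le> i" shows "D p q = k"
  using assms D_le_iff[of q p] by (metis order_antisym order_refl)

lemma D_triangle:
  assumes "wid q" "wid r" shows "D p r \<le> D p q + D q r"
proof -
  have "ple (spw (D p q) q) (spw (D p q) (spw (D q r) r))" using D_ple[OF assms(2)] by simp
  from ple_trans[OF D_ple[OF assms(1)] this] show ?thesis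
    by (simp add: D_le_iff assms spw_add)
qed

lemma D_spw:
  assumes "wid q" shows "D (spw i p) (spw j q) = D p q + i - j"
proof (rule D_eqI)
  fix k
  have "ple (spw i p) (spw k (spw j q)) \<longleftrightarrow> ple (spw i p) (spw i (spw (k + j - i) q))"
    by (simp add: spw_add)
  also have "\<dots> \<longleftrightarrow> D p q \<le> k + j - i" by (simp add: D_le_iff assms)
  finally show "ple (spw i p) (spw k (spw j q)) \<longleftrightarrow> D p q + i - j \<le> k" by linarith
qed (use assms in simp)

lemma D_self: assumes "wid p" shows "D p p = 0"
proof (rule antisym)
  show "D p p \<le> 0" by (simp add: D_le_iff assms)
  show "0 \<le> D p p"
  proof -
    have "fst p + snd p \<le> fst p + snd p + 2 * (of_int (D p p) * pi)"
      using D_ple[OF assms, of p] unfolding ple_def spw_def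
      by (cases "even (D p p)") (simp_all only: if_True if_False fst_conv snd_conv, linarith+)
    then have "0 \<le> of_int (D p p) * pi" by linarith
    then show ?thesis using pi_gt_zero by (simp add: zero_le_mult_iff not_le)
  qed
qed

lemma ple_swap: "ple (prod.swap p) (prod.swap q) \<longleftrightarrow> ple p q"
  by (auto simp: ple_def)

lemma spw_swap: "spw i (prod.swap p) = prod.swap (spw i p)"
  by (auto simp: spw_def prod.swap_def)

lemma D_swap: "D (prod.swap p) (prod.swap q) = D p q"
  by (simp add: D_def spw_swap ple_swap)

section \<open>Orbits of \<open>sigma\<close> and their normalized positions\<close>

definition pos :: "point \<Rightarrow> real \<times> real" where
  "pos t = (fst t, fst (snd t))"

lemma sigma_bij: "bij sigma"
proof (rule o_bij)
  show "(\<lambda>(x, y, e). (y - pi, x - pi, \<not> e)) \<circ> sigma = id"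
    by (auto simp: sigma_def)
  show "sigma \<circ> (\<lambda>(x, y, e). (y - pi, x - pi, \<not> e)) = id"
    by (auto simp: sigma_def)
qed

lemma inv_sigma: "inv sigma t = (fst (snd t) - pi, fst t - pi, \<not> snd (snd t))"
  by (rule inv_f_eq[OF bij_is_inj[OF sigma_bij]]) (simp add: sigma_def)

lemma sigma_funpow:
  "(sigma ^^ n) (x, y, e) = (if even n then (x + of_nat n * pi, y + of_nat n * pi, e)
     else (y + of_nat n * pi, x + of_nat n * pi, \<not> e))"
  by (induction n) (auto simp: sigma_def algebra_simps)

lemma inv_sigma_funpow:
  "(inv sigma ^^ n) (x, y, e) = (if even n then (x - of_nat n * pi, y - of_nat n * pi, e)
     else (y - of_nat n * pi, x - of_nat n * pi, \<not> e))"
  by (induction n) (auto simp: inv_sigma algebra_simps)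

lemma sigma_pow_eq:
  "sigma_pow i (x, y, e) = (if even i then (x + of_int i * pi, y + of_int i * pi, e)
     else (y + of_int i * pi, x + of_int i * pi, \<not> e))"
proof (cases "0 \<le> i")
  case True
  then obtain n where "i = int n" using nonneg_int_cases by blast
  then show ?thesis by (simp add: sigma_pow_def sigma_funpow)
next
  case False
  then obtain n where "i = - int n" by (metis int_cases2 neg_0_le_iff_le of_nat_0_le_iff)
  with False show ?thesis by (simp add: sigma_pow_def inv_sigma_funpow)
qed

lemma pos_sigma_pow [simp]: "pos (sigma_pow i t) = spw i (pos t)"
  by (cases t) (auto simp: pos_def sigma_pow_eq spw_def)

lemma sigma_pow_add: "sigma_pow i (sigma_pow j t) = sigma_pow (i + j) t"
  by (cases t) (auto simp: sigma_pow_eq algebra_simps)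

lemma sigma_pow_0 [simp]: "sigma_pow 0 t = t"
  by (cases t) (auto simp: sigma_pow_eq)

lemma point_le_ple: "point_le s t \<longleftrightarrow> ple (pos s) (pos t)"
  by (cases s; cases t) (auto simp: point_le_def ple_def pos_def)

lemma orbit_of_self [simp]: "t \<in> orbit_of t"
  unfolding orbit_of_def by (metis rangeI sigma_pow_0)

lemma orbit_of_eq: "s \<in> orbit_of t \<Longrightarrow> orbit_of s = orbit_of t"
proof -
  assume "s \<in> orbit_of t"
  then obtain i where i: "s = sigma_pow i t" by (auto simp: orbit_of_def)
  have "range (\<lambda>j. sigma_pow j s) = (\<lambda>j. sigma_pow j t) ` range (\<lambda>j. j + i)"
    by (simp only: i sigma_pow_add image_image)
  also have "range (\<lambda>j. j + i) = UNIV"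
    by (rule surjI[of _ "\<lambda>j. j - i"]) simp
  finally show ?thesis unfolding orbit_of_def .
qed

lemma orbit_of_sigma_pow [simp]: "orbit_of (sigma_pow i t) = orbit_of t"
  by (rule orbit_of_eq) (auto simp: orbit_of_def)

lemma M_False: "orbit_of (x, y, False) = M (y + pi) (x + pi)"
proof -
  have "sigma_pow 1 (x, y, False) = (y + pi, x + pi, True)" by (simp add: sigma_pow_eq)
  then show ?thesis unfolding M_def by (metis orbit_of_sigma_pow)
qed

lemma M_spw: "even i \<Longrightarrow> M (x + of_int i * pi) (y + of_int i * pi) = M x y"
proof -
  assume "even i"
  then have "sigma_pow i (x, y, True) = (x + of_int i * pi, y + of_int i * pi, True)" by (simp add: sigma_pow_eq)
  then show ?thesis unfolding M_def by (metis orbit_of_sigma_pow)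
qed

text \<open>\<open>sigma\<close> raises \<open>x + y\<close> by \<open>2 * pi\<close>, so the normalization picks exactly one position of the
  orbit; the sign is forgotten, as it plays no role for morphisms.\<close>

definition pt :: "orbit \<Rightarrow> real \<times> real" where
  "pt X = (SOME p. p \<in> pos ` X \<and> 0 \<le> fst p + snd p \<and> fst p + snd p < 2 * pi)"

lemma spw_norm_unique:
  assumes "0 \<le> fst p + snd p" "fst p + snd p < 2 * pi"
    "0 \<le> fst (spw k p) + snd (spw k p)" "fst (spw k p) + snd (spw k p) < 2 * pi"
  shows "k = 0"
proof -
  have s: "fst (spw k p) + snd (spw k p) = fst p + snd p + 2 * (of_int k * pi)"
    by (simp add: spw_def)
  have "of_int k * pi < 1 * pi" "-1 * pi < of_int k * pi" using assms unfolding s by linarith+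
  then have "of_int k < (1::real)" "(-1::real) < of_int k"
    by (simp_all only: mult_less_cancel_right) (use pi_gt_zero in auto)
  then show ?thesis by linarith
qed

lemma pt_orbit_of: "\<exists>k. pt (orbit_of t) = spw k (pos t)"
  and pt_sum: "0 \<le> fst (pt (orbit_of t)) + snd (pt (orbit_of t))"
    "fst (pt (orbit_of t)) + snd (pt (orbit_of t)) < 2 * pi"
proof -
  let ?Q = "\<lambda>p. p \<in> pos ` orbit_of t \<and> 0 \<le> fst p + snd p \<and> fst p + snd p < 2 * pi"
  let ?s = "fst (pos t) + snd (pos t)"
  let ?k = "- \<lfloor>?s / (2 * pi)\<rfloor>"
  have sum: "fst (spw k p) + snd (spw k p) = fst p + snd p + 2 * (of_int k * pi)" for k p
    by (simp add: spw_def)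
  have "of_int (- ?k) \<le> ?s / (2 * pi)" "?s / (2 * pi) < of_int (- ?k) + 1"
    by linarith+
  then have "of_int (- ?k) * (2 * pi) \<le> ?s" "?s < (of_int (- ?k) + 1) * (2 * pi)"
    by (simp_all only: pos_le_divide_eq[of "2 * pi"] pos_divide_less_eq[of "2 * pi"] pi_gt_zero
        zero_less_mult_iff zero_less_numeral simp_thms)
  then have "0 \<le> ?s + 2 * (of_int ?k * pi)" "?s + 2 * (of_int ?k * pi) < 2 * pi"
    by (simp_all add: algebra_simps)
  then have "?Q (spw ?k (pos t))"
    unfolding sum by (auto simp: orbit_of_def image_iff intro!: exI[of _ ?k])
  then have "?Q (pt (orbit_of t))" unfolding pt_def by (rule someI)
  then show "\<exists>k. pt (orbit_of t) = spw k (pos t)" "0 \<le> fst (pt (orbit_of t)) + snd (pt (orbit_of t))"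
    "fst (pt (orbit_of t)) + snd (pt (orbit_of t)) < 2 * pi"
    by (auto simp: orbit_of_def)
qed

lemma pt_eqI:
  assumes "0 \<le> fst q + snd q" "fst q + snd q < 2 * pi" "q = spw k (pos t)"
  shows "pt (orbit_of t) = q"
proof -
  obtain j where j: "pt (orbit_of t) = spw j (pos t)" using pt_orbit_of by blast
  then have "pt (orbit_of t) = spw (j - k) q" by (simp add: assms spw_add)
  moreover from this have "j - k = 0"
    using spw_norm_unique[of q "j - k"] assms(1,2) pt_sum[of t] by simp
  ultimately show ?thesis by simp
qed

lemma pt_M: "\<exists>k. pt (M x y) = spw k (x, y)"
  using pt_orbit_of[of "(x, y, True)"] by (simp add: M_def pos_def)

lemma orbits_M: "X \<in> orbits b \<longleftrightarrow> (\<exists>x y. \<bar>x - y\<bar> \<le> b \<and> X = M x y)"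
proof
  assume "X \<in> orbits b"
  then obtain x y e where X: "X = orbit_of (x, y, e)" "\<bar>x - y\<bar> \<le> b"
    by (auto simp: orbits_def strip_def)
  show "\<exists>x y. \<bar>x - y\<bar> \<le> b \<and> X = M x y"
  proof (cases e)
    case True with X show ?thesis by (auto simp: M_def)
  next
    case False
    with X show ?thesis
      by (intro exI[of _ "y + pi"] exI[of _ "x + pi"]) (auto simp: M_False)
  qed
next
  assume "\<exists>x y. \<bar>x - y\<bar> \<le> b \<and> X = M x y"
  then show "X \<in> orbits b" by (auto simp: orbits_def strip_def M_def)
qed

lemma spw_width: "\<bar>fst (spw k p) - snd (spw k p)\<bar> = \<bar>fst p - snd p\<bar>"
  by (auto simp: spw_def)

lemma pt_width: "\<bar>fst (pt (M x y)) - snd (pt (M x y))\<bar> = \<bar>x - y\<bar>"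
  using pt_M[of x y] spw_width[of _ "(x, y)"] by auto

lemma pt_wid: "X \<in> orbits b \<Longrightarrow> b \<le> pi \<Longrightarrow> wid (pt X)"
  by (auto simp: orbits_M wid_def pt_width)

section \<open>The involution on orbits\<close>

definition tau :: "point \<Rightarrow> point" where
  "tau = (\<lambda>(x, y, e). (x + pi, y + pi, e))"

lemma tau_sigma_pow: "tau (sigma_pow i t) = sigma_pow i (tau t)"
  by (cases t) (auto simp: tau_def sigma_pow_eq)

lemma psi_orbit_of: "psi_orbit (orbit_of t) = orbit_of (tau t)"
proof -
  have "psi_orbit (orbit_of t) = tau ` orbit_of t" by (simp add: psi_orbit_def tau_def)
  also have "\<dots> = orbit_of (tau t)"
    unfolding orbit_of_def by (simp add: image_image tau_sigma_pow)
  finally show ?thesis .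
qed

lemma psi_M: "psi_orbit (M x y) = M (x + pi) (y + pi)"
  by (simp add: M_def psi_orbit_of tau_def)

lemma psi_psi: "X \<in> orbits b \<Longrightarrow> psi_orbit (psi_orbit X) = X"
  using M_spw[of 2] by (auto simp: orbits_M psi_M algebra_simps)

lemma psi_orbits [simp]: "X \<in> orbits b \<Longrightarrow> psi_orbit X \<in> orbits b"
proof -
  assume "X \<in> orbits b"
  then obtain x y where "\<bar>x - y\<bar> \<le> b" "X = M x y" by (auto simp: orbits_M)
  then have "\<bar>(x + pi) - (y + pi)\<bar> \<le> b \<and> psi_orbit X = M (x + pi) (y + pi)" by (simp add: psi_M)
  then show ?thesis unfolding orbits_M by blast
qed

text \<open>On coordinates, translation by pi is the swap followed by \<open>sigma\<close>. The swap
  keeps the coordinate sum, so the swapped normalized position is again normalized; the factor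
  \<open>sigma\<close> accounts for the exponent k - 1.\<close>

lemma pt_psi: assumes "X \<in> orbits b" shows "pt (psi_orbit X) = prod.swap (pt X)"
proof -
  from assms obtain x y where X: "X = M x y" by (auto simp: orbits_M)
  obtain k where k: "pt X = spw k (x, y)" using pt_M X by blast
  have s: "0 \<le> fst (pt X) + snd (pt X)" "fst (pt X) + snd (pt X) < 2 * pi"
    using pt_sum[of "(x, y, True)"] by (simp_all add: X M_def)
  show ?thesis
    unfolding X psi_M unfolding M_def
  proof (rule pt_eqI[where k = "k - 1"])
    show "prod.swap (pt (orbit_of (x, y, True))) = spw (k - 1) (pos (x + pi, y + pi, True))"
      using k unfolding X M_def by (auto simp: spw_def pos_def algebra_simps)
  qed (use s in \<open>auto simp: X M_def add.commute\<close>)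
qed

text \<open>Between normalized positions all degrees are nonnegative. The change of representatives is a
  coboundary, so \<open>orbit_c X Y Z = dd X Y + dd Y Z - dd X Z\<close>.\<close>

definition dd :: "orbit \<Rightarrow> orbit \<Rightarrow> nat" where
  "dd X Y = nat (D (pt X) (pt Y))"

lemma pt_sum_orbits:
  "X \<in> orbits b \<Longrightarrow> 0 \<le> fst (pt X) + snd (pt X)" "X \<in> orbits b \<Longrightarrow> fst (pt X) + snd (pt X) < 2 * pi"
  using pt_sum by (auto simp: orbits_def)

text \<open>Normalized coordinate sums lie in [0, 2 pi) and each power of \<open>sigma\<close> adds
  2 pi, so no negative exponent can bring the position of Y above that of X.\<close>

lemma D_pt_nonneg:
  assumes "X \<in> orbits b" "Y \<in> orbits b" "b \<le> pi" shows "0 \<le> D (pt X) (pt Y)"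
proof -
  let ?d = "D (pt X) (pt Y)"
  have "fst (pt X) + snd (pt X) \<le> fst (pt Y) + snd (pt Y) + 2 * (of_int ?d * pi)"
    using D_ple[OF pt_wid[OF assms(2,3)], of "pt X"] by (auto simp: ple_def spw_def split: if_splits)
  then have "-1 * pi < of_int ?d * pi" using pt_sum_orbits[OF assms(1)] pt_sum_orbits[OF assms(2)] by linarith
  then have "(-1::real) < of_int ?d" by (simp only: mult_less_cancel_right) (use pi_gt_zero in auto)
  then show ?thesis by linarith
qed

lemma int_dd: "X \<in> orbits b \<Longrightarrow> Y \<in> orbits b \<Longrightarrow> b \<le> pi \<Longrightarrow> int (dd X Y) = D (pt X) (pt Y)"
  using D_pt_nonneg by (simp add: dd_def)

lemma dd_triangle:
  "X \<in> orbits b \<Longrightarrow> Y \<in> orbits b \<Longrightarrow> Z \<in> orbits b \<Longrightarrow> b \<le> pi \<Longrightarrow> dd X Z \<le> dd X Y + dd Y Z"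
  using D_triangle[of "pt Y" "pt Z" "pt X"] int_dd pt_wid by (smt (verit) of_nat_add of_nat_le_iff)

lemma dd_self [simp]: "X \<in> orbits b \<Longrightarrow> b \<le> pi \<Longrightarrow> dd X X = 0"
  using D_self pt_wid by (simp add: dd_def)

lemma dd_psi: "X \<in> orbits b \<Longrightarrow> Y \<in> orbits b \<Longrightarrow> dd (psi_orbit X) (psi_orbit Y) = dd X Y"
  using pt_psi D_swap by (simp add: dd_def)

lemma rep_pt: assumes "X \<in> orbits b" shows "\<exists>k. pos (rep X) = spw k (pt X)"
proof -
  obtain t where t: "X = orbit_of t" using assms by (auto simp: orbits_def)
  then have "rep X \<in> orbit_of t" unfolding rep_def by (metis orbit_of_self someI)
  then obtain i where i: "rep X = sigma_pow i t" by (auto simp: orbit_of_def)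
  obtain k where "pt X = spw k (pos t)" using pt_orbit_of t by blast
  then have "spw (i - k) (pt X) = pos (rep X)" by (simp add: i spw_add)
  then show ?thesis by metis
qed

lemma orbit_deg_D: "orbit_deg X Y = D (pos (rep X)) (pos (rep Y))"
  by (simp add: orbit_deg_def D_def point_le_ple)

lemma orbit_c_dd:
  assumes "X \<in> orbits b" "Y \<in> orbits b" "Z \<in> orbits b" "b \<le> pi"
  shows "orbit_c X Y Z = int (dd X Y) + int (dd Y Z) - int (dd X Z)"
proof -
  obtain i j k where "pos (rep X) = spw i (pt X)" "pos (rep Y) = spw j (pt Y)" "pos (rep Z) = spw k (pt Z)"
    using rep_pt assms by metis
  then show ?thesis
    unfolding orbit_c_def orbit_deg_D using assms
    by (simp add: D_spw pt_wid int_dd[where b = b])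
qed

lemma nat_orbit_c:
  assumes "X \<in> orbits b" "Y \<in> orbits b" "Z \<in> orbits b" "b \<le> pi"
  shows "nat (orbit_c X Y Z) + dd X Z = dd X Y + dd Y Z"
  using orbit_c_dd[OF assms] dd_triangle[OF assms] by simp

text \<open>The equation says that the composite of two basic morphisms is basic, with no extra
  factor u. The normalizing shifts enter as a coboundary and cancel, so any positions may replace
  the normalized ones.\<close>

lemma dd_cancel_M:
  assumes "wid p" "wid q" "wid r"
  shows "dd (M (fst p) (snd p)) (M (fst q) (snd q)) + dd (M (fst q) (snd q)) (M (fst r) (snd r))
      = dd (M (fst p) (snd p)) (M (fst r) (snd r)) \<longleftrightarrow> D p q + D q r = D p r"
proof -
  let ?X = "M (fst p) (snd p)" and ?Y = "M (fst q) (snd q)" and ?Z = "M (fst r) (snd r)"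
  have o: "?X \<in> orbits pi" "?Y \<in> orbits pi" "?Z \<in> orbits pi"
    using assms by (auto simp: orbits_M wid_def)
  obtain i j k where "pt ?X = spw i p" "pt ?Y = spw j q" "pt ?Z = spw k r"
    using pt_M by (metis prod.collapse)
  then have "int (dd ?X ?Y) = D p q + i - j" "int (dd ?Y ?Z) = D q r + j - k" "int (dd ?X ?Z) = D p r + i - k"
    using int_dd[OF o(1,2)] int_dd[OF o(2,3)] int_dd[OF o(1,3)] D_spw assms by simp_all
  then show ?thesis by linarith
qed

text \<open>If both degrees vanish, the basic morphisms in the two directions are inverse to each
  other. Thus positions detect isomorphism of orbits, and a composite through a different position
  always picks up a factor u.\<close>

lemma dd_iso_iff:
  assumes "X \<in> orbits b" "Y \<in> orbits b" "b \<le> pi"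
  shows "dd X Y + dd Y X = 0 \<longleftrightarrow> pt X = pt Y"
proof
  assume "dd X Y + dd Y X = 0"
  then have "D (pt X) (pt Y) = 0" "D (pt Y) (pt X) = 0" using int_dd assms by (metis add_is_0 of_nat_0)+
  then have "ple (pt X) (pt Y)" "ple (pt Y) (pt X)"
    using D_ple[of "pt Y" "pt X"] D_ple[of "pt X" "pt Y"] pt_wid assms by auto
  then show "pt X = pt Y" by (rule ple_antisym)
next
  assume "pt X = pt Y"
  then show "dd X Y + dd Y X = 0" using D_self pt_wid assms by (simp add: dd_def)
qed

lemma pt_M_eq_iff: "pt (M x y) = pt (M x' y') \<longleftrightarrow> (\<exists>k. (x', y') = spw k (x, y))"
proof
  assume "pt (M x y) = pt (M x' y')"
  moreover obtain i j where "pt (M x y) = spw i (x, y)" "pt (M x' y') = spw j (x', y')"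
    using pt_M by metis
  ultimately have "spw (- j) (spw j (x', y')) = spw (- j) (spw i (x, y))" by simp
  then show "\<exists>k. (x', y') = spw k (x, y)" by (auto simp: spw_add)
next
  assume "\<exists>k. (x', y') = spw k (x, y)"
  then obtain k where k: "(x', y') = spw k (x, y)" by blast
  obtain j where j: "pt (M x' y') = spw j (x', y')" using pt_M by metis
  then have "pt (M x' y') = spw (j + k) (pos (x, y, True))" by (simp add: k spw_add pos_def)
  moreover have "0 \<le> fst (pt (M x' y')) + snd (pt (M x' y'))" "fst (pt (M x' y')) + snd (pt (M x' y')) < 2 * pi"
    using pt_sum[of "(x', y', True)"] by (simp_all add: M_def)
  ultimately show "pt (M x y) = pt (M x' y')"
    unfolding M_def[of x y] by (intro pt_eqI) auto
qed

text \<open>The involution swaps the normalized position, so an orbit keeps its position only on the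
  diagonal. This separates the singular objects, on the diagonal, from the regular ones.\<close>

lemma pt_M_psi_iff: "pt (M x y) = pt (psi_orbit (M x y)) \<longleftrightarrow> x = y"
proof -
  have "pt (psi_orbit (M x y)) = prod.swap (pt (M x y))"
    by (rule pt_psi[of _ "\<bar>x - y\<bar>"]) (auto simp: orbits_M)
  moreover have "pt (M x y) = prod.swap (pt (M x y)) \<longleftrightarrow> fst (pt (M x y)) - snd (pt (M x y)) = 0"
    by (auto simp: prod_eq_iff)
  ultimately show ?thesis using pt_width[of x y] by (smt (verit))
qed

section \<open>Morphisms as scaled matrices\<close>

locale orbit_category =
  fixes u :: "'r::idom" and b :: real
  assumes u_nz: "u \<noteq> 0" and b_pos: "0 < b" and b_le: "b \<le> pi"
begin

definition Ob :: "orbit list set" where "Ob = {X. set X \<subseteq> orbits b}"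

lemma Ob_nth [simp]: "X \<in> Ob \<Longrightarrow> i < length X \<Longrightarrow> X ! i \<in> orbits b"
  unfolding Ob_def using nth_mem by blast

lemma Ob_append [simp]: "X @ Y \<in> Ob \<longleftrightarrow> X \<in> Ob \<and> Y \<in> Ob"
  by (auto simp: Ob_def)

lemma Ob_Nil [simp]: "[] \<in> Ob" by (simp add: Ob_def)

lemma Ob_Cons [simp]: "x # Y \<in> Ob \<longleftrightarrow> x \<in> orbits b \<and> Y \<in> Ob"
  by (auto simp: Ob_def)

lemma Ob_psi [simp]: "X \<in> Ob \<Longrightarrow> psi_obj X \<in> Ob"
  by (auto simp: Ob_def psi_obj_def)

lemma length_psi [simp]: "length (psi_obj X) = length X"
  by (simp add: psi_obj_def)

lemma nth_psi: "i < length X \<Longrightarrow> psi_obj X ! i = psi_orbit (X ! i)"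
  by (simp add: psi_obj_def)

lemma psi_psi_obj [simp]: "X \<in> Ob \<Longrightarrow> psi_obj (psi_obj X) = X"
  unfolding psi_obj_def Ob_def by (auto simp: o_def intro!: map_idI psi_psi)

lemma psi_obj_append: "psi_obj (X @ Y) = psi_obj X @ psi_obj Y"
  by (simp add: psi_obj_def)

lemma dd_self_Ob [simp]: "X \<in> orbits b \<Longrightarrow> dd X X = 0"
  using b_le by simp

text \<open>The scaled entry from \<open>X ! j\<close> to \<open>Y ! i\<close> is \<open>u ^ dd (X ! j) (Y ! i)\<close> times the entry of
  the morphism. The involution swaps the coordinates of \<open>pt\<close> and therefore fixes scaled matrices.\<close>

definition H :: "orbit list \<Rightarrow> orbit list \<Rightarrow> 'r fm set" where
  "H X Y = {a. X \<in> Ob \<and> Y \<in> Ob \<and> (\<forall>i j. ent a i j \<noteq> 0 \<longrightarrow> i < length Y \<and> j < length X) \<and>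
     (\<forall>i j. i < length Y \<longrightarrow> j < length X \<longrightarrow> u ^ dd (X ! j) (Y ! i) dvd ent a i j)}"

lemma H_Ob: "a \<in> H X Y \<Longrightarrow> X \<in> Ob" "a \<in> H X Y \<Longrightarrow> Y \<in> Ob"
  by (auto simp: H_def)

lemma H_supp: "a \<in> H X Y \<Longrightarrow> length Y \<le> i \<or> length X \<le> j \<Longrightarrow> ent a i j = 0"
  unfolding H_def using leD by blast

lemma H_dvd: "a \<in> H X Y \<Longrightarrow> i < length Y \<Longrightarrow> j < length X \<Longrightarrow> u ^ dd (X ! j) (Y ! i) dvd ent a i j"
  by (auto simp: H_def)

lemma H_I:
  assumes "X \<in> Ob" "Y \<in> Ob" "\<And>i j. length Y \<le> i \<or> length X \<le> j \<Longrightarrow> ent a i j = 0"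
    "\<And>i j. i < length Y \<Longrightarrow> j < length X \<Longrightarrow> u ^ dd (X ! j) (Y ! i) dvd ent a i j"
  shows "a \<in> H X Y"
  unfolding H_def using assms not_le by blast

lemma H_ent_mult:
  "a \<in> H X Y \<Longrightarrow> ent (c * a) i k = (\<Sum>j<length Y. ent c i j * ent a j k)"
  by (rule ent_mult) (simp add: H_supp)

text \<open>The triangle inequality for \<open>dd\<close> is what makes the divisibility conditions
  stable under matrix multiplication.\<close>

lemma H_mult [intro]:
  assumes a: "a \<in> H X Y" and c: "c \<in> H Y Z" shows "c * a \<in> H X Z"
proof (rule H_I)
  show "X \<in> Ob" "Z \<in> Ob" using a c H_Ob by auto
  fix i k
  show "length Z \<le> i \<or> length X \<le> k \<Longrightarrow> ent (c * a) i k = 0"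
    by (auto simp: H_ent_mult[OF a] H_supp[OF a] H_supp[OF c] intro!: sum.neutral)
  assume ik: "i < length Z" "k < length X"
  show "u ^ dd (X ! k) (Z ! i) dvd ent (c * a) i k"
    unfolding H_ent_mult[OF a]
  proof (rule dvd_sum)
    fix j assume j: "j \<in> {..<length Y}"
    then have "u ^ dd (Y ! j) (Z ! i) * u ^ dd (X ! k) (Y ! j) dvd ent c i j * ent a j k"
      using H_dvd[OF a] H_dvd[OF c] ik by (intro mult_dvd_mono) auto
    moreover have "dd (X ! k) (Z ! i) \<le> dd (X ! k) (Y ! j) + dd (Y ! j) (Z ! i)"
      using ik j H_Ob[OF a] H_Ob[OF c] by (intro dd_triangle[OF _ _ _ b_le]) auto
    then have "u ^ dd (X ! k) (Z ! i) dvd u ^ dd (Y ! j) (Z ! i) * u ^ dd (X ! k) (Y ! j)"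
      by (simp add: le_imp_power_dvd add.commute flip: power_add)
    ultimately show "u ^ dd (X ! k) (Z ! i) dvd ent c i j * ent a j k" by (rule dvd_trans[rotated])
  qed
qed

lemma H_add [intro]: "a \<in> H X Y \<Longrightarrow> c \<in> H X Y \<Longrightarrow> a + c \<in> H X Y"
  by (rule H_I) (auto simp: H_Ob ent_simps H_supp H_dvd intro!: dvd_add)

lemma H_diff [intro]: "a \<in> H X Y \<Longrightarrow> c \<in> H X Y \<Longrightarrow> a - c \<in> H X Y"
  by (rule H_I) (auto simp: H_Ob ent_simps H_supp H_dvd intro!: dvd_diff)

lemma H_sm [intro]: "a \<in> H X Y \<Longrightarrow> sm c a \<in> H X Y"
  by (rule H_I) (auto simp: H_Ob ent_sm H_supp H_dvd intro!: dvd_mult)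

lemma H_zero [intro]: "X \<in> Ob \<Longrightarrow> Y \<in> Ob \<Longrightarrow> 0 \<in> H X Y"
  by (rule H_I) (auto simp: ent_simps)

lemma H_idm [intro]: "X \<in> Ob \<Longrightarrow> idm (length X) \<in> H X X"
  by (rule H_I) (auto simp: ent_idm)

lemma H_idm_left: "a \<in> H X Y \<Longrightarrow> idm (length Y) * a = a"
  by (rule fm_eqI) (simp add: ent_idm_mult H_supp)

lemma H_idm_right: "a \<in> H X Y \<Longrightarrow> a * idm (length X) = a"
  by (rule fm_eqI) (simp add: ent_mult_idm H_supp)

lemma H_psi: "X \<in> Ob \<Longrightarrow> Y \<in> Ob \<Longrightarrow> H (psi_obj X) (psi_obj Y) = H X Y"
  unfolding H_def by (auto simp: nth_psi dd_psi[where b = b])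

lemma H_psi_swap: "X \<in> Ob \<Longrightarrow> Y \<in> Ob \<Longrightarrow> H (psi_obj X) Y = H X (psi_obj Y)"
  using H_psi[of "psi_obj X" Y] by simp

lemma H_mk:
  assumes "X \<in> Ob" "Y \<in> Ob" "\<And>i j. i < length Y \<Longrightarrow> j < length X \<Longrightarrow> u ^ dd (X ! j) (Y ! i) dvd f i j"
  shows "mk (length Y) (length X) f \<in> H X Y"
  by (rule H_I) (use assms in \<open>auto simp: ent_mk\<close>)

abbreviation F where "F \<equiv> F_cat u b"

text \<open>\<open>enc\<close> multiplies the entries of a morphism by powers of u and
  \<open>dec\<close> divides them out again; the quotient chosen by SOME is unique because u is
  nonzero.\<close>

definition dec :: "orbit list \<Rightarrow> orbit list \<Rightarrow> 'r fm \<Rightarrow> 'r fmor" where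
  "dec X Y a = (X, \<lambda>i j. if i < length Y \<and> j < length X
     then SOME r. ent a i j = r * u ^ dd (X ! j) (Y ! i) else 0, Y)"

definition enc :: "'r fmor \<Rightarrow> 'r fm" where
  "enc f = mk (length (snd (snd f))) (length (fst f))
     (\<lambda>i j. fst (snd f) i j * u ^ dd (fst f ! j) (snd (snd f) ! i))"

lemma Obj_F [simp]: "Obj F = Ob" by (simp add: F_cat_def Ob_def)

lemma Hom_F: "f \<in> Hom F X Y \<longleftrightarrow>
    (\<exists>A. f = (X, A, Y) \<and> (\<forall>i j. A i j \<noteq> 0 \<longrightarrow> i < length Y \<and> j < length X))"
  by (auto simp: F_cat_def)

lemma enc_H: "X \<in> Ob \<Longrightarrow> Y \<in> Ob \<Longrightarrow> f \<in> Hom F X Y \<Longrightarrow> enc f \<in> H X Y"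
  by (auto simp: Hom_F enc_def intro!: H_mk)

lemma dec_Hom: "dec X Y a \<in> Hom F X Y"
  by (auto simp: Hom_F dec_def)

lemma dec_enc: "X \<in> Ob \<Longrightarrow> Y \<in> Ob \<Longrightarrow> f \<in> Hom F X Y \<Longrightarrow> dec X Y (enc f) = f"
  by (auto simp: Hom_F enc_def dec_def ent_mk u_nz not_less intro!: ext)
    (metis leD)+

lemma enc_dec: assumes "a \<in> H X Y" shows "enc (dec X Y a) = a"
proof (rule fm_eqI)
  fix i j
  have "(SOME r. ent a i j = r * u ^ dd (X ! j) (Y ! i)) * u ^ dd (X ! j) (Y ! i) = ent a i j"
    if "i < length Y" "j < length X"
  proof -
    have "\<exists>r. ent a i j = r * u ^ dd (X ! j) (Y ! i)"
      using H_dvd[OF assms that] by (auto simp: dvd_def mult.commute)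
    from someI_ex[OF this] show ?thesis by simp
  qed
  then show "ent (enc (dec X Y a)) i j = ent a i j"
    using H_supp[OF assms, of i j] by (auto simp: enc_def dec_def ent_mk not_less)
qed

lemma enc_inj:
  "X \<in> Ob \<Longrightarrow> Y \<in> Ob \<Longrightarrow> f \<in> Hom F X Y \<Longrightarrow> g \<in> Hom F X Y \<Longrightarrow> enc f = enc g \<Longrightarrow> f = g"
  by (metis dec_enc)

lemma dec_eq_iff: "a \<in> H X Y \<Longrightarrow> c \<in> H X Y \<Longrightarrow> dec X Y a = dec X Y c \<longleftrightarrow> a = c"
  by (metis enc_dec)

lemma Comp_Hom: "f \<in> Hom F X Y \<Longrightarrow> g \<in> Hom F Y Z \<Longrightarrow> Comp F g f \<in> Hom F X Z"
proof -
  assume "f \<in> Hom F X Y" "g \<in> Hom F Y Z"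
  then obtain A C where A: "f = (X, A, Y)" "g = (Y, C, Z)"
    "\<And>i j. A i j \<noteq> 0 \<Longrightarrow> i < length Y \<and> j < length X" "\<And>i j. C i j \<noteq> 0 \<Longrightarrow> i < length Z \<and> j < length Y"
    by (auto simp: Hom_F)
  have "i < length Z \<and> k < length X"
    if "(\<Sum>j<length Y. C i j * A j k * u ^ nat (orbit_c (X ! k) (Y ! j) (Z ! i))) \<noteq> 0" for i k
  proof -
    from that obtain j where "C i j * A j k * u ^ nat (orbit_c (X ! k) (Y ! j) (Z ! i)) \<noteq> 0"
      by (meson sum.neutral)
    then show ?thesis using A(3)[of j k] A(4)[of i j] by auto
  qed
  then show ?thesis by (simp add: A F_cat_def)
qed

text \<open>The exponent c(X,Y,Z) of the composition law is a coboundary of \<open>dd\<close>, so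
  the scalings of the two factors supply both that power of u and the scaling of the
  product.\<close>

lemma enc_Comp:
  assumes X: "X \<in> Ob" and Y: "Y \<in> Ob" and Z: "Z \<in> Ob" and f: "f \<in> Hom F X Y" and g: "g \<in> Hom F Y Z"
  shows "enc (Comp F g f) = enc g * enc f"
proof (rule fm_eqI)
  fix i k
  obtain A C where A: "f = (X, A, Y)" "g = (Y, C, Z)" using f g by (auto simp: Hom_F)
  have "ent (enc g * enc f) i k = (\<Sum>j<length Y. ent (enc g) i j * ent (enc f) j k)"
    by (rule H_ent_mult[OF enc_H[OF X Y f]])
  also have "\<dots> = ent (enc (Comp F g f)) i k"
  proof (cases "i < length Z \<and> k < length X")
    case True
    have "u ^ nat (orbit_c (X ! k) (Y ! j) (Z ! i)) * u ^ dd (X ! k) (Z ! i)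
        = u ^ dd (X ! k) (Y ! j) * u ^ dd (Y ! j) (Z ! i)" if "j < length Y" for j
      using nat_orbit_c[OF _ _ _ b_le, of "X ! k" "Y ! j" "Z ! i"] True that X Y Z
      by (simp flip: power_add)
    then have "C i j * A j k * u ^ nat (orbit_c (X ! k) (Y ! j) (Z ! i)) * u ^ dd (X ! k) (Z ! i)
       = C i j * u ^ dd (Y ! j) (Z ! i) * (A j k * u ^ dd (X ! k) (Y ! j))" if "j < length Y" for j
      using that by (simp add: mult_ac)
    then have "(\<Sum>j<length Y. C i j * A j k * u ^ nat (orbit_c (X ! k) (Y ! j) (Z ! i)) * u ^ dd (X ! k) (Z ! i))
      = (\<Sum>j<length Y. C i j * u ^ dd (Y ! j) (Z ! i) * (A j k * u ^ dd (X ! k) (Y ! j)))"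
      by (intro sum.cong) auto
    then show ?thesis using True
      by (simp add: A enc_def ent_mk F_cat_def sum_distrib_right)
  next
    case False
    then show ?thesis by (auto simp: A enc_def ent_mk F_cat_def intro!: sum.neutral)
  qed
  finally show "ent (enc (Comp F g f)) i k = ent (enc g * enc f) i k" by simp
qed

lemma dec_Comp:
  assumes "a \<in> H X Y" "c \<in> H Y Z" shows "Comp F (dec Y Z c) (dec X Y a) = dec X Z (c * a)"
proof -
  have o: "X \<in> Ob" "Y \<in> Ob" "Z \<in> Ob" using assms H_Ob by auto
  have "enc (Comp F (dec Y Z c) (dec X Y a)) = c * a"
    using enc_Comp[OF o dec_Hom dec_Hom] assms by (simp add: enc_dec)
  moreover have "Comp F (dec Y Z c) (dec X Y a) \<in> Hom F X Z" by (rule Comp_Hom[OF dec_Hom dec_Hom])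
  ultimately show ?thesis using dec_enc o by metis
qed

lemma dec_zero: "X \<in> Ob \<Longrightarrow> Y \<in> Ob \<Longrightarrow> Zero F X Y = dec X Y 0"
  by (auto simp: F_cat_def dec_def ent_simps u_nz intro!: ext)

lemma dec_idm: assumes "X \<in> Ob" shows "Ident F X = dec X X (idm (length X))"
proof (rule enc_inj[OF assms assms _ dec_Hom])
  show "Ident F X \<in> Hom F X X" by (auto simp: F_cat_def)
  show "enc (Ident F X) = enc (dec X X (idm (length X)))"
    using assms by (subst enc_dec[OF H_idm]) (auto simp: F_cat_def enc_def ent_mk ent_idm b_le intro!: fm_eqI)
qed

lemma dec_add: assumes "a \<in> H X Y" "c \<in> H X Y"
  shows "Add F (dec X Y a) (dec X Y c) = dec X Y (a + c)"
proof (rule enc_inj[OF H_Ob[OF assms(1)] _ dec_Hom])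
  show "Add F (dec X Y a) (dec X Y c) \<in> Hom F X Y" by (auto simp: F_cat_def dec_def)
  have "enc (Add F (dec X Y a) (dec X Y c)) = enc (dec X Y a) + enc (dec X Y c)"
    by (rule fm_eqI) (auto simp: F_cat_def enc_def dec_def ent_mk ent_simps distrib_right)
  then show "enc (Add F (dec X Y a) (dec X Y c)) = enc (dec X Y (a + c))"
    using assms by (simp add: enc_dec H_add)
qed

lemma psi_dec: assumes "a \<in> H X Y" shows "psi_mor (dec X Y a) = dec (psi_obj X) (psi_obj Y) a"
  using H_Ob[OF assms]
  by (auto simp: psi_mor_def dec_def nth_psi dd_psi[where b = b] intro!: ext)

lemma F_Hom_dec: "X \<in> Ob \<Longrightarrow> Y \<in> Ob \<Longrightarrow> f \<in> Hom F X Y \<longleftrightarrow> (\<exists>a\<in>H X Y. f = dec X Y a)"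
  using enc_H dec_enc dec_Hom by metis

lemma inverse_pair_F:
  assumes "a \<in> H X Y" "c \<in> H Y X"
  shows "inverse_pair F X Y (dec X Y a) (dec Y X c) \<longleftrightarrow> c * a = idm (length X) \<and> a * c = idm (length Y)"
  using assms H_Ob[OF assms(1)]
  by (simp add: inverse_pair_def dec_Hom dec_Comp dec_idm dec_eq_iff[OF H_mult H_idm])

lemma iso_mor_F:
  assumes "a \<in> H X Y"
  shows "iso_mor F X Y (dec X Y a) \<longleftrightarrow> (\<exists>c\<in>H Y X. c * a = idm (length X) \<and> a * c = idm (length Y))"
proof
  assume "iso_mor F X Y (dec X Y a)"
  then obtain g where g: "inverse_pair F X Y (dec X Y a) g" by (auto simp: iso_mor_def)
  then obtain c where "c \<in> H Y X" "g = dec Y X c"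
    using F_Hom_dec H_Ob[OF assms] by (auto simp: inverse_pair_def)
  then show "\<exists>c\<in>H Y X. c * a = idm (length X) \<and> a * c = idm (length Y)"
    using g inverse_pair_F[OF assms] by auto
next
  assume "\<exists>c\<in>H Y X. c * a = idm (length X) \<and> a * c = idm (length Y)"
  then show "iso_mor F X Y (dec X Y a)"
    unfolding iso_mor_def using inverse_pair_F[OF assms] by blast
qed

end

section \<open>Inflations and projective-injective objects\<close>

declare split_paired_Ex [simp del] split_paired_All [simp del]

text \<open>Applies a known product a * b = c inside a right-nested product; with its help,
  identities of matrices are verified by rewriting.\<close>

lemma mult_assoc_eq: "a * b = c \<Longrightarrow> a * (b * z) = c * z" for a :: "'a::semigroup_mult"
  by (simp flip: mult.assoc)

text \<open>Inclusion of the second block. The inclusion and the projection of the first block are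
  both \<open>idm n\<close>, as matrices are padded with zeros.\<close>

definition in2 :: "nat \<Rightarrow> nat \<Rightarrow> 'a::zero_neq_one fm" where
  "in2 n m = mk (n + m) m (\<lambda>i j. if i = n + j then 1 else 0)"

definition pr2 :: "nat \<Rightarrow> nat \<Rightarrow> 'a::zero_neq_one fm" where
  "pr2 n m = mk m (n + m) (\<lambda>i j. if j = n + i then 1 else 0)"

lemma ent_in2: "ent (in2 n m) i j = (if j < m \<and> i = n + j then 1 else 0)"
  by (auto simp: in2_def ent_mk)

lemma ent_pr2: "ent (pr2 n m) i j = (if i < m \<and> j = n + i then 1 else 0)"
  by (auto simp: pr2_def ent_mk)

lemma ent_mult_in2:
  "ent (A * in2 n m) i j = (if j < m then ent A i (n + j) else (0::'a::ring_1))"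
proof -
  have "ent (A * in2 n m) i j = (\<Sum>k<n + m. ent A i k * ent (in2 n m) k j)"
    by (rule ent_mult) (auto simp: ent_in2)
  also have "\<dots> = (\<Sum>k<n + m. if k = n + j then if j < m then ent A i (n + j) else 0 else 0)"
    by (rule sum.cong) (auto simp: ent_in2)
  finally show ?thesis by auto
qed

lemma ent_pr2_mult:
  "ent (pr2 n m * A) i j = (if i < m then ent A (n + i) j else (0::'a::ring_1))"
proof -
  have "ent (pr2 n m * A) i j = (\<Sum>k<n + m. ent (pr2 n m) i k * ent A k j)"
    by (rule ent_mult) (auto simp: ent_pr2)
  also have "\<dots> = (\<Sum>k<n + m. if k = n + i then if i < m then ent A (n + i) j else 0 else 0)"
    by (rule sum.cong) (auto simp: ent_pr2)
  finally show ?thesis by auto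
qed

lemma idm_idm: "idm n * idm n = (idm n :: 'a::ring_1 fm)"
  by (rule fm_eqI) (simp add: ent_idm_mult ent_idm)

lemma pr2_in2: "pr2 n m * in2 n m = (idm m :: 'a::ring_1 fm)"
  by (rule fm_eqI) (auto simp: ent_pr2_mult ent_in2 ent_idm)

lemma idm_in2: "idm n * in2 n m = (0 :: 'a::ring_1 fm)"
  by (rule fm_eqI) (auto simp: ent_idm_mult ent_in2 ent_simps)

lemma pr2_idm: "pr2 n m * idm n = (0 :: 'a::ring_1 fm)"
  by (rule fm_eqI) (auto simp: ent_mult_idm ent_pr2 ent_simps)

lemma in2_pr2: "idm n + in2 n m * pr2 n m = (idm (n + m) :: 'a::ring_1 fm)"
proof (rule fm_eqI)
  fix i j
  have "ent (in2 n m * pr2 n m :: 'a fm) i j = (\<Sum>k<m. ent (in2 n m) i k * ent (pr2 n m) k j)"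
    by (rule ent_mult) (auto simp: ent_in2)
  also have "\<dots> = (\<Sum>k<m. if k = i - n then if n \<le> i \<and> i < n + m \<and> i = j then 1 else 0 else 0)"
    by (rule sum.cong) (auto simp: ent_in2 ent_pr2)
  finally show "ent (idm n + in2 n m * pr2 n m :: 'a fm) i j = ent (idm (n + m)) i j"
    by (auto simp: ent_simps ent_idm)
qed

lemma in2_in2: "in2 n n * in2 n n = (0 :: 'a::ring_1 fm)"
  by (rule fm_eqI) (auto simp: ent_mult_in2 ent_in2 ent_simps)

lemma pr2_pr2: "pr2 n n * pr2 n n = (0 :: 'a::ring_1 fm)"
  by (rule fm_eqI) (auto simp: ent_pr2_mult ent_pr2 ent_simps)

context orbit_category
begin

lemma in2_H: "J \<in> Ob \<Longrightarrow> K \<in> Ob \<Longrightarrow> in2 (length J) (length K) \<in> H K (J @ K)"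
  by (rule H_I) (auto simp: ent_in2 nth_append)

lemma pr2_H: "J \<in> Ob \<Longrightarrow> K \<in> Ob \<Longrightarrow> pr2 (length J) (length K) \<in> H (J @ K) K"
  by (rule H_I) (auto simp: ent_pr2 nth_append)

lemma in1_H: "J \<in> Ob \<Longrightarrow> K \<in> Ob \<Longrightarrow> idm (length J) \<in> H J (J @ K)"
  by (rule H_I) (auto simp: ent_idm nth_append)

lemma pr1_H: "J \<in> Ob \<Longrightarrow> K \<in> Ob \<Longrightarrow> idm (length J) \<in> H (J @ K) J"
  by (rule H_I) (auto simp: ent_idm nth_append)

text \<open>These orbits turn out to be the injective ones (\<open>injective_single_iff\<close>).
  The condition refers to the position, hence it is invariant under isomorphism.\<close>

definition boundary_orbit :: "orbit \<Rightarrow> bool" where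
  "boundary_orbit o1 \<longleftrightarrow> o1 \<in> orbits b \<and> \<bar>fst (pt o1) - snd (pt o1)\<bar> = b"

definition boundary :: "orbit list \<Rightarrow> bool" where
  "boundary X \<longleftrightarrow> (\<forall>o1\<in>set X. boundary_orbit o1)"

lemma boundary_Ob: "boundary X \<Longrightarrow> X \<in> Ob" by (auto simp: boundary_def boundary_orbit_def Ob_def)

lemma boundary_orbit_M: "boundary_orbit o1 \<longleftrightarrow> (\<exists>x y. \<bar>x - y\<bar> = b \<and> o1 = M x y)"
  by (auto simp: boundary_orbit_def orbits_M pt_width) (metis order_refl)

lemma boundary_nth: "boundary X \<Longrightarrow> i < length X \<Longrightarrow> boundary_orbit (X ! i)"
  unfolding boundary_def using nth_mem by blast

lemma boundary_orbit_psi: "boundary_orbit o1 \<Longrightarrow> boundary_orbit (psi_orbit o1)"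
  unfolding boundary_orbit_M using psi_M by (metis add_diff_cancel_right)

lemma boundary_psi: "boundary X \<Longrightarrow> boundary (psi_obj X)"
  by (auto simp: boundary_def psi_obj_def boundary_orbit_psi)

lemma boundary_append: "boundary (X @ Y) \<longleftrightarrow> boundary X \<and> boundary Y"
  by (auto simp: boundary_def)

text \<open>The scaled matrix of the structure map of \<open>S_obj\<close>. No powers of u occur:
  psi is an involution on orbits, so the swap identifies equal summands.\<close>

definition sw :: "nat \<Rightarrow> 'r fm" where "sw n = in2 n n + pr2 n n"

lemma sw_sw: "sw n * sw n = idm (n + n)"
proof -
  have "sw n * sw n = in2 n n * pr2 n n + idm n"
    by (simp add: sw_def algebra_simps in2_in2 pr2_pr2 pr2_in2)
  then show ?thesis using in2_pr2[of n n] by (simp add: add.commute)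
qed

lemma sw_H:
  assumes "J \<in> Ob" shows "sw (length J) \<in> H (psi_obj (J @ psi_obj J)) (J @ psi_obj J)"
proof (rule H_I)
  fix i j
  let ?n = "length J"
  show "length (J @ psi_obj J) \<le> i \<or> length (psi_obj (J @ psi_obj J)) \<le> j \<Longrightarrow> ent (sw ?n) i j = 0"
    by (auto simp: sw_def ent_simps ent_in2 ent_pr2)
  show "u ^ dd (psi_obj (J @ psi_obj J) ! j) ((J @ psi_obj J) ! i) dvd ent (sw ?n) i j"
    if "i < length (J @ psi_obj J)" "j < length (psi_obj (J @ psi_obj J))"
    using assms that by (auto simp: sw_def ent_simps ent_in2 ent_pr2 nth_append psi_obj_append)
qed (use assms in auto)

end

section \<open>Conflations of the given exact structure in terms of scaled matrices\<close>

locale exact_orbits = orbit_category u b for u :: "'r::idom" and b :: real +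
  fixes \<E> :: "('r fmor \<times> 'r fmor) set"
  assumes dvr: "dvr_uniformizer u" and odd_char: "\<not> u dvd 2" and exact: "F_exact u b \<E>"
begin

lemma frob: "frobenius F \<E>" and ex: "exact_structure F \<E>"
  using exact by (auto simp: F_exact_def frobenius_def)

lemma u_nonunit: "\<not> u dvd 1" and unit_or: "x dvd 1 \<or> u dvd x"
  using dvr by (auto simp: dvr_uniformizer_def)

lemma u_pow_dvd_1: "u ^ n dvd 1 \<longleftrightarrow> n = 0"
proof
  assume "u ^ n dvd 1"
  then show "n = 0" using u_nonunit by (metis dvd_trans dvd_triv_left gr0_implies_Suc neq0_conv power_Suc)
qed simp

lemma ex_kc:
  assumes "(f, g) \<in> \<E>"
  shows "\<exists>A\<in>Ob. \<exists>B\<in>Ob. \<exists>C\<in>Ob. kernel_cokernel_pair F A B C f g"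
  using conjunct1[OF ex[unfolded exact_structure_def Obj_F]] assms by blast

lemma ex_iso:
  assumes "(i, p) \<in> \<E>" "{A, B, C, A', B', C'} \<subseteq> Ob" "i \<in> Hom F A B" "p \<in> Hom F B C"
    "i' \<in> Hom F A' B'" "p' \<in> Hom F B' C'" "iso_mor F A A' a" "iso_mor F B B' b'" "iso_mor F C C' c"
    "Comp F b' i = Comp F i' a" "Comp F c p = Comp F p' b'"
  shows "(i', p') \<in> \<E>"
proof -
  have "\<forall>A \<in> Ob. \<forall>B \<in> Ob. \<forall>C \<in> Ob. \<forall>A' \<in> Ob. \<forall>B' \<in> Ob. \<forall>C' \<in> Ob.
        \<forall>i \<in> Hom F A B. \<forall>p \<in> Hom F B C. \<forall>i' \<in> Hom F A' B'. \<forall>p' \<in> Hom F B' C'. \<forall>a b c.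
          (i, p) \<in> \<E> \<and> iso_mor F A A' a \<and> iso_mor F B B' b \<and> iso_mor F C C' c \<and>
          Comp F b i = Comp F i' a \<and> Comp F c p = Comp F p' b \<longrightarrow> (i', p') \<in> \<E>"
    using ex unfolding exact_structure_def Obj_F by (elim conjE)
  from this[rule_format, of A B C A' B' C' i p i' p' a b' c] assms show ?thesis by simp
qed

lemma ex_id: "A \<in> Ob \<Longrightarrow> deflation \<E> (Ident F A)"
  using ex unfolding exact_structure_def Obj_F by (elim conjE) simp

lemma ex_comp:
  assumes "inflation \<E> f" "inflation \<E> g" "{A, B, C} \<subseteq> Ob" "f \<in> Hom F A B" "g \<in> Hom F B C"
  shows "inflation \<E> (Comp F g f)"
proof -
  have "\<forall>A \<in> Ob. \<forall>B \<in> Ob. \<forall>C \<in> Ob. \<forall>f \<in> Hom F A B. \<forall>g \<in> Hom F B C.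
        (inflation \<E> f \<and> inflation \<E> g \<longrightarrow> inflation \<E> (Comp F g f)) \<and>
        (deflation \<E> f \<and> deflation \<E> g \<longrightarrow> deflation \<E> (Comp F g f))"
    using ex unfolding exact_structure_def Obj_F by (elim conjE)
  from this[rule_format, of A B C f g] assms show ?thesis by simp
qed

lemma ex_pushout:
  assumes "inflation \<E> i" "{A, B, A'} \<subseteq> Ob" "i \<in> Hom F A B" "f \<in> Hom F A A'"
  shows "\<exists>B'\<in>Ob. \<exists>i' f'. pushout_square F A B A' B' i f i' f' \<and> inflation \<E> i'"
proof -
  have "\<forall>A \<in> Ob. \<forall>B \<in> Ob. \<forall>A' \<in> Ob. \<forall>i \<in> Hom F A B. \<forall>f \<in> Hom F A A'.
        inflation \<E> i \<longrightarrow>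
        (\<exists>B' \<in> Ob. \<exists>i' f'. pushout_square F A B A' B' i f i' f' \<and> inflation \<E> i')"
    using ex unfolding exact_structure_def Obj_F by (elim conjE)
  from this[rule_format, of A B A' i f] assms show ?thesis by simp
qed

definition conflation :: "orbit list \<Rightarrow> orbit list \<Rightarrow> orbit list \<Rightarrow> 'r fm \<Rightarrow> 'r fm \<Rightarrow> bool" where
  "conflation X Y Z i p \<longleftrightarrow> i \<in> H X Y \<and> p \<in> H Y Z \<and> (dec X Y i, dec Y Z p) \<in> \<E>"

lemma dec_src: "dec X Y i \<in> Hom F X' Y' \<Longrightarrow> X' = X \<and> Y' = Y"
  by (auto simp: Hom_F dec_def)

lemma E_conflation:
  assumes "(f, g) \<in> \<E>"
  obtains X Y Z i p where "conflation X Y Z i p" "f = dec X Y i" "g = dec Y Z p"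
proof -
  from ex_kc[OF assms] obtain A B C where o: "A \<in> Ob" "B \<in> Ob" "C \<in> Ob" and k: "kernel_cokernel_pair F A B C f g"
    by blast
  then have "f \<in> Hom F A B" "g \<in> Hom F B C" by (auto simp: kernel_cokernel_pair_def)
  then show ?thesis
    using that[of A B C "enc f" "enc g"] assms o enc_H dec_enc by (simp add: conflation_def)
qed

lemma conflation_kc:
  assumes "conflation X Y Z i p" shows "kernel_cokernel_pair F X Y Z (dec X Y i) (dec Y Z p)"
proof -
  from assms ex_kc obtain A B C where k: "kernel_cokernel_pair F A B C (dec X Y i) (dec Y Z p)"
    unfolding conflation_def by blast
  then have "dec X Y i \<in> Hom F A B" "dec Y Z p \<in> Hom F B C" by (auto simp: kernel_cokernel_pair_def)
  with k dec_src show ?thesis by blast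
qed

lemma conflation_H: "conflation X Y Z i p \<Longrightarrow> i \<in> H X Y" "conflation X Y Z i p \<Longrightarrow> p \<in> H Y Z"
  by (auto simp: conflation_def)

lemma conflation_Ob: "conflation X Y Z i p \<Longrightarrow> X \<in> Ob" "conflation X Y Z i p \<Longrightarrow> Y \<in> Ob" "conflation X Y Z i p \<Longrightarrow> Z \<in> Ob"
  using conflation_H H_Ob by metis+

lemma conflation_zero: assumes "conflation X Y Z i p" shows "p * i = 0"
proof -
  note h = conflation_H[OF assms] conflation_Ob[OF assms]
  have "dec X Z (p * i) = dec X Z 0"
    using conflation_kc[OF assms] h by (simp add: kernel_cokernel_pair_def dec_Comp dec_zero)
  then show ?thesis using dec_eq_iff[OF H_mult[OF h(1,2)] H_zero] h by blast
qed

lemma conflation_coker: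
  assumes "conflation X Y Z i p" "g \<in> H Y W" "g * i = 0" shows "\<exists>!g'. g' \<in> H Z W \<and> g' * p = g"
proof -
  note h = conflation_H[OF assms(1)] conflation_Ob[OF assms(1)]
  have W: "W \<in> Ob" using assms H_Ob by blast
  have "Comp F (dec Y W g) (dec X Y i) = Zero F X W"
    using h W assms by (simp add: dec_Comp dec_zero)
  with conflation_kc[OF assms(1)] W have ex1: "\<exists>!k. k \<in> Hom F Z W \<and> Comp F k (dec Y Z p) = dec Y W g"
    by (simp add: kernel_cokernel_pair_def dec_Hom)
  have *: "dec Z W k \<in> Hom F Z W \<and> Comp F (dec Z W k) (dec Y Z p) = dec Y W g" if "k \<in> H Z W" "k * p = g" for k
    using that h by (simp add: dec_Hom dec_Comp)
  obtain k where k: "k \<in> Hom F Z W" "Comp F k (dec Y Z p) = dec Y W g" using ex1 by (elim ex1E conjE)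
  then have e: "enc k \<in> H Z W" "k = dec Z W (enc k)" using enc_H dec_enc h W by auto
  then have "dec Y W (enc k * p) = dec Y W g" using k h by (metis dec_Comp)
  then have "enc k * p = g" using dec_eq_iff e(1) h(2) assms(2) by blast
  with e(1) show ?thesis
  proof (intro ex1I[of _ "enc k"])
    fix k' assume "k' \<in> H Z W \<and> k' * p = g"
    then show "k' = enc k" using ex1 k * enc_dec by metis
  qed auto
qed

lemma conflation_epi:
  assumes "conflation X Y Z i p" "g \<in> H Z W" "g' \<in> H Z W" "g * p = g' * p" shows "g = g'"
proof -
  note h = conflation_H[OF assms(1)]
  have "g * p * i = 0" using conflation_zero[OF assms(1)] by (simp add: mult.assoc)
  from conflation_coker[OF assms(1) H_mult[OF h(2) assms(2)] this] show ?thesis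
    using assms(2-4) by auto
qed

lemma conflation_mono_zero:
  assumes "conflation X Y Z i p" "f \<in> H W X" "i * f = 0" shows "f = 0"
proof -
  note h = conflation_H[OF assms(1)] conflation_Ob[OF assms(1)]
  have W: "W \<in> Ob" using assms H_Ob by blast
  have "Comp F (dec Y Z p) (dec W Y 0) = Zero F W Z"
    using h W dec_Comp[of 0 W Y p Z] by (simp add: dec_zero H_zero)
  with conflation_kc[OF assms(1)] W have "\<exists>!k. k \<in> Hom F W X \<and> Comp F (dec X Y i) k = dec W Y 0"
    by (simp add: kernel_cokernel_pair_def dec_Hom)
  moreover have "Comp F (dec X Y i) (dec W X f) = dec W Y 0" "Comp F (dec X Y i) (dec W X 0) = dec W Y 0"
    using h W assms dec_Comp[of f W X i Y] dec_Comp[of 0 W X i Y] by (simp_all add: H_zero)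
  ultimately have "dec W X f = dec W X 0" using dec_Hom by blast
  then show ?thesis using dec_eq_iff[OF assms(2) H_zero] W h by blast
qed

lemma inflationE:
  assumes "inflation \<E> (dec X Y i)" "i \<in> H X Y" obtains Z p where "conflation X Y Z i p"
proof -
  from assms obtain g where "(dec X Y i, g) \<in> \<E>" by (auto simp: inflation_def)
  then obtain X' Y' Z i' p where "conflation X' Y' Z i' p" "dec X Y i = dec X' Y' i'" using E_conflation by metis
  moreover from this have "X = X'" "Y = Y'" by (auto simp: dec_def)
  ultimately have "conflation X Y Z i' p" "i = i'" using dec_eq_iff[OF assms(2) conflation_H(1)] by auto
  then show ?thesis using that by blast
qed

lemma deflationE:
  assumes "deflation \<E> (dec Y Z p)" "p \<in> H Y Z" obtains X i where "conflation X Y Z i p"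
proof -
  from assms obtain g where "(g, dec Y Z p) \<in> \<E>" by (auto simp: deflation_def)
  then obtain X Y' Z' i p' where "conflation X Y' Z' i p'" "dec Y Z p = dec Y' Z' p'" using E_conflation by metis
  moreover from this have "Y = Y'" "Z = Z'" by (auto simp: dec_def)
  ultimately have "conflation X Y Z i p'" "p = p'" using dec_eq_iff[OF assms(2) conflation_H(2)] by auto
  then show ?thesis using that by blast
qed

lemma conflation_infl: "conflation X Y Z i p \<Longrightarrow> inflation \<E> (dec X Y i)" "conflation X Y Z i p \<Longrightarrow> deflation \<E> (dec Y Z p)"
  by (auto simp: conflation_def inflation_def deflation_def)

lemma injective_ext:
  assumes "injective F \<E> I" "conflation A B C i p" "f \<in> H A I" shows "\<exists>g\<in>H B I. g * i = f"
proof -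
  note h = conflation_H[OF assms(2)] conflation_Ob[OF assms(2)]
  have I: "I \<in> Ob" using assms H_Ob by blast
  obtain g where g: "g \<in> Hom F B I" "Comp F g (dec A B i) = dec A I f"
    using assms(1) h dec_Hom conflation_infl[OF assms(2)] unfolding injective_def by (metis Obj_F)
  then have e: "enc g \<in> H B I" "g = dec B I (enc g)" using enc_H dec_enc h I by auto
  then have "dec A I (enc g * i) = dec A I f" using g h by (metis dec_Comp)
  then have "enc g * i = f" using dec_eq_iff e(1) h(1) assms(3) by blast
  with e show ?thesis by blast
qed

lemma injectiveI:
  assumes "I \<in> Ob" "\<And>A B C i p f. conflation A B C i p \<Longrightarrow> f \<in> H A I \<Longrightarrow> \<exists>g\<in>H B I. g * i = f"
  shows "injective F \<E> I"
  unfolding injective_def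
proof (intro conjI ballI impI)
  show "I \<in> Obj F" using assms by simp
  fix A B i f assume o: "A \<in> Obj F" "B \<in> Obj F" and i: "i \<in> Hom F A B" "inflation \<E> i" and f: "f \<in> Hom F A I"
  then have i': "enc i \<in> H A B" "i = dec A B (enc i)" and f': "enc f \<in> H A I" "f = dec A I (enc f)"
    using enc_H dec_enc assms(1) by auto
  obtain C p where "conflation A B C (enc i) p" using inflationE i' i by metis
  from assms(2)[OF this f'(1)] obtain g where "g \<in> H B I" "g * enc i = enc f" by blast
  then show "\<exists>g\<in>Hom F B I. Comp F g i = f" using dec_Comp dec_Hom i' f' by metis
qed

lemma projective_lift:
  assumes "projective F \<E> P" "conflation A B C i p" "f \<in> H P C" shows "\<exists>g\<in>H P B. p * g = f"
proof -
  note h = conflation_H[OF assms(2)] conflation_Ob[OF assms(2)]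
  have P: "P \<in> Ob" using assms H_Ob by blast
  obtain g where g: "g \<in> Hom F P B" "Comp F (dec B C p) g = dec P C f"
    using assms(1) h dec_Hom conflation_infl[OF assms(2)] unfolding projective_def by (metis Obj_F)
  then have e: "enc g \<in> H P B" "g = dec P B (enc g)" using enc_H dec_enc h P by auto
  then have "dec P C (p * enc g) = dec P C f" using g h by (metis dec_Comp)
  then have "p * enc g = f" using dec_eq_iff e(1) h(2) assms(3) by blast
  with e show ?thesis by blast
qed

section \<open>Projective-injective objects are the sums of boundary orbits\<close>

lemma isomorphic_single:
  assumes "isomorphic F [o1] [o2]" "o1 \<in> orbits b" "o2 \<in> orbits b" shows "pt o1 = pt o2"
proof -
  from assms(1) obtain f g where fg: "inverse_pair F [o1] [o2] f g" by (auto simp: isomorphic_def iso_mor_def)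
  then obtain a c where ac: "a \<in> H [o1] [o2]" "c \<in> H [o2] [o1]" "f = dec [o1] [o2] a" "g = dec [o2] [o1] c"
    using F_Hom_dec assms(2,3) by (auto simp: inverse_pair_def)
  then have "c * a = idm 1" using fg inverse_pair_F by fastforce
  moreover have "ent (c * a) 0 0 = ent c 0 0 * ent a 0 0" using H_ent_mult[OF ac(1), of c] by simp
  ultimately have "ent c 0 0 * ent a 0 0 = 1" by (simp add: ent_idm)
  moreover have "u ^ dd o2 o1 * u ^ dd o1 o2 dvd ent c 0 0 * ent a 0 0"
    using H_dvd[OF ac(1), of 0 0] H_dvd[OF ac(2), of 0 0] by (intro mult_dvd_mono) auto
  ultimately have "u ^ (dd o2 o1 + dd o1 o2) dvd 1" by (simp add: power_add)
  then show ?thesis using dd_iso_iff[OF assms(2,3) b_le] by (auto simp: u_pow_dvd_1)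
qed

lemma zero_object_F: "X \<in> Ob \<Longrightarrow> zero_object F X \<longleftrightarrow> idm (length X) = (0 :: 'r fm)"
  by (simp add: zero_object_def dec_idm dec_zero dec_eq_iff[OF H_idm H_zero])

lemma idm_zero: "idm n = (0 :: 'r fm) \<longleftrightarrow> n = 0"
proof
  assume "idm n = (0 :: 'r fm)"
  then have "ent (idm n) 0 0 = (0 :: 'r)" by (simp add: ent_simps)
  then show "n = 0" by (auto simp: ent_idm split: if_splits)
next
  assume "n = 0" then show "idm n = (0 :: 'r fm)" by (intro fm_eqI) (simp add: ent_idm ent_simps)
qed

text \<open>An endomorphism of one orbit is given by a single entry in a domain, so the two
  orthogonal idempotents i1 * p1 and i2 * p2 cannot both be nonzero.\<close>

lemma indecomposable_single: assumes "o1 \<in> orbits b" shows "indecomposable F [o1]"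
  unfolding indecomposable_def
proof (intro conjI ballI impI)
  have o: "[o1] \<in> Ob" using assms by simp
  then show "[o1] \<in> Obj F" by simp
  show "\<not> zero_object F [o1]" using o by (simp add: zero_object_F idm_zero)
  fix A B assume AB: "A \<in> Obj F" "B \<in> Obj F" and "is_direct_sum F [o1] A B"
  then obtain i1 i2 p1 p2 where h: "i1 \<in> H A [o1]" "i2 \<in> H B [o1]" "p1 \<in> H [o1] A" "p2 \<in> H [o1] B"
    and e: "p1 * i1 = idm (length A)" "p2 * i2 = idm (length B)" "p1 * i2 = 0" "p2 * i1 = 0" "i1 * p1 + i2 * p2 = idm 1"
  proof -
    assume *: "\<And>i1 i2 p1 p2. i1 \<in> H A [o1] \<Longrightarrow> i2 \<in> H B [o1] \<Longrightarrow> p1 \<in> H [o1] A \<Longrightarrow> p2 \<in> H [o1] B \<Longrightarrow>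
      p1 * i1 = idm (length A) \<Longrightarrow> p2 * i2 = idm (length B) \<Longrightarrow> p1 * i2 = 0 \<Longrightarrow> p2 * i1 = 0 \<Longrightarrow>
      i1 * p1 + i2 * p2 = idm 1 \<Longrightarrow> thesis"
    have AB': "A \<in> Ob" "B \<in> Ob" using AB by auto
    from \<open>is_direct_sum F [o1] A B\<close> obtain f1 f2 g1 g2 where
      fg: "f1 \<in> Hom F A [o1]" "f2 \<in> Hom F B [o1]" "g1 \<in> Hom F [o1] A" "g2 \<in> Hom F [o1] B"
      "Comp F g1 f1 = Ident F A" "Comp F g2 f2 = Ident F B" "Comp F g1 f2 = Zero F B A" "Comp F g2 f1 = Zero F A B"
      "Add F (Comp F f1 g1) (Comp F f2 g2) = Ident F [o1]"
      unfolding is_direct_sum_def by blast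
    obtain i1 i2 p1 p2 where h: "i1 \<in> H A [o1]" "i2 \<in> H B [o1]" "p1 \<in> H [o1] A" "p2 \<in> H [o1] B"
      and d: "f1 = dec A [o1] i1" "f2 = dec B [o1] i2" "g1 = dec [o1] A p1" "g2 = dec [o1] B p2"
      using fg(1-4) F_Hom_dec AB' o by metis
    have "dec A A (p1 * i1) = dec A A (idm (length A))" "dec B B (p2 * i2) = dec B B (idm (length B))"
      "dec B A (p1 * i2) = dec B A 0" "dec A B (p2 * i1) = dec A B 0"
      "dec [o1] [o1] (i1 * p1 + i2 * p2) = dec [o1] [o1] (idm 1)"
      using fg(5-9) unfolding d
      using h AB' o dec_idm[OF o] dec_idm[OF AB'(1)] dec_idm[OF AB'(2)] dec_zero[OF AB'] dec_zero[OF AB'(2,1)]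
      by (simp_all add: dec_Comp dec_add[OF H_mult[OF h(3,1)] H_mult[OF h(4,2)]])
    then have "p1 * i1 = idm (length A)" "p2 * i2 = idm (length B)" "p1 * i2 = 0" "p2 * i1 = 0" "i1 * p1 + i2 * p2 = idm 1"
      using dec_eq_iff[OF H_mult[OF h(1,3)] H_idm[OF AB'(1)]] dec_eq_iff[OF H_mult[OF h(2,4)] H_idm[OF AB'(2)]]
        dec_eq_iff[OF H_mult[OF h(2,3)] H_zero[OF AB'(2,1)]] dec_eq_iff[OF H_mult[OF h(1,4)] H_zero[OF AB']]
        dec_eq_iff[OF H_add[OF H_mult[OF h(3,1)] H_mult[OF h(4,2)]] H_idm[OF o]] by auto
    with * h show thesis by blast
  qed
  have s: "ent (x * y) 0 0 = ent x 0 0 * ent y 0 0" if "y \<in> H [o1] [o1]" for x y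
    using H_ent_mult[OF that, of x] by simp
  define e1 where "e1 = i1 * p1"
  define e2 where "e2 = i2 * p2"
  have eH: "e1 \<in> H [o1] [o1]" "e2 \<in> H [o1] [o1]" using h by (auto simp: e1_def e2_def)
  have "e1 * e2 = 0" using e(3) by (simp add: e1_def e2_def mult.assoc mult_assoc_eq[OF e(3)])
  then have "ent e1 0 0 * ent e2 0 0 = 0" using s[OF eH(2), of e1] by (simp add: ent_simps)
  moreover have z: "x = 0" if "x \<in> H [o1] [o1]" "ent x 0 0 = 0" for x
  proof (rule fm_eqI)
    fix i j :: nat
    have "i = 0 \<and> j = 0 \<or> 1 \<le> i \<or> 1 \<le> j" by (cases i; cases j) auto
    then show "ent x i j = ent 0 i j" using that(2) H_supp[OF that(1), of i j] by (auto simp: ent_simps)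
  qed
  ultimately have "e1 = 0 \<or> e2 = 0" using eH by auto
  moreover have "length A = 0" if "e1 = 0"
  proof -
    have "idm (length A) = p1 * (i1 * p1) * i1" by (simp add: mult.assoc e(1) mult_assoc_eq[OF e(1)] idm_idm)
    then show ?thesis using that by (simp add: e1_def idm_zero)
  qed
  moreover have "length B = 0" if "e2 = 0"
  proof -
    have "idm (length B) = p2 * (i2 * p2) * i2" by (simp add: mult.assoc e(2) mult_assoc_eq[OF e(2)] idm_idm)
    then show ?thesis using that by (simp add: e2_def idm_zero)
  qed
  ultimately show "zero_object F A \<or> zero_object F B" using AB by (auto simp: zero_object_F idm_zero)
qed

lemma injective_single_iff: assumes "o1 \<in> orbits b" shows "injective F \<E> [o1] \<longleftrightarrow> boundary_orbit o1"
proof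
  assume "injective F \<E> [o1]"
  moreover have "projective F \<E> [o1]" using frob calculation assms by (simp add: frobenius_def)
  ultimately obtain x y where xy: "\<bar>x - y\<bar> = b" "isomorphic F [o1] [M x y]"
    using exact indecomposable_single[OF assms] assms unfolding F_exact_def by fastforce
  then have "M x y \<in> orbits b" by (auto simp: orbits_M)
  from isomorphic_single[OF xy(2) assms this] show "boundary_orbit o1" using xy(1) assms pt_width[of x y] by (simp add: boundary_orbit_def)
next
  assume "boundary_orbit o1"
  then obtain x y where xy: "\<bar>x - y\<bar> = b" "o1 = M x y" by (auto simp: boundary_orbit_M)
  have o: "[o1] \<in> Ob" using assms by simp
  have "inverse_pair F [o1] [o1] (dec [o1] [o1] (idm (length [o1]))) (dec [o1] [o1] (idm (length [o1])))"
    using inverse_pair_F[OF H_idm[OF o] H_idm[OF o]] by (simp add: idm_idm)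
  then have "isomorphic F [o1] [M x y]" using xy(2) by (auto simp: isomorphic_def iso_mor_def)
  with xy(1) have "\<exists>x y. \<bar>x - y\<bar> = b \<and> isomorphic F [o1] [M x y]" by blast
  moreover have "indecomposable F X \<and> projective F \<E> X \<and> injective F \<E> X \<longleftrightarrow>
        (\<exists>x y. \<bar>x - y\<bar> = b \<and> isomorphic F X [M x y])" if "X \<in> Ob" for X
    using exact that unfolding F_exact_def by simp
  ultimately show "injective F \<E> [o1]" using o by blast
qed

text \<open>So far injectivity is known for single boundary orbits. Every row of f is a map into a
  single orbit, so f is extended one row at a time.\<close>

lemma boundary_ext:
  assumes "boundary I" "conflation A B C k p" "f \<in> H A I" shows "\<exists>g\<in>H B I. g * k = f"
proof -
  note h = conflation_H[OF assms(2)] conflation_Ob[OF assms(2)]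
  have I: "I \<in> Ob" using boundary_Ob assms by blast
  have "\<forall>i\<in>{..<length I}. \<exists>g\<in>H B [I ! i]. g * k = mk 1 (length A) (\<lambda>_ j. ent f i j)"
  proof
    fix i assume i: "i \<in> {..<length I}"
    then have "injective F \<E> [I ! i]" using injective_single_iff boundary_nth[OF assms(1)] by (auto simp: boundary_orbit_def)
    moreover have "mk (length [I ! i]) (length A) (\<lambda>_ j. ent f i j) \<in> H A [I ! i]"
      using i I h H_dvd[OF assms(3), of i] by (intro H_mk) auto
    ultimately show "\<exists>g\<in>H B [I ! i]. g * k = mk 1 (length A) (\<lambda>_ j. ent f i j)"
      using injective_ext[OF _ assms(2)] by simp
  qed
  then obtain g where g: "\<And>i. i < length I \<Longrightarrow> g i \<in> H B [I ! i]"
    "\<And>i. i < length I \<Longrightarrow> g i * k = mk 1 (length A) (\<lambda>_ j. ent f i j)" by (metis lessThan_iff)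
  let ?g = "mk (length I) (length B) (\<lambda>i j. ent (g i) 0 j)"
  have gH: "?g \<in> H B I" using I h H_dvd[OF g(1), of _ 0] by (intro H_mk) auto
  have "?g * k = f"
  proof (rule fm_eqI)
    fix i j
    have 1: "ent (x * k) i j = (\<Sum>l<length B. ent x i l * ent k l j)" for x i j
      by (rule H_ent_mult[OF h(1)])
    show "ent (?g * k) i j = ent f i j"
    proof (cases "i < length I")
      case True
      then have "ent (?g * k) i j = ent (g i * k) 0 j" by (simp add: 1 ent_mk)
      also have "\<dots> = ent f i j" using True g(2) H_supp[OF assms(3), of i j] by (auto simp: ent_mk)
      finally show ?thesis .
    next
      case False
      then show ?thesis using H_supp[OF assms(3), of i j] by (simp add: 1 ent_mk)
    qed
  qed
  with gH show ?thesis by blast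
qed

text \<open>If I is injective, a map into its i-th summand is placed in row i of a map into I,
  extended there, and row i is taken back; so each summand is injective.\<close>

lemma injective_boundary: "injective F \<E> I \<longleftrightarrow> boundary I"
proof
  assume inj: "injective F \<E> I"
  then have I: "I \<in> Ob" by (auto simp: injective_def)
  have "injective F \<E> [I ! i]" if i: "i < length I" for i
  proof (rule injectiveI)
    show "[I ! i] \<in> Ob" using I i by simp
    fix A B C k p f assume conflation: "conflation A B C k p" and f: "f \<in> H A [I ! i]"
    have "mk (length I) (length A) (\<lambda>r j. if r = i then ent f 0 j else 0) \<in> H A I"
      using I H_Ob[OF f] H_dvd[OF f, of 0] by (intro H_mk) auto
    from injective_ext[OF inj conflation this] obtain g where g: "g \<in> H B I"
      "g * k = mk (length I) (length A) (\<lambda>r j. if r = i then ent f 0 j else 0)" by blast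
    have 1: "ent (x * k) i j = (\<Sum>l<length B. ent x i l * ent k l j)" for x i j
      by (rule H_ent_mult[OF conflation_H(1)[OF conflation]])
    let ?g = "mk (length [I ! i]) (length B) (\<lambda>_ j. ent g i j)"
    have "?g \<in> H B [I ! i]" using I i conflation_Ob[OF conflation] H_dvd[OF g(1), of i] by (intro H_mk) auto
    moreover have "?g * k = f"
    proof (rule fm_eqI)
      fix r j
      show "ent (?g * k) r j = ent f r j"
      proof (cases "r = 0")
        case True
        then have "ent (?g * k) r j = ent (g * k) i j" by (simp add: 1 ent_mk)
        then show ?thesis using True i H_supp[OF f, of 0 j] by (auto simp: g(2) ent_mk)
      next
        case False
        then show ?thesis using H_supp[OF f, of r j] by (simp add: 1 ent_mk)
      qed
    qed
    ultimately show "\<exists>g\<in>H B [I ! i]. g * k = f" by blast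
  qed
  then show "boundary I" using injective_single_iff I by (auto simp: boundary_def in_set_conv_nth)
next
  assume "boundary I" then show "injective F \<E> I" using injectiveI boundary_ext boundary_Ob by blast
qed

lemma projective_boundary: "projective F \<E> I \<longleftrightarrow> boundary I"
  using frob injective_boundary unfolding frobenius_def
  by (metis injective_def projective_def)

lemma boundary_lift: "boundary P \<Longrightarrow> conflation A B C i p \<Longrightarrow> f \<in> H P C \<Longrightarrow> \<exists>g\<in>H P B. p * g = f"
  by (rule projective_lift[unfolded projective_boundary])

section \<open>Equivariant embeddings into boundary objects\<close>

lemma ex_boundary_inflation:
  assumes "X \<in> Ob" obtains J C j p where "boundary J" "conflation X J C j p"
proof -
  from frob assms obtain I f where I: "injective F \<E> I" and f: "f \<in> Hom F X I" "inflation \<E> f"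
    unfolding frobenius_def by fastforce
  have "I \<in> Ob" using I by (auto simp: injective_def)
  then have "enc f \<in> H X I" "f = dec X I (enc f)" using f assms enc_H dec_enc by auto
  then obtain Z p where "conflation X I Z (enc f) p" using inflationE f by metis
  then show thesis using that[of I] I injective_boundary by simp
qed

lemma conflation_twist:
  assumes "conflation X Y Z i p" "\<beta> \<in> H Y Y'" "\<beta>' \<in> H Y' Y" "\<beta>' * \<beta> = idm (length Y)" "\<beta> * \<beta>' = idm (length Y')"
  shows "conflation X Y' Z (\<beta> * i) (p * \<beta>')"
proof -
  note h = conflation_H[OF assms(1)] conflation_Ob[OF assms(1)]
  have Y': "Y' \<in> Ob" using assms H_Ob by blast
  have iso: "iso_mor F X X (dec X X (idm (length X)))" "iso_mor F Y Y' (dec Y Y' \<beta>)" "iso_mor F Z Z (dec Z Z (idm (length Z)))"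
    using iso_mor_F[OF H_idm[OF h(3)]] iso_mor_F[OF assms(2)] iso_mor_F[OF H_idm[OF h(5)]] assms h
    by (auto simp: idm_idm intro: bexI[of _ "idm (length X)"] bexI[of _ "idm (length Z)"])
  have H': "\<beta> * i \<in> H X Y'" "p * \<beta>' \<in> H Y' Z" using assms h by auto
  have "Comp F (dec Y Y' \<beta>) (dec X Y i) = Comp F (dec X Y' (\<beta> * i)) (dec X X (idm (length X)))"
    using dec_Comp[OF h(1) assms(2)] dec_Comp[OF H_idm[OF h(3)] H'(1)] H_idm_right[OF H'(1)] by simp
  moreover have "Comp F (dec Z Z (idm (length Z))) (dec Y Z p) = Comp F (dec Y' Z (p * \<beta>')) (dec Y Y' \<beta>)"
    using dec_Comp[OF h(2) H_idm[OF h(5)]] dec_Comp[OF assms(2) H'(2)] H_idm_left[OF h(2)] H_idm_right[OF h(2)] assms(4)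
    by (simp add: mult.assoc)
  moreover have "(dec X Y i, dec Y Z p) \<in> \<E>" using assms(1) by (simp add: conflation_def)
  ultimately have "(dec X Y' (\<beta> * i), dec Y' Z (p * \<beta>')) \<in> \<E>"
    using ex_iso[of _ _ X Y Z X Y' Z _ _ _ _ _] h Y' iso dec_Hom by simp
  with H' show ?thesis by (simp add: conflation_def)
qed

lemma conflation_comp:
  assumes "conflation X Y Z i p" "conflation Y Y' Z' i' p'" obtains W q where "conflation X Y' W (i' * i) q"
proof -
  note h = conflation_H[OF assms(1)] conflation_H[OF assms(2)] conflation_Ob[OF assms(1)] conflation_Ob[OF assms(2)]
  have "inflation \<E> (Comp F (dec Y Y' i') (dec X Y i))"
    using ex_comp[of _ _ X Y Y'] h conflation_infl[OF assms(1)] conflation_infl[OF assms(2)] dec_Hom by simp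
  then have "inflation \<E> (dec X Y' (i' * i))" using dec_Comp h by simp
  then show thesis using inflationE that h H_mult by metis
qed

text \<open>The inclusion of J in J @ K is the pushout of the inflation 0 -> K along 0 -> J. The
  axioms supply only some pushout B', so B' is identified with J @ K by the mutually inverse maps k
  and l before \<open>conflation_twist\<close> applies.\<close>

lemma conflation_in1:
  assumes J: "J \<in> Ob" and K: "K \<in> Ob" obtains W q where "conflation J (J @ K) W (idm (length J)) q"
proof -
  let ?n = "length J" and ?m = "length K"
  \<comment> \<open>The identity of K is a deflation; its kernel A has zero identity, so A is the
    empty list, and 0 -> K becomes an inflation.\<close>
  have "deflation \<E> (dec K K (idm ?m))" using ex_id[OF K] dec_idm[OF K] by simp
  then obtain A i where A: "conflation A K K i (idm ?m)" using deflationE H_idm[OF K] by metis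
  have i0: "i = 0" using conflation_zero[OF A] H_idm_left[OF conflation_H(1)[OF A]] by simp
  have "idm (length A) = (0 :: 'r fm)"
    by (rule conflation_mono_zero[OF A H_idm]) (use conflation_Ob[OF A] i0 in auto)
  then have A0: "A = []" by (simp add: idm_zero)
  then have Nil: "conflation [] K K 0 (idm ?m)" using A i0 by simp
  have "\<exists>B'\<in>Obj F. \<exists>i' f'. pushout_square F [] K J B' (dec [] K 0) (dec [] J 0) i' f' \<and> inflation \<E> i'"
    using ex_pushout[OF conflation_infl(1)[OF Nil], of "[]" K J] J K dec_Hom by simp
  then obtain B' i' f' where B': "B' \<in> Ob"
    and po: "pushout_square F [] K J B' (dec [] K 0) (dec [] J 0) i' f'" and inf: "inflation \<E> i'" by auto
  have "i' \<in> Hom F J B'" "f' \<in> Hom F K B'" using po by (auto simp: pushout_square_def)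
  then obtain i1 f1 where i1: "i1 \<in> H J B'" "i' = dec J B' i1" and f1: "f1 \<in> H K B'" "f' = dec K B' f1"
    using F_Hom_dec J K B' by metis
  have uni: "\<exists>!k. k \<in> Hom F B' D \<and> Comp F k i' = dec J D g \<and> Comp F k f' = dec K D h"
    if "g \<in> H J D" "h \<in> H K D" for D g h
  proof -
    have "Comp F (dec J D g) (dec [] J 0) = Comp F (dec K D h) (dec [] K 0)"
      using that J K H_Ob dec_Comp[of 0 "[]" J g D] dec_Comp[of 0 "[]" K h D] by (simp add: H_zero)
    then show ?thesis using po that dec_Hom H_Ob[OF that(1)] unfolding pushout_square_def Obj_F by blast
  qed
  note in2 = in2_H[OF J K] and pr2 = pr2_H[OF J K] and in1 = in1_H[OF J K] and pr1 = pr1_H[OF J K]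
  from uni[OF in1 in2] obtain k' where k': "k' \<in> Hom F B' (J @ K)"
    "Comp F k' i' = dec J (J @ K) (idm ?n)" "Comp F k' f' = dec K (J @ K) (in2 ?n ?m)" by auto
  then obtain k where k: "k \<in> H B' (J @ K)" "k' = dec B' (J @ K) k" using F_Hom_dec B' J K by (metis Ob_append)
  have k1: "k * i1 = idm ?n"
    using k'(2) dec_eq_iff[OF H_mult[OF i1(1) k(1)] in1] by (simp add: k i1 dec_Comp[OF i1(1) k(1)])
  have k2: "k * f1 = in2 ?n ?m"
    using k'(3) dec_eq_iff[OF H_mult[OF f1(1) k(1)] in2] by (simp add: k f1 dec_Comp[OF f1(1) k(1)])
  define l where "l = i1 * idm ?n + f1 * pr2 ?n ?m"
  have l: "l \<in> H (J @ K) B'" unfolding l_def using i1 f1 pr1 pr2 by blast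
  have kl: "k * l = idm (length (J @ K))"
    by (simp add: l_def distrib_left mult_assoc_eq[OF k1] mult_assoc_eq[OF k2] idm_idm in2_pr2)
  have l1: "l * idm ?n = i1"
    by (simp add: l_def distrib_right mult.assoc idm_idm pr2_idm H_idm_right[OF i1(1)])
  have l2: "l * in2 ?n ?m = f1"
    by (simp add: l_def distrib_right mult.assoc idm_in2 pr2_in2 H_idm_right[OF f1(1)])
  have "dec B' B' (l * k) = dec B' B' (idm (length B'))"
  proof -
    have "Comp F (dec B' B' (l * k)) i' = dec J B' i1" "Comp F (dec B' B' (l * k)) f' = dec K B' f1"
      using dec_Comp[OF i1(1) H_mult[OF k(1) l]] dec_Comp[OF f1(1) H_mult[OF k(1) l]]
      by (simp_all add: i1 f1 mult.assoc k1 k2 l1 l2)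
    moreover have "Comp F (dec B' B' (idm (length B'))) i' = dec J B' i1" "Comp F (dec B' B' (idm (length B'))) f' = dec K B' f1"
      using dec_Comp[OF i1(1) H_idm[OF B']] dec_Comp[OF f1(1) H_idm[OF B']]
      by (simp_all add: i1(2) f1(2) H_idm_left[OF i1(1)] H_idm_left[OF f1(1)])
    ultimately show ?thesis using uni[OF i1(1) f1(1)] dec_Hom by blast
  qed
  then have lk: "l * k = idm (length B')" using dec_eq_iff[OF H_mult[OF k(1) l] H_idm[OF B']] by blast
  obtain W q where "conflation J B' W i1 q" using inflationE inf i1 by metis
  from conflation_twist[OF this k(1) l lk kl] k1 show thesis using that by simp
qed

definition eob :: "orbit list \<Rightarrow> 'r fm \<Rightarrow> bool" where
  "eob X x \<longleftrightarrow> X \<in> Ob \<and> x \<in> H (psi_obj X) X \<and> x * x = idm (length X)"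

lemma eob_H: assumes "eob X x" shows "X \<in> Ob" "x \<in> H (psi_obj X) X" "x \<in> H X (psi_obj X)" "x * x = idm (length X)"
  using assms H_psi_swap[of X X] by (auto simp: eob_def)

lemma eob_sw: "J \<in> Ob \<Longrightarrow> eob (J @ psi_obj J) (sw (length J))"
  using sw_H sw_sw by (simp add: eob_def)

text \<open>For an inflation j of X into a boundary object J, the column (j, j x) into the sum of J
  and psi J intertwines x with the swap, but it has to be shown to be an inflation. The column (j,
  0) is one, as a composite of inflations. Since k extends j x along j, the automorphism 1 + s k
  carries (j, 0) to (j, j x). The involution passes to the cokernel by its universal
  property.\<close>

lemma equivariant_inflation:
  assumes "eob X x"
  obtains J C i p c where "boundary J" "conflation X (J @ psi_obj J) C i p" "i * x = sw (length J) * i"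
    "eob C c" "p * sw (length J) = c * p"
proof -
  note x = eob_H[OF assms]
  obtain J C0 j p0 where J: "boundary J" "conflation X J C0 j p0" using ex_boundary_inflation[OF x(1)] .
  note jH = conflation_H(1)[OF J(2)]
  have JO: "J \<in> Ob" "psi_obj J \<in> Ob" using boundary_Ob[OF J(1)] by auto
  let ?n = "length J"
  have jx: "j * x \<in> H X (psi_obj J)" using H_mult[OF x(3)] jH H_psi[OF x(1) JO(1)] by blast
  obtain k where k: "k \<in> H J (psi_obj J)" "k * j = j * x"
    using boundary_ext[OF boundary_psi[OF J(1)] J(2) jx] by blast
  let ?I = "J @ psi_obj J"
  obtain W0 q0 where "conflation J ?I W0 (idm ?n) q0" using conflation_in1[OF JO] .
  then obtain W q where W: "conflation X ?I W j q"
    using conflation_comp[OF J(2)] H_idm_left[OF jH] by metis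
  define s where "s = (in2 ?n ?n :: 'r fm)"
  note s2 = in2_H[OF JO, folded s_def, simplified, folded s_def]
  have ks: "k * s = 0"
  proof -
    have "k * s = k * (idm ?n * s)" by (simp add: mult_assoc_eq[OF H_idm_right[OF k(1)]])
    then show ?thesis by (simp add: s_def idm_in2)
  qed
  have sk: "s * k \<in> H ?I ?I"
    using H_mult[OF pr1_H[OF JO] H_mult[OF k(1) s2]] H_idm_right[OF H_mult[OF k(1) s2]] by simp
  \<comment> \<open>As k vanishes on the second summand, \<open>s * k\<close> squares to zero, so 1
    - s k is the inverse of 1 + s k.\<close>
  define \<beta> where "\<beta> = idm (length ?I) + s * k"
  define \<beta>' where "\<beta>' = idm (length ?I) - s * k"
  have \<beta>H: "\<beta> \<in> H ?I ?I" "\<beta>' \<in> H ?I ?I" unfolding \<beta>_def \<beta>'_def using sk JO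
    by (simp_all add: H_add H_diff H_idm del: length_append)
  have sksk: "s * (k * (s * k)) = 0" by (simp add: mult_assoc_eq[OF ks])
  have b1: "\<beta>' * \<beta> = idm (length ?I)" "\<beta> * \<beta>' = idm (length ?I)"
    using H_idm_left[OF sk] H_idm_right[OF sk]
    by (simp_all add: \<beta>_def \<beta>'_def algebra_simps idm_idm sksk)
  note W' = conflation_twist[OF W \<beta>H b1]
  define i where "i = \<beta> * j"
  define p where "p = q * \<beta>'"
  have i: "i = j + s * (j * x)"
    using H_idm_left[OF conflation_H(1)[OF W]] k(2) by (simp add: i_def \<beta>_def distrib_right mult.assoc)
  have W2: "conflation X ?I W i p" using W' by (simp add: i_def p_def)
  have pr2j: "pr2 ?n ?n * j = 0"
    using mult_assoc_eq[OF pr2_idm[of ?n ?n], of j] H_idm_left[OF jH] by simp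
  have eq: "i * x = sw ?n * i"
  proof -
    have "i * x = j * x + s * j"
      using H_idm_right[OF jH] by (simp add: i distrib_right mult.assoc x(4))
    moreover have "sw ?n * i = s * j + j * x"
      using H_idm_left[OF jx]
      by (simp add: sw_def i s_def algebra_simps pr2j mult_assoc_eq[OF in2_in2] mult_assoc_eq[OF pr2_in2])
    ultimately show ?thesis by simp
  qed
  have swH: "sw ?n \<in> H ?I (psi_obj ?I)" using eob_H(3)[OF eob_sw[OF JO(1)]] .
  have "p * sw ?n \<in> H ?I (psi_obj W)"
    using H_mult[OF swH] conflation_H(2)[OF W2] H_psi[of ?I W] JO conflation_Ob[OF W2] by simp
  moreover have "p * sw ?n * i = 0"
    using conflation_zero[OF W2] eq by (simp add: mult.assoc flip: eq) (simp flip: mult.assoc)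
  ultimately obtain c where c: "c \<in> H W (psi_obj W)" "c * p = p * sw ?n"
    using conflation_coker[OF W2] by metis
  have c': "c \<in> H (psi_obj W) W" using c(1) H_psi_swap conflation_Ob[OF W2] by blast
  have "c * c * p = idm (length W) * p"
    using c(2) H_idm_left[OF conflation_H(2)[OF W2]] H_idm_right[OF conflation_H(2)[OF W2]] sw_sw[of ?n]
    by (simp add: mult.assoc mult_assoc_eq[OF c(2)])
  then have "c * c = idm (length W)"
    using conflation_epi[OF W2 H_mult[OF c(1) c'] H_idm] conflation_Ob[OF W2] by blast
  then have "eob W c" using c' conflation_Ob[OF W2] by (simp add: eob_def)
  with that[OF J(1) W2 eq] c(2) show thesis by simp
qed

end

section \<open>Equivariant objects and the stable category\<close>

context exact_orbits
begin

abbreviation Fp where "Fp \<equiv> Fpsi_cat u b"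
abbreviation Ep where "Ep \<equiv> Fpsi_exact u b \<E>"
abbreviation SC where "SC \<equiv> stable_category Fp Ep"

definition st :: "'r pobj \<Rightarrow> 'r fm" where "st A = enc (snd A)"

text \<open>The equation for \<open>snd A\<close> pins down the domain, the codomain and the zero
  entries outside the matrix, all of which \<open>enc\<close> forgets.\<close>

definition EOb :: "'r pobj set" where
  "EOb = {A. eob (fst A) (st A) \<and> snd A = dec (psi_obj (fst A)) (fst A) (st A)}"

definition EH :: "'r pobj \<Rightarrow> 'r pobj \<Rightarrow> 'r fm set" where
  "EH A B = {a \<in> H (fst A) (fst B). A \<in> EOb \<and> B \<in> EOb \<and> a * st A = st B * a}"

definition pm :: "'r pobj \<Rightarrow> 'r pobj \<Rightarrow> 'r fm \<Rightarrow> 'r pmor" where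
  "pm A B a = (A, fst (snd (dec (fst A) (fst B) a)), B)"

definition half :: 'r where "half = (SOME h. h + h = 1)"

lemma half: "half + half = 1"
proof -
  have "2 dvd (1::'r)" using unit_or odd_char by blast
  then obtain h :: 'r where "1 = 2 * h" by (auto simp: dvd_def)
  then have "h + h = 1" by (metis mult_2)
  then show ?thesis unfolding half_def by (rule someI)
qed

lemma sm_half: "sm half (a + a) = a"
proof -
  have "sm half (a + a) = sm (half + half) a" by (simp only: sm_add sm_sum_left)
  then show ?thesis by (simp only: half sm_1)
qed

lemma EOb_eob: "A \<in> EOb \<Longrightarrow> eob (fst A) (st A)" by (simp add: EOb_def)

lemma EOb_H: assumes "A \<in> EOb" shows "fst A \<in> Ob" "st A \<in> H (psi_obj (fst A)) (fst A)"
    "st A \<in> H (fst A) (psi_obj (fst A))" "st A * st A = idm (length (fst A))"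
  using eob_H[OF EOb_eob[OF assms]] by auto

lemma eob_EOb: assumes "eob X x"
  shows "(X, dec (psi_obj X) X x) \<in> EOb" "st (X, dec (psi_obj X) X x) = x"
proof -
  show "st (X, dec (psi_obj X) X x) = x" using enc_dec eob_H(2)[OF assms] by (simp add: st_def)
  then show "(X, dec (psi_obj X) X x) \<in> EOb" using assms by (simp add: EOb_def)
qed

lemma Obj_Fp [simp]: "Obj Fp = EOb"
proof (rule set_eqI)
  fix A :: "'r pobj"
  obtain X \<xi> where A: "A = (X, \<xi>)" by fastforce
  show "A \<in> Obj Fp \<longleftrightarrow> A \<in> EOb"
  proof
    assume "A \<in> Obj Fp"
    then have X: "X \<in> Ob" and iso: "iso_mor F (psi_obj X) X \<xi>" and c: "Comp F \<xi> (psi_mor \<xi>) = Ident F X"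
      by (auto simp: Fpsi_cat_def A)
    then have xh: "\<xi> \<in> Hom F (psi_obj X) X" by (auto simp: iso_mor_def inverse_pair_def)
    define x where "x = enc \<xi>"
    have x: "x \<in> H (psi_obj X) X" "\<xi> = dec (psi_obj X) X x"
      using xh X enc_H dec_enc by (auto simp: x_def)
    then have "psi_mor \<xi> = dec X (psi_obj X) x" using psi_dec X by simp
    then have "dec X X (x * x) = dec X X (idm (length X))"
      using c x X H_psi_swap dec_Comp dec_idm by metis
    then have "x * x = idm (length X)" using dec_eq_iff[OF H_mult H_idm] x X H_psi_swap by blast
    then show "A \<in> EOb" using x X by (simp add: EOb_def A st_def eob_def enc_dec)
  next
    assume "A \<in> EOb"
    then have e: "eob X (st A)" and xi: "\<xi> = dec (psi_obj X) X (st A)" by (auto simp: EOb_def A)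
    note x = eob_H[OF e]
    have "psi_mor \<xi> = dec X (psi_obj X) (st A)" using psi_dec x xi by simp
    then have "Comp F \<xi> (psi_mor \<xi>) = Ident F X" using dec_Comp[OF x(3,2)] x dec_idm xi by simp
    moreover have "iso_mor F (psi_obj X) X \<xi>" unfolding xi using iso_mor_F[OF x(2)] x by auto
    ultimately show "A \<in> Obj Fp" using x by (simp add: Fpsi_cat_def A)
  qed
qed

lemma EH_H: "a \<in> EH A B \<Longrightarrow> a \<in> H (fst A) (fst B)" by (simp add: EH_def)
lemma EH_eq: "a \<in> EH A B \<Longrightarrow> a * st A = st B * a" by (simp add: EH_def)
lemma EH_Ob: "a \<in> EH A B \<Longrightarrow> A \<in> EOb" "a \<in> EH A B \<Longrightarrow> B \<in> EOb" by (auto simp: EH_def)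

lemma EH_mult [intro]: "a \<in> EH A B \<Longrightarrow> c \<in> EH B C \<Longrightarrow> c * a \<in> EH A C"
  unfolding EH_def by (auto simp: mult.assoc) (simp flip: mult.assoc)

lemma EH_add [intro]: "a \<in> EH A B \<Longrightarrow> c \<in> EH A B \<Longrightarrow> a + c \<in> EH A B"
  unfolding EH_def by (auto simp: algebra_simps)

lemma EH_diff [intro]: "a \<in> EH A B \<Longrightarrow> c \<in> EH A B \<Longrightarrow> a - c \<in> EH A B"
  unfolding EH_def by (auto simp: algebra_simps)

lemma EH_sm [intro]: "a \<in> EH A B \<Longrightarrow> sm c a \<in> EH A B"
  unfolding EH_def by (auto simp: sm_mult_left sm_mult_right)

lemma EH_zero [intro]: "A \<in> EOb \<Longrightarrow> B \<in> EOb \<Longrightarrow> 0 \<in> EH A B"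
  unfolding EH_def by (auto intro!: H_zero EOb_H(1))

lemma EH_idm [intro]: "A \<in> EOb \<Longrightarrow> idm (length (fst A)) \<in> EH A A"
  unfolding EH_def using EOb_H H_idm H_idm_left[of "st A"] H_idm_right[of "st A"] by fastforce

lemma pm_eq_iff: "a \<in> H (fst A) (fst B) \<Longrightarrow> c \<in> H (fst A) (fst B) \<Longrightarrow> pm A B a = pm A B c \<longleftrightarrow> a = c"
  using dec_eq_iff[of a "fst A" "fst B" c] by (auto simp: pm_def dec_def)

lemma forget_pm: "forget (pm A B a) = dec (fst A) (fst B) a"
  by (simp add: forget_def pm_def dec_def)

lemma Hom_Fp:
  assumes "A \<in> EOb" "B \<in> EOb" shows "Hom Fp A B = pm A B ` EH A B"
proof -
  have e: "snd A = dec (psi_obj (fst A)) (fst A) (st A)" "snd B = dec (psi_obj (fst B)) (fst B) (st B)"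
    using assms by (auto simp: EOb_def)
  note a = EOb_H[OF assms(1)] and b' = EOb_H[OF assms(2)]
  have key: "Comp F (dec (fst A) (fst B) m) (snd A) = Comp F (snd B) (psi_mor (dec (fst A) (fst B) m))
      \<longleftrightarrow> m * st A = st B * m" if m: "m \<in> H (fst A) (fst B)" for m
  proof -
    have m': "m \<in> H (psi_obj (fst A)) (psi_obj (fst B))" using m H_psi a b' by simp
    show ?thesis unfolding e psi_dec[OF m] dec_Comp[OF a(2) m] dec_Comp[OF m' b'(2)]
      using dec_eq_iff[OF H_mult[OF a(2) m] H_mult[OF m' b'(2)]] .
  qed
  show ?thesis
  proof (rule set_eqI)
    fix f
    show "f \<in> Hom Fp A B \<longleftrightarrow> f \<in> pm A B ` EH A B"
    proof
      assume "f \<in> Hom Fp A B"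
      then obtain m where f: "f = (A, m, B)" "(fst A, m, fst B) \<in> Hom F (fst A) (fst B)"
        "Comp F (fst A, m, fst B) (snd A) = Comp F (snd B) (psi_mor (fst A, m, fst B))"
        by (auto simp: Fpsi_cat_def)
      define c where "c = enc (fst A, m, fst B)"
      have c: "c \<in> H (fst A) (fst B)" "(fst A, m, fst B) = dec (fst A) (fst B) c"
        using f(2) enc_H dec_enc a b' by (auto simp: c_def)
      then have "c \<in> EH A B" using key[OF c(1)] f(3) assms by (simp add: EH_def)
      moreover have "f = pm A B c" using c(2) by (simp add: f(1) pm_def dec_def)
      ultimately show "f \<in> pm A B ` EH A B" by blast
    next
      assume "f \<in> pm A B ` EH A B"
      then obtain c where c: "c \<in> EH A B" "f = pm A B c" by blast
      have d: "(fst A, fst (snd (dec (fst A) (fst B) c)), fst B) = dec (fst A) (fst B) c" by (simp add: dec_def)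
      have "dec (fst A) (fst B) c \<in> Hom F (fst A) (fst B)" by (rule dec_Hom)
      then show "f \<in> Hom Fp A B" using key[OF EH_H[OF c(1)]] EH_eq[OF c(1)] d
        by (simp add: c(2) pm_def Fpsi_cat_def)
    qed
  qed
qed

lemma pm_Hom: "a \<in> EH A B \<Longrightarrow> pm A B a \<in> Hom Fp A B"
  using Hom_Fp EH_Ob by blast

lemma pm_Comp: "a \<in> H (fst A) (fst B) \<Longrightarrow> c \<in> H (fst B) (fst C) \<Longrightarrow> Comp Fp (pm B C c) (pm A B a) = pm A C (c * a)"
  using dec_Comp[of a "fst A" "fst B" c "fst C"]
  by (simp add: Fpsi_cat_def forget_pm) (simp add: pm_def)

lemma pm_Ident: "A \<in> EOb \<Longrightarrow> Ident Fp A = pm A A (idm (length (fst A)))"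
  using dec_idm EOb_H by (simp add: Fpsi_cat_def pm_def)

lemma pm_Zero: "A \<in> EOb \<Longrightarrow> B \<in> EOb \<Longrightarrow> Zero Fp A B = pm A B 0"
  using dec_zero[of "fst A" "fst B"] EOb_H by (auto simp: Fpsi_cat_def F_cat_def pm_def dec_def)

lemma pm_Add: "a \<in> H (fst A) (fst B) \<Longrightarrow> c \<in> H (fst A) (fst B) \<Longrightarrow> Add Fp (pm A B a) (pm A B c) = pm A B (a + c)"
  using dec_add[of a "fst A" "fst B" c] by (simp add: Fpsi_cat_def F_cat_def pm_def dec_def)

text \<open>The projection onto the equivariant maps, for which 2 has to be invertible.\<close>

definition average :: "'r pobj \<Rightarrow> 'r pobj \<Rightarrow> 'r fm \<Rightarrow> 'r fm" where
  "average A B a = sm half (a + st B * a * st A)"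

lemma average_EH:
  assumes "A \<in> EOb" "B \<in> EOb" "a \<in> H (fst A) (fst B)" shows "average A B a \<in> EH A B"
proof -
  note A = EOb_H[OF assms(1)] and B = EOb_H[OF assms(2)]
  have "st B * a * st A \<in> H (fst A) (fst B)"
    using H_mult[OF A(3) H_mult[OF _ B(2)]] assms(3) H_psi A B by (simp add: mult.assoc)
  moreover have "(a + st B * a * st A) * st A = st B * (a + st B * a * st A)"
    using H_idm_left[OF H_mult[OF A(2) assms(3)]] H_idm_right[OF H_mult[OF assms(3) H_mult]] H_idm_right[OF assms(3)]
    by (simp add: algebra_simps A(4) mult_assoc_eq[OF B(4)])
  ultimately show ?thesis
    unfolding average_def EH_def using assms by (auto simp: sm_mult_left sm_mult_right)
qed

lemma average_id: assumes "a \<in> EH A B" shows "average A B a = a"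
proof -
  have "st B * a * st A = a"
    using EH_eq[OF assms] H_idm_right[OF EH_H[OF assms]] EOb_H(4)[OF EH_Ob(1)[OF assms]]
    by (metis mult.assoc)
  then show ?thesis by (simp add: average_def sm_half)
qed

lemma average_left: assumes "g \<in> EH B C" shows "g * average A B a = average A C (g * a)"
  using mult_assoc_eq[OF EH_eq[OF assms]]
  by (simp add: average_def sm_mult_right distrib_left mult.assoc)

lemma average_right: assumes "g \<in> EH A B" shows "average B C a * g = average A C (a * g)"
  using EH_eq[OF assms]
  by (simp add: average_def sm_mult_left distrib_right mult.assoc)

section \<open>Conflations and injective objects in the equivariant category\<close>

definition equivariant_conflation :: "'r pobj \<Rightarrow> 'r pobj \<Rightarrow> 'r pobj \<Rightarrow> 'r fm \<Rightarrow> 'r fm \<Rightarrow> bool" where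
  "equivariant_conflation A B C i p \<longleftrightarrow> i \<in> EH A B \<and> p \<in> EH B C \<and> conflation (fst A) (fst B) (fst C) i p"

lemma equivariant_conflationD: "equivariant_conflation A B C i p \<Longrightarrow> i \<in> EH A B" "equivariant_conflation A B C i p \<Longrightarrow> p \<in> EH B C"
    "equivariant_conflation A B C i p \<Longrightarrow> conflation (fst A) (fst B) (fst C) i p"
  by (auto simp: equivariant_conflation_def)

lemma Ep_equivariant_conflation:
  assumes "i \<in> EH A B" "p \<in> EH B C" shows "(pm A B i, pm B C p) \<in> Ep \<longleftrightarrow> equivariant_conflation A B C i p"
proof
  assume "(pm A B i, pm B C p) \<in> Ep"
  then have "(dec (fst A) (fst B) i, dec (fst B) (fst C) p) \<in> \<E>" by (auto simp: Fpsi_exact_def forget_pm)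
  then show "equivariant_conflation A B C i p" using assms EH_H by (simp add: equivariant_conflation_def conflation_def)
next
  assume "equivariant_conflation A B C i p"
  then show "(pm A B i, pm B C p) \<in> Ep"
    using pm_Hom[OF assms(1)] pm_Hom[OF assms(2)] EH_Ob[OF assms(1)] EH_Ob[OF assms(2)]
    unfolding Fpsi_exact_def Obj_Fp equivariant_conflation_def conflation_def by (auto simp: forget_pm)
qed

lemma Ep_E:
  assumes "(f, g) \<in> Ep" obtains A B C i p where "equivariant_conflation A B C i p" "f = pm A B i" "g = pm B C p"
proof -
  from assms obtain A B C where o: "A \<in> EOb" "B \<in> EOb" "C \<in> EOb" and h: "f \<in> Hom Fp A B" "g \<in> Hom Fp B C"
    by (auto simp: Fpsi_exact_def)
  then obtain i p where "i \<in> EH A B" "f = pm A B i" "p \<in> EH B C" "g = pm B C p"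
    by (auto simp: Hom_Fp)
  then show thesis using that Ep_equivariant_conflation assms by blast
qed

lemma pm_src: "pm A B a = pm A' B' a' \<Longrightarrow> A = A' \<and> B = B'" by (auto simp: pm_def)

text \<open>An extension exists in \<open>F\<close> because the underlying list is boundary. It need
  not be equivariant, but its average is, and averaging does not change the equivariant map f' that
  is being extended.\<close>

lemma boundary_injective_Fp: assumes "I \<in> EOb" "boundary (fst I)" shows "injective Fp Ep I"
  unfolding injective_def
proof (intro conjI ballI impI)
  show "I \<in> Obj Fp" using assms by simp
  fix A B i f assume o: "A \<in> Obj Fp" "B \<in> Obj Fp" and h: "i \<in> Hom Fp A B" "inflation Ep i" "f \<in> Hom Fp A I"
  from h o assms obtain f' where f: "f' \<in> EH A I" "f = pm A I f'" by (auto simp: Hom_Fp)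
  from h obtain g where "(i, g) \<in> Ep" by (auto simp: inflation_def)
  then obtain A' B' C i' p where c: "equivariant_conflation A' B' C i' p" "i = pm A' B' i'" using Ep_E by metis
  moreover have "A' = A" "B' = B" using h(1) c(2) o by (auto simp: Hom_Fp dest: pm_src)
  ultimately have c: "equivariant_conflation A B C i' p" "i = pm A B i'" by auto
  obtain g' where g: "g' \<in> H (fst B) (fst I)" "g' * i' = f'" using boundary_ext[OF assms(2) equivariant_conflationD(3)[OF c(1)] EH_H[OF f(1)]] by blast
  let ?g = "average B I g'"
  have gE: "?g \<in> EH B I" using average_EH o assms g by auto
  have "?g * i' = f'" using average_right[OF equivariant_conflationD(1)[OF c(1)]] g average_id[OF f(1)] by simp
  then have "Comp Fp (pm B I ?g) i = f" using pm_Comp[OF EH_H[OF equivariant_conflationD(1)[OF c(1)]] EH_H[OF gE]] c f by simp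
  then show "\<exists>g\<in>Hom Fp B I. Comp Fp g i = f" using pm_Hom[OF gE] by blast
qed

lemma boundary_projective_Fp: assumes "P \<in> EOb" "boundary (fst P)" shows "projective Fp Ep P"
  unfolding projective_def
proof (intro conjI ballI impI)
  show "P \<in> Obj Fp" using assms by simp
  fix B C p f assume o: "B \<in> Obj Fp" "C \<in> Obj Fp" and h: "p \<in> Hom Fp B C" "deflation Ep p" "f \<in> Hom Fp P C"
  from h o assms obtain f' where f: "f' \<in> EH P C" "f = pm P C f'" by (auto simp: Hom_Fp)
  from h obtain g where "(g, p) \<in> Ep" by (auto simp: deflation_def)
  then obtain A B' C' i p' where c: "equivariant_conflation A B' C' i p'" "p = pm B' C' p'" using Ep_E by metis
  moreover have "B' = B" "C' = C" using h(1) c(2) o by (auto simp: Hom_Fp dest: pm_src)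
  ultimately have c: "equivariant_conflation A B C i p'" "p = pm B C p'" by auto
  obtain g' where g: "g' \<in> H (fst P) (fst B)" "p' * g' = f'" using boundary_lift[OF assms(2) equivariant_conflationD(3)[OF c(1)] EH_H[OF f(1)]] by blast
  let ?g = "average P B g'"
  have gE: "?g \<in> EH P B" using average_EH o assms g by auto
  have "p' * ?g = f'" using average_left[OF equivariant_conflationD(2)[OF c(1)]] g average_id[OF f(1)] by simp
  then have "Comp Fp p (pm P B ?g) = f" using pm_Comp[OF EH_H[OF gE] EH_H[OF equivariant_conflationD(2)[OF c(1)]]] c f by simp
  then show "\<exists>g\<in>Hom Fp P B. Comp Fp p g = f" using pm_Hom[OF gE] by blast
qed

lemma ex_equivariant_conflation:
  assumes "A \<in> EOb" obtains I C i p where "equivariant_conflation A I C i p" "boundary (fst I)"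
proof -
  obtain J C i p c where J: "boundary J" "conflation (fst A) (J @ psi_obj J) C i p" "i * st A = sw (length J) * i"
    "eob C c" "p * sw (length J) = c * p" using equivariant_inflation[OF EOb_eob[OF assms]] .
  let ?I = "(J @ psi_obj J, dec (psi_obj (J @ psi_obj J)) (J @ psi_obj J) (sw (length J)))"
  let ?C = "(C, dec (psi_obj C) C c)"
  note I = eob_EOb[OF eob_sw[OF boundary_Ob[OF J(1)]]] and C = eob_EOb[OF J(4)]
  have "equivariant_conflation A ?I ?C i p"
    using J conflation_H[OF J(2)] I C assms by (simp add: equivariant_conflation_def EH_def)
  then show thesis using that J(1) boundary_psi by (simp add: boundary_append)
qed

text \<open>If u does not divide the entry, some term of the sum is a unit. A term passing through Y
  ! l is divisible by u to the sum of the two degrees, so for that l both degrees vanish. This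
  replaces the Krull-Schmidt theorem: a summand that factors through Y has the position of a summand
  of Y.\<close>

lemma unit_entry:
  assumes "a \<in> H X Y" "c \<in> H Y X" "k < length X" "\<not> u dvd ent (c * a) k k"
  shows "\<exists>l<length Y. pt (X ! k) = pt (Y ! l)"
proof (rule ccontr)
  assume n: "\<not> ?thesis"
  have "u dvd (\<Sum>l<length Y. ent c k l * ent a l k)"
  proof (rule dvd_sum)
    fix l assume l: "l \<in> {..<length Y}"
    then have "dd (X ! k) (Y ! l) + dd (Y ! l) (X ! k) \<noteq> 0"
      using n assms(3) H_Ob[OF assms(1)] dd_iso_iff[OF _ _ b_le, of "X ! k" "Y ! l"] by auto
    then have "u dvd u ^ (dd (Y ! l) (X ! k) + dd (X ! k) (Y ! l))" by (intro dvd_power) auto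
    also have "\<dots> dvd ent c k l * ent a l k"
      unfolding power_add using H_dvd[OF assms(1)] H_dvd[OF assms(2)] l assms(3) by (intro mult_dvd_mono) auto
    finally show "u dvd ent c k l * ent a l k" .
  qed
  with assms(4) show False by (simp add: H_ent_mult[OF assms(1)])
qed

text \<open>An injective object is a retract of one with boundary orbits. The diagonal entries of
  the identity are units, so \<open>unit_entry\<close> gives each of its orbits the position of a
  boundary orbit.\<close>

lemma injective_Fp_iff: "injective Fp Ep I \<longleftrightarrow> I \<in> EOb \<and> boundary (fst I)"
proof
  assume inj: "injective Fp Ep I"
  then have I: "I \<in> EOb" by (auto simp: injective_def)
  obtain J C i p where J: "equivariant_conflation I J C i p" "boundary (fst J)" using ex_equivariant_conflation[OF I] .
  have JO: "J \<in> EOb" using EH_Ob equivariant_conflationD(1)[OF J(1)] by blast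
  have "inflation Ep (pm I J i)" unfolding inflation_def using Ep_equivariant_conflation[OF equivariant_conflationD(1,2)[OF J(1)]] J(1) by blast
  then have "\<exists>g\<in>Hom Fp J I. Comp Fp g (pm I J i) = pm I I (idm (length (fst I)))"
    using inj I JO pm_Hom[OF equivariant_conflationD(1)[OF J(1)]] pm_Hom[OF EH_idm[OF I]] unfolding injective_def by simp
  then obtain r where r: "r \<in> EH J I" "Comp Fp (pm J I r) (pm I J i) = pm I I (idm (length (fst I)))"
    using Hom_Fp[OF JO I] by auto
  note iH = EH_H[OF equivariant_conflationD(1)[OF J(1)]] and rH = EH_H[OF r(1)]
  have ri: "r * i = idm (length (fst I))"
    using r(2) pm_Comp[OF iH rH] pm_eq_iff[OF H_mult[OF iH rH] EH_H[OF EH_idm[OF I]]] by simp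
  have "boundary_orbit (fst I ! k)" if k: "k < length (fst I)" for k
  proof -
    have "\<not> u dvd ent (r * i) k k" using k u_nonunit by (simp add: ri ent_idm)
    from unit_entry[OF iH rH k this] obtain l where "l < length (fst J)" "pt (fst I ! k) = pt (fst J ! l)" by blast
    then show ?thesis using boundary_nth[OF J(2)] k EOb_H(1)[OF I] by (simp add: boundary_orbit_def)
  qed
  then show "I \<in> EOb \<and> boundary (fst I)" using I by (auto simp: boundary_def in_set_conv_nth)
qed (use boundary_injective_Fp in blast)

text \<open>The factorization takes place in \<open>F\<close>, without equivariance; by
  \<open>null_mors_Fp\<close> an equivariant map of this kind is null in the equivariant category as
  well.\<close>

definition Fac :: "orbit list \<Rightarrow> orbit list \<Rightarrow> 'r fm set" where
  "Fac X Y = {g * f |g f P. boundary P \<and> f \<in> H X P \<and> g \<in> H P Y}"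

lemma FacI: "boundary P \<Longrightarrow> f \<in> H X P \<Longrightarrow> g \<in> H P Y \<Longrightarrow> g * f \<in> Fac X Y"
  by (auto simp: Fac_def)

lemma Fac_left: "a \<in> Fac X Y \<Longrightarrow> c \<in> H Y Z \<Longrightarrow> c * a \<in> Fac X Z"
proof -
  assume "a \<in> Fac X Y" "c \<in> H Y Z"
  then obtain g f P where "a = g * f" "boundary P" "f \<in> H X P" "c * g \<in> H P Z" by (auto simp: Fac_def)
  then show ?thesis using FacI[of P f X "c * g" Z] by (simp add: mult.assoc)
qed

lemma Fac_right: "a \<in> Fac X Y \<Longrightarrow> c \<in> H W X \<Longrightarrow> a * c \<in> Fac W Y"
proof -
  assume "a \<in> Fac X Y" "c \<in> H W X"
  then obtain g f P where "a = g * f" "boundary P" "f * c \<in> H W P" "g \<in> H P Y" by (auto simp: Fac_def)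
  then show ?thesis using FacI[of P "f * c" W g Y] by (simp add: mult.assoc)
qed

lemma Fac_sm: "a \<in> Fac X Y \<Longrightarrow> sm c a \<in> Fac X Y"
proof -
  assume "a \<in> Fac X Y"
  then obtain g f P where "a = g * f" "boundary P" "f \<in> H X P" "sm c g \<in> H P Y" by (auto simp: Fac_def)
  then show ?thesis using FacI[of P f X "sm c g" Y] by (simp add: sm_mult_left)
qed

lemma Fac_uminus: "a \<in> Fac X Y \<Longrightarrow> - a \<in> Fac X Y"
  using Fac_sm[of a X Y "- 1"] by (simp add: sm_minus1)

lemma Fac_zero: assumes "X \<in> Ob" "Y \<in> Ob" shows "0 \<in> Fac X Y"
  using FacI[of "[]" 0 X 0 Y] H_zero[OF assms(1) Ob_Nil] H_zero[OF Ob_Nil assms(2)] by (simp add: boundary_def)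

text \<open>The two factorizations are combined through the direct sum P @ P'.\<close>

lemma Fac_add: assumes "a \<in> Fac X Y" "c \<in> Fac X Y" shows "a + c \<in> Fac X Y"
proof -
  obtain g f P where a: "a = g * f" "boundary P" "f \<in> H X P" "g \<in> H P Y" using assms(1) by (auto simp: Fac_def)
  obtain g' f' P' where c: "c = g' * f'" "boundary P'" "f' \<in> H X P'" "g' \<in> H P' Y" using assms(2) by (auto simp: Fac_def)
  note o = boundary_Ob[OF a(2)] boundary_Ob[OF c(2)]
  let ?i2 = "in2 (length P) (length P')" and ?p2 = "pr2 (length P) (length P')"
  have 1: "idm (length P) * f + ?i2 * f' \<in> H X (P @ P')"
    using H_mult[OF a(3) in1_H[OF o]] H_mult[OF c(3) in2_H[OF o]] by blast
  have 2: "g * idm (length P) + g' * ?p2 \<in> H (P @ P') Y"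
    using H_mult[OF pr1_H[OF o] a(4)] H_mult[OF pr2_H[OF o] c(4)] by blast
  have "?p2 * f = 0" using mult_assoc_eq[OF pr2_idm[of "length P" "length P'"], of f] H_idm_left[OF a(3)] by simp
  moreover have "g * (?i2 * f') = 0"
  proof -
    have "g * (?i2 * f') = g * (idm (length P) * (?i2 * f'))" by (simp only: mult_assoc_eq[OF H_idm_right[OF a(4)]])
    then show ?thesis by (simp add: mult_assoc_eq[OF idm_in2])
  qed
  ultimately have "(g * idm (length P) + g' * ?p2) * (idm (length P) * f + ?i2 * f') = a + c"
    using H_idm_left[OF a(3)] H_idm_left[OF c(3)]
    by (simp add: algebra_simps a(1) c(1) mult_assoc_eq[OF idm_idm] mult_assoc_eq[OF idm_in2] mult_assoc_eq[OF pr2_idm]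
        mult_assoc_eq[OF pr2_in2])
  with FacI[OF _ 1 2] show ?thesis using a(2) c(2) by (simp add: boundary_append)
qed

lemma Fac_diff: "a \<in> Fac X Y \<Longrightarrow> c \<in> Fac X Y \<Longrightarrow> a - c \<in> Fac X Y"
  using Fac_add[OF _ Fac_uminus] by (metis diff_conv_add_uminus)

text \<open>A factorization a = g f through P in \<open>F\<close> yields equivariant maps (f, f x)
  and (g, y g) through the object S P. Their composite is g f + y g f x = 2 a, because a is
  equivariant, so halving one of them gives an equivariant factorization of a.\<close>

lemma null_mors_Fp:
  assumes "A \<in> EOb" "B \<in> EOb"
  shows "null_mors Fp Ep A B = pm A B ` (EH A B \<inter> Fac (fst A) (fst B))"
proof (intro set_eqI iffI)
  fix h assume "h \<in> null_mors Fp Ep A B"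
  then obtain f g P where P: "injective Fp Ep P" "f \<in> Hom Fp A P" "g \<in> Hom Fp P B" "h = Comp Fp g f"
    by (auto simp: null_mors_def)
  then have PO: "P \<in> EOb" "boundary (fst P)" by (auto simp: injective_Fp_iff)
  obtain f' g' where f': "f' \<in> EH A P" "f = pm A P f'" and g': "g' \<in> EH P B" "g = pm P B g'"
    using P Hom_Fp PO assms by auto
  have "g' * f' \<in> EH A B \<inter> Fac (fst A) (fst B)"
    using FacI[OF PO(2) EH_H[OF f'(1)] EH_H[OF g'(1)]] f' g' by blast
  moreover have "h = pm A B (g' * f')" using pm_Comp[OF EH_H[OF f'(1)] EH_H[OF g'(1)]] f' g' P by simp
  ultimately show "h \<in> pm A B ` (EH A B \<inter> Fac (fst A) (fst B))" by blast
next
  fix h assume "h \<in> pm A B ` (EH A B \<inter> Fac (fst A) (fst B))"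
  then obtain a where a: "h = pm A B a" "a \<in> EH A B" "a \<in> Fac (fst A) (fst B)" by blast
  then obtain g f P where P: "a = g * f" "boundary P" "f \<in> H (fst A) P" "g \<in> H P (fst B)" by (auto simp: Fac_def)
  note o = boundary_Ob[OF P(2)] Ob_psi[OF boundary_Ob[OF P(2)]]
  note A = EOb_H[OF assms(1)] and B = EOb_H[OF assms(2)]
  let ?n = "length P"
  let ?S = "(P @ psi_obj P, dec (psi_obj (P @ psi_obj P)) (P @ psi_obj P) (sw ?n))"
  note S = eob_EOb[OF eob_sw[OF o(1)]]
  define x where "x = st A"
  define y where "y = st B"
  define s where "s = (in2 ?n ?n :: 'r fm)"
  define t where "t = (pr2 ?n ?n :: 'r fm)"
  have sH: "s \<in> H (psi_obj P) (P @ psi_obj P)" "t \<in> H (P @ psi_obj P) (psi_obj P)"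
    using in2_H[OF o] pr2_H[OF o] by (simp_all add: s_def t_def)
  have fx: "f * x \<in> H (fst A) (psi_obj P)" "y * g \<in> H (psi_obj P) (fst B)"
    using H_mult[OF A(3)] H_mult[OF _ B(2)] P H_psi A B o by (auto simp: x_def y_def)
  have xx: "f * (x * x) = f" "y * (y * g) = g"
    using A(4) B(4) H_idm_right[OF P(3)] H_idm_left[OF P(4)] by (simp_all add: x_def y_def flip: mult.assoc)
  have yy: "(y * y) * g = g" using xx(2) by (simp add: mult.assoc)
  have yg: "y * (y * (g * t)) = g * t" using yy by (simp flip: mult.assoc)
  have gs: "g * s = 0" by (metis H_idm_right[OF P(4)] idm_in2 mult.assoc mult_zero_right s_def)
  have tf: "t * f = 0" by (metis H_idm_left[OF P(3)] pr2_idm mult.assoc mult_zero_left t_def)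
  have ts: "t * s = idm ?n" "t * t = 0" "s * s = 0" by (simp_all add: s_def t_def pr2_in2 pr2_pr2 in2_in2)
  have n: "idm ?n * (f * x) = f * x" using H_idm_left[OF P(3)] by (simp flip: mult.assoc)
  have n': "y * (g * idm ?n) = y * g" using H_idm_right[OF P(4)] by simp
  define f1 where "f1 = f + s * (f * x)"
  define g1 where "g1 = g + (y * g) * t"
  have f1: "f1 \<in> EH A ?S"
  proof -
    have "f1 \<in> H (fst A) (P @ psi_obj P)"
      using H_mult[OF P(3) in1_H[OF o]] H_idm_left[OF P(3)] H_mult[OF fx(1) sH(1)] by (auto simp: f1_def)
    moreover have "f1 * x = sw ?n * f1"
      by (simp add: sw_def f1_def s_def[symmetric] t_def[symmetric] algebra_simps xx tf mult_assoc_eq[OF ts(1)] mult_assoc_eq[OF ts(3)] n)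
    ultimately show ?thesis using S assms by (simp add: EH_def x_def)
  qed
  have g1: "g1 \<in> EH ?S B"
  proof -
    have "g1 \<in> H (P @ psi_obj P) (fst B)"
      using H_mult[OF pr1_H[OF o] P(4)] H_idm_right[OF P(4)] H_mult[OF sH(2) fx(2)] by (auto simp: g1_def)
    moreover have "g1 * sw ?n = y * g1"
      by (simp add: sw_def g1_def s_def[symmetric] t_def[symmetric] algebra_simps xx gs ts n' yg)
    ultimately show ?thesis using S assms by (simp add: EH_def y_def)
  qed
  have "y * (g * (f * x)) = a"
    using average_id[OF a(2)] EH_eq[OF a(2)] A(4) H_idm_right[OF EH_H[OF a(2)]]
    by (metis P(1) mult.assoc x_def y_def)
  then have "g1 * f1 = a + a"
    by (simp add: g1_def f1_def algebra_simps tf mult_assoc_eq[OF gs] mult_assoc_eq[OF ts(1)] n P(1))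
  then have e: "sm half g1 * f1 = a" by (simp add: sm_mult_left sm_half)
  have Sb: "?S \<in> EOb" "boundary (fst ?S)" using S P(2) boundary_psi by (auto simp: boundary_append)
  have "Comp Fp (pm ?S B (sm half g1)) (pm A ?S f1) = pm A B a"
    using pm_Comp[OF EH_H[OF f1] EH_H[OF EH_sm[OF g1]]] e by simp
  then show "h \<in> null_mors Fp Ep A B"
    unfolding null_mors_def a(1) using boundary_injective_Fp[OF Sb] boundary_projective_Fp[OF Sb] pm_Hom[OF f1] pm_Hom[OF EH_sm[OF g1]]
    by (metis (mono_tags, lifting) mem_Collect_eq)
qed

section \<open>The stable category and Ext in terms of matrices\<close>

definition cl :: "'r pobj \<Rightarrow> 'r pobj \<Rightarrow> 'r fm \<Rightarrow> 'r pmor set" where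
  "cl A B a = {pm A B (a + n) |n. n \<in> EH A B \<and> n \<in> Fac (fst A) (fst B)}"

text \<open>A morphism records its domain and codomain, so the quantified objects X and Y in
  \<open>stable_class\<close> can only be A and B.\<close>

lemma stable_class_pm:
  assumes "a \<in> EH A B" shows "stable_class Fp Ep (pm A B a) = cl A B a"
proof -
  note o = EH_Ob[OF assms]
  have "stable_class Fp Ep (pm A B a) = {Add Fp (pm A B a) h |h. h \<in> null_mors Fp Ep A B}"
  proof -
    have "X = A \<and> Y = B" if "X \<in> EOb" "Y \<in> EOb" "pm A B a \<in> Hom Fp X Y" for X Y
    proof -
      have "pm A B a \<in> pm X Y ` EH X Y" using that(3) by (simp only: Hom_Fp[OF that(1,2)])
      then obtain a' where "pm A B a = pm X Y a'" by (rule imageE)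
      then show ?thesis using pm_src by metis
    qed
    note u1 = this
    show ?thesis unfolding stable_class_def Obj_Fp
    proof (intro set_eqI iffI)
      fix z assume "z \<in> {Add Fp (pm A B a) h |h X Y. X \<in> EOb \<and> Y \<in> EOb \<and> pm A B a \<in> Hom Fp X Y \<and> h \<in> null_mors Fp Ep X Y}"
      then obtain h X Y where z: "z = Add Fp (pm A B a) h" "X \<in> EOb" "Y \<in> EOb" "pm A B a \<in> Hom Fp X Y" "h \<in> null_mors Fp Ep X Y"
        by (elim CollectE exE conjE)
      then show "z \<in> {Add Fp (pm A B a) h |h. h \<in> null_mors Fp Ep A B}" using u1[OF z(2-4)] by blast
    next
      fix z assume "z \<in> {Add Fp (pm A B a) h |h. h \<in> null_mors Fp Ep A B}"
      then obtain h where "z = Add Fp (pm A B a) h" "h \<in> null_mors Fp Ep A B" by (elim CollectE exE conjE)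
      then show "z \<in> {Add Fp (pm A B a) h |h X Y. X \<in> EOb \<and> Y \<in> EOb \<and> pm A B a \<in> Hom Fp X Y \<and> h \<in> null_mors Fp Ep X Y}"
        using o pm_Hom[OF assms] by (intro CollectI exI conjI)
    qed
  qed
  also have "\<dots> = cl A B a"
  proof -
    have "Add Fp (pm A B a) (pm A B n) = pm A B (a + n)" if "n \<in> EH A B" for n
      using pm_Add[OF EH_H[OF assms] EH_H[OF that]] .
    then have "(\<exists>h. z = Add Fp (pm A B a) h \<and> h \<in> pm A B ` (EH A B \<inter> Fac (fst A) (fst B))) \<longleftrightarrow>
        (\<exists>n. z = pm A B (a + n) \<and> n \<in> EH A B \<and> n \<in> Fac (fst A) (fst B))" for z
      unfolding image_iff by (metis IntE IntI)
    then show ?thesis unfolding null_mors_Fp[OF o] cl_def by simp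
  qed
  finally show ?thesis .
qed

lemma cl_mem: "a \<in> EH A B \<Longrightarrow> c \<in> EH A B \<Longrightarrow> pm A B c \<in> cl A B a \<longleftrightarrow> c - a \<in> Fac (fst A) (fst B)"
proof
  assume a: "a \<in> EH A B" "c \<in> EH A B" and "pm A B c \<in> cl A B a"
  then obtain n where n: "n \<in> EH A B" "n \<in> Fac (fst A) (fst B)" "pm A B c = pm A B (a + n)" by (auto simp: cl_def)
  then have "c = a + n" using pm_eq_iff EH_H a EH_add by blast
  then show "c - a \<in> Fac (fst A) (fst B)" using n by simp
next
  assume a: "a \<in> EH A B" "c \<in> EH A B" and "c - a \<in> Fac (fst A) (fst B)"
  then show "pm A B c \<in> cl A B a" unfolding cl_def using EH_diff[OF a(2,1)]
    by (intro CollectI exI[of _ "c - a"]) auto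
qed

lemma cl_eq:
  assumes "a \<in> EH A B" "c \<in> EH A B" shows "cl A B a = cl A B c \<longleftrightarrow> a - c \<in> Fac (fst A) (fst B)"
proof
  assume "cl A B a = cl A B c"
  moreover have "pm A B a \<in> cl A B a"
    using cl_mem[OF assms(1,1)] Fac_zero EOb_H(1) EH_Ob[OF assms(1)] by simp
  ultimately show "a - c \<in> Fac (fst A) (fst B)" using cl_mem[OF assms(2,1)] by simp
next
  have sub: "cl A B a \<subseteq> cl A B c" if "a \<in> EH A B" "c \<in> EH A B" "a - c \<in> Fac (fst A) (fst B)" for a c
  proof
    fix h assume "h \<in> cl A B a"
    then obtain n where n: "n \<in> EH A B" "n \<in> Fac (fst A) (fst B)" "h = pm A B (a + n)" by (auto simp: cl_def)
    have "a + n - c = (a - c) + n" by simp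
    then have "a + n - c \<in> Fac (fst A) (fst B)" using Fac_add[OF that(3) n(2)] by (simp only:)
    then show "h \<in> cl A B c" using cl_mem[OF that(2) EH_add[OF that(1) n(1)]] n by simp
  qed
  assume d: "a - c \<in> Fac (fst A) (fst B)"
  then have "c - a \<in> Fac (fst A) (fst B)" using Fac_uminus by fastforce
  with d sub assms show "cl A B a = cl A B c" by blast
qed

lemma cl_elim:
  assumes "h \<in> cl A B a" "a \<in> EH A B"
  obtains a' where "h = pm A B a'" "a' \<in> EH A B" "a' - a \<in> Fac (fst A) (fst B)"
proof -
  from assms(1) obtain n where n: "h = pm A B (a + n)" "n \<in> EH A B" "n \<in> Fac (fst A) (fst B)" by (auto simp: cl_def)
  show thesis by (rule that[OF n(1) EH_add[OF assms(2) n(2)]]) (use n(3) in simp)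
qed

lemma cl_self: "a \<in> EH A B \<Longrightarrow> pm A B a \<in> cl A B a"
  using cl_mem[of a A B a] Fac_zero EOb_H(1) EH_Ob by simp

lemma Obj_SC [simp]: "Obj SC = EOb" by (simp add: stable_category_def)

lemma Hom_SC: "A \<in> EOb \<Longrightarrow> B \<in> EOb \<Longrightarrow> Hom SC A B = cl A B ` EH A B"
  by (auto simp: stable_category_def Hom_Fp stable_class_pm image_image)

text \<open>The null maps form an ideal, so all choices of representatives give the same coset, and
  the union in the definition of \<open>Comp\<close> is this coset.\<close>

lemma Comp_SC:
  assumes a: "a \<in> EH A B" and c: "c \<in> EH B C" shows "Comp SC (cl B C c) (cl A B a) = cl A C (c * a)"
proof -
  have "stable_class Fp Ep (Comp Fp g f) = cl A C (c * a)" if g: "g \<in> cl B C c" and f: "f \<in> cl A B a" for g f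
  proof -
    obtain c' where c': "g = pm B C c'" "c' \<in> EH B C" "c' - c \<in> Fac (fst B) (fst C)" using cl_elim[OF g c] .
    obtain a' where a': "f = pm A B a'" "a' \<in> EH A B" "a' - a \<in> Fac (fst A) (fst B)" using cl_elim[OF f a] .
    have "stable_class Fp Ep (Comp Fp g f) = cl A C (c' * a')"
      using pm_Comp[OF EH_H[OF a'(2)] EH_H[OF c'(2)]] stable_class_pm[OF EH_mult[OF a'(2) c'(2)]] c' a' by simp
    moreover have "c' * a' - c * a = (c' - c) * a' + c * (a' - a)" by (simp add: algebra_simps)
    then have "c' * a' - c * a \<in> Fac (fst A) (fst C)"
      using Fac_add[OF Fac_right[OF c'(3) EH_H[OF a'(2)]] Fac_left[OF a'(3) EH_H[OF c]]] by simp
    ultimately show ?thesis using cl_eq[OF EH_mult[OF a'(2) c'(2)] EH_mult[OF a c]] by simp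
  qed
  moreover have "pm B C c \<in> cl B C c" "pm A B a \<in> cl A B a" using cl_self a c by auto
  ultimately have "(\<Union>g\<in>cl B C c. \<Union>f\<in>cl A B a. stable_class Fp Ep (Comp Fp g f)) = cl A C (c * a)" by blast
  then show ?thesis by (simp add: stable_category_def)
qed

lemma Add_SC:
  assumes a: "a \<in> EH A B" and c: "c \<in> EH A B" shows "Add SC (cl A B c) (cl A B a) = cl A B (c + a)"
proof -
  have "stable_class Fp Ep (Add Fp g f) = cl A B (c + a)" if g: "g \<in> cl A B c" and f: "f \<in> cl A B a" for g f
  proof -
    obtain c' where c': "g = pm A B c'" "c' \<in> EH A B" "c' - c \<in> Fac (fst A) (fst B)" using cl_elim[OF g c] .
    obtain a' where a': "f = pm A B a'" "a' \<in> EH A B" "a' - a \<in> Fac (fst A) (fst B)" using cl_elim[OF f a] .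
    have "stable_class Fp Ep (Add Fp g f) = cl A B (c' + a')"
      using pm_Add[OF EH_H[OF c'(2)] EH_H[OF a'(2)]] stable_class_pm[OF EH_add[OF c'(2) a'(2)]] c' a' by simp
    moreover have "c' + a' - (c + a) = (c' - c) + (a' - a)" by (simp add: algebra_simps)
    then have "c' + a' - (c + a) \<in> Fac (fst A) (fst B)" using Fac_add[OF c'(3) a'(3)] by (simp only:)
    ultimately show ?thesis using cl_eq[OF EH_add[OF c'(2) a'(2)] EH_add[OF c a]] by simp
  qed
  moreover have "pm A B c \<in> cl A B c" "pm A B a \<in> cl A B a" using cl_self a c by auto
  ultimately have "(\<Union>g\<in>cl A B c. \<Union>f\<in>cl A B a. stable_class Fp Ep (Add Fp g f)) = cl A B (c + a)" by blast
  then show ?thesis by (simp add: stable_category_def)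
qed

lemma Ident_SC: "A \<in> EOb \<Longrightarrow> Ident SC A = cl A A (idm (length (fst A)))"
  by (simp add: stable_category_def pm_Ident stable_class_pm EH_idm)

lemma Zero_SC: "A \<in> EOb \<Longrightarrow> B \<in> EOb \<Longrightarrow> Zero SC A B = cl A B 0"
  by (simp add: stable_category_def pm_Zero stable_class_pm EH_zero)

definition stably_eq :: "'r pobj \<Rightarrow> 'r pobj \<Rightarrow> 'r fm \<Rightarrow> 'r fm \<Rightarrow> bool" where
  "stably_eq A B a c \<longleftrightarrow> a - c \<in> Fac (fst A) (fst B)"

lemma isomorphic_SC:
  assumes "A \<in> EOb" "B \<in> EOb"
  shows "isomorphic SC A B \<longleftrightarrow> (\<exists>a\<in>EH A B. \<exists>c\<in>EH B A.
    stably_eq A A (c * a) (idm (length (fst A))) \<and> stably_eq B B (a * c) (idm (length (fst B))))"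
  unfolding isomorphic_def iso_mor_def inverse_pair_def
  using assms by (auto simp: Hom_SC Comp_SC Ident_SC cl_eq[OF EH_mult EH_idm] stably_eq_def)

lemma zero_object_SC: "A \<in> EOb \<Longrightarrow> zero_object SC A \<longleftrightarrow> idm (length (fst A)) \<in> Fac (fst A) (fst A)"
  by (simp add: zero_object_def Ident_SC Zero_SC cl_eq[OF EH_idm EH_zero])

lemma is_direct_sum_SC:
  assumes "X \<in> EOb" "A \<in> EOb" "B \<in> EOb"
  shows "is_direct_sum SC X A B \<longleftrightarrow> (\<exists>i1\<in>EH A X. \<exists>i2\<in>EH B X. \<exists>p1\<in>EH X A. \<exists>p2\<in>EH X B.
     stably_eq A A (p1 * i1) (idm (length (fst A))) \<and> stably_eq B B (p2 * i2) (idm (length (fst B))) \<and>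
     stably_eq B A (p1 * i2) 0 \<and> stably_eq A B (p2 * i1) 0 \<and> stably_eq X X (i1 * p1 + i2 * p2) (idm (length (fst X))))"
proof -
  have "Comp SC (cl X A p1) (cl A X i1) = Ident SC A \<and> Comp SC (cl X B p2) (cl B X i2) = Ident SC B \<and>
        Comp SC (cl X A p1) (cl B X i2) = Zero SC B A \<and> Comp SC (cl X B p2) (cl A X i1) = Zero SC A B \<and>
        Add SC (Comp SC (cl A X i1) (cl X A p1)) (Comp SC (cl B X i2) (cl X B p2)) = Ident SC X \<longleftrightarrow>
     stably_eq A A (p1 * i1) (idm (length (fst A))) \<and> stably_eq B B (p2 * i2) (idm (length (fst B))) \<and>
     stably_eq B A (p1 * i2) 0 \<and> stably_eq A B (p2 * i1) 0 \<and> stably_eq X X (i1 * p1 + i2 * p2) (idm (length (fst X)))"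
    if h: "i1 \<in> EH A X" "i2 \<in> EH B X" "p1 \<in> EH X A" "p2 \<in> EH X B" for i1 i2 p1 p2
    unfolding stably_eq_def Comp_SC[OF h(1,3)] Comp_SC[OF h(2,4)] Comp_SC[OF h(2,3)] Comp_SC[OF h(1,4)]
      Comp_SC[OF h(3,1)] Comp_SC[OF h(4,2)] Add_SC[OF EH_mult[OF h(4,2)] EH_mult[OF h(3,1)]]
      Ident_SC[OF assms(1)] Ident_SC[OF assms(2)] Ident_SC[OF assms(3)] Zero_SC[OF assms(3,2)] Zero_SC[OF assms(2,3)]
      cl_eq[OF EH_mult[OF h(1,3)] EH_idm[OF assms(2)]] cl_eq[OF EH_mult[OF h(2,4)] EH_idm[OF assms(3)]]
      cl_eq[OF EH_mult[OF h(2,3)] EH_zero[OF assms(3,2)]] cl_eq[OF EH_mult[OF h(1,4)] EH_zero[OF assms(2,3)]]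
      cl_eq[OF EH_add[OF EH_mult[OF h(3,1)] EH_mult[OF h(4,2)]] EH_idm[OF assms(1)]] ..
  note key = this
  show ?thesis
    unfolding is_direct_sum_def Hom_SC[OF assms(2,1)] Hom_SC[OF assms(3,1)] Hom_SC[OF assms(1,2)] Hom_SC[OF assms(1,3)]
      bex_simps(7)
    by (intro bex_cong[OF refl] key)
qed

text \<open>A suitable conflation exists, so the object chosen by SOME has one too. Nothing else is
  known about it, which is why Ext is later computed by comparison.\<close>

lemma shift_equivariant_conflation:
  assumes "B \<in> EOb" obtains I i p where "equivariant_conflation B I (shift Fp Ep B) i p" "boundary (fst I)"
proof -
  let ?Q = "\<lambda>C. C \<in> Obj Fp \<and>
     (\<exists>I. injective Fp Ep I \<and> (\<exists>i \<in> Hom Fp B I. \<exists>p \<in> Hom Fp I C. (i, p) \<in> Ep))"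
  obtain I C i p where c: "equivariant_conflation B I C i p" "boundary (fst I)" using ex_equivariant_conflation[OF assms] .
  note h = equivariant_conflationD[OF c(1)] and o = EH_Ob[OF equivariant_conflationD(1)[OF c(1)]] EH_Ob[OF equivariant_conflationD(2)[OF c(1)]]
  have "?Q C" using o boundary_injective_Fp[OF o(2) c(2)] pm_Hom[OF h(1)] pm_Hom[OF h(2)] Ep_equivariant_conflation[OF h(1,2)] c(1) by auto
  then have "?Q (shift Fp Ep B)" unfolding shift_def by (rule someI)
  then obtain I' i' p' where C': "shift Fp Ep B \<in> EOb" "I' \<in> EOb" "boundary (fst I')" "i' \<in> Hom Fp B I'"
    "p' \<in> Hom Fp I' (shift Fp Ep B)" "(i', p') \<in> Ep" by (auto simp: injective_Fp_iff)
  then obtain i'' p'' where "i'' \<in> EH B I'" "i' = pm B I' i''" "p'' \<in> EH I' (shift Fp Ep B)" "p' = pm I' (shift Fp Ep B) p''"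
    using assms by (auto simp: Hom_Fp)
  then have "equivariant_conflation B I' (shift Fp Ep B) i'' p''" using Ep_equivariant_conflation[of i'' B I' p''] C'(6) by simp
  then show thesis using that C'(3) by simp
qed

lemma Ext1_vanishes_iff:
  assumes "A \<in> EOb" "B \<in> EOb"
  shows "Ext1_vanishes Fp Ep A B \<longleftrightarrow> (\<forall>f\<in>EH A (shift Fp Ep B). f \<in> Fac (fst A) (fst (shift Fp Ep B)))"
proof -
  obtain I i p where "equivariant_conflation B I (shift Fp Ep B) i p" using shift_equivariant_conflation[OF assms(2)] by metis
  then have C: "shift Fp Ep B \<in> EOb" by (rule EH_Ob(2)[OF equivariant_conflationD(2)])
  show ?thesis
    unfolding Ext1_vanishes_def Ext1_def Hom_SC[OF assms(1) C] Zero_SC[OF assms(1) C]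
  proof
    assume e: "cl A (shift Fp Ep B) ` EH A (shift Fp Ep B) = {cl A (shift Fp Ep B) 0}"
    show "\<forall>f\<in>EH A (shift Fp Ep B). f \<in> Fac (fst A) (fst (shift Fp Ep B))"
    proof
      fix f assume f: "f \<in> EH A (shift Fp Ep B)"
      then have "cl A (shift Fp Ep B) f = cl A (shift Fp Ep B) 0" using e by blast
      then show "f \<in> Fac (fst A) (fst (shift Fp Ep B))" using cl_eq[OF f EH_zero[OF assms(1) C]] by simp
    qed
  next
    assume "\<forall>f\<in>EH A (shift Fp Ep B). f \<in> Fac (fst A) (fst (shift Fp Ep B))"
    then have "\<forall>f\<in>EH A (shift Fp Ep B). cl A (shift Fp Ep B) f = cl A (shift Fp Ep B) 0"
      using cl_eq[OF _ EH_zero[OF assms(1) C]] by simp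
    then show "cl A (shift Fp Ep B) ` EH A (shift Fp Ep B) = {cl A (shift Fp Ep B) 0}"
      using EH_zero[OF assms(1) C] by blast
  qed
qed

end

section \<open>Indecomposable objects\<close>

context exact_orbits
begin

section \<open>Isomorphisms and direct sums up to stable equality\<close>

lemma stably_eq_refl: "A \<in> EOb \<Longrightarrow> B \<in> EOb \<Longrightarrow> stably_eq A B a a"
  by (simp add: stably_eq_def Fac_zero EOb_H(1))

lemma stably_eq_sym: "stably_eq A B a c \<Longrightarrow> stably_eq A B c a"
  using Fac_uminus by (fastforce simp: stably_eq_def)

lemma stably_eq_trans [trans]: "stably_eq A B a c \<Longrightarrow> stably_eq A B c d \<Longrightarrow> stably_eq A B a d"
  using Fac_add[of "a - c" "fst A" "fst B" "c - d"] by (simp add: stably_eq_def)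

lemma stably_eq_left: "stably_eq A B a c \<Longrightarrow> d \<in> EH B C \<Longrightarrow> stably_eq A C (d * a) (d * c)"
  using Fac_left[OF _ EH_H] by (fastforce simp: stably_eq_def simp flip: right_diff_distrib)

lemma stably_eq_right: "stably_eq A B a c \<Longrightarrow> d \<in> EH C A \<Longrightarrow> stably_eq C B (a * d) (c * d)"
  using Fac_right[OF _ EH_H] by (fastforce simp: stably_eq_def simp flip: left_diff_distrib)

lemma EH_idm_left: "a \<in> EH A B \<Longrightarrow> idm (length (fst B)) * a = a"
  using H_idm_left EH_H by blast

lemma EH_idm_right: "a \<in> EH A B \<Longrightarrow> a * idm (length (fst A)) = a"
  using H_idm_right EH_H by blast

lemma iso_strict:
  assumes "a \<in> EH A B" "c \<in> EH B A" "c * a = idm (length (fst A))" "a * c = idm (length (fst B))"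
  shows "isomorphic SC A B"
proof -
  have "stably_eq A A (c * a) (idm (length (fst A)))" "stably_eq B B (a * c) (idm (length (fst B)))"
    using assms stably_eq_refl EH_Ob[OF assms(1)] by simp_all
  then show ?thesis using isomorphic_SC[OF EH_Ob[OF assms(1)]] assms(1,2) by blast
qed

lemma iso_refl: assumes "A \<in> EOb" shows "isomorphic SC A A"
  by (rule iso_strict[OF EH_idm[OF assms] EH_idm[OF assms]]) (simp_all add: idm_idm)

lemma iso_sym: "A \<in> EOb \<Longrightarrow> B \<in> EOb \<Longrightarrow> isomorphic SC A B \<Longrightarrow> isomorphic SC B A"
  unfolding isomorphic_SC by blast

lemma iso_trans:
  assumes "A \<in> EOb" "B \<in> EOb" "C \<in> EOb" "isomorphic SC A B" "isomorphic SC B C"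
  shows "isomorphic SC A C"
proof -
  obtain a a' where a: "a \<in> EH A B" "a' \<in> EH B A" "stably_eq A A (a' * a) (idm (length (fst A)))" "stably_eq B B (a * a') (idm (length (fst B)))"
    using assms isomorphic_SC by metis
  obtain c c' where c: "c \<in> EH B C" "c' \<in> EH C B" "stably_eq B B (c' * c) (idm (length (fst B)))" "stably_eq C C (c * c') (idm (length (fst C)))"
    using assms isomorphic_SC by metis
  have "stably_eq A A (a' * (c' * c) * a) (a' * idm (length (fst B)) * a)"
    using stably_eq_right[OF stably_eq_left[OF c(3) a(2)] a(1)] .
  also have "a' * idm (length (fst B)) * a = a' * a" using EH_idm_right[OF a(2)] by simp
  also note a(3)
  finally have 1: "stably_eq A A ((a' * c') * (c * a)) (idm (length (fst A)))" by (simp add: mult.assoc)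
  have "stably_eq C C (c * (a * a') * c') (c * idm (length (fst B)) * c')"
    using stably_eq_right[OF stably_eq_left[OF a(4) c(1)] c(2)] .
  also have "c * idm (length (fst B)) * c' = c * c'" using EH_idm_right[OF c(1)] by simp
  also note c(4)
  finally have 2: "stably_eq C C ((c * a) * (a' * c')) (idm (length (fst C)))" by (simp add: mult.assoc)
  show ?thesis
    using isomorphic_SC[OF assms(1,3)] EH_mult[OF a(1) c(1)] EH_mult[OF c(2) a(2)] 1 2 by blast
qed

lemma direct_sum_iso:
  assumes o: "A \<in> EOb" "B \<in> EOb" "C \<in> EOb" "D' \<in> EOb" and iso: "isomorphic SC A B" and ds: "is_direct_sum SC B C D'"
  shows "is_direct_sum SC A C D'"
proof -
  obtain f g where f: "f \<in> EH A B" "g \<in> EH B A" "stably_eq A A (g * f) (idm (length (fst A)))" "stably_eq B B (f * g) (idm (length (fst B)))"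
    using o iso isomorphic_SC by metis
  obtain i1 i2 p1 p2 where h: "i1 \<in> EH C B" "i2 \<in> EH D' B" "p1 \<in> EH B C" "p2 \<in> EH B D'"
    and e: "stably_eq C C (p1 * i1) (idm (length (fst C)))" "stably_eq D' D' (p2 * i2) (idm (length (fst D')))"
     "stably_eq D' C (p1 * i2) 0" "stably_eq C D' (p2 * i1) 0" "stably_eq B B (i1 * p1 + i2 * p2) (idm (length (fst B)))"
    using ds is_direct_sum_SC[OF o(2-4)] by blast
  \<comment> \<open>The product f * g is stably the identity of B, so moving the inclusions and
    projections from B to A changes none of their composites.\<close>
  have mid: "stably_eq X Y ((p * f) * (g * i)) (p * i)" if "i \<in> EH X B" "p \<in> EH B Y" for X Y i p
  proof -
    have "stably_eq X Y (p * (f * g) * i) (p * idm (length (fst B)) * i)"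
      using stably_eq_right[OF stably_eq_left[OF f(4) that(2)] that(1)] .
    then show ?thesis using EH_idm_right[OF that(2)] by (simp add: mult.assoc)
  qed
  have "stably_eq A A (g * (i1 * p1 + i2 * p2) * f) (g * idm (length (fst B)) * f)"
    using stably_eq_right[OF stably_eq_left[OF e(5) f(2)] f(1)] .
  also have "g * idm (length (fst B)) * f = g * f" using EH_idm_right[OF f(2)] by simp
  also note f(3)
  finally have 5: "stably_eq A A ((g * i1) * (p1 * f) + (g * i2) * (p2 * f)) (idm (length (fst A)))"
    by (simp add: algebra_simps)
  show ?thesis
    unfolding is_direct_sum_SC[OF o(1,3,4)]
    using EH_mult[OF h(1) f(2)] EH_mult[OF h(2) f(2)] EH_mult[OF f(1) h(3)] EH_mult[OF f(1) h(4)]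
      stably_eq_trans[OF mid[OF h(1,3)] e(1)] stably_eq_trans[OF mid[OF h(2,4)] e(2)]
      stably_eq_trans[OF mid[OF h(2,3)] e(3)] stably_eq_trans[OF mid[OF h(1,4)] e(4)] 5 by blast
qed

lemma zero_iso:
  assumes o: "A \<in> EOb" "B \<in> EOb" and iso: "isomorphic SC A B" and z: "zero_object SC B" shows "zero_object SC A"
proof -
  obtain f g where f: "f \<in> EH A B" "g \<in> EH B A" "stably_eq A A (g * f) (idm (length (fst A)))"
    using o iso isomorphic_SC by metis
  have "idm (length (fst B)) \<in> Fac (fst B) (fst B)" using z zero_object_SC o by blast
  then have "g * (idm (length (fst B)) * f) \<in> Fac (fst A) (fst A)"
    using Fac_left[OF Fac_right[OF _ EH_H[OF f(1)]] EH_H[OF f(2)]] by blast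
  then have "g * f \<in> Fac (fst A) (fst A)" using EH_idm_left[OF f(1)] by simp
  then have "g * f - (g * f - idm (length (fst A))) \<in> Fac (fst A) (fst A)"
    using Fac_diff f(3) unfolding stably_eq_def by blast
  then show ?thesis using zero_object_SC o by simp
qed

lemma indecomposable_iso:
  assumes o: "A \<in> EOb" "B \<in> EOb" and iso: "isomorphic SC A B" and ind: "indecomposable SC A"
  shows "indecomposable SC B"
  unfolding indecomposable_def
proof (intro conjI ballI impI)
  show "B \<in> Obj SC" using o by simp
  show "\<not> zero_object SC B" using zero_iso[OF o iso] ind by (auto simp: indecomposable_def)
  fix C D' assume "C \<in> Obj SC" "D' \<in> Obj SC" "is_direct_sum SC B C D'"
  then show "zero_object SC C \<or> zero_object SC D'"
    using direct_sum_iso[OF o _ _ iso] ind unfolding indecomposable_def Obj_SC by blast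
qed

lemma stably_eq_zero: "stably_eq A B a 0 \<longleftrightarrow> a \<in> Fac (fst A) (fst B)" by (simp add: stably_eq_def)

text \<open>The element i1 * p1 is only stably idempotent, but it is an honest endomorphism, so it
  or its complement has a left inverse c. In the first case p2 i2 = p2 c i1 p1 i2, which is stably
  zero with p1 i2; in the second case p1 i1 is stably p1 c i2 p2 i1, which is stably zero with p2
  i1.\<close>

lemma local_indecomposable:
  assumes A: "A \<in> EOb" and nz: "\<not> zero_object SC A"
    and loc: "\<And>e. e \<in> EH A A \<Longrightarrow> (\<exists>c\<in>EH A A. c * e = idm (length (fst A))) \<or>
      (\<exists>c\<in>EH A A. c * (idm (length (fst A)) - e) = idm (length (fst A)))"
  shows "indecomposable SC A"
  unfolding indecomposable_def
proof (intro conjI ballI impI)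
  show "A \<in> Obj SC" using A by simp
  show "\<not> zero_object SC A" by (rule nz)
  fix C D' assume "C \<in> Obj SC" "D' \<in> Obj SC" and ds: "is_direct_sum SC A C D'"
  then have o: "C \<in> EOb" "D' \<in> EOb" by auto
  obtain i1 i2 p1 p2 where h: "i1 \<in> EH C A" "i2 \<in> EH D' A" "p1 \<in> EH A C" "p2 \<in> EH A D'"
    and e: "stably_eq C C (p1 * i1) (idm (length (fst C)))" "stably_eq D' D' (p2 * i2) (idm (length (fst D')))"
     "stably_eq D' C (p1 * i2) 0" "stably_eq C D' (p2 * i1) 0" "stably_eq A A (i1 * p1 + i2 * p2) (idm (length (fst A)))"
    using ds is_direct_sum_SC[OF A o] by blast
  let ?n = "length (fst A)"
  from loc[OF EH_mult[OF h(3,1)]] show "zero_object SC C \<or> zero_object SC D'"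
  proof
    assume "\<exists>c\<in>EH A A. c * (i1 * p1) = idm ?n"
    then obtain c where c: "c \<in> EH A A" "c * (i1 * p1) = idm ?n" by blast
    have "stably_eq D' D' ((p2 * c * i1) * (p1 * i2)) 0"
      using stably_eq_left[OF e(3) EH_mult[OF h(1) EH_mult[OF c(1) h(4)]]] by (simp add: mult.assoc)
    moreover have "(p2 * c * i1) * (p1 * i2) = p2 * ((c * (i1 * p1)) * i2)" by (simp add: mult.assoc)
    then have "(p2 * c * i1) * (p1 * i2) = p2 * i2" using c(2) EH_idm_left[OF h(2)] by simp
    ultimately have "stably_eq D' D' (idm (length (fst D'))) 0" using stably_eq_trans[OF stably_eq_sym[OF e(2)]] by simp
    then show ?thesis using zero_object_SC[OF o(2)] by (simp add: stably_eq_zero)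
  next
    assume "\<exists>c\<in>EH A A. c * (idm ?n - i1 * p1) = idm ?n"
    then obtain c where c: "c \<in> EH A A" "c * (idm ?n - i1 * p1) = idm ?n" by blast
    have "stably_eq A A (i2 * p2) (idm ?n - i1 * p1)" using e(5) by (simp add: stably_eq_def algebra_simps)
    then have "stably_eq C C (p1 * c * (i2 * p2) * i1) (p1 * c * (idm ?n - i1 * p1) * i1)"
      using stably_eq_right[OF stably_eq_left[OF _ EH_mult[OF c(1) h(3)]] h(1)] by blast
    moreover have "p1 * c * (idm ?n - i1 * p1) * i1 = p1 * i1"
      using c(2) EH_idm_left[OF h(1)] by (simp add: mult.assoc flip: mult.assoc[of c])
    moreover have "stably_eq C C (p1 * c * (i2 * p2) * i1) 0"
      using stably_eq_left[OF e(4) EH_mult[OF h(2) EH_mult[OF c(1) h(3)]]] by (simp add: mult.assoc)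
    ultimately have "stably_eq C C (p1 * i1) 0" using stably_eq_trans stably_eq_sym by metis
    then have "stably_eq C C (idm (length (fst C))) 0" using stably_eq_trans[OF stably_eq_sym[OF e(1)]] by simp
    then show ?thesis using zero_object_SC[OF o(1)] by (simp add: stably_eq_zero)
  qed
qed

text \<open>The basic morphism from X to Y is the composite of basic morphisms through a boundary
  orbit, with no extra power of u.\<close>

definition stably_zero :: "orbit \<Rightarrow> orbit \<Rightarrow> bool" where
  "stably_zero X Y \<longleftrightarrow> (\<exists>o1. boundary_orbit o1 \<and> dd X o1 + dd o1 Y = dd X Y)"

lemma not_stably_zero_iso:
  assumes "X \<in> orbits b" "Y \<in> orbits b" "pt X = pt Y" "\<not> boundary_orbit X" shows "\<not> stably_zero X Y" "dd X Y = 0"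
proof -
  show d: "dd X Y = 0" using dd_iso_iff[OF assms(1,2) b_le] assms(3) by simp
  have "dd X o1 + dd o1 Y \<noteq> 0" if "boundary_orbit o1" for o1
  proof
    assume z: "dd X o1 + dd o1 Y = 0"
    have o1: "o1 \<in> orbits b" using that by (simp add: boundary_orbit_def)
    have "dd o1 X = dd o1 Y" using assms(3) by (simp add: dd_def)
    then have "pt X = pt o1" using dd_iso_iff[OF assms(1) o1 b_le] z by simp
    then show False using that assms(1,4) by (simp add: boundary_orbit_def)
  qed
  then show "\<not> stably_zero X Y" using d by (auto simp: stably_zero_def)
qed

text \<open>By the triangle inequality every path through a boundary orbit has exponent at least
  \<open>dd\<close>; equality would make the basic morphism stably zero, so each term has at least
  one further factor u.\<close>

lemma Fac_entry:
  assumes "a \<in> Fac X Y" "i < length Y" "j < length X" "\<not> stably_zero (X ! j) (Y ! i)"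
  shows "u ^ Suc (dd (X ! j) (Y ! i)) dvd ent a i j"
proof -
  obtain g f P where a: "a = g * f" "boundary P" "f \<in> H X P" "g \<in> H P Y" using assms(1) by (auto simp: Fac_def)
  show ?thesis unfolding a(1) H_ent_mult[OF a(3)]
  proof (rule dvd_sum)
    fix k assume k: "k \<in> {..<length P}"
    have bk: "boundary_orbit (P ! k)" using boundary_nth[OF a(2)] k by simp
    have "dd (X ! j) (Y ! i) \<le> dd (X ! j) (P ! k) + dd (P ! k) (Y ! i)"
      using H_Ob[OF a(3)] H_Ob[OF a(4)] assms k by (intro dd_triangle[OF _ _ _ b_le]) auto
    moreover have "dd (X ! j) (P ! k) + dd (P ! k) (Y ! i) \<noteq> dd (X ! j) (Y ! i)"
      using assms(4) bk by (auto simp: stably_zero_def)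
    ultimately have "Suc (dd (X ! j) (Y ! i)) \<le> dd (P ! k) (Y ! i) + dd (X ! j) (P ! k)" by simp
    then have "u ^ Suc (dd (X ! j) (Y ! i)) dvd u ^ (dd (P ! k) (Y ! i) + dd (X ! j) (P ! k))"
      by (rule le_imp_power_dvd)
    also have "\<dots> dvd ent g i k * ent f k j"
      unfolding power_add using H_dvd[OF a(3)] H_dvd[OF a(4)] k assms by (intro mult_dvd_mono) auto
    finally show "u ^ Suc (dd (X ! j) (Y ! i)) dvd ent g i k * ent f k j" .
  qed
qed

lemma Fac_sum:
  assumes "finite S" "\<And>s. s \<in> S \<Longrightarrow> h s \<in> Fac X Y" "X \<in> Ob" "Y \<in> Ob" shows "sum h S \<in> Fac X Y"
  using assms by (induction S rule: finite_induct) (auto intro: Fac_zero Fac_add)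

text \<open>The map is the sum of its single entries, and each entry is a multiple of a basic
  morphism that factors through one boundary orbit.\<close>

lemma Fac_full:
  assumes "a \<in> H X Y" "\<And>i j. i < length Y \<Longrightarrow> j < length X \<Longrightarrow> stably_zero (X ! j) (Y ! i)"
  shows "a \<in> Fac X Y"
proof -
  let ?n = "length Y" and ?m = "length X"
  define E where "E = (\<lambda>(i, j). mk ?n ?m (\<lambda>i' j'. if i' = i \<and> j' = j then ent a i j else 0))"
  have "a = (\<Sum>s\<in>{..<?n} \<times> {..<?m}. E s)"
  proof (rule fm_eqI)
    fix i j
    show "ent a i j = ent (\<Sum>s\<in>{..<?n} \<times> {..<?m}. E s) i j"
    proof (cases "i < ?n \<and> j < ?m")
      case True
      have "ent (\<Sum>s\<in>{..<?n} \<times> {..<?m}. E s) i j = (\<Sum>s\<in>{..<?n} \<times> {..<?m}. if s = (i, j) then ent a i j else 0)"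
        unfolding ent_sum by (rule sum.cong) (use True in \<open>auto simp: E_def ent_mk split: if_splits\<close>)
      then show ?thesis using True by simp
    next
      case False
      then have "ent (\<Sum>s\<in>{..<?n} \<times> {..<?m}. E s) i j = 0"
        unfolding ent_sum by (intro sum.neutral) (auto simp: E_def ent_mk)
      then show ?thesis using H_supp[OF assms(1), of i j] False by auto
    qed
  qed
  moreover have "E s \<in> Fac X Y" if sS: "s \<in> {..<?n} \<times> {..<?m}" for s
  proof -
    obtain i j where s: "s = (i, j)" "i < ?n" "j < ?m" using sS by (cases s) auto
    obtain o1 where o1: "boundary_orbit o1" "dd (X ! j) o1 + dd o1 (Y ! i) = dd (X ! j) (Y ! i)"
      using assms(2)[OF s(2,3)] by (auto simp: stably_zero_def)
    obtain r where r: "ent a i j = u ^ dd (X ! j) (Y ! i) * r" using H_dvd[OF assms(1) s(2,3)] by (auto simp: dvd_def)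
    note XY = H_Ob[OF assms(1)]
    have oO: "[o1] \<in> Ob" "o1 \<in> orbits b" using o1 by (auto simp: boundary_orbit_def)
    define f where "f = mk (length [o1]) ?m (\<lambda>_ j'. if j' = j then u ^ dd (X ! j) o1 else 0)"
    define g where "g = mk ?n (length [o1]) (\<lambda>i' _. if i' = i then r * u ^ dd o1 (Y ! i) else 0)"
    have f: "f \<in> H X [o1]" unfolding f_def by (rule H_mk) (use XY oO in auto)
    have g: "g \<in> H [o1] Y" unfolding g_def by (rule H_mk) (use XY oO in auto)
    have "g * f = E s"
      by (rule fm_eqI, subst H_ent_mult[OF f]) (auto simp: f_def g_def E_def s ent_mk r o1(2)[symmetric] power_add mult_ac)
    then show ?thesis using FacI[OF _ f g] o1 by (simp add: boundary_def)
  qed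
  ultimately show ?thesis using Fac_sum[of "{..<?n} \<times> {..<?m}" E] H_Ob[OF assms(1)] by simp
qed

text \<open>At a summand off the boundary, stably zero endomorphisms have diagonal entries divisible
  by u. The diagonal entry of g * f is therefore 1 modulo u, and \<open>unit_entry\<close>
  applies.\<close>

lemma iso_pt:
  assumes "isomorphic SC A B" "A \<in> EOb" "B \<in> EOb" "k < length (fst A)" "\<not> boundary_orbit (fst A ! k)"
  shows "\<exists>l<length (fst B). pt (fst A ! k) = pt (fst B ! l)"
proof -
  obtain f g where f: "f \<in> EH A B" "g \<in> EH B A" "stably_eq A A (g * f) (idm (length (fst A)))"
    using assms isomorphic_SC by metis
  have o: "fst A ! k \<in> orbits b" using EOb_H(1) assms by simp
  have "u ^ Suc (dd (fst A ! k) (fst A ! k)) dvd ent (g * f - idm (length (fst A))) k k"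
    by (rule Fac_entry) (use f(3) assms not_stably_zero_iso[OF o o refl] in \<open>auto simp: stably_eq_def\<close>)
  then have "u dvd ent (g * f - idm (length (fst A))) k k" by (metis dvd_mult_left power_Suc)
  then have d: "u dvd ent (g * f) k k - 1" using assms(4) by (simp add: ent_simps ent_idm)
  have "\<not> u dvd ent (g * f) k k"
  proof
    assume "u dvd ent (g * f) k k"
    then have "u dvd ent (g * f) k k - (ent (g * f) k k - 1)" using d dvd_diff by blast
    then show False using u_nonunit by simp
  qed
  then show ?thesis using unit_entry[OF EH_H[OF f(1)] EH_H[OF f(2)] assms(4)] by blast
qed

lemma nonzero_object:
  assumes "A \<in> EOb" "k < length (fst A)" "\<not> boundary_orbit (fst A ! k)" shows "\<not> zero_object SC A"
proof
  assume "zero_object SC A"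
  then have z: "idm (length (fst A)) \<in> Fac (fst A) (fst A)" using zero_object_SC assms by blast
  have o: "fst A ! k \<in> orbits b" using EOb_H(1) assms by simp
  have "u ^ Suc (dd (fst A ! k) (fst A ! k)) dvd ent (idm (length (fst A))) k k"
    by (rule Fac_entry[OF z]) (use assms not_stably_zero_iso[OF o o refl] in auto)
  then show False using u_nonunit assms o by (simp add: ent_idm)
qed

section \<open>The named objects: isomorphisms and indecomposability\<close>

lemma S_obj:
  assumes "X \<in> Ob"
  shows "S_obj X \<in> EOb" "fst (S_obj X :: 'r pobj) = X @ psi_obj X" "st (S_obj X) = sw (length X)"
proof -
  let ?J = "X @ psi_obj X" and ?n = "length X"
  have J: "?J \<in> Ob" "psi_obj ?J \<in> Ob" using assms by (auto intro!: Ob_psi)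
  have h: "snd (S_obj X :: 'r pobj) \<in> Hom F (psi_obj ?J) ?J"
    by (auto simp: S_obj_def Hom_F)
  have "enc (snd (S_obj X :: 'r pobj)) = sw ?n"
  proof (rule fm_eqI)
    fix i j
    show "ent (enc (snd (S_obj X :: 'r pobj))) i j = ent (sw ?n) i j"
      using assms H_dvd[OF sw_H[OF assms]]
      by (auto simp: S_obj_def enc_def ent_mk sw_def ent_simps ent_in2 ent_pr2 nth_append psi_obj_append)
  qed
  then have "snd (S_obj X :: 'r pobj) = dec (psi_obj ?J) ?J (sw ?n)" using dec_enc[OF J(2,1) h] by simp
  then have "S_obj X = (?J, dec (psi_obj ?J) ?J (sw ?n))" by (simp add: S_obj_def prod_eq_iff)
  then show "S_obj X \<in> EOb" "fst (S_obj X :: 'r pobj) = X @ psi_obj X" "st (S_obj X) = sw (length X)"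
    using eob_EOb[OF eob_sw[OF assms]] by simp_all
qed

lemma M_orbits: "\<bar>x - y\<bar> \<le> b \<Longrightarrow> M x y \<in> orbits b" by (auto simp: orbits_M)

lemma SM_obj:
  assumes "\<bar>x - y\<bar> \<le> b"
  shows "SM x y \<in> EOb" "fst (SM x y :: 'r pobj) = [M x y, psi_orbit (M x y)]" "st (SM x y) = sw 1"
  using S_obj[of "[M x y]"] M_orbits[OF assms] by (simp_all add: SM_def psi_obj_def)

definition sg :: "bool \<Rightarrow> 'r" where "sg e = (if e then 1 else - 1)"

lemma sg_sq: "sg e * sg e = 1" by (simp add: sg_def)

lemma pt_psi_M: "pt (psi_orbit (M x x)) = pt (M x x)" using pt_M_psi_iff by metis

lemma dd_pt_eq: "X \<in> orbits b \<Longrightarrow> Y \<in> orbits b \<Longrightarrow> pt X = pt Y \<Longrightarrow> dd X Y = 0"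
  using dd_iso_iff[of X b Y] b_le by simp

text \<open>On the diagonal psi preserves the position, so the basic isomorphism is scaled by no
  power of u, and the structure map is just the sign.\<close>

lemma Z_obj:
  shows "Z_obj e x \<in> EOb" "fst (Z_obj e x :: 'r pobj) = [M x x]" "st (Z_obj e x) = sm (sg e) (idm 1)"
proof -
  have o: "M x x \<in> orbits b" using M_orbits b_pos by simp
  have d: "dd (psi_orbit (M x x)) (M x x) = 0" using dd_pt_eq[OF psi_orbits[OF o] o pt_psi_M] .
  let ?J = "[M x x]"
  have J: "?J \<in> Ob" "psi_obj ?J \<in> Ob" using o by (auto simp: psi_obj_def)
  have h: "snd (Z_obj e x :: 'r pobj) \<in> Hom F (psi_obj ?J) ?J"
    by (auto simp: Z_obj_def Hom_F)
  have enc: "enc (snd (Z_obj e x :: 'r pobj)) = sm (sg e) (idm 1)"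
    by (rule fm_eqI) (auto simp: Z_obj_def enc_def ent_mk ent_sm ent_idm psi_obj_def d sg_def)
  then have d: "snd (Z_obj e x :: 'r pobj) = dec (psi_obj ?J) ?J (sm (sg e) (idm 1))" using dec_enc[OF J(2,1) h] by simp
  have "enc (snd (Z_obj e x :: 'r pobj)) \<in> H (psi_obj ?J) ?J" by (rule enc_H[OF J(2,1) h])
  then have "eob ?J (sm (sg e) (idm 1))" using J
    by (simp add: enc eob_def sm_mult_left sm_mult_right sm_sm idm_idm sg_sq sm_1)
  from eob_EOb[OF this] show "Z_obj e x \<in> EOb" "fst (Z_obj e x :: 'r pobj) = [M x x]" "st (Z_obj e x) = sm (sg e) (idm 1)"
    using d by (simp_all add: Z_obj_def)
qed

lemma boundary_orbit_M_iff: "\<bar>x - y\<bar> \<le> b \<Longrightarrow> boundary_orbit (M x y) \<longleftrightarrow> \<bar>x - y\<bar> = b"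
  using M_orbits by (auto simp: boundary_orbit_def pt_width)

lemma two_nz: "a + a = 0 \<Longrightarrow> a = (0::'r)"
  using half by (metis distrib_right mult.left_neutral mult_zero_right add.commute distrib_left)

text \<open>Equal positions are matched by the identity matrix. Swapped positions, where M x y has
  the position of psi M x' y', are matched by the swap of summands.\<close>

lemma SM_iso:
  assumes "\<bar>x - y\<bar> \<le> b" "\<bar>x' - y'\<bar> \<le> b" "pt (M x y) = pt (M x' y') \<or> pt (M x y) = prod.swap (pt (M x' y'))"
  shows "isomorphic SC (SM x y) (SM x' y')"
proof -
  let ?o = "M x y" and ?o' = "M x' y'"
  note o = M_orbits[OF assms(1)] M_orbits[OF assms(2)]
  note S = SM_obj[OF assms(1)] and S' = SM_obj[OF assms(2)]
  have sw: "sw 1 * sw 1 = (idm 2 :: 'r fm)" using sw_sw[of 1] by (simp add: numeral_2_eq_2)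
  from assms(3) show ?thesis
  proof
    assume e: "pt ?o = pt ?o'"
    have 1: "idm 2 \<in> EH (SM a c) (SM a' c')" if "pt (M a c) = pt (M a' c')" "\<bar>a - c\<bar> \<le> b" "\<bar>a' - c'\<bar> \<le> b" for a c a' c'
    proof -
      have "idm 2 \<in> H [M a c, psi_orbit (M a c)] [M a' c', psi_orbit (M a' c')]"
        using M_orbits[OF that(2)] M_orbits[OF that(3)] dd_pt_eq that pt_psi[where b = b]
        by (intro H_I) (auto simp: ent_idm less_Suc_eq)
      then show ?thesis using SM_obj[OF that(2)] SM_obj[OF that(3)] H_idm_left[OF sw_H[of "[M a c]"]] H_idm_right[OF sw_H[of "[M a c]"]] M_orbits[OF that(2)]
        by (simp add: EH_def numeral_2_eq_2)
    qed
    show ?thesis by (rule iso_strict[OF 1 1]) (use e assms S S' idm_idm[of 2] in \<open>simp_all add: numeral_2_eq_2\<close>)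
  next
    assume e: "pt ?o = prod.swap (pt ?o')"
    have 1: "sw 1 \<in> EH (SM a c) (SM a' c')" if "pt (M a c) = prod.swap (pt (M a' c'))" "\<bar>a - c\<bar> \<le> b" "\<bar>a' - c'\<bar> \<le> b" for a c a' c'
    proof -
      have "sw 1 \<in> H [M a c, psi_orbit (M a c)] [M a' c', psi_orbit (M a' c')]"
        using M_orbits[OF that(2)] M_orbits[OF that(3)] dd_pt_eq that pt_psi[where b = b]
        by (intro H_I) (auto simp: sw_def ent_simps ent_in2 ent_pr2 less_Suc_eq)
      then show ?thesis using SM_obj[OF that(2)] SM_obj[OF that(3)]
        by (simp add: EH_def)
    qed
    show ?thesis by (rule iso_strict[OF 1 1]) (use e assms S S' sw in \<open>simp_all add: numeral_2_eq_2\<close>)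
  qed
qed

lemma SM_iso_pt:
  assumes "\<bar>x - y\<bar> < b" "B \<in> EOb" "isomorphic SC (SM x y) B"
  shows "\<exists>l<length (fst B). pt (M x y) = pt (fst B ! l)"
  using iso_pt[OF assms(3) SM_obj(1) assms(2), of 0] assms boundary_orbit_M_iff[of x y] by (simp add: SM_obj)

lemma Z_iso_pt:
  assumes "B \<in> EOb" "isomorphic SC (Z_obj e x) B"
  shows "\<exists>l<length (fst B). pt (M x x) = pt (fst B ! l)"
  using iso_pt[OF assms(2) Z_obj(1) assms(1), of 0] boundary_orbit_M_iff[of x x] b_pos by (simp add: Z_obj)

lemma Z_iso:
  assumes "pt (M x x) = pt (M y y)" shows "isomorphic SC (Z_obj e x) (Z_obj e y)"
proof -
  have 1: "idm 1 \<in> EH (Z_obj e x) (Z_obj e y)" if "pt (M x x) = pt (M y y)" for x y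
  proof -
    have o: "M x x \<in> orbits b" "M y y \<in> orbits b" using M_orbits b_pos by auto
    have "idm 1 \<in> H [M x x] [M y y]" using o dd_pt_eq[OF o that]
      by (intro H_I) (auto simp: ent_idm)
    then show ?thesis using Z_obj[of e x] Z_obj[of e y] by (simp add: EH_def sm_mult_left sm_mult_right)
  qed
  show ?thesis by (rule iso_strict[OF 1 1]) (use assms Z_obj[of e x] Z_obj[of e y] idm_idm[of 1] in simp_all)
qed

text \<open>A map between singular objects of opposite sign satisfies f = - f, so it is zero as 2 is
  invertible; an isomorphism would then make the object stably zero, although it lies off the
  boundary.\<close>

lemma Z_iso_iff: "isomorphic SC (Z_obj e x) (Z_obj e' y) \<longleftrightarrow> e = e' \<and> pt (M x x) = pt (M y y)"
proof
  assume iso: "isomorphic SC (Z_obj e x) (Z_obj e' y)"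
  have "e = e'"
  proof (rule ccontr)
    assume ne: "e \<noteq> e'"
    obtain f g where f: "f \<in> EH (Z_obj e x) (Z_obj e' y)" "g \<in> EH (Z_obj e' y) (Z_obj e x)"
      "stably_eq (Z_obj e x) (Z_obj e x) (g * f) (idm (length (fst (Z_obj e x :: 'r pobj))))"
      using iso isomorphic_SC[OF Z_obj(1) Z_obj(1)] by blast
    have "f * sm (sg e) (idm 1) = sm (sg e') (idm 1) * f" using EH_eq[OF f(1)] Z_obj(3)[of e x] Z_obj(3)[of e' y] by simp
    then have "sm (sg e) f = sm (sg e') f" using EH_idm_left[OF f(1)] EH_idm_right[OF f(1)] Z_obj(2)[of e x] Z_obj(2)[of e' y]
      by (simp add: sm_mult_left sm_mult_right)
    then have "f + f = 0"
      using ne by (cases e; cases e') (auto simp: sg_def sm_1 sm_minus1 eq_neg_iff_add_eq_0 neg_eq_iff_add_eq_0)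
    then have "ent f i j + ent f i j = 0" for i j by (metis ent_add ent_zero)
    then have "ent f i j = 0" for i j by (rule two_nz)
    then have "f = 0" by (intro fm_eqI) (simp add: ent_simps)
    then have "idm (length (fst (Z_obj e x :: 'r pobj))) \<in> Fac (fst (Z_obj e x :: 'r pobj)) (fst (Z_obj e x :: 'r pobj))"
      using f(3) Fac_uminus by (fastforce simp: stably_eq_def)
    then have "zero_object SC (Z_obj e x)" using zero_object_SC[OF Z_obj(1)] by blast
    then show False using nonzero_object[OF Z_obj(1), of 0 e x] Z_obj(2)[of e x] boundary_orbit_M_iff[of x x] b_pos by simp
  qed
  moreover have "pt (M x x) = pt (M y y)" using Z_iso_pt[OF Z_obj(1) iso] Z_obj(2)[of e' y] by simp
  ultimately show "e = e' \<and> pt (M x x) = pt (M y y)" by simp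
qed (use Z_iso in auto)

lemma unit_local: "(x::'r) dvd 1 \<or> 1 - x dvd 1"
proof (rule ccontr)
  assume "\<not> ?thesis"
  then have "u dvd x" "u dvd 1 - x" using unit_or by blast+
  then have "u dvd x + (1 - x)" by (rule dvd_add)
  then show False using u_nonunit by simp
qed

lemma Z_indecomposable: "indecomposable SC (Z_obj e x)"
proof (rule local_indecomposable[OF Z_obj(1)])
  show "\<not> zero_object SC (Z_obj e x)"
    using nonzero_object[OF Z_obj(1), of 0 e x] Z_obj(2)[of e x] boundary_orbit_M_iff[of x x] b_pos by simp
  fix f assume f: "f \<in> EH (Z_obj e x) (Z_obj e x)"
  have l: "length (fst (Z_obj e x :: 'r pobj)) = 1" using Z_obj(2) by simp
  have feq: "f = sm (ent f 0 0) (idm 1)"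
  proof (rule fm_eqI)
    fix i j :: nat
    have "i = 0 \<and> j = 0 \<or> 1 \<le> i \<or> 1 \<le> j" by (cases i; cases j) auto
    then show "ent f i j = ent (sm (ent f 0 0) (idm 1)) i j"
      using H_supp[OF EH_H[OF f], of i j] by (auto simp: ent_sm ent_idm l)
  qed
  have I: "idm 1 \<in> EH (Z_obj e x) (Z_obj e x)" using EH_idm[OF Z_obj(1), of e x] l by simp
  have inv: "\<exists>c\<in>EH (Z_obj e x) (Z_obj e x). c * sm r (idm 1) = idm 1" if "r dvd 1" for r
  proof -
    obtain v where "1 = r * v" using \<open>r dvd 1\<close> by (auto simp: dvd_def)
    then have "sm v (idm 1) * sm r (idm 1) = (idm 1 :: 'r fm)"
      by (simp add: sm_mult_left sm_mult_right sm_sm idm_idm mult.commute) (metis sm_1)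
    then show ?thesis using EH_sm[OF I] by blast
  qed
  have "idm 1 - f = sm (1 - ent f 0 0) (idm 1)"
    by (subst feq) (auto intro!: fm_eqI simp: ent_simps ent_sm algebra_simps)
  then show "(\<exists>c\<in>EH (Z_obj e x) (Z_obj e x). c * f = idm (length (fst (Z_obj e x :: 'r pobj)))) \<or>
      (\<exists>c\<in>EH (Z_obj e x) (Z_obj e x). c * (idm (length (fst (Z_obj e x :: 'r pobj))) - f) = idm (length (fst (Z_obj e x :: 'r pobj))))"
    using unit_local[of "ent f 0 0"] inv feq unfolding l by metis
qed

lemma ent_sw1: "ent (sw 1) i j = (if i = 1 \<and> j = 0 \<or> i = 0 \<and> j = 1 then 1 else 0)"
  by (auto simp: sw_def ent_simps ent_in2 ent_pr2)

text \<open>The equivariant endomorphisms are a + c * sw. Off the diagonal the degree between M x y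
  and its image under psi is positive, so u divides c. Since (a - c * sw)(a + c * sw) = a * a - c *
  c, such an endomorphism is invertible as soon as a is a unit, and the endomorphism ring is
  local.\<close>

lemma SM_indecomposable:
  assumes "0 < \<bar>x - y\<bar>" "\<bar>x - y\<bar> < b" shows "indecomposable SC (SM x y)"
proof (rule local_indecomposable)
  let ?S = "SM x y :: 'r pobj" and ?o = "M x y"
  have le: "\<bar>x - y\<bar> \<le> b" using assms by simp
  note S = SM_obj[OF le] and o = M_orbits[OF le]
  show "?S \<in> EOb" by (rule S)
  show "\<not> zero_object SC ?S"
    using nonzero_object[OF S(1), of 0] S(2) boundary_orbit_M_iff[OF le] assms by simp
  have l: "length (fst ?S) = 2" using S by simp
  have I: "idm 2 \<in> EH ?S ?S" using EH_idm[OF S(1)] l by simp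
  have sw: "sw 1 * sw 1 = (idm 2 :: 'r fm)" using sw_sw[of 1] by (simp add: numeral_2_eq_2)
  have swI: "sw 1 * idm 2 = (sw 1 :: 'r fm)" "idm 2 * sw 1 = (sw 1 :: 'r fm)"
    by (auto intro!: fm_eqI simp: ent_idm_mult ent_mult_idm ent_sw1[unfolded One_nat_def])
  have "dd (psi_orbit ?o) ?o \<noteq> 0"
  proof
    assume z: "dd (psi_orbit ?o) ?o = 0"
    then have "dd ?o (psi_orbit ?o) = 0"
      using dd_psi[OF psi_orbits[OF o] o] psi_psi[OF o] by simp
    then have "pt ?o = pt (psi_orbit ?o)" using z dd_iso_iff[OF o psi_orbits[OF o] b_le] by simp
    then show False using pt_M_psi_iff assms by auto
  qed
  then have ud: "u dvd u ^ dd (psi_orbit ?o) ?o" by (intro dvd_power) auto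
  have form: "f = sm (ent f 0 0) (idm 2) + sm (ent f 0 1) (sw 1)" and off: "u dvd ent f 0 1"
    if f: "f \<in> EH ?S ?S" for f
  proof -
    have "u ^ dd (psi_orbit ?o) ?o dvd ent f 0 1" using H_dvd[OF EH_H[OF f], of 0 1] S by simp
    then show "u dvd ent f 0 1" using ud dvd_trans by blast
    have e: "f * sw 1 = sw 1 * f" using EH_eq[OF f] S by simp
    have 1: "ent (f * sw 1) i j = (\<Sum>k<2. ent f i k * ent (sw 1) k j)" for i j
      by (rule ent_mult) (auto simp: ent_sw1[unfolded One_nat_def])
    have 2: "ent (sw 1 * f) i j = (\<Sum>k<2. ent (sw 1) i k * ent f k j)" for i j
      by (rule ent_mult) (auto simp: ent_sw1[unfolded One_nat_def])
    have "ent f 1 1 = ent f 0 0" "ent f 1 0 = ent f 0 1"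
      using arg_cong[OF e, of "\<lambda>z. ent z 0 1"] arg_cong[OF e, of "\<lambda>z. ent z 0 0"]
      unfolding 1 2 by (simp_all add: ent_sw1[unfolded One_nat_def] numeral_2_eq_2)
    then show "f = sm (ent f 0 0) (idm 2) + sm (ent f 0 1) (sw 1)"
    proof (intro fm_eqI)
      fix i j :: nat
      have "ent f i j = 0" if "2 \<le> i \<or> 2 \<le> j" using H_supp[OF EH_H[OF f], of i j] that l by simp
      then show "ent f i j = ent (sm (ent f 0 0) (idm 2) + sm (ent f 0 1) (sw 1)) i j"
        using \<open>ent f 1 1 = ent f 0 0\<close> \<open>ent f 1 0 = ent f 0 1\<close>
        unfolding ent_add ent_sm ent_idm ent_sw1
        by (cases "i < 2"; cases "j < 2") (auto simp: less_2_cases_iff)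
    qed
  qed
  have inv: "\<exists>c\<in>EH ?S ?S. c * f = idm 2" if f: "f \<in> EH ?S ?S" and un: "ent f 0 0 dvd 1" for f
  proof -
    define a c where "a = ent f 0 0" and "c = ent f 0 1"
    have fe: "f = sm a (idm 2) + sm c (sw 1)" using form[OF f] by (simp add: a_def c_def)
    have "a * a - c * c dvd 1"
    proof (rule ccontr)
      assume "\<not> ?thesis"
      then have "u dvd (a * a - c * c) + c * c" using unit_or off[OF f] c_def by (metis dvd_add dvd_mult)
      then have "u dvd a * a" by simp
      moreover have "a * a dvd 1" using un unfolding a_def by (metis mult_1 mult_dvd_mono)
      ultimately show False using u_nonunit dvd_trans by blast
    qed
    then obtain v where v: "(a * a - c * c) * v = 1" by (metis dvdE)
    have "sm c (sw 1) = f - sm a (idm 2)" by (simp add: fe)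
    then have "sm c (sw 1) \<in> EH ?S ?S" using EH_diff[OF f EH_sm[OF I]] by simp
    then have cE: "sm v (sm a (idm 2) - sm c (sw 1)) \<in> EH ?S ?S" using EH_sm EH_diff EH_sm[OF I] by blast
    have "(sm a (idm 2) - sm c (sw 1)) * f = sm (a * a - c * c) (idm 2)"
      unfolding fe by (rule fm_eqI)
        (simp add: algebra_simps sm_mult_left sm_mult_right sm_sm idm_idm sw[unfolded One_nat_def] swI[unfolded One_nat_def] ent_simps ent_sm)
    then have "sm v (sm a (idm 2) - sm c (sw 1)) * f = idm 2"
      using v by (simp add: sm_mult_left sm_sm mult.commute sm_1)
    then show ?thesis using cE by blast
  qed
  fix f assume f: "f \<in> EH ?S ?S"
  have "ent (idm 2 - f) 0 0 = 1 - ent f 0 0" by (simp add: ent_simps ent_idm)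
  then show "(\<exists>c\<in>EH ?S ?S. c * f = idm (length (fst ?S))) \<or>
      (\<exists>c\<in>EH ?S ?S. c * (idm (length (fst ?S)) - f) = idm (length (fst ?S)))"
    unfolding l using inv[OF f] inv[OF EH_diff[OF I f]] unit_local[of "ent f 0 0"] by metis
qed

end

section \<open>Splitting off a direct summand\<close>

definition inc :: "nat \<Rightarrow> nat list \<Rightarrow> 'a::zero_neq_one fm" where
  "inc n ks = mk n (length ks) (\<lambda>i j. if i = ks ! j then 1 else 0)"

definition prj :: "nat \<Rightarrow> nat list \<Rightarrow> 'a::zero_neq_one fm" where
  "prj n ks = mk (length ks) n (\<lambda>i j. if j = ks ! i then 1 else 0)"

lemma ent_prj_mult:
  assumes "set ks \<subseteq> {..<n}"
  shows "ent (prj n ks * a) i j = (if i < length ks then ent a (ks ! i) j else (0::'a::ring_1))"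
proof -
  have "ent (prj n ks * a) i j = (\<Sum>k<n. ent (prj n ks) i k * ent a k j)"
    by (rule ent_mult) (auto simp: prj_def ent_mk)
  also have "\<dots> = (\<Sum>k<n. if k = ks ! i then if i < length ks then ent a (ks ! i) j else 0 else 0)"
    by (rule sum.cong) (auto simp: prj_def ent_mk)
  finally show ?thesis using assms nth_mem by fastforce
qed

lemma prj_inc:
  assumes "set ks \<subseteq> {..<n}" "set ls \<subseteq> {..<n}"
  shows "prj n ks * inc n ls = mk (length ks) (length ls) (\<lambda>i j. if ks ! i = ls ! j then 1 else (0::'a::ring_1))"
  by (rule fm_eqI) (use assms(1) nth_mem in \<open>fastforce simp: ent_prj_mult[OF assms(1)] inc_def ent_mk\<close>)

lemma prj_inc_same: "set ks \<subseteq> {..<n} \<Longrightarrow> distinct ks \<Longrightarrow> prj n ks * inc n ks = (idm (length ks) :: 'a::ring_1 fm)"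
  by (rule fm_eqI) (auto simp: prj_inc ent_mk ent_idm nth_eq_iff_index_eq)

lemma prj_inc_disjoint:
  assumes "set ks \<subseteq> {..<n}" "set ls \<subseteq> {..<n}" "set ks \<inter> set ls = {}"
  shows "prj n ks * inc n ls = (0 :: 'a::ring_1 fm)"
proof (rule fm_eqI)
  fix i j
  have "ks ! i \<noteq> ls ! j" if "i < length ks" "j < length ls"
    using nth_mem[OF that(1)] nth_mem[OF that(2)] assms(3) by (metis disjoint_iff)
  then show "ent (prj n ks * inc n ls :: 'a fm) i j = ent 0 i j"
    by (auto simp: prj_inc[OF assms(1,2)] ent_mk ent_simps)
qed

lemma ent_inc_prj:
  assumes "set ks \<subseteq> {..<n}" "distinct ks"
  shows "ent (inc n ks * prj n ks) i j = (if i = j \<and> i \<in> set ks then 1 else (0::'a::ring_1))"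
proof -
  have "ent (inc n ks * prj n ks :: 'a fm) i j = (\<Sum>m<length ks. ent (inc n ks) i m * ent (prj n ks) m j)"
    by (rule ent_mult) (auto simp: inc_def ent_mk)
  also have "\<dots> = (\<Sum>m<length ks. if ks ! m = i \<and> i = j then 1 else 0)"
    by (rule sum.cong) (use assms(1) nth_mem in \<open>fastforce simp: inc_def prj_def ent_mk\<close>)+
  also have "\<dots> = (if i = j \<and> i \<in> set ks then 1 else 0)"
  proof (cases "i = j \<and> i \<in> set ks")
    case True
    then obtain m where m: "m < length ks" "ks ! m = i" by (auto simp: in_set_conv_nth)
    have "(\<Sum>m<length ks. if ks ! m = i \<and> i = j then 1 else 0) = (\<Sum>m'<length ks. if m' = m then 1 else (0::'a))"
      by (rule sum.cong) (use m True assms(2) in \<open>auto simp: nth_eq_iff_index_eq\<close>)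
    then show ?thesis using True[THEN conjunct1] True[THEN conjunct2] m(1) by simp
  next
    case False
    then show ?thesis by (auto intro!: sum.neutral)
  qed
  finally show ?thesis .
qed

lemma inc_prj:
  assumes "distinct (ks @ ls)" "set (ks @ ls) = {..<n}"
  shows "inc n ks * prj n ks + inc n ls * prj n ls = (idm n :: 'a::ring_1 fm)"
proof (rule fm_eqI)
  fix i j
  have s: "set ks \<subseteq> {..<n}" "distinct ks" "set ls \<subseteq> {..<n}" "distinct ls" "set ks \<inter> set ls = {}" "i < n \<longleftrightarrow> i \<in> set ks \<or> i \<in> set ls"
    using assms by auto
  show "ent (inc n ks * prj n ks + inc n ls * prj n ls :: 'a fm) i j = ent (idm n) i j"
    unfolding ent_add ent_inc_prj[OF s(1,2)] ent_inc_prj[OF s(3,4)] ent_idm using s(5,6) by auto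
qed

context exact_orbits
begin

lemma inc_H: assumes "X \<in> Ob" "set ks \<subseteq> {..<length X}"
  shows "inc (length X) ks \<in> H (map ((!) X) ks) X" "prj (length X) ks \<in> H X (map ((!) X) ks)"
    "map ((!) X) ks \<in> Ob"
proof -
  have m: "ks ! j < length X" if "j < length ks" for j using assms(2) nth_mem[OF that] by auto
  have m': "\<not> length X \<le> ks ! j" if "j < length ks" for j using m[OF that] by simp
  show o: "map ((!) X) ks \<in> Ob" using assms unfolding Ob_def by (auto simp: subset_iff)
  show "inc (length X) ks \<in> H (map ((!) X) ks) X" "prj (length X) ks \<in> H X (map ((!) X) ks)"
    by (rule H_I; use assms o in \<open>auto simp: inc_def prj_def ent_mk m m'\<close>)+
qed

text \<open>The map s is split in \<open>F\<close>, because it is invertible after projection to the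
  summands ks; averaging makes the retraction equivariant. The complement lives on the remaining
  summands ls, and its structure map is the transport q * x * t of the given one.\<close>

lemma split_off:
  assumes o: "N \<in> EOb" "A \<in> EOb" and s: "s \<in> EH N A"
    and ks: "distinct (ks @ ls)" "set (ks @ ls) = {..<length (fst A)}"
    and w: "w \<in> H (map ((!) (fst A)) ks) (fst N)"
      "w * (prj (length (fst A)) ks * s) = idm (length (fst N))"
      "(prj (length (fst A)) ks * s) * w = idm (length ks)"
  obtains A' r t q where "A' \<in> EOb" "r \<in> EH A N" "t \<in> EH A' A" "q \<in> EH A A'"
    "r * s = idm (length (fst N))" "q * t = idm (length (fst A'))" "r * t = 0" "q * s = 0"
    "s * r + t * q = idm (length (fst A))"
proof -
  define X where "X = fst A"
  define Y where "Y = fst N"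
  define n where "n = length X"
  define i1 p1 i2 p2 where "i1 = (inc n ks :: 'r fm)" and "p1 = (prj n ks :: 'r fm)"
    and "i2 = (inc n ls :: 'r fm)" and "p2 = (prj n ls :: 'r fm)"
  define K where "K = map ((!) X) ks"
  define X' where "X' = map ((!) X) ls"
  define x where "x = st A"
  define y where "y = st N"
  note A = EOb_H[OF o(2), folded X_def x_def]
  note N = EOb_H[OF o(1), folded Y_def y_def]
  have sub: "set ks \<subseteq> {..<length X}" "set ls \<subseteq> {..<length X}" using ks by (auto simp: X_def)
  note k = inc_H[OF A(1) sub(1), folded n_def K_def, folded i1_def p1_def]
  note k' = inc_H[OF A(1) sub(2), folded n_def X'_def, folded i2_def p2_def]
  have lX': "length X' = length ls" by (simp add: X'_def)
  have p2i2: "p2 * i2 = idm (length X')"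
    using prj_inc_same[OF sub(2)] ks by (simp add: p2_def i2_def n_def lX')
  have p1i2: "p1 * i2 = 0" unfolding p1_def i2_def
    by (rule prj_inc_disjoint) (use sub ks n_def in auto)
  have ip: "i1 * p1 + i2 * p2 = idm n" unfolding i1_def p1_def i2_def p2_def
    by (rule inc_prj) (use ks in \<open>auto simp: n_def X_def\<close>)
  define I where "I = (idm n :: 'r fm)"
  have sH: "s \<in> H Y X" using EH_H[OF s] by (simp add: X_def Y_def)
  have wH: "w \<in> H K Y" using w(1) by (simp add: K_def X_def Y_def)
  define r0 where "r0 = w * p1"
  have r0: "r0 \<in> H X Y" unfolding r0_def using wH k by blast
  have r0s: "r0 * s = idm (length Y)"
    using w(2) by (simp add: r0_def p1_def n_def X_def Y_def mult.assoc)
  have r0i2: "r0 * i2 = 0" by (simp add: r0_def mult.assoc p1i2)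
  have IH: "I \<in> H X X" using A(1) by (auto simp: I_def n_def)
  have Il: "I * a = a" if "a \<in> H Z X" for a Z using H_idm_left[OF that] by (simp add: I_def n_def)
  have Ir: "a * I = a" if "a \<in> H X Z" for a Z using H_idm_right[OF that] by (simp add: I_def n_def)
  have sr0: "s * r0 \<in> H X X" using sH r0 by blast
  define r where "r = average A N r0"
  have rE: "r \<in> EH A N" unfolding r_def by (rule average_EH[OF o(2,1)]) (use r0 in \<open>simp add: X_def Y_def\<close>)
  have rH: "r \<in> H X Y" using EH_H[OF rE] by (simp add: X_def Y_def)
  have rs: "r * s = idm (length Y)"
    using average_right[OF s, of N r0] average_id[OF EH_idm[OF o(1)]] r0s by (simp add: r_def Y_def)
  have sr: "s * r \<in> H X X" using sH rH by blast
  have sI: "s * idm (length Y) = s" using H_idm_right[OF sH] .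
  \<comment> \<open>Two retractions are mixed. The inclusion t uses the equivariant r, so that r * t
    = 0. The projection q uses the original r0, because I - s * r0 takes values in the summands ls
    alone, which gives s * r + t * q = I.\<close>
  define t where "t = (I - s * r) * i2"
  define q where "q = p2 * (I - s * r0)"
  have tH: "t \<in> H X' X" unfolding t_def using k' IH sr by blast
  have qH: "q \<in> H X X'" unfolding q_def using k' IH sr0 by blast
  have qs: "q * s = 0"
    by (simp add: q_def mult.assoc left_diff_distrib r0s sI Il[OF sH])
  have rt: "r * t = 0"
    using H_idm_left[OF H_mult[OF k'(1) rH]] H_mult[OF k'(1) rH]
    by (simp add: t_def mult.assoc left_diff_distrib right_diff_distrib Il[OF k'(1)] mult_assoc_eq[OF rs])
  have qt: "q * t = idm (length X')"
  proof -
    have "q * t = q * i2 - q * (s * (r * i2))"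
      by (simp add: t_def left_diff_distrib right_diff_distrib mult.assoc Il[OF k'(1)])
    also have "q * (s * (r * i2)) = 0" by (simp add: mult_assoc_eq[OF qs])
    also have "q * i2 = p2 * i2" by (simp add: q_def left_diff_distrib mult.assoc Il[OF k'(1)] r0i2)
    finally show ?thesis by (simp add: p2i2)
  qed
  have key: "i2 * p2 * (I - s * r0) = I - s * r0"
  proof -
    have "p1 * (I - s * r0) = p1 - (p1 * s * w) * p1"
      by (simp add: right_diff_distrib Ir[OF k(2)] r0_def mult.assoc)
    also have "p1 * s * w = idm (length ks)" using w(3) by (simp add: p1_def n_def X_def)
    also have "idm (length ks) * p1 = p1" using H_idm_left[OF k(2)] by (simp add: K_def)
    finally have 0: "p1 * (I - s * r0) = 0" by simp
    have "(i1 * p1 + i2 * p2) * (I - s * r0) = I - s * r0"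
      using Il[OF H_diff[OF IH sr0]] by (simp only: ip I_def[symmetric])
    then show ?thesis using 0 by (simp add: distrib_right mult.assoc)
  qed
  have sum: "s * r + t * q = I"
  proof -
    have "t * q = (I - s * r) * (i2 * p2 * (I - s * r0))" by (simp add: t_def q_def mult.assoc)
    also have "\<dots> = I - s * r0 - s * r + s * ((r * s) * r0)"
      unfolding key using Ir[OF sr] Ir[OF IH] Il[OF sr0]
      by (simp add: left_diff_distrib right_diff_distrib mult.assoc)
    also have "(r * s) * r0 = r0" using rs H_idm_left[OF r0] by simp
    finally show ?thesis by simp
  qed
  define x' where "x' = q * x * t"
  have xs: "x * s = s * y" using EH_eq[OF s] by (simp add: x_def y_def)
  have rx: "r * x = y * r" using EH_eq[OF rE] by (simp add: x_def y_def)
  have tq: "t * q = I - s * r" using sum by (simp add: eq_diff_eq add.commute)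
  have qxs: "q * (x * (s * z)) = 0" for z
  proof -
    have "q * (x * (s * z)) = q * s * (y * z)" using mult_assoc_eq[OF xs] by (simp add: mult.assoc)
    then show ?thesis by (simp add: qs)
  qed
  have xt: "x * t \<in> H X' (psi_obj X)" using tH A(3) by blast
  have x'H: "x' \<in> H (psi_obj X') X'"
  proof -
    have "t \<in> H (psi_obj X') (psi_obj X)" using tH H_psi k'(3) A(1) by simp
    then show ?thesis using H_mult[OF H_mult[OF _ A(2)] qH] by (simp add: x'_def mult.assoc)
  qed
  have tx': "t * x' = x * t"
  proof -
    have "t * x' = (t * q) * (x * t)" by (simp add: x'_def mult.assoc)
    also have "\<dots> = I * (x * t) - s * (r * (x * t))" by (simp add: tq left_diff_distrib mult.assoc)
    also have "r * (x * t) = 0" by (simp add: mult_assoc_eq[OF rx] mult.assoc rt)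
    also have "I * (x * t) = x * t" using H_idm_left[OF xt] by (simp add: I_def n_def)
    finally show ?thesis by simp
  qed
  have qx': "x' * q = q * x"
  proof -
    have "x' * q = q * (x * (t * q))" by (simp add: x'_def mult.assoc)
    also have "\<dots> = q * (x * I) - q * (x * (s * r))" by (simp add: tq right_diff_distrib)
    also have "x * I = x" using H_idm_right[OF A(3)] by (simp add: I_def n_def)
    finally show ?thesis by (simp add: qxs)
  qed
  have x'x': "x' * x' = idm (length X')"
  proof -
    have "x' * x' = q * x * (t * x')" by (simp add: x'_def mult.assoc)
    also have "\<dots> = q * ((x * x) * t)" by (simp add: tx' mult.assoc)
    also have "(x * x) * t = t" using A(4) H_idm_left[OF tH] by simp
    finally show ?thesis by (simp add: qt)
  qed
  have e: "eob X' x'" using k'(3) x'H x'x' by (simp add: eob_def)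
  let ?A' = "(X', dec (psi_obj X') X' x')"
  note A' = eob_EOb[OF e]
  have tE: "t \<in> EH ?A' A" using tH tx' A' o by (simp add: EH_def X_def x_def)
  have qE: "q \<in> EH A ?A'" using qH qx' A' o by (simp add: EH_def X_def x_def)
  show thesis
    by (rule that[OF A'(1) rE tE qE]) (use rs qt rt qs sum in \<open>simp_all add: Y_def I_def n_def X_def\<close>)
qed

text \<open>Indecomposability makes the complement stably zero, so r and s, with r * s = 1, become
  inverse to each other in the stable category.\<close>

lemma split_off_iso:
  assumes ind: "indecomposable SC A" and nz: "\<not> zero_object SC N"
    and o: "N \<in> EOb" "A \<in> EOb" and s: "s \<in> EH N A"
    and ks: "distinct (ks @ ls)" "set (ks @ ls) = {..<length (fst A)}"
    and w: "w \<in> H (map ((!) (fst A)) ks) (fst N)"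
      "w * (prj (length (fst A)) ks * s) = idm (length (fst N))"
      "(prj (length (fst A)) ks * s) * w = idm (length ks)"
  shows "isomorphic SC A N"
proof -
  obtain A' r t q where h: "A' \<in> EOb" "r \<in> EH A N" "t \<in> EH A' A" "q \<in> EH A A'"
    and e: "r * s = idm (length (fst N))" "q * t = idm (length (fst A'))" "r * t = 0" "q * s = 0"
    "s * r + t * q = idm (length (fst A))" using split_off[OF o s ks w] .
  have "stably_eq N N (r * s) (idm (length (fst N))) \<and> stably_eq A' A' (q * t) (idm (length (fst A'))) \<and>
     stably_eq A' N (r * t) 0 \<and> stably_eq N A' (q * s) 0 \<and> stably_eq A A (s * r + t * q) (idm (length (fst A)))"
    unfolding e using o h(1) stably_eq_refl by simp
  then have "is_direct_sum SC A N A'" unfolding is_direct_sum_SC[OF o(2,1) h(1)] using s h by blast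
  then have "zero_object SC A'" using ind nz o h(1) unfolding indecomposable_def Obj_SC by blast
  then have "idm (length (fst A')) \<in> Fac (fst A') (fst A')" using zero_object_SC[OF h(1)] by blast
  then have "t * (idm (length (fst A')) * q) \<in> Fac (fst A) (fst A)"
    using Fac_left[OF Fac_right[OF _ EH_H[OF h(4)]] EH_H[OF h(3)]] by blast
  then have "t * q \<in> Fac (fst A) (fst A)" using EH_idm_left[OF h(4)] by simp
  moreover have "s * r - idm (length (fst A)) = - (t * q)" using e(5) by (simp add: algebra_simps)
  ultimately have "stably_eq A A (s * r) (idm (length (fst A)))" using Fac_uminus by (simp add: stably_eq_def)
  moreover have "stably_eq N N (r * s) (idm (length (fst N)))" unfolding e using o stably_eq_refl by simp
  ultimately show ?thesis using isomorphic_SC[OF o(2,1)] s h(2) by blast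
qed

section \<open>Classification of the indecomposable objects\<close>

lemma unit_entry_strong:
  assumes "a \<in> H X Y" "c \<in> H Y X" "k < length X" "\<not> u dvd ent (c * a) k k"
  shows "\<exists>l<length Y. pt (X ! k) = pt (Y ! l) \<and> \<not> u dvd ent a l k"
proof -
  have "\<exists>l<length Y. \<not> u dvd ent c k l * ent a l k"
    using assms(4) unfolding H_ent_mult[OF assms(1)] by (meson dvd_sum lessThan_iff)
  then obtain l where l: "l < length Y" "\<not> u dvd ent c k l * ent a l k" by blast
  have "u ^ (dd (Y ! l) (X ! k) + dd (X ! k) (Y ! l)) dvd ent c k l * ent a l k"
    unfolding power_add using H_dvd[OF assms(1)] H_dvd[OF assms(2)] l assms(3) by (intro mult_dvd_mono) auto
  then have "\<not> u dvd u ^ (dd (Y ! l) (X ! k) + dd (X ! k) (Y ! l))" using l(2) dvd_trans by metis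
  then have "dd (Y ! l) (X ! k) + dd (X ! k) (Y ! l) = 0" by (metis dvd_power neq0_conv)
  then have "pt (X ! k) = pt (Y ! l)"
    using dd_iso_iff[OF _ _ b_le, of "X ! k" "Y ! l"] H_Ob[OF assms(1)] l assms(3) by simp
  moreover have "\<not> u dvd ent a l k" using l(2) dvd_mult by metis
  ultimately show ?thesis using l(1) by blast
qed

lemma ent_mult_unit_vec:
  assumes "k < n"
  shows "ent (a * mk n 1 (\<lambda>i j. if i = k then 1 else 0)) i j = (if j = 0 then ent a i k else (0::'r))"
proof -
  have "ent (a * mk n 1 (\<lambda>i j. if i = k then 1 else 0)) i j = (\<Sum>l<n. ent a i l * ent (mk n 1 (\<lambda>i j. if i = k then 1 else 0)) l j)"
    by (rule ent_mult) (auto simp: ent_mk)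
  also have "\<dots> = (\<Sum>l<n. if l = k then if j = 0 then ent a i k else 0 else 0)"
    by (rule sum.cong) (auto simp: ent_mk)
  finally show ?thesis using assms by simp
qed

text \<open>A non-boundary summand X ! k exists, as otherwise the object would be stably zero. Off
  the diagonal, x * x = 1 forces a unit in column k of x, in a row l whose orbit has the position of
  psi (X ! k); the inclusion of X ! k and its image under x together split off a copy of SM. On the
  diagonal, averaging the inclusion of X ! k splits off a singular object.\<close>

lemma indecomposable_classify:
  assumes A: "A \<in> EOb" and ind: "indecomposable SC A"
  shows "(\<exists>x y. 0 < \<bar>x - y\<bar> \<and> \<bar>x - y\<bar> < b \<and> isomorphic SC A (SM x y)) \<or>
    (\<exists>e x. isomorphic SC A (Z_obj e x))"
proof -
  define X where "X = fst A"
  define x where "x = st A"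
  define n where "n = length X"
  note a = EOb_H[OF A, folded X_def x_def]
  have "\<not> boundary X"
  proof
    assume bX: "boundary X"
    have I: "idm n \<in> H X X" using a(1) by (auto simp: n_def)
    have "idm n * idm n \<in> Fac X X" using FacI[OF bX I I] .
    then show False using ind zero_object_SC[OF A] by (simp add: indecomposable_def X_def n_def idm_idm)
  qed
  then obtain k where k: "k < n" "\<not> boundary_orbit (X ! k)" by (auto simp: boundary_def in_set_conv_nth n_def)
  have ok: "X ! k \<in> orbits b" using a(1) k by (simp add: n_def)
  then obtain c d where cd: "\<bar>c - d\<bar> \<le> b" "X ! k = M c d" by (auto simp: orbits_M)
  then have cdb: "\<bar>c - d\<bar> < b" using k boundary_orbit_M_iff by fastforce
  define \<epsilon> where "\<epsilon> = mk n 1 (\<lambda>i j. if i = k then 1 else (0::'r))"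
  have eps: "\<epsilon> \<in> H [M c d] X"
    using H_mk[of "[M c d]" X "\<lambda>i j. if i = k then 1 else 0"] a(1) cd ok by (auto simp: \<epsilon>_def n_def)
  have ent_eps: "ent (z * \<epsilon>) i j = (if j = 0 then ent z i k else 0)" for z i j
    unfolding \<epsilon>_def by (rule ent_mult_unit_vec[OF k(1)])
  have xxk: "\<not> u dvd ent (x * x) k k" using a(4) k u_nonunit by (simp add: ent_idm n_def)
  have unit: "\<exists>v. z * v = 1" if "\<not> u dvd z" for z using that unit_or[of z] by (metis dvdE)
  have comp: "\<exists>ls. distinct (ks @ ls) \<and> set (ks @ ls) = {..<n}" if "distinct ks" "set ks \<subseteq> {..<n}" for ks
    by (rule exI[of _ "filter (\<lambda>i. i \<notin> set ks) [0..<n]"]) (use that in auto)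
  show ?thesis
  proof (cases "c = d")
    case False
    obtain l where l: "l < n" "pt (X ! k) = pt (psi_obj X ! l)" "\<not> u dvd ent x l k"
      using unit_entry_strong[OF a(3,2) _ xxk] k by (auto simp: n_def)
    have pl: "pt (psi_obj X ! l) = prod.swap (pt (X ! l))"
      using l(1) a(1) pt_psi[of "X ! l" b] by (simp add: nth_psi n_def)
    have "k \<noteq> l"
    proof
      assume "k = l"
      then have "pt (X ! k) = pt (psi_orbit (X ! k))" using l k(1) by (simp add: nth_psi n_def)
      then show False using False cd pt_M_psi_iff by simp
    qed
    obtain v where v: "ent x l k * v = 1" using unit[OF l(3)] by blast
    let ?N = "SM c d :: 'r pobj"
    note N = SM_obj[OF cd(1)]
    define p where "p = (pr2 1 1 :: 'r fm)"
    have pH: "p \<in> H [M c d, psi_orbit (M c d)] [psi_orbit (M c d)]"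
      using pr2_H[of "[M c d]" "[psi_orbit (M c d)]"] ok cd by (simp add: p_def)
    have p1H: "idm 1 \<in> H [M c d, psi_orbit (M c d)] [M c d]"
      using pr1_H[of "[M c d]" "[psi_orbit (M c d)]"] ok cd by simp
    have xe: "x * \<epsilon> \<in> H [psi_orbit (M c d)] X"
    proof -
      have "\<epsilon> \<in> H (psi_obj [M c d]) (psi_obj X)" using eps H_psi[OF H_Ob[OF eps]] by simp
      then show ?thesis using H_mult[OF _ a(2)] by (simp add: psi_obj_def)
    qed
    define s where "s = \<epsilon> * idm 1 + x * \<epsilon> * p"
    have sH: "s \<in> H [M c d, psi_orbit (M c d)] X" unfolding s_def using eps p1H pH xe by blast
    have e1: "\<epsilon> * idm 1 = \<epsilon>" using H_idm_right[OF eps] by simp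
    have eqs: "\<epsilon> * in2 1 1 = 0"
      by (rule fm_eqI) (auto simp: ent_mult_in2 ent_simps \<epsilon>_def ent_mk)
    have pin: "p * in2 1 1 = idm 1" and pp: "p * p = 0"
      using pr2_in2[of 1 1] pr2_pr2[of 1] by (simp_all add: p_def)
    have xe1: "x * (\<epsilon> * idm 1) = x * \<epsilon>" by (simp only: e1)
    have s_eq: "s * sw 1 = x * s"
    proof -
      have "s * sw 1 = \<epsilon> * p + x * \<epsilon>"
        unfolding s_def e1 sw_def p_def[symmetric] using xe1
        by (simp add: distrib_left distrib_right mult.assoc eqs pin pp
            del: One_nat_def)
      moreover have "x * s = x * \<epsilon> + \<epsilon> * p"
        unfolding s_def e1 using mult_assoc_eq[OF a(4), of "\<epsilon> * p"] H_idm_left[OF eps]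
        by (simp add: distrib_left mult.assoc flip: mult.assoc[of "idm _"])
      ultimately show ?thesis by (simp add: add.commute)
    qed
    have sE: "s \<in> EH ?N A" using sH s_eq N A by (simp add: EH_def X_def x_def)
    have ent_s: "ent s i j = (if j = 0 then if i = k then 1 else 0 else if j = 1 then ent x i k else 0)" for i j
    proof -
      have "ent (x * \<epsilon> * p) i j = (\<Sum>m<1. ent (x * \<epsilon>) i m * ent p m j)"
        by (rule ent_mult) (auto simp: ent_eps)
      then have "ent (x * \<epsilon> * p) i j = (if j = 1 then ent x i k else 0)"
        by (auto simp: ent_eps p_def ent_pr2)
      moreover have "ent \<epsilon> i j = (if j = 0 \<and> i = k then 1 else 0)" using k(1) by (auto simp: \<epsilon>_def ent_mk)
      moreover have "s = \<epsilon> + x * \<epsilon> * p" by (simp only: s_def e1)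
      ultimately show ?thesis by (auto simp: ent_simps)
    qed
    \<comment> \<open>The inverse of the upper triangular matrix of s in rows k and l, whose
      diagonal entries are 1 and the unit \<open>ent x l k\<close> with inverse v.\<close>
    define w where "w = mk 2 2 (\<lambda>i j. if i = 0 \<and> j = 0 then 1 else if i = 0 \<and> j = 1 then - (ent x k k * v)
       else if i = 1 \<and> j = 1 then v else 0)"
    have ol: "X ! l \<in> orbits b" using a(1) l(1) by (simp add: n_def)
    have ptl: "pt (X ! l) = pt (psi_orbit (M c d))"
      using l(2) pl pt_psi[OF ok] cd by simp
    then have ddl: "dd (X ! l) Y = dd (psi_orbit (M c d)) Y" for Y by (simp add: dd_def)
    have xkk: "u ^ dd (psi_orbit (M c d)) (M c d) dvd ent x k k"
      using H_dvd[OF a(2), of k k] k cd by (simp add: n_def nth_psi)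
    have wH: "w \<in> H (map ((!) X) [k, l]) (fst ?N)"
      unfolding w_def N(2) using ok ol cd xkk
      by (intro H_I) (auto simp: ent_mk ddl less_Suc_eq numeral_2_eq_2 dd_pt_eq)
    have sub: "set [k, l] \<subseteq> {..<n}" using k l by auto
    have ps: "prj n [k, l] * s = mk 2 2 (\<lambda>i j. if i = 0 \<and> j = 0 then 1 else if i = 0 \<and> j = 1 then ent x k k
       else if i = 1 \<and> j = 1 then ent x l k else 0)"
      by (rule fm_eqI) (use \<open>k \<noteq> l\<close> in \<open>auto simp: ent_prj_mult[OF sub] ent_s ent_mk less_Suc_eq numeral_2_eq_2\<close>)
    have m22: "ent (mk 2 2 f * mk 2 2 g) i j = (\<Sum>m<2. ent (mk 2 2 f) i m * ent (mk 2 2 g) m j)" for f g :: "nat \<Rightarrow> nat \<Rightarrow> 'r" and i j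
      by (rule ent_mult) (simp add: ent_mk)
    have w1: "w * (prj n [k, l] * s) = idm 2"
      unfolding ps w_def by (rule fm_eqI, unfold m22) (use v in \<open>auto simp: ent_mk ent_idm numeral_2_eq_2 less_Suc_eq mult.commute mult.left_commute\<close>)
    have w2: "(prj n [k, l] * s) * w = idm 2"
      unfolding ps w_def by (rule fm_eqI, unfold m22) (use v in \<open>auto simp: ent_mk ent_idm numeral_2_eq_2 less_Suc_eq mult.commute mult.left_commute\<close>)
    obtain ls where ls: "distinct ([k, l] @ ls)" "set ([k, l] @ ls) = {..<n}"
      using comp[of "[k, l]"] sub \<open>k \<noteq> l\<close> by auto
    have "\<not> zero_object SC ?N"
      using nonzero_object[OF N(1), of 0] N(2) k cd by simp
    from split_off_iso[OF ind this N(1) A sE ls[unfolded n_def X_def]] wH w1 w2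
    have "isomorphic SC A ?N" by (simp add: N(2) n_def X_def numeral_2_eq_2)
    then show ?thesis using False cdb by (intro disjI1 exI[of _ c] exI[of _ d]) auto
  next
    case True
    let ?N = "\<lambda>e. Z_obj e c :: 'r pobj"
    have N: "?N e \<in> EOb" "fst (?N e) = [M c d]" "st (?N e) = sm (sg e) (idm 1)" for e
      using Z_obj[of e c] True by simp_all
    define s where "s e = average (?N e) A \<epsilon>" for e
    have sE: "s e \<in> EH (?N e) A" for e
      unfolding s_def by (rule average_EH[OF N(1) A]) (use eps N X_def in simp)
    have xe: "x * \<epsilon> * sm (sg e) (idm 1) = sm (sg e) (x * \<epsilon>)" for e
      using H_idm_right[OF eps] by (simp add: sm_mult_right mult.assoc)
    \<comment> \<open>The averages for the two signs are the halves of \<epsilon> + x \<epsilon> and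
      \<epsilon> - x \<epsilon>. Their entries at k add up to 1, so at least one of them is a unit
      and decides the sign.\<close>
    have "s True + s False = sm half (\<epsilon> + \<epsilon>)"
      by (rule fm_eqI) (simp add: s_def average_def N(3) xe x_def[symmetric] sm_add sg_def sm_1 sm_minus1 ent_simps ent_sm algebra_simps)
    then have "s True + s False = \<epsilon>" by (simp add: sm_half)
    then have "ent (s True) k 0 + ent (s False) k 0 = 1" using k(1) by (simp add: \<epsilon>_def ent_mk flip: ent_add)
    then have "\<exists>e. \<not> u dvd ent (s e) k 0" using u_nonunit dvd_add by metis
    then obtain e where e: "\<not> u dvd ent (s e) k 0" by blast
    obtain v where v: "ent (s e) k 0 * v = 1" using unit[OF e] by blast
    have sub: "set [k] \<subseteq> {..<n}" using k by auto
    have sH: "s e \<in> H [M c d] X" using EH_H[OF sE] N X_def by simp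
    define w where "w = sm v (idm 1 :: 'r fm)"
    have "map ((!) X) [k] = [M c d]" "[M c d] \<in> Ob" using cd ok by auto
    then have wH: "w \<in> H (map ((!) X) [k]) (fst (?N e))"
      using H_idm[of "[M c d]"] H_sm by (simp add: w_def N)
    have ps: "prj n [k] * s e = sm (ent (s e) k 0) (idm 1)"
    proof (rule fm_eqI)
      fix i j :: nat
      have "ent (s e) k j = 0" if "1 \<le> j" using H_supp[OF sH] that by simp
      then show "ent (prj n [k] * s e) i j = ent (sm (ent (s e) k 0) (idm 1)) i j"
        by (cases j) (auto simp: ent_prj_mult[OF sub] ent_sm ent_idm)
    qed
    have w1: "w * (prj n [k] * s e) = idm 1" "(prj n [k] * s e) * w = idm 1"
      using v by (simp_all add: ps w_def sm_mult_left sm_mult_right sm_sm idm_idm mult.commute sm_1)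
    obtain ls where ls: "distinct ([k] @ ls)" "set ([k] @ ls) = {..<n}"
      using comp[of "[k]"] sub by auto
    have "\<not> zero_object SC (?N e)"
      using nonzero_object[OF N(1), of 0] N(2) k cd by simp
    from split_off_iso[OF ind this N(1) A sE ls[unfolded n_def X_def]] wH w1
    have "isomorphic SC A (?N e)" by (simp add: N(2) n_def X_def)
    then show ?thesis by blast
  qed
qed

end

section \<open>Extensions\<close>

context exact_orbits
begin

text \<open>A copresentation \<open>X \<rightarrow> I \<oplus> I' \<rightarrow> C\<close> by basic morphisms: the identity of degrees makes the
  composite zero, the first disjunction yields that \<open>C\<close> is a cokernel, the second that maps to
  projective-injective objects extend.\<close>

definition injective_square :: "orbit \<Rightarrow> orbit \<Rightarrow> orbit \<Rightarrow> orbit \<Rightarrow> bool" where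
  "injective_square X I I' C \<longleftrightarrow> X \<in> orbits b \<and> boundary_orbit I \<and> boundary_orbit I' \<and> C \<in> orbits b \<and>
     dd X I + dd I C = dd X I' + dd I' C \<and>
     (\<forall>W\<in>orbits b. dd I C + dd C W = dd I W \<or> dd I' C + dd C W = dd I' W) \<and>
     (\<forall>W. boundary_orbit W \<longrightarrow> dd X I + dd I W = dd X W \<or> dd X I' + dd I' W = dd X W)"

lemma dd_M:
  assumes "\<bar>x - y\<bar> \<le> pi" "\<bar>x' - y'\<bar> \<le> pi" "\<bar>x'' - y''\<bar> \<le> pi"
  shows "dd (M x y) (M x' y') + dd (M x' y') (M x'' y'') = dd (M x y) (M x'' y'')
    \<longleftrightarrow> D (x, y) (x', y') + D (x', y') (x'', y'') = D (x, y) (x'', y'')"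
  using dd_cancel_M[of "(x, y)" "(x', y')" "(x'', y'')"] assms by (simp add: wid_def)

lemma D_zeroI:
  assumes "wid q" "ple p q" "\<not> ple p (spw (-1) q)" shows "D p q = 0"
  using assms D_le_iff[of q p 0] D_le_iff[of q p "-1"] by simp

text \<open>The rectangle with lower corner (x, y) whose two neighbouring corners (x, x + b) and (y
  + b, y) lie on the boundary lines; C is the opposite corner. As b < pi, the five degrees among the
  corners are zero. C is the join of the two middle corners, so its degree to any W equals one of
  theirs; and a point above (x, y) with |s - t| = b lies above one of the middle corners.\<close>

lemma injective_square_M:
  assumes "\<bar>x - y\<bar> \<le> b" "b < pi"
  shows "injective_square (M x y) (M x (x + b)) (M (y + b) y) (M (y + b) (x + b))"
proof -
  define p q q' r where "p = (x, y)" and "q = (x, x + b)" and "q' = (y + b, y)" and "r = (y + b, x + b)"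
  note defs = p_def q_def q'_def r_def
  have w: "wid p" "wid q" "wid q'" "wid r" using assms b_pos by (auto simp: defs wid_def)
  have xy: "x \<le> y + b" "y \<le> x + b" using assms(1) by linarith+
  have z: "D p q = 0" "D p q' = 0" "D q r = 0" "D q' r = 0" "D p r = 0"
    by (rule D_zeroI; use w xy assms b_pos in \<open>simp add: defs ple_def spw_def\<close>)+
  have le: "\<bar>x - y\<bar> \<le> pi" "\<bar>x - (x + b)\<bar> \<le> pi" "\<bar>y + b - y\<bar> \<le> pi" "\<bar>y + b - (x + b)\<bar> \<le> pi"
    using assms b_pos by auto
  have bI: "boundary_orbit (M x (x + b))" "boundary_orbit (M (y + b) y)" unfolding boundary_orbit_M using b_pos by force+
  have join: "ple r v \<longleftrightarrow> ple q v \<and> ple q' v" for v using xy by (auto simp: defs ple_def)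
  have Dmax: "D r v = D q v \<or> D r v = D q' v" if "wid v" for v
  proof -
    have "D r v \<le> i \<longleftrightarrow> D q v \<le> i \<and> D q' v \<le> i" for i using join D_le_iff[OF that] by simp
    then show ?thesis by (metis dual_order.refl linorder_linear order_antisym)
  qed
  have 1: "dd (M x y) (M x (x + b)) + dd (M x (x + b)) (M (y + b) (x + b)) = dd (M x y) (M (y + b) (x + b))"
    "dd (M x y) (M (y + b) y) + dd (M (y + b) y) (M (y + b) (x + b)) = dd (M x y) (M (y + b) (x + b))"
    unfolding dd_M[OF le(1,2,4)] dd_M[OF le(1,3,4)] using z by (simp_all add: defs)
  have 2: "dd (M x (x + b)) (M (y + b) (x + b)) + dd (M (y + b) (x + b)) W = dd (M x (x + b)) W \<or>
     dd (M (y + b) y) (M (y + b) (x + b)) + dd (M (y + b) (x + b)) W = dd (M (y + b) y) W" if WO: "W \<in> orbits b" for W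
  proof -
    obtain s t where W: "W = M s t" "\<bar>s - t\<bar> \<le> pi" using WO b_le by (auto simp: orbits_M intro: order_trans)
    show ?thesis unfolding W(1) dd_M[OF le(2,4) W(2)] dd_M[OF le(3,4) W(2)]
      using Dmax[of "(s, t)"] z W(2) by (auto simp: defs wid_def)
  qed
  have 3: "dd (M x y) (M x (x + b)) + dd (M x (x + b)) W = dd (M x y) W \<or>
     dd (M x y) (M (y + b) y) + dd (M (y + b) y) W = dd (M x y) W" if bW: "boundary_orbit W" for W
  proof -
    obtain s t where W: "W = M s t" "\<bar>s - t\<bar> = b" using bW by (auto simp: boundary_orbit_M)
    then have W': "\<bar>s - t\<bar> \<le> pi" using b_le by simp
    let ?v = "(s, t)"
    have wv: "wid ?v" using W' by (simp add: wid_def)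
    define k where "k = D p ?v"
    define v where "v = spw k ?v"
    have pv: "ple p v" using D_ple[OF wv] by (simp add: v_def k_def)
    have "\<bar>fst v - snd v\<bar> = b" unfolding v_def spw_width using W by simp
    then have "ple q v \<or> ple q' v" using pv by (auto simp: defs ple_def)
    then have "D q ?v \<le> k \<or> D q' ?v \<le> k" using D_le_iff[OF wv] by (simp add: v_def)
    moreover have "k \<le> D q ?v" "k \<le> D q' ?v"
      using D_triangle[OF w(2) wv, of p] D_triangle[OF w(3) wv, of p] z by (simp_all add: k_def)
    ultimately show ?thesis unfolding W(1) dd_M[OF le(1,2) W'] dd_M[OF le(1,3) W']
      using z by (auto simp: defs k_def)
  qed
  show ?thesis unfolding injective_square_def using bI M_orbits[OF assms(1)] M_orbits[of "y + b" "x + b"] assms(1) 1 2 3 by auto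
qed

lemma injective_square_pt:
  assumes "injective_square X I I' C" "boundary_orbit I''" "pt I'' = pt I'" shows "injective_square X I I'' C"
  using assms unfolding injective_square_def dd_def by simp

section \<open>Comparing explicit copresentations with the shift\<close>

definition injective_squares :: "orbit list \<Rightarrow> orbit list \<Rightarrow> orbit list \<Rightarrow> orbit list \<Rightarrow> bool" where
  "injective_squares B I1 I2 C \<longleftrightarrow> length I1 = length B \<and> length I2 = length B \<and> length C = length B \<and>
     (\<forall>j<length B. injective_square (B ! j) (I1 ! j) (I2 ! j) (C ! j))"

text \<open>The factor s, a square root of 1, is put on the second component so that the maps can be
  made equivariant. It is 1 in \<open>compare_shift\<close> and the sign of the object in
  \<open>Ext1_Z_iff\<close>.\<close>

definition k0 :: "orbit list \<Rightarrow> orbit list \<Rightarrow> orbit list \<Rightarrow> 'r \<Rightarrow> 'r fm" where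
  "k0 B I1 I2 s = mk (length (I1 @ I2)) (length B) (\<lambda>i j. if i = j then u ^ dd (B ! j) (I1 ! j)
     else if i = length B + j then s * u ^ dd (B ! j) (I2 ! j) else 0)"

definition p0 :: "orbit list \<Rightarrow> orbit list \<Rightarrow> orbit list \<Rightarrow> 'r \<Rightarrow> 'r fm" where
  "p0 I1 I2 C s = mk (length C) (length (I1 @ I2)) (\<lambda>i j. if j = i then u ^ dd (I1 ! i) (C ! i)
     else if j = length C + i then - s * u ^ dd (I2 ! i) (C ! i) else 0)"

context
  fixes B I1 I2 C and s :: 'r
  assumes injective_squares: "injective_squares B I1 I2 C" and s: "s * s = 1"
begin

lemma injective_squares_len: "length I1 = length B" "length I2 = length B" "length C = length B"
  using injective_squares by (auto simp: injective_squares_def)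

lemma injective_squares_injective_square: "j < length B \<Longrightarrow> injective_square (B ! j) (I1 ! j) (I2 ! j) (C ! j)"
  using injective_squares by (auto simp: injective_squares_def)

lemma injective_squares_boundary: "boundary (I1 @ I2)"
  using injective_squares_injective_square injective_squares_len by (auto simp: boundary_def injective_square_def in_set_conv_nth)

lemma injective_squares_Ob: "B \<in> Ob" "C \<in> Ob"
  using injective_squares_injective_square injective_squares_len by (auto simp: Ob_def injective_square_def in_set_conv_nth)

lemma k0_H: "k0 B I1 I2 s \<in> H B (I1 @ I2)"
  unfolding k0_def by (rule H_mk) (use injective_squares_Ob boundary_Ob[OF injective_squares_boundary] injective_squares_len in \<open>auto simp: nth_append\<close>)

lemma p0_H: "p0 I1 I2 C s \<in> H (I1 @ I2) C"
  unfolding p0_def by (rule H_mk) (use injective_squares_Ob boundary_Ob[OF injective_squares_boundary] injective_squares_len in \<open>auto simp: nth_append\<close>)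

lemma ent_mult_k0:
  assumes "j < length B"
  shows "ent (a * k0 B I1 I2 s) i j = ent a i j * u ^ dd (B ! j) (I1 ! j)
    + ent a i (length B + j) * (s * u ^ dd (B ! j) (I2 ! j))"
proof -
  let ?n = "length B"
  have "ent (a * k0 B I1 I2 s) i j = (\<Sum>l<?n + ?n. ent a i l * ent (k0 B I1 I2 s) l j)"
    by (rule ent_mult) (auto simp: k0_def ent_mk injective_squares_len)
  also have "\<dots> = (\<Sum>l\<in>{j, ?n + j}. ent a i l * ent (k0 B I1 I2 s) l j)"
    by (rule sum.mono_neutral_right) (use assms in \<open>auto simp: k0_def ent_mk injective_squares_len\<close>)
  also have "\<dots> = ent a i j * ent (k0 B I1 I2 s) j j + ent a i (?n + j) * ent (k0 B I1 I2 s) (?n + j) j"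
    using assms by (subst sum.insert) auto
  finally show ?thesis using assms by (auto simp: k0_def ent_mk injective_squares_len)
qed

lemma ent_mult_p0:
  "ent (a * p0 I1 I2 C s) i j = (if j < length B then ent a i j * u ^ dd (I1 ! j) (C ! j)
    else if j < length B + length B then ent a i (j - length B) * (- s * u ^ dd (I2 ! (j - length B)) (C ! (j - length B))) else 0)"
proof -
  let ?n = "length B"
  have *: "ent (a * p0 I1 I2 C s) i j = (\<Sum>l<?n. ent a i l * ent (p0 I1 I2 C s) l j)"
    by (rule ent_mult) (auto simp: p0_def ent_mk injective_squares_len)
  consider "j < ?n" | "?n \<le> j" "j < ?n + ?n" | "?n + ?n \<le> j" by linarith
  then show ?thesis
  proof cases
    case 1
    have "(\<Sum>l<?n. ent a i l * ent (p0 I1 I2 C s) l j) = (\<Sum>l<?n. if l = j then ent a i j * u ^ dd (I1 ! j) (C ! j) else 0)"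
      by (rule sum.cong) (use 1 in \<open>auto simp: p0_def ent_mk injective_squares_len\<close>)
    then show ?thesis using 1 * by simp
  next
    case 2
    have "(\<Sum>l<?n. ent a i l * ent (p0 I1 I2 C s) l j) = (\<Sum>l<?n. if l = j - ?n then ent a i (j - ?n) * (- s * u ^ dd (I2 ! (j - ?n)) (C ! (j - ?n))) else 0)"
      by (rule sum.cong) (use 2 in \<open>auto simp: p0_def ent_mk injective_squares_len\<close>)
    then show ?thesis using 2 * by auto
  next
    case 3
    then show ?thesis unfolding * by (auto intro!: sum.neutral simp: p0_def ent_mk injective_squares_len)
  qed
qed

lemma p0_k0: "p0 I1 I2 C s * k0 B I1 I2 s = 0"
proof (rule fm_eqI)
  fix i j
  show "ent (p0 I1 I2 C s * k0 B I1 I2 s) i j = ent 0 i j"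
  proof (cases "j < length B")
    case True
    let ?\<alpha> = "u ^ dd (B ! j) (I1 ! j)" and ?\<beta> = "u ^ dd (B ! j) (I2 ! j)"
      and ?\<gamma> = "u ^ dd (I1 ! j) (C ! j)" and ?\<delta> = "u ^ dd (I2 ! j) (C ! j)"
    have ab: "?\<alpha> * ?\<gamma> = ?\<beta> * ?\<delta>" using injective_squares_injective_square[OF True] unfolding injective_square_def by (simp flip: power_add)
    show ?thesis
    proof (cases "i = j")
      case ij: True
      then have "ent (p0 I1 I2 C s * k0 B I1 I2 s) i j = ?\<gamma> * ?\<alpha> + (- s * ?\<delta>) * (s * ?\<beta>)"
        using True by (auto simp: ent_mult_k0[OF True] p0_def ent_mk injective_squares_len)
      also have "\<dots> = ?\<alpha> * ?\<gamma> - (s * s) * (?\<beta> * ?\<delta>)" by (simp add: mult_ac)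
      also have "\<dots> = 0" unfolding s ab by simp
      finally show ?thesis by (simp add: ent_simps)
    next
      case False
      then show ?thesis using True by (auto simp: ent_mult_k0[OF True] p0_def ent_mk injective_squares_len ent_simps)
    qed
  next
    case False
    then show ?thesis using H_supp[OF H_mult[OF k0_H p0_H]] by (simp add: ent_simps)
  qed
qed

lemma p0_epi:
  assumes "g \<in> H C W" "g' \<in> H C W" "g * p0 I1 I2 C s = g' * p0 I1 I2 C s" shows "g = g'"
proof (rule fm_eqI)
  fix i j
  show "ent g i j = ent g' i j"
  proof (cases "j < length B")
    case True
    have "ent (g * p0 I1 I2 C s) i j = ent (g' * p0 I1 I2 C s) i j" using assms(3) by simp
    then show ?thesis using True u_nz by (simp add: ent_mult_p0)
  next
    case False
    then show ?thesis using H_supp[OF assms(1)] H_supp[OF assms(2)] injective_squares_len by simp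
  qed
qed

text \<open>For each entry, one of the two paths from the middle corners to W passes through C
  without extra power of u. The component of g on that path is divisible and defines the quotient;
  the relation g * k0 = 0 then determines the other component.\<close>

lemma p0_coker:
  assumes g: "g \<in> H (I1 @ I2) W" and z: "g * k0 B I1 I2 s = 0"
  shows "\<exists>g'\<in>H C W. g' * p0 I1 I2 C s = g"
proof -
  let ?n = "length B"
  have W: "W \<in> Ob" using H_Ob[OF g] by simp
  have "\<exists>r. r * u ^ dd (I1 ! j) (C ! j) = ent g i j \<and> - s * r * u ^ dd (I2 ! j) (C ! j) = ent g i (?n + j) \<and>
      u ^ dd (C ! j) (W ! i) dvd r" if i: "i < length W" and j: "j < ?n" for i j
  proof -
    note J = injective_squares_injective_square[OF j, unfolded injective_square_def]
    let ?\<alpha> = "u ^ dd (B ! j) (I1 ! j)" and ?\<beta> = "u ^ dd (B ! j) (I2 ! j)"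
      and ?\<gamma> = "u ^ dd (I1 ! j) (C ! j)" and ?\<delta> = "u ^ dd (I2 ! j) (C ! j)"
    let ?g1 = "ent g i j" and ?g2 = "ent g i (?n + j)" and ?w = "u ^ dd (C ! j) (W ! i)"
    have rel: "?g1 * ?\<alpha> + ?g2 * (s * ?\<beta>) = 0"
      using arg_cong[OF z, of "\<lambda>z. ent z i j"] by (simp add: ent_mult_k0[OF j] ent_simps)
    have ab: "?\<alpha> * ?\<gamma> = ?\<beta> * ?\<delta>" using J by (simp flip: power_add)
    have d1: "u ^ dd (I1 ! j) (W ! i) dvd ?g1" using H_dvd[OF g i, of j] j injective_squares_len by (simp add: nth_append)
    have d2: "u ^ dd (I2 ! j) (W ! i) dvd ?g2" using H_dvd[OF g i, of "?n + j"] j injective_squares_len by (simp add: nth_append)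
    have "W ! i \<in> orbits b" using W i by simp
    then consider "dd (I1 ! j) (C ! j) + dd (C ! j) (W ! i) = dd (I1 ! j) (W ! i)"
      | "dd (I2 ! j) (C ! j) + dd (C ! j) (W ! i) = dd (I2 ! j) (W ! i)" using J by blast
    then show ?thesis
    proof cases
      case 1
      then have "?w * ?\<gamma> = u ^ dd (I1 ! j) (W ! i)" by (simp add: power_add mult.commute flip: 1)
      then have "?w * ?\<gamma> dvd ?g1" using d1 by simp
      then obtain c where c: "?g1 = ?w * ?\<gamma> * c" by (auto simp: dvd_def)
      define r where "r = ?w * c"
      have g1: "r * ?\<gamma> = ?g1" by (simp add: c r_def mult_ac)
      have rel': "?g1 * ?\<alpha> = - (?g2 * (s * ?\<beta>))" using rel by (simp only: eq_neg_iff_add_eq_0)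
      have "?\<beta> * (- s * r * ?\<delta>) = - s * (r * ?\<gamma> * ?\<alpha>)" using ab by (simp add: mult_ac)
      also have "\<dots> = - s * (- (?g2 * (s * ?\<beta>)))" by (simp only: g1 rel')
      also have "\<dots> = s * s * (?g2 * ?\<beta>)" by (simp add: mult_ac)
      also have "\<dots> = ?\<beta> * ?g2" by (simp add: s)
      finally have "- s * r * ?\<delta> = ?g2" by (rule mult_left_cancel[THEN iffD1, rotated]) (simp add: u_nz)
      then show ?thesis using g1 by (intro exI[of _ r]) (auto simp: r_def)
    next
      case 2
      then have "?w * ?\<delta> = u ^ dd (I2 ! j) (W ! i)" by (simp add: power_add mult.commute flip: 2)
      then have "?w * ?\<delta> dvd ?g2" using d2 by simp
      then obtain c where c: "?g2 = ?w * ?\<delta> * c" by (auto simp: dvd_def)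
      define r where "r = - s * (?w * c)"
      have g2: "- s * r * ?\<delta> = ?g2"
      proof -
        have "- s * r * ?\<delta> = s * s * (?w * ?\<delta> * c)" by (simp add: r_def mult_ac)
        then show ?thesis by (simp add: s c)
      qed
      have "?\<alpha> * (r * ?\<gamma>) = r * (?\<beta> * ?\<delta>)" using ab by (simp add: mult_ac)
      also have "\<dots> = - ((- s * (- s * r * ?\<delta>) * ?\<beta>) * - 1)" using s by (simp add: mult_ac flip: mult.assoc[of s s])
      also have "\<dots> = - (?g2 * (s * ?\<beta>))" unfolding g2 by (simp add: mult_ac)
      also have "\<dots> = ?\<alpha> * ?g1" using rel by (simp add: eq_neg_iff_add_eq_0 neg_eq_iff_add_eq_0 mult_ac add.commute)
      finally have "r * ?\<gamma> = ?g1" by (rule mult_left_cancel[THEN iffD1, rotated]) (simp add: u_nz)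
      then show ?thesis using g2 by (intro exI[of _ r]) (auto simp: r_def)
    qed
  qed
  then obtain R where R: "\<And>i j. i < length W \<Longrightarrow> j < ?n \<Longrightarrow> R i j * u ^ dd (I1 ! j) (C ! j) = ent g i j \<and>
      - s * R i j * u ^ dd (I2 ! j) (C ! j) = ent g i (?n + j) \<and> u ^ dd (C ! j) (W ! i) dvd R i j" by metis
  define g' where "g' = mk (length W) (length C) R"
  have g': "g' \<in> H C W" unfolding g'_def by (rule H_mk) (use R injective_squares_Ob W injective_squares_len in auto)
  have "g' * p0 I1 I2 C s = g"
  proof (rule fm_eqI)
    fix i j
    show "ent (g' * p0 I1 I2 C s) i j = ent g i j"
    proof (cases "i < length W \<and> j < ?n + ?n")
      case True
      then show ?thesis using R[of i j] R[of i "j - ?n"] injective_squares_len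
        by (auto simp: ent_mult_p0 g'_def ent_mk not_less mult_ac)
    next
      case False
      then have "ent g i j = 0" "ent (g' * p0 I1 I2 C s) i j = 0"
        using H_supp[OF g] H_supp[OF H_mult[OF p0_H g']] injective_squares_len by auto
      then show ?thesis by simp
    qed
  qed
  with g' show ?thesis by blast
qed

text \<open>Each entry of f factors through one of the two middle corners, so the other component of
  the extension may be taken to be zero.\<close>

lemma k0_ext:
  assumes f: "f \<in> H B J" and J: "boundary J" shows "\<exists>h\<in>H (I1 @ I2) J. h * k0 B I1 I2 s = f"
proof -
  let ?n = "length B"
  have JO: "J \<in> Ob" by (rule boundary_Ob[OF J])
  have "\<exists>r1 r2. r1 * u ^ dd (B ! j) (I1 ! j) + r2 * (s * u ^ dd (B ! j) (I2 ! j)) = ent f i j \<and>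
      u ^ dd (I1 ! j) (J ! i) dvd r1 \<and> u ^ dd (I2 ! j) (J ! i) dvd r2" if i: "i < length J" and j: "j < ?n" for i j
  proof -
    have "boundary_orbit (J ! i)" using boundary_nth[OF J i] .
    then consider "dd (B ! j) (I1 ! j) + dd (I1 ! j) (J ! i) = dd (B ! j) (J ! i)"
      | "dd (B ! j) (I2 ! j) + dd (I2 ! j) (J ! i) = dd (B ! j) (J ! i)" using injective_squares_injective_square[OF j] by (auto simp: injective_square_def)
    moreover obtain c where c: "ent f i j = u ^ dd (B ! j) (J ! i) * c" using H_dvd[OF f i j] by (auto simp: dvd_def)
    ultimately show ?thesis
    proof cases
      case 1
      then show ?thesis by (intro exI[of _ "u ^ dd (I1 ! j) (J ! i) * c"] exI[of _ 0]) (simp add: c power_add[symmetric] mult_ac flip: 1)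
    next
      case 2
      have "s * c * u ^ dd (I2 ! j) (J ! i) * (s * u ^ dd (B ! j) (I2 ! j)) = s * s * (u ^ (dd (B ! j) (I2 ! j) + dd (I2 ! j) (J ! i)) * c)"
        by (simp add: power_add mult_ac)
      then show ?thesis
        by (intro exI[of _ 0] exI[of _ "s * c * u ^ dd (I2 ! j) (J ! i)"]) (simp add: c 2 s)
    qed
  qed
  then obtain R1 R2 where R: "\<And>i j. i < length J \<Longrightarrow> j < ?n \<Longrightarrow>
      R1 i j * u ^ dd (B ! j) (I1 ! j) + R2 i j * (s * u ^ dd (B ! j) (I2 ! j)) = ent f i j \<and>
      u ^ dd (I1 ! j) (J ! i) dvd R1 i j \<and> u ^ dd (I2 ! j) (J ! i) dvd R2 i j" by metis
  define h where "h = mk (length J) (length (I1 @ I2)) (\<lambda>i j. if j < ?n then R1 i j else R2 i (j - ?n))"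
  have h: "h \<in> H (I1 @ I2) J" unfolding h_def
    by (rule H_mk) (use R JO boundary_Ob[OF injective_squares_boundary] injective_squares_len in \<open>auto simp: nth_append\<close>)
  have "h * k0 B I1 I2 s = f"
  proof (rule fm_eqI)
    fix i j
    show "ent (h * k0 B I1 I2 s) i j = ent f i j"
    proof (cases "i < length J \<and> j < ?n")
      case True
      then show ?thesis using R[of i j] injective_squares_len by (simp add: ent_mult_k0 h_def ent_mk)
    next
      case False
      then show ?thesis using H_supp[OF f, of i j] H_supp[OF H_mult[OF k0_H h], of i j] by auto
    qed
  qed
  with h show ?thesis by blast
qed

text \<open>The argument of Schanuel's lemma. Extending each first map along the other induces c and
  c' on the cokernels. The differences N and N0 from the identities vanish on the first maps, so
  they descend to the cokernels, and the errors of c * c' and c' * c factor through I and I1 @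
  I2.\<close>

lemma compare:
  assumes conflation: "conflation B I Z i p" and I: "boundary I"
    and h: "h \<in> H (I1 @ I2) I" "h * k0 B I1 I2 s = i" and h': "h' \<in> H I (I1 @ I2)" "h' * i = k0 B I1 I2 s"
  obtains c c' m m0 where "c \<in> H C Z" "c' \<in> H Z C" "c * p0 I1 I2 C s = p * h" "c' * p = p0 I1 I2 C s * h'"
    "m \<in> Fac Z Z" "m0 \<in> Fac C C" "c * c' + m = idm (length Z)" "c' * c + m0 = idm (length C)"
proof -
  note i = conflation_H[OF conflation]
  let ?k = "k0 B I1 I2 s" and ?p = "p0 I1 I2 C s" and ?I = "I1 @ I2"
  have IO: "?I \<in> Ob" "I \<in> Ob" using boundary_Ob injective_squares_boundary I by blast+
  have "p * h * ?k = 0" using h conflation_zero[OF conflation] by (simp add: mult.assoc)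
  then obtain c where c: "c \<in> H C Z" "c * ?p = p * h" using p0_coker[OF H_mult[OF h(1) i(2)]] by blast
  have "?p * h' * i = 0" using h' p0_k0 by (simp add: mult.assoc)
  then obtain c' where c': "c' \<in> H Z C" "c' * p = ?p * h'" using conflation_coker[OF conflation H_mult[OF h'(1) p0_H]] by blast
  define N where "N = idm (length I) - h * h'"
  have N: "N \<in> H I I" unfolding N_def using IO h h' by blast
  have "N * i = 0" using h h' H_idm_left[OF i(1)] by (simp add: N_def left_diff_distrib mult.assoc)
  then obtain m where m: "m \<in> H Z I" "m * p = N" using conflation_coker[OF conflation N] by blast
  define N0 where "N0 = idm (length ?I) - h' * h"
  have N0: "N0 \<in> H ?I ?I" unfolding N0_def using IO h h' by blast
  have "N0 * ?k = 0" using h h' H_idm_left[OF k0_H] by (simp add: N0_def left_diff_distrib mult.assoc)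
  then obtain m0 where m0: "m0 \<in> H C ?I" "m0 * ?p = N0" using p0_coker[OF N0] by blast
  have "c * c' + p * m = idm (length Z)"
  proof (rule conflation_epi[OF conflation])
    show "c * c' + p * m \<in> H Z Z" "idm (length Z) \<in> H Z Z" using c c' m i conflation_Ob[OF conflation] by auto
    have "(c * c' + p * m) * p = p * h * h' + p * N"
      using mult_assoc_eq[OF c(2), of h'] by (simp add: distrib_right mult.assoc c'(2) m(2))
    also have "\<dots> = p" using H_idm_right[OF i(2)] by (simp add: N_def right_diff_distrib mult.assoc)
    finally show "(c * c' + p * m) * p = idm (length Z) * p" using H_idm_left[OF i(2)] by simp
  qed
  moreover have "c' * c + ?p * m0 = idm (length C)"
  proof (rule p0_epi)
    show "c' * c + ?p * m0 \<in> H C C" "idm (length C) \<in> H C C" using c c' m0 p0_H injective_squares_Ob by auto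
    have "(c' * c + ?p * m0) * ?p = ?p * h' * h + ?p * N0"
      using mult_assoc_eq[OF c'(2), of h] by (simp add: distrib_right mult.assoc c(2) m0(2))
    also have "\<dots> = ?p" using H_idm_right[OF p0_H] by (simp add: N0_def right_diff_distrib mult.assoc)
    finally show "(c' * c + ?p * m0) * ?p = idm (length C) * ?p" using H_idm_left[OF p0_H] by simp
  qed
  ultimately show thesis using that[OF c(1) c'(1) c(2) c'(2) FacI[OF I m(1) i(2)] FacI[OF injective_squares_boundary m0(1) p0_H]] by simp
qed

end

section \<open>Vanishing of Ext for regular and singular objects\<close>

lemma sw1_entries: "ent (sw 1) i j = (if i = 1 \<and> j = 0 \<or> i = 0 \<and> j = 1 then 1 else 0)"
  by (auto simp: sw_def ent_simps ent_in2 ent_pr2)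

text \<open>The maps c and c' need not be equivariant; they serve where vanishing can be tested by
  factorizations in \<open>F\<close>.\<close>

lemma compare_shift:
  assumes B: "B \<in> EOb" and j: "injective_squares (fst B) I1 I2 C"
  obtains c c' m m0 where "c \<in> H C (fst (shift Fp Ep B))" "c' \<in> H (fst (shift Fp Ep B)) C"
    "m \<in> Fac (fst (shift Fp Ep B)) (fst (shift Fp Ep B))" "m0 \<in> Fac C C"
    "c * c' + m = idm (length (fst (shift Fp Ep B)))" "c' * c + m0 = idm (length C)"
proof -
  obtain I i p where c: "equivariant_conflation B I (shift Fp Ep B) i p" "boundary (fst I)" using shift_equivariant_conflation[OF B] .
  note conflation = equivariant_conflationD(3)[OF c(1)]
  have s: "(1::'r) * 1 = 1" by simp
  obtain h where h: "h \<in> H (I1 @ I2) (fst I)" "h * k0 (fst B) I1 I2 1 = i"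
    using k0_ext[OF j s conflation_H(1)[OF conflation] c(2)] by blast
  obtain h' where h': "h' \<in> H (fst I) (I1 @ I2)" "h' * i = k0 (fst B) I1 I2 1"
    using boundary_ext[OF injective_squares_boundary[OF j s] conflation k0_H[OF j s]] by blast
  show thesis using compare[OF j s conflation c(2) h h'] that by metis
qed

text \<open>Since c' * f has only stably zero components, it factors through boundary orbits, and f
  equals c * (c' * f) + m * f.\<close>

lemma Ext1_vanishesI:
  assumes A: "A \<in> EOb" and B: "B \<in> EOb" and j: "injective_squares (fst B) I1 I2 C"
    and st: "\<And>i k. i < length C \<Longrightarrow> k < length (fst A) \<Longrightarrow> stably_zero (fst A ! k) (C ! i)"
  shows "Ext1_vanishes Fp Ep A B"
  unfolding Ext1_vanishes_iff[OF A B]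
proof
  fix f assume f: "f \<in> EH A (shift Fp Ep B)"
  obtain c c' m m0 where c: "c \<in> H C (fst (shift Fp Ep B))" "c' \<in> H (fst (shift Fp Ep B)) C"
    "m \<in> Fac (fst (shift Fp Ep B)) (fst (shift Fp Ep B))" "m0 \<in> Fac C C"
    "c * c' + m = idm (length (fst (shift Fp Ep B)))" "c' * c + m0 = idm (length C)"
    using compare_shift[OF B j] .
  note fH = EH_H[OF f]
  have "c' * f \<in> Fac (fst A) C" by (rule Fac_full[OF H_mult[OF fH c(2)]]) (use st in blast)
  then have "c * (c' * f) + m * f \<in> Fac (fst A) (fst (shift Fp Ep B))"
    using Fac_add Fac_left[OF _ c(1)] Fac_right[OF c(3) fH] by blast
  moreover have "c * (c' * f) + m * f = (c * c' + m) * f" by (simp add: algebra_simps)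
  ultimately show "f \<in> Fac (fst A) (fst (shift Fp Ep B))" using c(5) H_idm_left[OF fH] by simp
qed

text \<open>The adjunction between S and the forgetful functor: a map g on M x y extends to SM x y
  by \<open>st Z * g\<close> on the second summand, and is recovered by restriction.\<close>

lemma adjoint_EH:
  assumes "\<bar>x - y\<bar> \<le> b" "Z \<in> EOb" "g \<in> H [M x y] (fst Z)"
  shows "g + st Z * g * pr2 1 1 \<in> EH (SM x y) Z" "(g + st Z * g * pr2 1 1) * idm 1 = g"
proof -
  note S = SM_obj[OF assms(1)] and o = M_orbits[OF assms(1)] and z = EOb_H[OF assms(2)]
  have J: "[M x y] \<in> Ob" "[psi_orbit (M x y)] \<in> Ob" using o by auto
  define p where "p = (pr2 1 1 :: 'r fm)"
  have pH: "p \<in> H [M x y, psi_orbit (M x y)] [psi_orbit (M x y)]" using pr2_H[OF J] by (simp add: p_def)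
  have g1: "g * idm 1 = g" using H_idm_right[OF assms(3)] by simp
  have gH: "g \<in> H [M x y, psi_orbit (M x y)] (fst Z)"
    using H_mult[OF pr1_H[OF J] assms(3)] g1 by simp
  have zg: "st Z * g \<in> H [psi_orbit (M x y)] (fst Z)"
  proof -
    have "g \<in> H (psi_obj [M x y]) (psi_obj (fst Z))" using assms(3) H_psi[OF J(1) z(1)] by simp
    then show ?thesis using H_mult[OF _ z(2)] by (simp add: psi_obj_def)
  qed
  have pin: "p * in2 1 1 = idm 1" and pp: "p * p = 0" and pi: "p * idm 1 = 0"
    using pr2_in2[of 1 1] pr2_pr2[of 1] pr2_idm[of 1 1] by (simp_all add: p_def)
  have gin: "g * in2 1 1 = 0" using mult_assoc_eq[OF g1, of "in2 1 1"] by (simp add: idm_in2 del: One_nat_def)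
  have zg1: "st Z * (g * idm 1) = st Z * g" by (simp only: g1)
  have zz: "st Z * (st Z * (g * p)) = g * p"
    using mult_assoc_eq[OF z(4), of "g * p"] mult_assoc_eq[OF H_idm_left[OF assms(3)], of p] by simp
  have "(g + st Z * g * p) * sw 1 = st Z * (g + st Z * g * p)"
    by (simp add: sw_def p_def[symmetric] distrib_left distrib_right mult.assoc gin pin pp zg1 zz add.commute del: One_nat_def)
  then show "g + st Z * g * pr2 1 1 \<in> EH (SM x y) Z"
    using H_add[OF gH H_mult[OF pH zg]] S assms(2) by (simp add: EH_def p_def)
  show "(g + st Z * g * pr2 1 1) * idm 1 = g"
    using g1 pi by (simp add: distrib_right mult.assoc p_def)
qed

text \<open>The basic morphism into C ! i is carried to the shift by c and extended equivariantly to
  SM x y. If Ext vanishes, this extension factors through boundary orbits; restricting to the first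
  summand and returning by c' shows the same for the basic morphism, which contradicts
  \<open>Fac_entry\<close>.\<close>

lemma Ext1_vanishes_SM_D:
  assumes xy: "\<bar>x - y\<bar> \<le> b" and B: "B \<in> EOb" and j: "injective_squares (fst B) I1 I2 C"
    and v: "Ext1_vanishes Fp Ep (SM x y) B" and i: "i < length C"
  shows "stably_zero (M x y) (C ! i)"
proof (rule ccontr)
  assume ns: "\<not> stably_zero (M x y) (C ! i)"
  let ?Z = "shift Fp Ep B"
  obtain c c' m m0 where c: "c \<in> H C (fst ?Z)" "c' \<in> H (fst ?Z) C"
    "m \<in> Fac (fst ?Z) (fst ?Z)" "m0 \<in> Fac C C"
    "c * c' + m = idm (length (fst ?Z))" "c' * c + m0 = idm (length C)"
    using compare_shift[OF B j] .
  obtain I k p where "equivariant_conflation B I ?Z k p" "boundary (fst I)" using shift_equivariant_conflation[OF B] .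
  then have Z: "?Z \<in> EOb" using EH_Ob(2)[OF equivariant_conflationD(2)] by metis
  have o: "M x y \<in> orbits b" "[M x y] \<in> Ob" using M_orbits[OF xy] by auto
  define g0 where "g0 = mk (length C) (length [M x y]) (\<lambda>k _. if k = i then u ^ dd (M x y) (C ! i) else 0)"
  have g0: "g0 \<in> H [M x y] C" unfolding g0_def by (rule H_mk) (use o H_Ob[OF c(1)] in auto)
  note a = adjoint_EH[OF xy Z H_mult[OF g0 c(1)]]
  have "c * g0 + st ?Z * (c * g0) * pr2 1 1 \<in> Fac (fst (SM x y :: 'r pobj)) (fst ?Z)"
    using v a(1) unfolding Ext1_vanishes_iff[OF SM_obj(1)[OF xy] B] by blast
  moreover have "idm 1 \<in> H [M x y] (fst (SM x y :: 'r pobj))"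
    using in1_H[of "[M x y]" "[psi_orbit (M x y)]"] o SM_obj(2)[OF xy] by simp
  ultimately have "(c * g0 + st ?Z * (c * g0) * pr2 1 1) * idm 1 \<in> Fac [M x y] (fst ?Z)" by (rule Fac_right)
  then have "c * g0 \<in> Fac [M x y] (fst ?Z)" by (simp only: a(2))
  then have "c' * (c * g0) + m0 * g0 \<in> Fac [M x y] C"
    using Fac_add Fac_left[OF _ c(2)] Fac_right[OF c(4) g0] by blast
  moreover have "c' * (c * g0) + m0 * g0 = (c' * c + m0) * g0" by (simp add: algebra_simps)
  ultimately have "g0 \<in> Fac [M x y] C" using c(6) H_idm_left[OF g0] by simp
  from Fac_entry[OF this i, of 0] ns have "u ^ Suc (dd (M x y) (C ! i)) dvd ent g0 i 0" by simp
  then have "u ^ dd (M x y) (C ! i) * u dvd u ^ dd (M x y) (C ! i) * 1" using i by (simp add: g0_def ent_mk mult.commute)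
  then have "u dvd 1" using u_nz by (simp only: dvd_mult_cancel_left power_not_zero simp_thms)
  then show False using u_nonunit by simp
qed

text \<open>Here signs decide, so the comparison itself must be equivariant. The copresentation of
  the singular object at y runs through SM y (y + b), whose orbits are on the boundary, to the
  singular object at y + b. The relative sign of the two components is s in \<open>k0\<close> and -
  s in \<open>p0\<close>, so the shift reverses the sign.\<close>

lemma Ext1_Z_iff:
  assumes A: "A \<in> EOb" and b: "b < pi"
  shows "Ext1_vanishes Fp Ep A (Z_obj e y) \<longleftrightarrow>
    (\<forall>f\<in>EH A (Z_obj (\<not> e) (y + b)). f \<in> Fac (fst A) [M (y + b) (y + b)])"
proof -
  let ?B = "Z_obj e y :: 'r pobj" and ?C = "Z_obj (\<not> e) (y + b) :: 'r pobj" and ?J = "SM y (y + b) :: 'r pobj"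
  let ?I = "M y (y + b)" and ?X = "M y y" and ?Y = "M (y + b) (y + b)"
  have yb: "\<bar>y - (y + b)\<bar> \<le> b" using b_pos by simp
  note B = Z_obj[of e y] and C = Z_obj[of "\<not> e" "y + b"] and J = SM_obj[OF yb]
  have oI: "?I \<in> orbits b" "?X \<in> orbits b" "?Y \<in> orbits b" using M_orbits b_pos by auto
  have "boundary_orbit ?I" using boundary_orbit_M_iff[OF yb] b_pos by simp
  then have "boundary_orbit (psi_orbit ?I)" by (rule boundary_orbit_psi)
  \<comment> \<open>The second middle corner (y + b, y) has the position of psi of the first, so the
    middle term can be taken to be SM y (y + b).\<close>
  moreover have "pt (psi_orbit ?I) = pt (M (y + b) y)"
    unfolding psi_M pt_M_eq_iff by (intro exI[of _ "- 1"]) (simp add: spw_def)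
  ultimately have "injective_square ?X ?I (psi_orbit ?I) ?Y" using injective_square_pt[OF injective_square_M[of y y]] b b_pos by simp
  then have j: "injective_squares (fst ?B) [?I] [psi_orbit ?I] [?Y]" by (simp add: injective_squares_def B)
  let ?s = "sg e"
  have s: "?s * ?s = 1" by (rule sg_sq)
  have dd1: "dd ?X (psi_orbit ?I) = dd ?X ?I"
    using dd_psi[OF psi_orbits[OF oI(2)] oI(1)] psi_psi[OF oI(2)] pt_psi_M by (simp add: dd_def)
  have dd2: "dd (psi_orbit ?I) ?Y = dd ?I ?Y"
    using dd_psi[OF oI(1) psi_orbits[OF oI(3)]] psi_psi[OF oI(3)] pt_psi_M by (simp add: dd_def)
  let ?k = "k0 (fst ?B) [?I] [psi_orbit ?I] ?s" and ?p = "p0 [?I] [psi_orbit ?I] [?Y] ?s"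
  have kH: "?k \<in> H (fst ?B) (fst ?J)" using k0_H[OF j s] by (simp add: J)
  have pH: "?p \<in> H (fst ?J) (fst ?C)" using p0_H[OF j s] by (simp add: J C)
  have sw_mult: "ent (sw 1 * a) i k = (if i = 0 then ent a 1 k else if i = 1 then ent a 0 k else 0)" for a i k
  proof -
    have "ent (sw 1 * a) i k = (\<Sum>l<2. ent (sw 1) i l * ent a l k)" by (rule ent_mult) (auto simp: sw1_entries[unfolded One_nat_def])
    then show ?thesis by (auto simp: sw1_entries[unfolded One_nat_def] numeral_2_eq_2)
  qed
  have mult_sw: "ent (a * sw 1) i k = (if k = 0 then ent a i 1 else if k = 1 then ent a i 0 else 0)" for a i k
  proof -
    have "ent (a * sw 1) i k = (\<Sum>l<2. ent a i l * ent (sw 1) l k)" by (rule ent_mult) (auto simp: sw1_entries[unfolded One_nat_def])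
    then show ?thesis by (auto simp: sw1_entries[unfolded One_nat_def] numeral_2_eq_2)
  qed
  have "sm ?s ?k = sw 1 * ?k"
  proof (rule fm_eqI)
    fix i k
    show "ent (sm ?s ?k) i k = ent (sw 1 * ?k) i k"
      unfolding ent_sm sw_mult using s by (auto simp: k0_def ent_mk B dd1 less_Suc_eq simp flip: mult.assoc)
  qed
  then have kE: "?k \<in> EH ?B ?J" using kH B J H_idm_right[OF kH] by (simp add: EH_def sm_mult_right)
  have "?p * sw 1 = sm (sg (\<not> e)) ?p"
  proof (rule fm_eqI)
    fix i k
    show "ent (?p * sw 1) i k = ent (sm (sg (\<not> e)) ?p) i k"
      unfolding ent_sm mult_sw by (auto simp: p0_def ent_mk dd2 less_Suc_eq sg_def)
  qed
  then have pE: "?p \<in> EH ?J ?C" using pH C J H_idm_left[OF pH] by (simp add: EH_def sm_mult_left)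
  let ?Z = "shift Fp Ep ?B"
  obtain I i p where c: "equivariant_conflation ?B I ?Z i p" "boundary (fst I)" using shift_equivariant_conflation[OF B(1)] .
  note conflation = equivariant_conflationD(3)[OF c(1)] and iE = equivariant_conflationD(1)[OF c(1)] and pE' = equivariant_conflationD(2)[OF c(1)]
  have IE: "I \<in> EOb" and Z: "?Z \<in> EOb" using EH_Ob[OF pE'] by auto
  obtain h0 where h0: "h0 \<in> H (fst ?J) (fst I)" "h0 * ?k = i"
    using k0_ext[OF j s conflation_H(1)[OF conflation] c(2)] by (auto simp: J)
  obtain h0' where h0': "h0' \<in> H (fst I) (fst ?J)" "h0' * i = ?k"
    using boundary_ext[OF injective_squares_boundary[OF j s] conflation k0_H[OF j s]] by (auto simp: J)
  \<comment> \<open>Averaging makes the extensions equivariant and keeps the equations with ?k and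
    i, since these maps are already equivariant.\<close>
  define h where "h = average ?J I h0"
  define h' where "h' = average I ?J h0'"
  have hE: "h \<in> EH ?J I" unfolding h_def by (rule average_EH[OF J(1) IE h0(1)])
  have h'E: "h' \<in> EH I ?J" unfolding h'_def by (rule average_EH[OF IE J(1) h0'(1)])
  have hk: "h * ?k = i" using average_right[OF kE, of I h0] h0(2) average_id[OF iE] by (simp add: h_def)
  have h'i: "h' * i = ?k" using average_right[OF iE, of ?J h0'] h0'(2) average_id[OF kE] by (simp add: h'_def)
  have hH: "h \<in> H ([?I] @ [psi_orbit ?I]) (fst I)" "h' \<in> H (fst I) ([?I] @ [psi_orbit ?I])"
    using EH_H[OF hE] EH_H[OF h'E] J(2) by simp_all
  obtain d d' m m0 where d: "d \<in> H [?Y] (fst ?Z)" "d' \<in> H (fst ?Z) [?Y]" "d * ?p = p * h" "d' * p = ?p * h'"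
    "m \<in> Fac (fst ?Z) (fst ?Z)" "m0 \<in> Fac [?Y] [?Y]" "d * d' + m = idm (length (fst ?Z))" "d' * d + m0 = idm (length [?Y])"
    using compare[OF j s conflation c(2) hH(1) hk hH(2) h'i] .
  have cO: "st ?C \<in> H [?Y] (psi_obj [?Y])" "st ?C \<in> H (psi_obj [?Y]) [?Y]" using EOb_H[OF C(1)] C(2) by simp_all
  have dpsi: "d \<in> H (psi_obj [?Y]) (psi_obj (fst ?Z))" "d' \<in> H (psi_obj (fst ?Z)) (psi_obj [?Y])"
    using d(1,2) H_psi H_Ob[OF d(1)] by simp_all
  \<comment> \<open>Equivariance of d is checked after composition with ?p, which can be cancelled
    by \<open>p0_epi\<close>.\<close>
  have dE: "d \<in> EH ?C ?Z"
  proof -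
    have "d * st ?C * ?p = st ?Z * d * ?p"
    proof -
      have "d * st ?C * ?p = d * ?p * st ?J" using EH_eq[OF pE] by (simp add: mult.assoc)
      also have "\<dots> = p * (h * st ?J)" using d(3) by (simp add: mult.assoc)
      also have "\<dots> = p * st I * h" using EH_eq[OF hE] by (simp add: mult.assoc)
      also have "\<dots> = st ?Z * (p * h)" using EH_eq[OF pE'] by (simp add: mult.assoc)
      finally show ?thesis using d(3) by (simp add: mult.assoc)
    qed
    moreover have "d * st ?C \<in> H [?Y] (psi_obj (fst ?Z))" using cO dpsi by blast
    moreover have "st ?Z * d \<in> H [?Y] (psi_obj (fst ?Z))" using d(1) EOb_H(3)[OF Z] by blast
    ultimately have "d * st ?C = st ?Z * d" using p0_epi[OF j s] by blast
    then show ?thesis using d(1) C Z by (simp add: EH_def)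
  qed
  have d'E: "d' \<in> EH ?Z ?C"
  proof -
    have "d' * st ?Z * p = st ?C * d' * p"
    proof -
      have "d' * st ?Z * p = d' * p * st I" using EH_eq[OF pE'] by (simp add: mult.assoc)
      also have "\<dots> = ?p * (h' * st I)" using d(4) by (simp add: mult.assoc)
      also have "\<dots> = ?p * st ?J * h'" using EH_eq[OF h'E] by (simp add: mult.assoc)
      also have "\<dots> = st ?C * (?p * h')" using EH_eq[OF pE] by (simp add: mult.assoc)
      finally show ?thesis using d(4) by (simp add: mult.assoc)
    qed
    moreover have "d' * st ?Z \<in> H (fst ?Z) (psi_obj [?Y])" using EOb_H(3)[OF Z] dpsi by blast
    moreover have "st ?C * d' \<in> H (fst ?Z) (psi_obj [?Y])" using d(2) cO by blast
    ultimately have "d' * st ?Z = st ?C * d'" using conflation_epi[OF conflation] by blast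
    then show ?thesis using d(2) C Z by (simp add: EH_def)
  qed
  show ?thesis
    unfolding Ext1_vanishes_iff[OF A B(1)]
  proof
    assume v: "\<forall>f\<in>EH A ?Z. f \<in> Fac (fst A) (fst ?Z)"
    show "\<forall>f\<in>EH A ?C. f \<in> Fac (fst A) [?Y]"
    proof
      fix f assume f: "f \<in> EH A ?C"
      then have fH: "f \<in> H (fst A) [?Y]" using EH_H C(2) by fastforce
      have "d * f \<in> Fac (fst A) (fst ?Z)" using v EH_mult[OF f dE] by blast
      then have "d' * (d * f) + m0 * f \<in> Fac (fst A) [?Y]" using Fac_add Fac_left[OF _ d(2)] Fac_right[OF d(6) fH] by blast
      moreover have "d' * (d * f) + m0 * f = (d' * d + m0) * f" by (simp add: algebra_simps)
      ultimately show "f \<in> Fac (fst A) [?Y]" using d(8) H_idm_left[OF fH] by simp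
    qed
  next
    assume v: "\<forall>f\<in>EH A ?C. f \<in> Fac (fst A) [?Y]"
    show "\<forall>f\<in>EH A ?Z. f \<in> Fac (fst A) (fst ?Z)"
    proof
      fix f assume f: "f \<in> EH A ?Z"
      note fH = EH_H[OF f]
      have "d' * f \<in> Fac (fst A) [?Y]" using v EH_mult[OF f d'E] by blast
      then have "d * (d' * f) + m * f \<in> Fac (fst A) (fst ?Z)" using Fac_add Fac_left[OF _ d(1)] Fac_right[OF d(5) fH] by blast
      moreover have "d * (d' * f) + m * f = (d * d' + m) * f" by (simp add: algebra_simps)
      ultimately show "f \<in> Fac (fst A) (fst ?Z)" using d(7) H_idm_left[OF fH] by simp
    qed
  qed
qed

text \<open>Since the shift reverses the sign, equal signs leave only maps with f = - f, hence zero.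
  For different signs every map is equivariant, and vanishing is a question about one basic
  morphism.\<close>

lemma Ext1_Z_Z:
  assumes "b < pi"
  shows "Ext1_vanishes Fp Ep (Z_obj e x) (Z_obj e' y) \<longleftrightarrow> e = e' \<or> stably_zero (M x x) (M (y + b) (y + b))"
proof -
  let ?A = "Z_obj e x :: 'r pobj" and ?C = "Z_obj (\<not> e') (y + b) :: 'r pobj"
  let ?X = "M x x" and ?Y = "M (y + b) (y + b)"
  note A = Z_obj[of e x] and C = Z_obj[of "\<not> e'" "y + b"]
  have o: "[?X] \<in> Ob" "[?Y] \<in> Ob" using M_orbits b_pos by auto
  show ?thesis
  proof (cases "e = e'")
    case True
    have "f = 0" if f: "f \<in> EH ?A ?C" for f
    proof -
      have "sm (sg e) f = sm (sg (\<not> e)) f"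
        using EH_eq[OF f] EH_idm_left[OF f] EH_idm_right[OF f] unfolding A C
        using True by (simp add: sm_mult_left sm_mult_right)
      then have "f + f = 0"
        by (cases e) (auto simp: sg_def sm_1 sm_minus1 eq_neg_iff_add_eq_0 neg_eq_iff_add_eq_0)
      then have "ent f i j + ent f i j = 0" for i j by (metis ent_add ent_zero)
      then have "ent f i j = 0" for i j by (rule two_nz)
      then show "f = 0" by (intro fm_eqI) (simp add: ent_simps)
    qed
    then show ?thesis using True Ext1_Z_iff[OF A(1) assms] Fac_zero[OF o] A(2) by force
  next
    case False
    then have e: "(\<not> e') = e" by auto
    have E: "EH ?A ?C = H [?X] [?Y]"
    proof -
      have "f * sm (sg e) (idm 1) = sm (sg e) (idm 1) * f" if "f \<in> H [?X] [?Y]" for f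
        using H_idm_left[OF that] H_idm_right[OF that] by (simp add: sm_mult_left sm_mult_right)
      then show ?thesis unfolding e by (auto simp: EH_def A C[unfolded e])
    qed
    have "stably_zero ?X ?Y \<longleftrightarrow> (\<forall>f\<in>H [?X] [?Y]. f \<in> Fac [?X] [?Y])"
    proof
      assume "stably_zero ?X ?Y" then show "\<forall>f\<in>H [?X] [?Y]. f \<in> Fac [?X] [?Y]" using Fac_full by force
    next
      assume v: "\<forall>f\<in>H [?X] [?Y]. f \<in> Fac [?X] [?Y]"
      let ?f = "mk (length [?Y]) (length [?X]) (\<lambda>_ _. u ^ dd ?X ?Y)"
      have "?f \<in> H [?X] [?Y]" by (rule H_mk[OF o]) auto
      then have f: "?f \<in> Fac [?X] [?Y]" using v by blast
      show "stably_zero ?X ?Y"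
      proof (rule ccontr)
        assume "\<not> stably_zero ?X ?Y"
        with Fac_entry[OF f, of 0 0] have "u ^ Suc (dd ?X ?Y) dvd u ^ dd ?X ?Y" by (simp add: ent_mk)
        then have "u ^ dd ?X ?Y * u dvd u ^ dd ?X ?Y * 1" by (simp add: mult.commute)
        then have "u dvd 1" using u_nz by (simp only: dvd_mult_cancel_left power_not_zero simp_thms)
        then show False using u_nonunit by simp
      qed
    qed
    then show ?thesis using False Ext1_Z_iff[OF A(1) assms] E A(2) by simp
  qed
qed

end

section \<open>The limit of compatibility\<close>

text \<open>\<open>nst b x y s t\<close> holds if the basic morphism from \<open>M x y\<close> to \<open>M s t\<close> is not stably zero, and
  \<open>G b x y x' y'\<close> if \<open>Ext1\<close> of \<open>SM x y\<close> by \<open>SM x' y'\<close> does not vanish, where \<open>x' = y'\<close> stands for the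
  singular objects. \<open>Gp\<close> is the limit of \<open>G\<close> as \<open>b \<rightarrow> pi\<close>; only in the limit the condition becomes
  symmetric.\<close>

definition nst :: "real \<Rightarrow> real \<Rightarrow> real \<Rightarrow> real \<Rightarrow> real \<Rightarrow> bool" where
  "nst b x y s t \<longleftrightarrow> (\<exists>i. ple (x, y) (spw i (s, t)) \<and> fst (spw i (s, t)) < y + b \<and> snd (spw i (s, t)) < x + b)"

definition G :: "real \<Rightarrow> real \<Rightarrow> real \<Rightarrow> real \<Rightarrow> real \<Rightarrow> bool" where
  "G b x y x' y' \<longleftrightarrow> (\<exists>i::int.
     x - b \<le> y' + of_int i * pi \<and> y' + of_int i * pi < y \<and> y - b \<le> x' + of_int i * pi \<and> x' + of_int i * pi < x \<or>
     x - b \<le> x' + of_int i * pi \<and> x' + of_int i * pi < y \<and> y - b \<le> y' + of_int i * pi \<and> y' + of_int i * pi < x)"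

definition Gp :: "real \<Rightarrow> real \<Rightarrow> real \<Rightarrow> real \<Rightarrow> bool" where
  "Gp x y x' y' \<longleftrightarrow> (\<exists>i::int.
     x - pi < y' + of_int i * pi \<and> y' + of_int i * pi < y \<and> y - pi < x' + of_int i * pi \<and> x' + of_int i * pi < x \<or>
     x - pi < x' + of_int i * pi \<and> x' + of_int i * pi < y \<and> y - pi < y' + of_int i * pi \<and> y' + of_int i * pi < x)"

lemma nst_G: "nst b x y (y' + b) (x' + b) \<Longrightarrow> G b x y x' y'"
  unfolding nst_def G_def
proof (elim exE)
  fix i assume *: "ple (x, y) (spw i (y' + b, x' + b)) \<and> fst (spw i (y' + b, x' + b)) < y + b \<and> snd (spw i (y' + b, x' + b)) < x + b"
  show "\<exists>i::int.
     x - b \<le> y' + of_int i * pi \<and> y' + of_int i * pi < y \<and> y - b \<le> x' + of_int i * pi \<and> x' + of_int i * pi < x \<or>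
     x - b \<le> x' + of_int i * pi \<and> x' + of_int i * pi < y \<and> y - b \<le> y' + of_int i * pi \<and> y' + of_int i * pi < x"
    by (rule exI[of _ i]) (use * in \<open>cases "even i"; simp add: spw_def ple_def; linarith\<close>)
qed

lemma G_shift_right: "G b x y (x' + pi) (y' + pi) \<longleftrightarrow> G b x y x' y'"
proof -
  have 1: "G b x y x' y'" if "G b x y (x' + of_int j * pi) (y' + of_int j * pi)" for x' y' and j :: int
  proof -
    have e: "z + of_int j * pi + of_int i * pi = z + of_int (i + j) * pi" for z and i :: int
      by (simp add: algebra_simps)
    from that show ?thesis unfolding G_def e by blast
  qed
  from 1[of "x' + pi" "-1" "y' + pi"] 1[of x' 1 y'] show ?thesis by auto
qed

lemma G_shift_left: "G b (x + pi) (y + pi) x' y' \<longleftrightarrow> G b x y x' y'"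
proof -
  have 1: "G b x y x' y'" if "G b (x + of_int j * pi) (y + of_int j * pi) x' y'" for x y and j :: int
  proof -
    from that obtain i :: int where
      "x + of_int j * pi - b \<le> y' + of_int i * pi \<and> y' + of_int i * pi < y + of_int j * pi \<and>
       y + of_int j * pi - b \<le> x' + of_int i * pi \<and> x' + of_int i * pi < x + of_int j * pi \<or>
       x + of_int j * pi - b \<le> x' + of_int i * pi \<and> x' + of_int i * pi < y + of_int j * pi \<and>
       y + of_int j * pi - b \<le> y' + of_int i * pi \<and> y' + of_int i * pi < x + of_int j * pi"
      unfolding G_def by blast
    then show ?thesis unfolding G_def
      by (intro exI[of _ "i - j"]) (auto simp: algebra_simps)
  qed
  from 1[of "x + pi" "-1" "y + pi"] 1[of x 1 y] show ?thesis by auto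
qed

text \<open>In \<open>G\<close> both pairings of the coordinates are allowed for every i, while in
  \<open>nst\<close> the parity of i determines the pairing. The missing parity is supplied by the
  second summand of SM, which is translated by pi; this uses up one step, whence i - 1.\<close>

lemma G_nst:
  assumes "G b x y x' y'"
  shows "nst b x y (y' + b) (x' + b) \<or> nst b x y (y' + pi + b) (x' + pi + b)"
proof -
  have e: "z + pi + b + (of_int i - 1) * pi = z + b + of_int i * pi" for z and i :: int
    by (simp add: algebra_simps)
  from assms obtain i :: int where i:
     "x - b \<le> y' + of_int i * pi \<and> y' + of_int i * pi < y \<and> y - b \<le> x' + of_int i * pi \<and> x' + of_int i * pi < x \<or>
     x - b \<le> x' + of_int i * pi \<and> x' + of_int i * pi < y \<and> y - b \<le> y' + of_int i * pi \<and> y' + of_int i * pi < x"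
    unfolding G_def by blast
  show ?thesis
  proof (cases "(x - b \<le> y' + of_int i * pi \<and> y' + of_int i * pi < y \<and> y - b \<le> x' + of_int i * pi \<and> x' + of_int i * pi < x) = even i")
    case True
    then have "nst b x y (y' + b) (x' + b)"
      unfolding nst_def by (intro exI[of _ i]) (use i in \<open>cases "even i"; simp add: spw_def ple_def; linarith\<close>)
    then show ?thesis ..
  next
    case False
    then have "nst b x y (y' + pi + b) (x' + pi + b)"
      unfolding nst_def by (intro exI[of _ "i - 1"]) (use i in \<open>cases "even i"; simp add: spw_def ple_def e; linarith\<close>)
    then show ?thesis ..
  qed
qed

lemma G_nst_diag: "G b x y z z \<longleftrightarrow> nst b x y (z + b) (z + b)"
proof
  assume "G b x y z z"
  then obtain i :: int where i: "x - b \<le> z + of_int i * pi \<and> z + of_int i * pi < y \<and> y - b \<le> z + of_int i * pi \<and> z + of_int i * pi < x"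
    unfolding G_def by blast
  show "nst b x y (z + b) (z + b)"
    unfolding nst_def by (intro exI[of _ i]) (use i in \<open>cases "even i"; simp add: spw_def ple_def; linarith\<close>)
qed (rule nst_G)

lemma G_Gp: "b < pi \<Longrightarrow> G b x y x' y' \<Longrightarrow> Gp x y x' y'"
proof -
  assume b: "b < pi" and "G b x y x' y'"
  then obtain i :: int where i:
     "x - b \<le> y' + of_int i * pi \<and> y' + of_int i * pi < y \<and> y - b \<le> x' + of_int i * pi \<and> x' + of_int i * pi < x \<or>
     x - b \<le> x' + of_int i * pi \<and> x' + of_int i * pi < y \<and> y - b \<le> y' + of_int i * pi \<and> y' + of_int i * pi < x"
    unfolding G_def by blast
  show "Gp x y x' y'" unfolding Gp_def by (rule exI[of _ i]) (use i b in auto)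
qed

text \<open>The inequalities against pi are strict, so they persist for all b above the maximum of
  the two differences.\<close>

lemma Gp_G: assumes "Gp x y x' y'" shows "\<forall>\<^sub>F b in at_left pi. G b x y x' y'"
proof -
  obtain i :: int where i:
     "x - pi < y' + of_int i * pi \<and> y' + of_int i * pi < y \<and> y - pi < x' + of_int i * pi \<and> x' + of_int i * pi < x \<or>
     x - pi < x' + of_int i * pi \<and> x' + of_int i * pi < y \<and> y - pi < y' + of_int i * pi \<and> y' + of_int i * pi < x"
    using assms unfolding Gp_def by blast
  then show ?thesis
  proof
    assume i: "x - pi < y' + of_int i * pi \<and> y' + of_int i * pi < y \<and> y - pi < x' + of_int i * pi \<and> x' + of_int i * pi < x"
    let ?m = "max (x - (y' + of_int i * pi)) (y - (x' + of_int i * pi))"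
    have "?m < pi" using i by auto
    then have "\<forall>\<^sub>F b in at_left pi. b \<in> {?m<..<pi}" by (rule eventually_at_leftI[rotated]) simp
    then show ?thesis by (rule eventually_mono) (use i in \<open>auto simp: G_def intro!: exI[of _ i]\<close>)
  next
    assume i: "x - pi < x' + of_int i * pi \<and> x' + of_int i * pi < y \<and> y - pi < y' + of_int i * pi \<and> y' + of_int i * pi < x"
    let ?m = "max (x - (x' + of_int i * pi)) (y - (y' + of_int i * pi))"
    have "?m < pi" using i by auto
    then have "\<forall>\<^sub>F b in at_left pi. b \<in> {?m<..<pi}" by (rule eventually_at_leftI[rotated]) simp
    then show ?thesis by (rule eventually_mono) (use i in \<open>auto simp: G_def intro!: exI[of _ i]\<close>)
  qed
qed

text \<open>Exchanging the pairs replaces i by - i - 1. Lower and upper bounds trade places, which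
  works because both are strict and the shift involved is exactly pi.\<close>

lemma Gp_sym: assumes "Gp x y x' y'" shows "Gp x' y' x y"
proof -
  obtain i :: int where i:
     "x - pi < y' + of_int i * pi \<and> y' + of_int i * pi < y \<and> y - pi < x' + of_int i * pi \<and> x' + of_int i * pi < x \<or>
     x - pi < x' + of_int i * pi \<and> x' + of_int i * pi < y \<and> y - pi < y' + of_int i * pi \<and> y' + of_int i * pi < x"
    using assms unfolding Gp_def by blast
  have e: "of_int (- i - 1) * pi = - (of_int i * pi) - pi" by (simp add: algebra_simps)
  show ?thesis unfolding Gp_def by (rule exI[of _ "- i - 1"], unfold e) (use i in linarith)
qed

context exact_orbits
begin

text \<open>The lowest boundary points above (x, y) are (x, x + b) and (y + b, y). A boundary point
  fits between (x, y) and a lift of (s, t) above it iff that lift is above one of these two, that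
  is, not strictly inside the rectangle. Lifts are linearly ordered, so the lowest one, of degree D,
  decides.\<close>

lemma stably_zero_M:
  assumes "\<bar>x - y\<bar> \<le> b" "\<bar>s - t\<bar> \<le> b"
  shows "stably_zero (M x y) (M s t) \<longleftrightarrow> \<not> nst b x y s t"
proof -
  define p q where "p = (x, y)" and "q = (s, t)"
  have le: "\<bar>x - y\<bar> \<le> pi" "\<bar>s - t\<bar> \<le> pi" using assms b_le by auto
  have w: "wid p" "wid q" using le by (auto simp: p_def q_def wid_def)
  show ?thesis
  proof
    assume "stably_zero (M x y) (M s t)"
    then obtain o1 where o1: "boundary_orbit o1" "dd (M x y) o1 + dd o1 (M s t) = dd (M x y) (M s t)" by (auto simp: stably_zero_def)
    then obtain v v' where v: "\<bar>v - v'\<bar> = b" "o1 = M v v'" by (auto simp: boundary_orbit_M)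
    have vle: "\<bar>v - v'\<bar> \<le> pi" using v b_le by simp
    define r where "r = (v, v')"
    have wr: "wid r" using vle by (simp add: r_def wid_def)
    have De: "D p r + D r q = D p q"
      using o1(2) unfolding v(2) dd_M[OF le(1) vle le(2)] by (simp add: p_def q_def r_def)
    define r' where "r' = spw (D p r) r"
    have 1: "ple p r'" using D_ple[OF wr] by (simp add: r'_def)
    have 2: "ple r' (spw (D p q) q)" using D_ple[OF w(2), of r] by (simp add: r'_def De[symmetric] flip: spw_add)
    have wd: "\<bar>fst r' - snd r'\<bar> = b" unfolding r'_def spw_width using v by (simp add: r_def)
    show "\<not> nst b x y s t"
    proof
      assume "nst b x y s t"
      then obtain i where i: "ple p (spw i q)" "fst (spw i q) < y + b" "snd (spw i q) < x + b"
        by (auto simp: nst_def p_def q_def)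
      have "D p q \<le> i" using i D_le_iff[OF w(2)] by simp
      then have "ple r' (spw i q)" using 2 ple_trans ple_spw_mono[OF w(2)] by blast
      then show False using 1 wd i by (auto simp: ple_def p_def)
    qed
  next
    assume n: "\<not> nst b x y s t"
    let ?k = "D p q"
    have pk: "ple p (spw ?k q)" by (rule D_ple[OF w(2)])
    then consider "y + b \<le> fst (spw ?k q)" | "x + b \<le> snd (spw ?k q)" using n by (force simp: nst_def p_def q_def)
    then obtain r where r: "r = (y + b, y) \<or> r = (x, x + b)" and pr: "ple p r" and rk: "ple r (spw ?k q)"
    proof cases
      case 1
      then show ?thesis using that[of "(y + b, y)"] pk assms by (auto simp: ple_def p_def)
    next
      case 2
      then show ?thesis using that[of "(x, x + b)"] pk assms by (auto simp: ple_def p_def)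
    qed
    have vb: "\<bar>fst r - snd r\<bar> = b" using r b_pos by auto
    then have vle: "\<bar>fst r - snd r\<bar> \<le> pi" using b_le by simp
    have wr: "wid r" using vle by (simp add: wid_def)
    have "D p r \<le> 0" "D r q \<le> ?k" using D_le_iff[OF wr, of p 0] D_le_iff[OF w(2), of r ?k] pr rk by auto
    moreover have "?k \<le> D p r + D r q" by (rule D_triangle[OF wr w(2)])
    ultimately have "D p r + D r q = ?k" by simp
    then have "dd (M x y) (M (fst r) (snd r)) + dd (M (fst r) (snd r)) (M s t) = dd (M x y) (M s t)"
      unfolding dd_M[OF le(1) vle le(2)] by (simp add: p_def q_def)
    moreover have "boundary_orbit (M (fst r) (snd r))" using vb by (auto simp: boundary_orbit_M)
    ultimately show "stably_zero (M x y) (M s t)" by (auto simp: stably_zero_def)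
  qed
qed

section \<open>Ext between the named objects in terms of \<open>G\<close>\<close>

lemma SM_obj': assumes "\<bar>x - y\<bar> \<le> b" shows "fst (SM x y :: 'r pobj) = [M x y, M (x + pi) (y + pi)]"
  using SM_obj(2)[OF assms] psi_M by simp

lemma injective_squares_SM:
  assumes "\<bar>x - y\<bar> \<le> b" "b < pi"
  shows "injective_squares (fst (SM x y :: 'r pobj)) [M x (x + b), M (x + pi) (x + pi + b)] [M (y + b) y, M (y + pi + b) (y + pi)]
    [M (y + b) (x + b), M (y + pi + b) (x + pi + b)]"
  using injective_square_M[OF assms] injective_square_M[of "x + pi" "y + pi"] assms by (auto simp: injective_squares_def SM_obj'[OF assms(1)] less_Suc_eq)

lemma Ext1_SM_SM:
  assumes b: "b < pi" and xy: "\<bar>x - y\<bar> \<le> b" "\<bar>x' - y'\<bar> \<le> b"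
  shows "Ext1_vanishes Fp Ep (SM x y) (SM x' y') \<longleftrightarrow> \<not> G b x y x' y'"
proof
  have le: "\<bar>y' + b - (x' + b)\<bar> \<le> b" "\<bar>y' + pi + b - (x' + pi + b)\<bar> \<le> b" "\<bar>(x + pi) - (y + pi)\<bar> \<le> b" using xy by auto
  assume v: "Ext1_vanishes Fp Ep (SM x y) (SM x' y')"
  note 1 = Ext1_vanishes_SM_D[OF xy(1) SM_obj(1)[OF xy(2)] injective_squares_SM[OF xy(2) b] v]
  have "stably_zero (M x y) (M (y' + b) (x' + b))" "stably_zero (M x y) (M (y' + pi + b) (x' + pi + b))"
    using 1[of 0] 1[of 1] by auto
  then show "\<not> G b x y x' y'" using G_nst[of b x y x' y'] stably_zero_M[OF xy(1) le(1)] stably_zero_M[OF xy(1) le(2)] by blast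
next
  have le: "\<bar>y' + b - (x' + b)\<bar> \<le> b" "\<bar>y' + pi + b - (x' + pi + b)\<bar> \<le> b" "\<bar>(x + pi) - (y + pi)\<bar> \<le> b" using xy by auto
  assume n: "\<not> G b x y x' y'"
  have n2: "\<not> G b x y (x' + pi) (y' + pi)" "\<not> G b (x + pi) (y + pi) x' y'" "\<not> G b (x + pi) (y + pi) (x' + pi) (y' + pi)"
    using n G_shift_left G_shift_right by auto
  have "stably_zero (M x y) (M (y' + b) (x' + b))" "stably_zero (M x y) (M (y' + pi + b) (x' + pi + b))"
     "stably_zero (M (x + pi) (y + pi)) (M (y' + b) (x' + b))" "stably_zero (M (x + pi) (y + pi)) (M (y' + pi + b) (x' + pi + b))"
    unfolding stably_zero_M[OF xy(1) le(1)] stably_zero_M[OF xy(1) le(2)] stably_zero_M[OF le(3) le(1)] stably_zero_M[OF le(3) le(2)]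
    using n n2 nst_G by blast+
  then show "Ext1_vanishes Fp Ep (SM x y) (SM x' y')"
    by (intro Ext1_vanishesI[OF SM_obj(1)[OF xy(1)] SM_obj(1)[OF xy(2)] injective_squares_SM[OF xy(2) b]])
      (auto simp: SM_obj'[OF xy(1)] less_Suc_eq)
qed

lemma injective_squares_Z:
  assumes "b < pi"
  shows "injective_squares (fst (Z_obj e z :: 'r pobj)) [M z (z + b)] [M (z + b) z] [M (z + b) (z + b)]"
  using injective_square_M[of z z] assms b_pos by (auto simp: injective_squares_def Z_obj)

lemma Ext1_SM_Z:
  assumes b: "b < pi" and xy: "\<bar>x - y\<bar> \<le> b"
  shows "Ext1_vanishes Fp Ep (SM x y) (Z_obj e z) \<longleftrightarrow> \<not> G b x y z z"
proof
  have le: "\<bar>z + b - (z + b)\<bar> \<le> b" "\<bar>(x + pi) - (y + pi)\<bar> \<le> b" using xy b_pos by auto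
  assume v: "Ext1_vanishes Fp Ep (SM x y) (Z_obj e z)"
  show "\<not> G b x y z z"
    using Ext1_vanishes_SM_D[OF xy Z_obj(1) injective_squares_Z[OF b] v, of 0] stably_zero_M[OF xy le(1)] G_nst_diag by simp
next
  have le: "\<bar>z + b - (z + b)\<bar> \<le> b" "\<bar>(x + pi) - (y + pi)\<bar> \<le> b" using xy b_pos by auto
  assume n: "\<not> G b x y z z"
  have "stably_zero (M x y) (M (z + b) (z + b))" "stably_zero (M (x + pi) (y + pi)) (M (z + b) (z + b))"
    unfolding stably_zero_M[OF xy le(1)] stably_zero_M[OF le(2) le(1)] using n G_shift_left nst_G by blast+
  then show "Ext1_vanishes Fp Ep (SM x y) (Z_obj e z)"
    by (intro Ext1_vanishesI[OF SM_obj(1)[OF xy] Z_obj(1) injective_squares_Z[OF b]])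
      (auto simp: SM_obj'[OF xy] less_Suc_eq)
qed

text \<open>One implication is enough here: the other constraint on compatibility comes from Ext in
  the opposite direction, and both conditions have the same limit \<open>Gp\<close>.\<close>

lemma Ext1_Z_SM:
  assumes b: "b < pi" and xy: "\<bar>x - y\<bar> \<le> b" and n: "\<not> G b z z x y"
  shows "Ext1_vanishes Fp Ep (Z_obj e z) (SM x y)"
proof -
  have le: "\<bar>y + b - (x + b)\<bar> \<le> b" "\<bar>y + pi + b - (x + pi + b)\<bar> \<le> b" "\<bar>z - z\<bar> \<le> b" using xy b_pos by auto
  have "stably_zero (M z z) (M (y + b) (x + b))" "stably_zero (M z z) (M (y + pi + b) (x + pi + b))"
    unfolding stably_zero_M[OF le(3) le(1)] stably_zero_M[OF le(3) le(2)] using n G_shift_right[of b z z x y] nst_G by blast+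
  then show ?thesis
    by (intro Ext1_vanishesI[OF Z_obj(1) SM_obj(1)[OF xy] injective_squares_SM[OF xy b]])
      (auto simp: Z_obj less_Suc_eq)
qed

lemma Ext1_Z_Z_G:
  assumes b: "b < pi"
  shows "Ext1_vanishes Fp Ep (Z_obj e x) (Z_obj e' y) \<longleftrightarrow> e = e' \<or> \<not> G b x x y y"
  unfolding Ext1_Z_Z[OF b] G_nst_diag using stably_zero_M[of x x "y + b" "y + b"] b_pos by simp

end

section \<open>Compatibility for b close to pi\<close>

locale frob_family =
  fixes u :: "'r::idom" and E :: "'r exacts"
  assumes dvr: "dvr_uniformizer u" and odd_char: "\<not> u dvd 2"
    and exact: "\<And>b. 0 < b \<Longrightarrow> b \<le> pi \<Longrightarrow> F_exact u b (E b)"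
begin

lemma eo: "0 < b \<Longrightarrow> b \<le> pi \<Longrightarrow> exact_orbits u b (E b)"
  using dvr odd_char exact by unfold_locales (auto simp: dvr_uniformizer_def)

lemma compatible_at_SM_SM:
  assumes b: "0 < b" "b < pi" and xy: "\<bar>x - y\<bar> \<le> b" "\<bar>x' - y'\<bar> \<le> b"
  shows "compatible_at u E b (SM x y) (SM x' y') \<longleftrightarrow> \<not> G b x y x' y' \<and> \<not> G b x' y' x y"
proof -
  interpret exact_orbits u b "E b" using eo b by simp
  show ?thesis unfolding compatible_at_def using Ext1_SM_SM[OF b(2) xy] Ext1_SM_SM[OF b(2) xy(2,1)] by simp
qed

lemma compatible_at_SM_Z:
  assumes b: "0 < b" "b < pi" and xy: "\<bar>x - y\<bar> \<le> b"
  shows "compatible_at u E b (SM x y) (Z_obj e z) \<Longrightarrow> \<not> G b x y z z"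
    "compatible_at u E b (Z_obj e z) (SM x y) \<Longrightarrow> \<not> G b x y z z"
    "\<not> G b x y z z \<Longrightarrow> \<not> G b z z x y \<Longrightarrow> compatible_at u E b (SM x y) (Z_obj e z)"
    "\<not> G b x y z z \<Longrightarrow> \<not> G b z z x y \<Longrightarrow> compatible_at u E b (Z_obj e z) (SM x y)"
proof -
  interpret exact_orbits u b "E b" using eo b by simp
  note 1 = Ext1_SM_Z[OF b(2) xy, of e z] Ext1_Z_SM[OF b(2) xy, of z e]
  show "compatible_at u E b (SM x y) (Z_obj e z) \<Longrightarrow> \<not> G b x y z z"
    "compatible_at u E b (Z_obj e z) (SM x y) \<Longrightarrow> \<not> G b x y z z"
    "\<not> G b x y z z \<Longrightarrow> \<not> G b z z x y \<Longrightarrow> compatible_at u E b (SM x y) (Z_obj e z)"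
    "\<not> G b x y z z \<Longrightarrow> \<not> G b z z x y \<Longrightarrow> compatible_at u E b (Z_obj e z) (SM x y)"
    unfolding compatible_at_def using 1 by auto
qed

lemma compatible_at_Z_Z:
  assumes b: "0 < b" "b < pi"
  shows "compatible_at u E b (Z_obj e x) (Z_obj e' y) \<longleftrightarrow> e = e' \<or> \<not> G b x x y y \<and> \<not> G b y y x x"
proof -
  interpret exact_orbits u b "E b" using eo b by simp
  show ?thesis unfolding compatible_at_def Ext1_Z_Z_G[OF b(2)] by auto
qed

lemma ev_range: "\<forall>\<^sub>F b in at_left pi. b \<in> {max c 0<..<pi}" if "c < pi"
  by (rule eventually_at_leftI[of "max c 0"]) (use that in auto)

text \<open>P b is squeezed between the failure of both \<open>G\<close> conditions and the failure
  of one of them. In the limit these agree, because \<open>Gp\<close> is symmetric. The bound c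
  allows P to be controlled only for strips wide enough to contain the named objects.\<close>

lemma ev_iff:
  assumes "c < pi" "\<And>b. c \<le> b \<Longrightarrow> 0 < b \<Longrightarrow> b < pi \<Longrightarrow> P b \<Longrightarrow> \<not> G b x y x' y'"
    "\<And>b. c \<le> b \<Longrightarrow> 0 < b \<Longrightarrow> b < pi \<Longrightarrow> \<not> G b x y x' y' \<Longrightarrow> \<not> G b x' y' x y \<Longrightarrow> P b"
  shows "(\<forall>\<^sub>F b in at_left pi. P b) \<longleftrightarrow> \<not> Gp x y x' y'"
proof
  note r = ev_range[OF assms(1)]
  assume "\<forall>\<^sub>F b in at_left pi. P b"
  with r have n: "\<forall>\<^sub>F b in at_left pi. \<not> G b x y x' y'"
    by eventually_elim (use assms(2) in auto)
  show "\<not> Gp x y x' y'"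
  proof
    assume "Gp x y x' y'"
    from Gp_G[OF this] n have "\<forall>\<^sub>F b in at_left pi. False" by eventually_elim simp
    then show False by (simp add: trivial_limit_at_left_real)
  qed
next
  note r = ev_range[OF assms(1)]
  assume n: "\<not> Gp x y x' y'"
  then have n': "\<not> Gp x' y' x y" using Gp_sym by blast
  from r show "\<forall>\<^sub>F b in at_left pi. P b"
  proof eventually_elim
    case (elim b)
    then show ?case using assms(3)[of b] G_Gp[of b x y x' y'] G_Gp[of b x' y' x y] n n' by auto
  qed
qed

lemma ev_SM_SM:
  assumes "\<bar>x - y\<bar> < pi" "\<bar>x' - y'\<bar> < pi"
  shows "(\<forall>\<^sub>F b in at_left pi. compatible_at u E b (SM x y) (SM x' y')) \<longleftrightarrow> \<not> Gp x y x' y'"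
  by (rule ev_iff[where c = "max \<bar>x - y\<bar> \<bar>x' - y'\<bar>"]) (use assms compatible_at_SM_SM in auto)

lemma ev_SM_Z:
  assumes "\<bar>x - y\<bar> < pi"
  shows "(\<forall>\<^sub>F b in at_left pi. compatible_at u E b (SM x y) (Z_obj e z)) \<longleftrightarrow> \<not> Gp x y z z"
    "(\<forall>\<^sub>F b in at_left pi. compatible_at u E b (Z_obj e z) (SM x y)) \<longleftrightarrow> \<not> Gp x y z z"
  by (rule ev_iff[where c = "\<bar>x - y\<bar>"]; use assms compatible_at_SM_Z in blast)+

lemma ev_Z_Z:
  "(\<forall>\<^sub>F b in at_left pi. compatible_at u E b (Z_obj e x) (Z_obj e' y)) \<longleftrightarrow> e = e' \<or> \<not> Gp x x y y"
proof (cases "e = e'")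
  case True
  have "\<forall>\<^sub>F b in at_left pi. compatible_at u E b (Z_obj e x) (Z_obj e' y)"
    using ev_range[of 0] pi_gt_zero
    by (auto elim!: eventually_mono simp: compatible_at_Z_Z True)
  then show ?thesis using True by simp
next
  case False
  then show ?thesis
    using ev_iff[of 0 "\<lambda>b. compatible_at u E b (Z_obj e x) (Z_obj e' y)" x x y y] compatible_at_Z_Z by auto
qed

end

section \<open>Objects as arcs and points\<close>

lemma circ_eq_iff: "circ x = circ y \<longleftrightarrow> (\<exists>k::int. y = x + of_int k * pi)"
proof
  assume "circ x = circ y"
  moreover have "y \<in> circ y" by (auto simp: circ_def intro!: image_eqI[of _ _ 0])
  ultimately show "\<exists>k::int. y = x + of_int k * pi" by (auto simp: circ_def)
next
  assume "\<exists>k::int. y = x + of_int k * pi"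
  then obtain k :: int where k: "y = x + of_int k * pi" by blast
  have "y + of_int j * pi = x + of_int (k + j) * pi" for j :: int by (simp add: k algebra_simps)
  then have "circ y = (\<lambda>j. x + of_int j * pi) ` range (\<lambda>j. k + j)"
    by (simp only: circ_def image_image)
  also have "range (\<lambda>j. k + j) = UNIV" by (rule surjI[of _ "\<lambda>j. j - k"]) simp
  finally show "circ x = circ y" by (simp add: circ_def)
qed

lemma circ_shift [simp]: "circ (x + of_int k * pi) = circ x"
  using circ_eq_iff by metis

section \<open>The limit condition as crossing of arcs on the circle\<close>

lemma Gp_swap_left: "Gp y x s t \<longleftrightarrow> Gp x y s t"
  unfolding Gp_def by (rule ex_cong1) auto

lemma Gp_shift_left: "Gp (x + of_int k * pi) (y + of_int k * pi) s t \<longleftrightarrow> Gp x y s t"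
proof -
  have 1: "Gp x y s t" if g: "Gp (x + of_int k * pi) (y + of_int k * pi) s t" for x y and k :: int
  proof -
    obtain i :: int where i:
     "x + of_int k * pi - pi < t + of_int i * pi \<and> t + of_int i * pi < y + of_int k * pi \<and>
      y + of_int k * pi - pi < s + of_int i * pi \<and> s + of_int i * pi < x + of_int k * pi \<or>
      x + of_int k * pi - pi < s + of_int i * pi \<and> s + of_int i * pi < y + of_int k * pi \<and>
      y + of_int k * pi - pi < t + of_int i * pi \<and> t + of_int i * pi < x + of_int k * pi"
      using g unfolding Gp_def by blast
    have e: "of_int (i - k) * pi = of_int i * pi - of_int k * pi" by (simp add: algebra_simps)
    show ?thesis unfolding Gp_def by (rule exI[of _ "i - k"], unfold e) (use i in linarith)
  qed
  show ?thesis using 1[of x k y] 1[of "x + of_int k * pi" "- k" "y + of_int k * pi"] by auto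
qed

definition crosses :: "real \<Rightarrow> real \<Rightarrow> real \<Rightarrow> real \<Rightarrow> bool" where
  "crosses x y x' y' \<longleftrightarrow> x < x' \<and> x' < y \<and> y < y'"

text \<open>As SE x y is SM x (y - pi), the two alternatives of \<open>Gp\<close> become the two
  ways in which the endpoints of lifted arcs can interleave; in one of them the index of the lift
  moves by one.\<close>

lemma Gp_crosses:
  assumes "x < y" "y < x + pi" "x' < y'" "y' < x' + pi"
  shows "Gp x (y - pi) x' (y' - pi) \<longleftrightarrow>
    (\<exists>k::int. crosses x y (x' + of_int k * pi) (y' + of_int k * pi) \<or> crosses (x' + of_int k * pi) (y' + of_int k * pi) x y)"
proof
  assume "Gp x (y - pi) x' (y' - pi)"
  then obtain i :: int where i:
     "x - pi < y' - pi + of_int i * pi \<and> y' - pi + of_int i * pi < y - pi \<and> y - pi - pi < x' + of_int i * pi \<and> x' + of_int i * pi < x \<or>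
     x - pi < x' + of_int i * pi \<and> x' + of_int i * pi < y - pi \<and> y - pi - pi < y' - pi + of_int i * pi \<and> y' - pi + of_int i * pi < x"
    unfolding Gp_def by blast
  have e: "of_int (i + 1) * pi = of_int i * pi + pi" by (simp add: algebra_simps)
  from i show "\<exists>k::int. crosses x y (x' + of_int k * pi) (y' + of_int k * pi) \<or> crosses (x' + of_int k * pi) (y' + of_int k * pi) x y"
  proof
    assume "x - pi < y' - pi + of_int i * pi \<and> y' - pi + of_int i * pi < y - pi \<and> y - pi - pi < x' + of_int i * pi \<and> x' + of_int i * pi < x"
    then show ?thesis by (intro exI[of _ i] disjI2) (auto simp: crosses_def)
  next
    assume "x - pi < x' + of_int i * pi \<and> x' + of_int i * pi < y - pi \<and> y - pi - pi < y' - pi + of_int i * pi \<and> y' - pi + of_int i * pi < x"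
    then show ?thesis by (intro exI[of _ "i + 1"] disjI1, unfold crosses_def e) linarith
  qed
next
  assume "\<exists>k::int. crosses x y (x' + of_int k * pi) (y' + of_int k * pi) \<or> crosses (x' + of_int k * pi) (y' + of_int k * pi) x y"
  then obtain k :: int where "crosses x y (x' + of_int k * pi) (y' + of_int k * pi) \<or> crosses (x' + of_int k * pi) (y' + of_int k * pi) x y"
    by blast
  moreover have e: "of_int (k - 1) * pi = of_int k * pi - pi" by (simp add: algebra_simps)
  ultimately show "Gp x (y - pi) x' (y' - pi)"
  proof (elim disjE)
    assume "crosses x y (x' + of_int k * pi) (y' + of_int k * pi)"
    then show ?thesis unfolding Gp_def crosses_def
      by (intro exI[of _ "k - 1"] disjI2, unfold e) (use assms in linarith)
  next
    assume "crosses (x' + of_int k * pi) (y' + of_int k * pi) x y"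
    then show ?thesis unfolding Gp_def crosses_def
      by (intro exI[of _ k] disjI1) (use assms in linarith)
  qed
qed

lemma Gp_point:
  assumes "x < y" "y < x + pi"
  shows "Gp x (y - pi) z z \<longleftrightarrow> (\<exists>k::int. x < z + of_int k * pi \<and> z + of_int k * pi < y)"
proof
  assume "Gp x (y - pi) z z"
  then obtain i :: int where "x - pi < z + of_int i * pi \<and> z + of_int i * pi < y - pi" unfolding Gp_def by blast
  then show "\<exists>k::int. x < z + of_int k * pi \<and> z + of_int k * pi < y"
    by (intro exI[of _ "i + 1"]) (auto simp: algebra_simps)
next
  assume "\<exists>k::int. x < z + of_int k * pi \<and> z + of_int k * pi < y"
  then obtain k :: int where k: "x < z + of_int k * pi \<and> z + of_int k * pi < y" by blast
  have e: "of_int (k - 1) * pi = of_int k * pi - pi" by (simp add: algebra_simps)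
  show "Gp x (y - pi) z z" unfolding Gp_def
    by (intro exI[of _ "k - 1"] disjI1, unfold e) (use assms k in linarith)
qed

text \<open>The condition asks for a translate of w in the open interval (z - pi, z), whose length
  is the period. Such a translate exists unless z itself is a translate of w.\<close>

lemma Gp_points: "Gp z z w w \<longleftrightarrow> circ z \<noteq> circ w"
proof
  assume "Gp z z w w"
  then obtain i :: int where i: "z - pi < w + of_int i * pi" "w + of_int i * pi < z" unfolding Gp_def by blast
  show "circ z \<noteq> circ w"
  proof
    assume "circ z = circ w"
    then obtain k :: int where "w = z + of_int k * pi" using circ_eq_iff by blast
    moreover define m where "m = k + i"
    ultimately have "-1 * pi < of_int m * pi" "of_int m * pi < 0 * pi" using i by (simp_all add: algebra_simps)
    then have "(-1::real) < of_int m" "of_int m < (0::real)"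
      by (simp_all only: mult_less_cancel_right) (use pi_gt_zero in auto)
    then have "-1 < m" "m < 0" by linarith+
    then show False by linarith
  qed
next
  assume ne: "circ z \<noteq> circ w"
  define k where "k = \<lceil>(z - w) / pi\<rceil> - 1"
  have "(z - w) / pi \<le> of_int (k + 1)" "of_int k < (z - w) / pi" unfolding k_def by linarith+
  then have k: "z - w \<le> of_int (k + 1) * pi" "of_int k * pi < z - w"
    by (simp_all only: pos_divide_le_eq[OF pi_gt_zero] pos_less_divide_eq[OF pi_gt_zero])
  have "z - w \<noteq> of_int (k + 1) * pi"
  proof
    assume "z - w = of_int (k + 1) * pi"
    then have "z = w + of_int (k + 1) * pi" by simp
    then show False using ne circ_eq_iff[of w z] by metis
  qed
  then have "z - pi < w + of_int k * pi" using k(1) by (simp add: algebra_simps)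
  then show "Gp z z w w" unfolding Gp_def using k(2) by (intro exI[of _ k]) simp
qed

lemma int_pi_eq_zero: "\<bar>of_int k * pi\<bar> < pi \<Longrightarrow> k = (0::int)"
proof -
  assume "\<bar>of_int k * pi\<bar> < pi"
  then have "\<bar>of_int k\<bar> * pi < 1 * pi" by (simp add: abs_mult)
  then have "\<bar>of_int k\<bar> < (1::real)" by (simp only: mult_less_cancel_right) (use pi_gt_zero in auto)
  then show ?thesis by linarith
qed

context frob_family
begin

section \<open>Isomorphism classes at b = pi\<close>

sublocale P: exact_orbits u pi "E pi"
  by (rule eo) auto

abbreviation iso :: "'r pobj \<Rightarrow> 'r pobj \<Rightarrow> bool" where "iso X Y \<equiv> isomorphic (Cpsi u E pi) X Y"

lemma Cpsi_SC: "Cpsi u E pi = P.SC" by (simp add: Cpsi_def)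

lemma Obj_Cpsi: "Obj (Cpsi u E pi) = P.EOb" by (simp add: Cpsi_SC)

lemma iso_symmetric: "X \<in> P.EOb \<Longrightarrow> Y \<in> P.EOb \<Longrightarrow> iso X Y \<Longrightarrow> iso Y X"
  unfolding Cpsi_SC by (rule P.iso_sym)

lemma iso_transitive: "X \<in> P.EOb \<Longrightarrow> Y \<in> P.EOb \<Longrightarrow> Z \<in> P.EOb \<Longrightarrow> iso X Y \<Longrightarrow> iso Y Z \<Longrightarrow> iso X Z"
  unfolding Cpsi_SC by (rule P.iso_trans)

lemma SM_EOb: "\<bar>x - y\<bar> \<le> pi \<Longrightarrow> SM x y \<in> P.EOb" by (rule P.SM_obj(1))

lemma Z_EOb: "Z_obj e x \<in> P.EOb" by (rule P.Z_obj(1))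

lemma SE_EOb: "x < y \<Longrightarrow> y < x + pi \<Longrightarrow> SE x y \<in> P.EOb"
  unfolding SE_def by (rule SM_EOb) auto

lemma pt_shift: "pt (M (x + of_int k * pi) (y + of_int k * pi)) = (if even k then pt (M x y) else prod.swap (pt (M x y)))"
proof (cases "even k")
  case True
  then show ?thesis using M_spw by simp
next
  case False
  then have "even (k - 1)" by simp
  then have "M (x + of_int k * pi) (y + of_int k * pi) = M (x + pi) (y + pi)"
    using M_spw[of "k - 1" "x + pi" "y + pi"] by (simp add: algebra_simps)
  then show ?thesis using False pt_psi[of "M x y" "\<bar>x - y\<bar>"] by (simp add: psi_M orbits_M) (metis order_refl)
qed

text \<open>An isomorphism makes the positions agree up to a power of \<open>sigma\<close> and the
  translation by pi. An odd power would turn the length y - x into 2 pi - (y - x), which is more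
  than pi.\<close>

lemma SE_iso_iff:
  assumes "x < y" "y < x + pi" "x' < y'" "y' < x' + pi"
  shows "iso (SE x y) (SE x' y') \<longleftrightarrow> (\<exists>k::int. x' = x + of_int k * pi \<and> y' = y + of_int k * pi)"
proof
  assume i: "iso (SE x y) (SE x' y')"
  have le: "\<bar>x' - (y' - pi)\<bar> \<le> pi" "\<bar>x - (y - pi)\<bar> < pi" using assms by auto
  have "\<exists>l<length (fst (SE x' y' :: 'r pobj)). pt (M x (y - pi)) = pt (fst (SE x' y' :: 'r pobj) ! l)"
    using P.SM_iso_pt[OF le(2) SE_EOb[OF assms(3,4)]] i unfolding Cpsi_SC SE_def by blast
  then have "pt (M x (y - pi)) = pt (M x' (y' - pi)) \<or> pt (M x (y - pi)) = pt (M (x' + pi) y')"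
    using P.SM_obj'[OF le(1)] by (auto simp: SE_def less_Suc_eq)
  then obtain k where k: "(x', y' - pi) = spw k (x, y - pi) \<or> (x' + pi, y') = spw k (x, y - pi)"
    using pt_M_eq_iff by metis
  have odd: False if "odd k"
  proof -
    have "y' - x' = x - y + 2 * pi" using k that by (auto simp: spw_def)
    then show False using assms by simp
  qed
  from k show "\<exists>k::int. x' = x + of_int k * pi \<and> y' = y + of_int k * pi"
  proof
    assume "(x', y' - pi) = spw k (x, y - pi)"
    then show ?thesis using odd by (intro exI[of _ k]) (auto simp: spw_def split: if_splits)
  next
    assume "(x' + pi, y') = spw k (x, y - pi)"
    then show ?thesis using odd by (intro exI[of _ "k - 1"]) (auto simp: spw_def algebra_simps split: if_splits)
  qed
next
  assume "\<exists>k::int. x' = x + of_int k * pi \<and> y' = y + of_int k * pi"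
  then obtain k :: int where k: "x' = x + of_int k * pi" "y' = y + of_int k * pi" by blast
  have e: "y' - pi = y - pi + of_int k * pi" using k by simp
  show "iso (SE x y) (SE x' y')" unfolding Cpsi_SC SE_def
  proof (rule P.SM_iso)
    show "pt (M x (y - pi)) = pt (M x' (y' - pi)) \<or> pt (M x (y - pi)) = prod.swap (pt (M x' (y' - pi)))"
      unfolding e k(1) pt_shift by auto
  qed (use assms in auto)
qed

lemma Z_iso_circ: "iso (Z_obj e x) (Z_obj e' y) \<longleftrightarrow> e = e' \<and> circ x = circ y"
proof -
  have "pt (M x x) = pt (M y y) \<longleftrightarrow> circ x = circ y"
    unfolding pt_M_eq_iff circ_eq_iff by (rule ex_cong1) (auto simp: spw_def)
  then show ?thesis unfolding Cpsi_SC P.Z_iso_iff by simp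
qed

lemma SE_not_Z:
  assumes "x < y" "y < x + pi" shows "\<not> iso (SE x y) (Z_obj e z)"
proof
  assume i: "iso (SE x y) (Z_obj e z)"
  have le: "\<bar>x - (y - pi)\<bar> < pi" using assms by auto
  have "pt (M x (y - pi)) = pt (M z z)"
    using P.SM_iso_pt[OF le Z_EOb] i P.Z_obj(2)[of e z] unfolding Cpsi_SC SE_def by fastforce
  then have "\<bar>x - (y - pi)\<bar> = \<bar>z - z\<bar>" using pt_width by metis
  then show False using assms by simp
qed

text \<open>The pair (x, y) is one lift of the arc; it is determined up to a common multiple of pi.
  By \<open>regular_arc\<close> this normal form covers all regular objects.\<close>

definition arc :: "'r pobj \<Rightarrow> real \<Rightarrow> real \<Rightarrow> bool" where
  "arc X x y \<longleftrightarrow> X \<in> P.EOb \<and> x < y \<and> y < x + pi \<and> iso X (SE x y)"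

definition sng :: "'r pobj \<Rightarrow> bool \<Rightarrow> real \<Rightarrow> bool" where
  "sng X e z \<longleftrightarrow> X \<in> P.EOb \<and> iso X (Z_obj e z)"

lemma SE_arc: "x < y \<Longrightarrow> y < x + pi \<Longrightarrow> arc (SE x y) x y"
  using P.iso_refl[OF SE_EOb] SE_EOb by (simp add: arc_def Cpsi_SC)

lemma Z_sng: "sng (Z_obj e z) e z"
  using P.iso_refl[OF Z_EOb] Z_EOb by (simp add: sng_def Cpsi_SC)

lemma arc_iso_iff:
  assumes "arc X x y" "arc X' x' y'"
  shows "iso X X' \<longleftrightarrow> (\<exists>k::int. x' = x + of_int k * pi \<and> y' = y + of_int k * pi)"
proof -
  have a: "X \<in> P.EOb" "x < y" "y < x + pi" "iso X (SE x y)" "X' \<in> P.EOb" "x' < y'" "y' < x' + pi" "iso X' (SE x' y')"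
    using assms by (auto simp: arc_def)
  note o = SE_EOb[OF a(2,3)] SE_EOb[OF a(6,7)]
  have "iso X X' \<longleftrightarrow> iso (SE x y) (SE x' y')"
    using iso_transitive iso_symmetric a(1,4,5,8) o by meson
  then show ?thesis using SE_iso_iff a by simp
qed

lemma arc_shift: "arc X x y \<Longrightarrow> arc X (x + of_int k * pi) (y + of_int k * pi)"
proof -
  assume a: "arc X x y"
  then have b: "x < y" "y < x + pi" "x + of_int k * pi < y + of_int k * pi" "y + of_int k * pi < x + of_int k * pi + pi"
    by (auto simp: arc_def)
  then have "iso (SE x y) (SE (x + of_int k * pi) (y + of_int k * pi))" using SE_iso_iff by blast
  then show ?thesis using a b iso_transitive SE_EOb unfolding arc_def by meson
qed

lemma sng_iso_iff: "sng X e z \<Longrightarrow> sng X' e' z' \<Longrightarrow> iso X X' \<longleftrightarrow> e = e' \<and> circ z = circ z'"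
proof -
  assume a: "sng X e z" "sng X' e' z'"
  then have o: "X \<in> P.EOb" "X' \<in> P.EOb" and i: "iso X (Z_obj e z)" "iso X' (Z_obj e' z')" by (auto simp: sng_def)
  note i' = iso_symmetric[OF o(1) Z_EOb i(1)] iso_symmetric[OF o(2) Z_EOb i(2)]
  show ?thesis unfolding Z_iso_circ[symmetric]
    using iso_transitive[OF Z_EOb o(1) Z_EOb i'(1) iso_transitive[OF o Z_EOb _ i(2)]]
      iso_transitive[OF o(1) Z_EOb o(2) i(1) iso_transitive[OF Z_EOb Z_EOb o(2) _ i'(2)]] by blast
qed

lemma sng_circ: "sng X e z \<Longrightarrow> circ z = circ z' \<Longrightarrow> sng X e z'"
proof -
  assume a: "sng X e z" "circ z = circ z'"
  then have "iso (Z_obj e z) (Z_obj e z')" using Z_iso_circ by blast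
  then show ?thesis using a(1) iso_transitive[OF _ Z_EOb Z_EOb] unfolding sng_def by blast
qed

lemma arc_sng_not_iso: assumes "arc X x y" "sng X' e z" shows "\<not> iso X X'" "\<not> iso X' X"
proof -
  have a: "X \<in> P.EOb" "x < y" "y < x + pi" "iso X (SE x y)" "X' \<in> P.EOb" "iso X' (Z_obj e z)"
    using assms by (auto simp: arc_def sng_def)
  have o: "SE x y \<in> P.EOb" "Z_obj e z \<in> P.EOb" using SE_EOb a Z_EOb by blast+
  show 1: "\<not> iso X X'"
  proof
    assume "iso X X'"
    then have "iso (SE x y) (Z_obj e z)" using iso_transitive iso_symmetric a(1,4,5,6) o by meson
    then show False using SE_not_Z a by blast
  qed
  then show "\<not> iso X' X" using iso_symmetric a by blast
qed

lemma arc_not_sng: "arc X x y \<Longrightarrow> \<not> sng X e z"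
  using arc_sng_not_iso(1)[of X x y X e z] P.iso_refl[of X] by (auto simp: arc_def Cpsi_SC)

text \<open>M x y has the position of psi M y x, so the coordinates of SM can be exchanged up to
  isomorphism; the larger coordinate becomes the left end of the arc.\<close>

lemma SM_arc:
  assumes "0 < \<bar>x - y\<bar>" "\<bar>x - y\<bar> < pi"
  shows "\<exists>a c. arc (SM x y) a c \<and> (a = x \<and> c = y + pi \<or> a = y \<and> c = x + pi)"
proof (cases "x < y")
  case False
  then have "arc (SM x y) x (y + pi)" using SE_arc[of x "y + pi"] assms by (simp add: SE_def)
  then show ?thesis by blast
next
  case True
  have "pt (M x y) = pt (M (y + pi) (x + pi))"
    unfolding pt_M_eq_iff by (intro exI[of _ 1]) (simp add: spw_def)
  then have "pt (M x y) = prod.swap (pt (M y x))" using pt_shift[of y 1 x] by simp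
  then have "iso (SM x y) (SE y (x + pi))"
    unfolding Cpsi_SC SE_def using assms by (intro P.SM_iso) auto
  then have "arc (SM x y) y (x + pi)" using assms True SM_EOb[of x y] by (auto simp: arc_def)
  then show ?thesis by blast
qed

lemma regular_arc: "regular u E X \<longleftrightarrow> (\<exists>x y. arc X x y)"
proof
  assume "regular u E X"
  then obtain x y where xy: "X \<in> P.EOb" "0 < \<bar>x - y\<bar>" "\<bar>x - y\<bar> < pi" "iso X (SM x y)"
    by (auto simp: regular_def Obj_Cpsi)
  then obtain a c where "arc (SM x y) a c" using SM_arc by blast
  then have "arc X a c" using xy iso_transitive SE_EOb unfolding arc_def by meson
  then show "\<exists>x y. arc X x y" by blast
next
  assume "\<exists>x y. arc X x y"
  then obtain x y where "arc X x y" by blast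
  then show "regular u E X" unfolding regular_def arc_def SE_def Obj_Cpsi
    by (intro conjI exI[of _ x] exI[of _ "y - pi"]) auto
qed

lemma singular_at_sng: "singular_at u E e p X \<longleftrightarrow> (\<exists>z. p = circ z \<and> sng X e z)"
  unfolding singular_at_def sng_def Obj_Cpsi by blast

lemma indecomposable_arc_sng: "indecomposable (Cpsi u E pi) X \<longleftrightarrow> (\<exists>x y. arc X x y) \<or> (\<exists>e z. sng X e z)"
proof
  assume i: "indecomposable (Cpsi u E pi) X"
  then have X: "X \<in> P.EOb" by (simp add: indecomposable_def Obj_Cpsi)
  from P.indecomposable_classify[OF X] i
  have "(\<exists>x y. 0 < \<bar>x - y\<bar> \<and> \<bar>x - y\<bar> < pi \<and> iso X (SM x y)) \<or> (\<exists>e x. iso X (Z_obj e x))" by (simp add: Cpsi_SC)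
  then show "(\<exists>x y. arc X x y) \<or> (\<exists>e z. sng X e z)"
    using X regular_arc unfolding regular_def sng_def Obj_Cpsi by blast
next
  assume "(\<exists>x y. arc X x y) \<or> (\<exists>e z. sng X e z)"
  then show "indecomposable (Cpsi u E pi) X"
  proof
    assume "\<exists>x y. arc X x y"
    then obtain x y where a: "X \<in> P.EOb" "x < y" "y < x + pi" "iso X (SE x y)" by (auto simp: arc_def)
    have "indecomposable P.SC (SE x y)" unfolding SE_def using a by (intro P.SM_indecomposable) auto
    moreover have "iso (SE x y) X" using iso_symmetric a SE_EOb by blast
    ultimately show ?thesis using P.indecomposable_iso[OF SE_EOb[OF a(2,3)] a(1)] by (simp add: Cpsi_SC)
  next
    assume "\<exists>e z. sng X e z"
    then obtain e z where a: "X \<in> P.EOb" "iso X (Z_obj e z)" by (auto simp: sng_def)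
    have "iso (Z_obj e z) X" using iso_symmetric a Z_EOb by blast
    then show ?thesis using P.indecomposable_iso[OF Z_EOb a(1)] P.Z_indecomposable by (simp add: Cpsi_SC)
  qed
qed

lemma circ_image_shift: "circ ` {x + of_int k * pi<..<y + of_int k * pi} = circ ` {x<..<y}"
proof -
  have "{x + of_int k * pi<..<y + of_int k * pi} = (\<lambda>z. z + of_int k * pi) ` {x<..<y}"
    by (auto intro!: image_eqI[of _ _ "_ - of_int k * pi"])
  then show ?thesis by (simp add: image_image)
qed

lemma supp_arc: assumes "arc X x y" shows "supp u E X = circ ` {x<..<y}"
  unfolding supp_def
proof (rule the_equality)
  show "\<exists>a c. iso X (SE a c) \<and> (a < c \<and> c < a + pi \<and> circ ` {x<..<y} = circ ` {a<..<c} \<or>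
      a + pi < c \<and> c < a + 2 * pi \<and> circ ` {x<..<y} = circ ` {c<..<a + 2 * pi})"
    using assms by (auto simp: arc_def)
  fix J assume "\<exists>a c. iso X (SE a c) \<and> (a < c \<and> c < a + pi \<and> J = circ ` {a<..<c} \<or>
      a + pi < c \<and> c < a + 2 * pi \<and> J = circ ` {c<..<a + 2 * pi})"
  then obtain a c where ac: "iso X (SE a c)" and d: "a < c \<and> c < a + pi \<and> J = circ ` {a<..<c} \<or>
      a + pi < c \<and> c < a + 2 * pi \<and> J = circ ` {c<..<a + 2 * pi}" by blast
  have X: "X \<in> P.EOb" using assms by (simp add: arc_def)
  from d show "J = circ ` {x<..<y}"
  proof
    assume d: "a < c \<and> c < a + pi \<and> J = circ ` {a<..<c}"
    then have "arc X a c" using X ac by (simp add: arc_def)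
    then have "iso X X \<longleftrightarrow> (\<exists>k::int. a = x + of_int k * pi \<and> c = y + of_int k * pi)" by (rule arc_iso_iff[OF assms])
    then obtain k :: int where "a = x + of_int k * pi" "c = y + of_int k * pi"
      using P.iso_refl[OF X] by (auto simp: Cpsi_SC)
    then show ?thesis using d circ_image_shift by simp
  next
    \<comment> \<open>In the second description of the support the coordinates come in the other
      order. Exchanging them gives a lift (c - pi, a + pi) of the normal form, and the interval in
      question is its translate by pi.\<close>
    assume d: "a + pi < c \<and> c < a + 2 * pi \<and> J = circ ` {c<..<a + 2 * pi}"
    have "0 < \<bar>a - (c - pi)\<bar>" "\<bar>a - (c - pi)\<bar> < pi" using d by auto
    from SM_arc[OF this] obtain v w where v: "arc (SM a (c - pi)) v w" "v = a \<and> w = c \<or> v = c - pi \<and> w = a + pi" by auto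
    have "\<not> (v = a \<and> w = c)" using v(1) d by (auto simp: arc_def)
    then have vw: "v = c - pi" "w = a + pi" using v(2) by auto
    have "arc X v w" using X ac v(1) iso_transitive SE_EOb unfolding SE_def[of a c] arc_def by meson
    then have "iso X X \<longleftrightarrow> (\<exists>k::int. v = x + of_int k * pi \<and> w = y + of_int k * pi)" by (rule arc_iso_iff[OF assms])
    then obtain k :: int where "v = x + of_int k * pi" "w = y + of_int k * pi"
      using P.iso_refl[OF X] by (auto simp: Cpsi_SC)
    then have "c = x + of_int (k + 1) * pi" "a + 2 * pi = y + of_int (k + 1) * pi" using vw by (auto simp: algebra_simps)
    then show ?thesis using d circ_image_shift[of x "k + 1" y] by simp
  qed
qed

text \<open>The definition of \<open>compatible\<close> refers to some name of the object. Different
  names of a regular object differ by exchanges and translations, under which \<open>Gp\<close> is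
  invariant, so the choice of the name does not matter.\<close>

lemma named_arc:
  assumes "N \<in> named_objects" "iso X N" "arc X x y"
  obtains a c where "N = SM a c" "\<bar>a - c\<bar> < pi" "\<forall>s t. Gp a c s t \<longleftrightarrow> Gp x (y - pi) s t"
proof -
  have X: "X \<in> P.EOb" using assms by (simp add: arc_def)
  from assms(1) consider a c where "N = SM a c" "0 < \<bar>a - c\<bar>" "\<bar>a - c\<bar> < pi" | e z where "N = Z_obj e z"
    by (auto simp: named_objects_def)
  then show thesis
  proof cases
    case 1
    obtain v w where v: "arc (SM a c) v w" "v = a \<and> w = c + pi \<or> v = c \<and> w = a + pi" using SM_arc[OF 1(2,3)] by blast
    have "\<exists>k::int. v = x + of_int k * pi \<and> w = y + of_int k * pi"
      using arc_iso_iff[OF assms(3) v(1)] assms(2) 1 by blast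
    then obtain k :: int where k: "v = x + of_int k * pi" "w = y + of_int k * pi" by blast
    have "w - pi = (y - pi) + of_int k * pi" using k by simp
    then have "Gp v (w - pi) s t \<longleftrightarrow> Gp x (y - pi) s t" for s t using Gp_shift_left k by metis
    then have "Gp a c s t \<longleftrightarrow> Gp x (y - pi) s t" for s t using v(2) Gp_swap_left by auto
    then show thesis using that 1 by blast
  next
    case 2
    then have "sng X e z" using assms X by (simp add: sng_def)
    then show thesis using arc_not_sng assms by blast
  qed
qed

lemma named_sng:
  assumes "N \<in> named_objects" "iso X N" "sng X e z"
  obtains w where "N = Z_obj e w" "circ w = circ z"
proof -
  have X: "X \<in> P.EOb" using assms by (simp add: sng_def)
  from assms(1) consider a c where "N = SM a c" "0 < \<bar>a - c\<bar>" "\<bar>a - c\<bar> < pi" | e z where "N = Z_obj e z"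
    by (auto simp: named_objects_def)
  then show thesis
  proof cases
    case 1
    then have "regular u E X" using X assms by (auto simp: regular_def Obj_Cpsi)
    then show thesis using arc_not_sng assms regular_arc by blast
  next
    case (2 e' w)
    then have "sng X e' w" using assms X by (simp add: sng_def)
    then have "e = e' \<and> circ z = circ w" using sng_iso_iff[OF assms(3)] P.iso_refl[OF X] by (simp add: Cpsi_SC)
    then show thesis using that 2 by simp
  qed
qed

lemma arc_named: assumes "arc X x y" shows "SE x y \<in> named_objects" "iso X (SE x y)" "SE x y = SM x (y - pi)" "\<bar>x - (y - pi)\<bar> < pi"
proof -
  have a: "x < y" "y < x + pi" "iso X (SE x y)" using assms by (auto simp: arc_def)
  then show "iso X (SE x y)" "SE x y = SM x (y - pi)" "\<bar>x - (y - pi)\<bar> < pi" by (auto simp: SE_def)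
  have "0 < \<bar>x - (y - pi)\<bar> \<and> \<bar>x - (y - pi)\<bar> < pi" using a by auto
  then show "SE x y \<in> named_objects" unfolding named_objects_def SE_def by blast
qed

lemma sng_named: assumes "sng X e z" shows "Z_obj e z \<in> named_objects" "iso X (Z_obj e z)"
  using assms by (auto simp: sng_def named_objects_def)

section \<open>Compatibility of arcs and signed points\<close>

lemma compatible_arc_arc:
  assumes "arc X x y" "arc X' x' y'"
  shows "compatible u E X X' \<longleftrightarrow>
    (\<forall>k::int. \<not> crosses x y (x' + of_int k * pi) (y' + of_int k * pi) \<and> \<not> crosses (x' + of_int k * pi) (y' + of_int k * pi) x y)"
proof -
  have "compatible u E X X' \<longleftrightarrow> \<not> Gp x (y - pi) x' (y' - pi)"
  proof
    assume "compatible u E X X'"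
    then obtain N N' where N: "N \<in> named_objects" "N' \<in> named_objects" "iso X N" "iso X' N'"
      "\<forall>\<^sub>F b in at_left pi. compatible_at u E b N N'" by (auto simp: compatible_def)
    obtain a c where a: "N = SM a c" "\<bar>a - c\<bar> < pi" "\<forall>s t. Gp a c s t \<longleftrightarrow> Gp x (y - pi) s t"
      using named_arc[OF N(1,3) assms(1)] .
    obtain a' c' where a': "N' = SM a' c'" "\<bar>a' - c'\<bar> < pi" "\<forall>s t. Gp a' c' s t \<longleftrightarrow> Gp x' (y' - pi) s t"
      using named_arc[OF N(2,4) assms(2)] .
    have "\<not> Gp a c a' c'" using N(5) ev_SM_SM[OF a(2) a'(2)] a(1) a'(1) by simp
    then show "\<not> Gp x (y - pi) x' (y' - pi)" using a(3) a'(3) Gp_sym by blast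
  next
    assume "\<not> Gp x (y - pi) x' (y' - pi)"
    then show "compatible u E X X'" unfolding compatible_def
      using arc_named[OF assms(1)] arc_named[OF assms(2)] ev_SM_SM by metis
  qed
  then show ?thesis using Gp_crosses assms by (auto simp: arc_def)
qed

lemma compatible_arc_sng:
  assumes "arc X x y" "sng Y e z"
  shows "compatible u E X Y \<longleftrightarrow> (\<forall>k::int. \<not> (x < z + of_int k * pi \<and> z + of_int k * pi < y))"
    "compatible u E Y X \<longleftrightarrow> (\<forall>k::int. \<not> (x < z + of_int k * pi \<and> z + of_int k * pi < y))"
proof -
  have xy: "x < y" "y < x + pi" using assms by (auto simp: arc_def)
  have c: "Gp a c w w \<longleftrightarrow> Gp a c z z" if wz: "circ w = circ z" for a c w
  proof -
    obtain k :: int where "z = w + of_int k * pi" using wz circ_eq_iff by blast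
    then show ?thesis using Gp_shift_left[of w k w a c] Gp_sym[of a c] Gp_sym[of _ _ a c] by auto
  qed
  have 1: "compatible u E X Y \<longleftrightarrow> \<not> Gp x (y - pi) z z"
  proof
    assume "compatible u E X Y"
    then obtain N N' where N: "N \<in> named_objects" "N' \<in> named_objects" "iso X N" "iso Y N'"
      "\<forall>\<^sub>F b in at_left pi. compatible_at u E b N N'" by (auto simp: compatible_def)
    obtain a c where a: "N = SM a c" "\<bar>a - c\<bar> < pi" "\<forall>s t. Gp a c s t \<longleftrightarrow> Gp x (y - pi) s t"
      using named_arc[OF N(1,3) assms(1)] .
    obtain w where w: "N' = Z_obj e w" "circ w = circ z" using named_sng[OF N(2,4) assms(2)] .
    have "\<not> Gp a c w w" using N(5) ev_SM_Z(1)[OF a(2)] a(1) w(1) by simp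
    then show "\<not> Gp x (y - pi) z z" using a(3) c[OF w(2)] by blast
  next
    assume "\<not> Gp x (y - pi) z z"
    then show "compatible u E X Y" unfolding compatible_def
      using arc_named[OF assms(1)] sng_named[OF assms(2)] ev_SM_Z(1) by metis
  qed
  have 2: "compatible u E Y X \<longleftrightarrow> \<not> Gp x (y - pi) z z"
  proof
    assume "compatible u E Y X"
    then obtain N N' where N: "N' \<in> named_objects" "N \<in> named_objects" "iso Y N'" "iso X N"
      "\<forall>\<^sub>F b in at_left pi. compatible_at u E b N' N" by (auto simp: compatible_def)
    obtain a c where a: "N = SM a c" "\<bar>a - c\<bar> < pi" "\<forall>s t. Gp a c s t \<longleftrightarrow> Gp x (y - pi) s t"
      using named_arc[OF N(2,4) assms(1)] .
    obtain w where w: "N' = Z_obj e w" "circ w = circ z" using named_sng[OF N(1,3) assms(2)] .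
    have "\<not> Gp a c w w" using N(5) ev_SM_Z(2)[OF a(2)] a(1) w(1) by simp
    then show "\<not> Gp x (y - pi) z z" using a(3) c[OF w(2)] by blast
  next
    assume "\<not> Gp x (y - pi) z z"
    then show "compatible u E Y X" unfolding compatible_def
      using arc_named[OF assms(1)] sng_named[OF assms(2)] ev_SM_Z(2) by metis
  qed
  show "compatible u E X Y \<longleftrightarrow> (\<forall>k::int. \<not> (x < z + of_int k * pi \<and> z + of_int k * pi < y))"
    "compatible u E Y X \<longleftrightarrow> (\<forall>k::int. \<not> (x < z + of_int k * pi \<and> z + of_int k * pi < y))"
    using 1 2 Gp_point[OF xy] by auto
qed

lemma compatible_sng_sng:
  assumes "sng X e z" "sng Y e' z'"
  shows "compatible u E X Y \<longleftrightarrow> e = e' \<or> circ z = circ z'"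
proof
  assume "compatible u E X Y"
  then obtain N N' where N: "N \<in> named_objects" "N' \<in> named_objects" "iso X N" "iso Y N'"
    "\<forall>\<^sub>F b in at_left pi. compatible_at u E b N N'" by (auto simp: compatible_def)
  obtain w where w: "N = Z_obj e w" "circ w = circ z" using named_sng[OF N(1,3) assms(1)] .
  obtain w' where w': "N' = Z_obj e' w'" "circ w' = circ z'" using named_sng[OF N(2,4) assms(2)] .
  show "e = e' \<or> circ z = circ z'" using N(5) ev_Z_Z[of e w e' w'] w w' Gp_points by simp
next
  assume "e = e' \<or> circ z = circ z'"
  then show "compatible u E X Y" unfolding compatible_def
    using sng_named[OF assms(1)] sng_named[OF assms(2)] ev_Z_Z Gp_points by metis
qed

text \<open>All lifts are collected, so that compatibility can be stated for the lifts themselves,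
  with no quantification over shifts.\<close>

definition arcs_of :: "'r pobj set \<Rightarrow> (real \<times> real) set" where
  "arcs_of L = {(x, y). \<exists>X\<in>L. arc X x y}"

definition points_of :: "'r pobj set \<Rightarrow> (bool \<times> real) set" where
  "points_of L = {(e, z). \<exists>X\<in>L. sng X e z}"

lemma arcs_of_shift: "(x, y) \<in> arcs_of L \<Longrightarrow> (x + of_int k * pi, y + of_int k * pi) \<in> arcs_of L"
  unfolding arcs_of_def using arc_shift by blast

lemma points_of_circ: "(e, z) \<in> points_of L \<Longrightarrow> circ z = circ z' \<Longrightarrow> (e, z') \<in> points_of L"
  unfolding points_of_def using sng_circ by blast

lemma arcs_of_proper: "(x, y) \<in> arcs_of L \<Longrightarrow> x < y \<and> y < x + pi"
  unfolding arcs_of_def arc_def by blast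

end

section \<open>Noncrossing arcs on the circle\<close>

lemma gap_exists:
  fixes W :: "real set"
  assumes "open W" "z \<in> W" "w1 < z" "w1 \<notin> W" "z < w2" "w2 \<notin> W"
  obtains p q where "w1 \<le> p" "p < z" "z < q" "q \<le> w2" "p \<notin> W" "q \<notin> W" "{p<..<q} \<subseteq> W"
proof -
  let ?S = "{w1..z} - W" and ?T = "{z..w2} - W"
  have cl: "closed ?S" "closed ?T" using assms(1) by (auto intro: closed_Diff)
  have ne: "w1 \<in> ?S" "w2 \<in> ?T" using assms by auto
  have bdd: "bdd_above ?S" "bdd_below ?T" by (auto intro!: bdd_aboveI[of _ z] bdd_belowI[of _ z])
  define p where "p = Sup ?S"
  define q where "q = Inf ?T"
  have p: "p \<in> ?S" unfolding p_def using closed_contains_Sup[OF _ bdd(1) cl(1)] ne by blast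
  have q: "q \<in> ?T" unfolding q_def using closed_contains_Inf[OF _ bdd(2) cl(2)] ne by blast
  have pu: "v \<le> p" if "v \<in> ?S" for v unfolding p_def by (rule cSup_upper[OF that bdd(1)])
  have ql: "q \<le> v" if "v \<in> ?T" for v unfolding q_def by (rule cInf_lower[OF that bdd(2)])
  have "{p<..<q} \<subseteq> W"
  proof
    fix v assume v: "v \<in> {p<..<q}"
    show "v \<in> W"
    proof (rule ccontr)
      assume "v \<notin> W"
      then have "v \<in> ?S \<or> v \<in> ?T" using v p q by auto
      then show False using pu[of v] ql[of v] v by auto
    qed
  qed
  moreover have "p \<noteq> z" "q \<noteq> z" using p q assms(2) by auto
  ultimately show thesis using that[of p q] p q by auto
qed

section \<open>Periodic open sets and the components of their images\<close>

definition periodic :: "real set \<Rightarrow> bool" where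
  "periodic W \<longleftrightarrow> (\<forall>z. \<forall>k::int. z + of_int k * pi \<in> W \<longleftrightarrow> z \<in> W)"

lemma periodicD: "periodic W \<Longrightarrow> z + of_int k * pi \<in> W \<longleftrightarrow> z \<in> W"
  by (auto simp: periodic_def)

lemma periodic_circ: "periodic W \<Longrightarrow> circ z = circ w \<Longrightarrow> z \<in> W \<longleftrightarrow> w \<in> W"
  by (auto simp: periodic_def circ_eq_iff)

lemma periodic_vimage: "periodic (circ -` U)"
  by (simp add: periodic_def)

lemma shift_below: "\<exists>k::int. w + of_int k * pi < (z::real)" and shift_above: "\<exists>k::int. z < w + of_int k * pi"
proof -
  obtain n where n: "w - z < real n * pi" using reals_Archimedean3[OF pi_gt_zero] by blast
  show "\<exists>k::int. w + of_int k * pi < z" by (rule exI[of _ "- int n"]) (use n in simp)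
  obtain n where n: "z - w < real n * pi" using reals_Archimedean3[OF pi_gt_zero] by blast
  show "\<exists>k::int. z < w + of_int k * pi" by (rule exI[of _ "int n"]) (use n in simp)
qed

text \<open>The nearest points outside W on both sides of z are taken. As a translate of p, the
  point p + pi is outside W too, which bounds the length of the gap.\<close>

lemma periodic_gap:
  assumes "open W" "periodic W" "z \<in> W" "w \<notin> W"
  obtains p q where "p < z" "z < q" "q \<le> p + pi" "p \<notin> W" "q \<notin> W" "{p<..<q} \<subseteq> W"
proof -
  obtain k l :: int where kl: "w + of_int k * pi < z" "z < w + of_int l * pi" using shift_below shift_above by metis
  then obtain p q where pq: "p < z" "z < q" "p \<notin> W" "q \<notin> W" "{p<..<q} \<subseteq> W"
    using gap_exists[OF assms(1,3) kl(1) _ kl(2)] periodicD[OF assms(2)] assms(4) by metis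
  have "p + pi \<notin> W" using periodicD[OF assms(2), of p 1] pq by simp
  then have "q \<le> p + pi" using pq pi_gt_zero by (metis greaterThanLessThan_iff less_add_same_cancel1 not_le subsetD)
  then show thesis using that pq by blast
qed

lemma shift_into: "\<exists>k::int. a \<le> x + of_int k * pi \<and> x + of_int k * pi < a + pi"
proof -
  define k where "k = \<lceil>(a - x) / pi\<rceil>"
  have "(a - x) / pi \<le> of_int k" "of_int k - 1 < (a - x) / pi" unfolding k_def by linarith+
  then have "a - x \<le> of_int k * pi" "(of_int k - 1) * pi < a - x"
    by (simp_all only: pos_divide_le_eq[OF pi_gt_zero] pos_less_divide_eq[OF pi_gt_zero])
  then show ?thesis by (intro exI[of _ k]) (simp add: algebra_simps)
qed

lemma vimage_circ_image: "circ -` (circ ` V) = (\<Union>k::int. (\<lambda>z. z + of_int k * pi) ` V)"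
proof (intro set_eqI iffI)
  fix z assume "z \<in> circ -` (circ ` V)"
  then obtain v where v: "v \<in> V" "circ v = circ z" by auto
  then obtain k :: int where "z = v + of_int k * pi" using circ_eq_iff by blast
  then show "z \<in> (\<Union>k::int. (\<lambda>z. z + of_int k * pi) ` V)" using v by blast
qed auto

lemma open_circ_image: "open V \<Longrightarrow> openin S1 (circ ` V)"
  unfolding openin_S1 vimage_circ_image
  by (auto intro!: open_UN simp: add.commute[of _ "_ * pi"] open_translation)

lemma continuous_map_circ: "continuous_map euclidean S1 circ"
  unfolding continuous_map_def by (auto simp: topspace_S1 openin_S1 vimage_def)

lemma connectedin_circ_image: "connected V \<Longrightarrow> connectedin S1 (circ ` V)"
  by (rule connectedin_continuous_map_image[OF continuous_map_circ]) simp

lemma circ_image_subset: "circ ` V \<subseteq> U \<longleftrightarrow> V \<subseteq> circ -` U"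
  by auto

lemma image_circ_vimage: "openin S1 U \<Longrightarrow> circ ` (circ -` U) = U"
  by (auto simp: openin_S1)

text \<open>The image of a gap is open and connected. It is also closed in U: a ball inside the
  preimage of U that contains a point of a translated gap avoids the ends of that gap, hence lies in
  it. A connected set that is open and closed in U is a component.\<close>

lemma components_S1_gap:
  assumes U: "openin S1 U" and p: "p < q" "p \<notin> circ -` U" "q \<notin> circ -` U" "{p<..<q} \<subseteq> circ -` U"
  shows "circ ` {p<..<q} \<in> components_S1 U"
proof -
  let ?C = "circ ` {p<..<q}" and ?X = "subtopology S1 U" and ?W = "circ -` U"
  have sub: "?C \<subseteq> U" using p(4) by auto
  have tX: "topspace ?X = U" using openin_subset[OF U] by auto
  have op: "openin ?X ?C" unfolding openin_open_subtopology[OF U] using open_circ_image sub by auto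
  have con: "connectedin ?X ?C" unfolding connectedin_subtopology using connectedin_circ_image sub by auto
  have W: "open ?W" using U by (simp add: openin_S1)
  have "openin S1 (U - ?C)"
    unfolding openin_S1
  proof
    show "U - ?C \<subseteq> range circ" using U by (auto simp: openin_S1)
    show "open (circ -` (U - ?C))"
    proof (rule openI)
      fix z assume z: "z \<in> circ -` (U - ?C)"
      then obtain e where e: "e > 0" "ball z e \<subseteq> ?W" using W openE[of ?W z] by auto
      have "ball z e \<subseteq> circ -` (U - ?C)"
      proof
        fix v assume v: "v \<in> ball z e"
        show "v \<in> circ -` (U - ?C)"
        proof (rule ccontr)
          assume "v \<notin> circ -` (U - ?C)"
          then have "v \<in> circ -` ?C" using v e by auto
          then obtain k :: int and z' where "v = z' + of_int k * pi" "p < z'" "z' < q"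
            unfolding vimage_circ_image by auto
          then have k: "p + of_int k * pi < v" "v < q + of_int k * pi" by auto
          have n: "p + of_int k * pi \<notin> ?W" "q + of_int k * pi \<notin> ?W" using p periodicD[OF periodic_vimage] by auto
          then have "p + of_int k * pi \<notin> ball z e" "q + of_int k * pi \<notin> ball z e" using e by auto
          then have "p + of_int k * pi < z" "z < q + of_int k * pi" using k v by (auto simp: dist_real_def)
          then have "z - of_int k * pi \<in> {p<..<q}" "circ (z - of_int k * pi) = circ z"
            using circ_shift[of "z - of_int k * pi" k] by auto
          then show False using z by (metis DiffD2 imageI vimageD)
        qed
      qed
      then show "\<exists>T>0. ball z T \<subseteq> circ -` (U - ?C)" using e by blast
    qed
  qed
  then have cl: "closedin ?X ?C" unfolding closedin_def tX using sub openin_open_subtopology[OF U] by auto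
  let ?m = "(p + q) / 2"
  have m: "circ ?m \<in> ?C" using p(1) by auto
  let ?K = "connected_component_of_set ?X (circ ?m)"
  have "?C \<subseteq> ?K" by (rule connected_component_of_maximal[OF con m])
  moreover have "?K \<subseteq> ?C \<or> disjnt ?K ?C"
    by (rule connectedin_clopen_cases[OF connectedin_connected_component_of cl op])
  moreover have "circ ?m \<in> ?K" using m \<open>?C \<subseteq> ?K\<close> by blast
  ultimately have "?K \<subseteq> ?C" using m unfolding disjnt_def by blast
  with \<open>?C \<subseteq> ?K\<close> have "?C = ?K" by blast
  then show ?thesis unfolding components_S1_def connected_components_of_def tX using m sub by blast
qed

lemma components_S1_disjoint:
  "I \<in> components_S1 U \<Longrightarrow> I' \<in> components_S1 U \<Longrightarrow> I \<noteq> I' \<Longrightarrow> I \<inter> I' = {}"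
  using pairwise_disjoint_connected_components_of[of "subtopology S1 U"]
  unfolding components_S1_def pairwise_def disjnt_def by blast

lemma components_S1_subset: "I \<in> components_S1 U \<Longrightarrow> I \<subseteq> U"
  using connected_components_of_subset[of I "subtopology S1 U"] unfolding components_S1_def by auto

lemma components_S1_superset:
  assumes "openin S1 U" "connectedin S1 J" "J \<noteq> {}" "J \<subseteq> U"
  shows "\<exists>I\<in>components_S1 U. J \<subseteq> I"
proof -
  obtain x where x: "x \<in> J" using assms by blast
  have con: "connectedin (subtopology S1 U) J" using assms by (simp add: connectedin_subtopology)
  have "topspace (subtopology S1 U) = U" using openin_subset[OF assms(1)] by auto
  then have "connected_component_of_set (subtopology S1 U) x \<in> components_S1 U"
    unfolding components_S1_def connected_components_of_def using x assms by blast
  then show ?thesis using connected_component_of_maximal[OF con x] by blast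
qed

lemma not_top_lift: "openin S1 U \<Longrightarrow> U \<noteq> topspace S1 \<Longrightarrow> \<exists>w. w \<notin> circ -` U"
  unfolding topspace_S1 openin_S1 by auto

lemma components_S1_form:
  assumes U: "openin S1 U" "U \<noteq> topspace S1" and I: "I \<in> components_S1 U"
  obtains p q where "p < q" "q \<le> p + pi" "p \<notin> circ -` U" "q \<notin> circ -` U" "{p<..<q} \<subseteq> circ -` U" "I = circ ` {p<..<q}"
proof -
  have "I \<noteq> {}" using nonempty_connected_components_of I unfolding components_S1_def by blast
  then obtain c where c: "c \<in> I" by blast
  then have "c \<in> U" using components_S1_subset[OF I] by blast
  then obtain z where z: "c = circ z" "z \<in> circ -` U" using U by (auto simp: openin_S1)
  have W: "open (circ -` U)" using U by (simp add: openin_S1)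
  obtain w where w: "w \<notin> circ -` U" using not_top_lift[OF U] by blast
  obtain p q where pq: "p < z" "z < q" "q \<le> p + pi" "p \<notin> circ -` U" "q \<notin> circ -` U" "{p<..<q} \<subseteq> circ -` U"
    using periodic_gap[OF W periodic_vimage z(2) w] .
  have "circ ` {p<..<q} \<in> components_S1 U" using components_S1_gap[OF U(1) _ pq(4,5,6)] pq by simp
  moreover have "c \<in> circ ` {p<..<q}" using pq z by auto
  ultimately have "I = circ ` {p<..<q}" using components_S1_disjoint I c by blast
  moreover have "p < q" using pq by simp
  ultimately show thesis using that[of p q] pq by blast
qed

lemma components_S1_interval:
  assumes "openin S1 U" "U \<noteq> topspace S1" "I \<in> components_S1 U" shows "circle_interval I"
proof -
  obtain p q where pq: "p < q" "p \<notin> circ -` U" "I = circ ` {p<..<q}" using components_S1_form[OF assms] by metis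
  have "circ p \<notin> I" using components_S1_subset[OF assms(3)] pq by auto
  then have "I \<noteq> topspace S1" by (auto simp: topspace_S1)
  then show ?thesis unfolding circle_interval_def pq(3)
    using pq open_circ_image connectedin_circ_image by simp
qed

section \<open>The region covered by noncrossing arcs\<close>

definition covered :: "(real \<times> real) set \<Rightarrow> real set" where
  "covered A = {z. \<exists>x y. (x, y) \<in> A \<and> x < z \<and> z < y}"

lemma covered_iff: "z \<in> covered A \<longleftrightarrow> (\<exists>x y. (x, y) \<in> A \<and> x < z \<and> z < y)"
  by (simp add: covered_def)

lemma open_covered: "open (covered A)"
proof -
  have "covered A = (\<Union>a\<in>A. {fst a<..<snd a})"
  proof (intro set_eqI iffI)
    fix z assume "z \<in> covered A"
    then obtain x y where "(x, y) \<in> A" "x < z" "z < y" unfolding covered_iff by blast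
    then show "z \<in> (\<Union>a\<in>A. {fst a<..<snd a})" by (intro UN_I[of "(x, y)"]) simp_all
  next
    fix z assume "z \<in> (\<Union>a\<in>A. {fst a<..<snd a})"
    then obtain a where "a \<in> A" "fst a < z" "z < snd a" by auto
    then show "z \<in> covered A" unfolding covered_iff by (intro exI[of _ "fst a"] exI[of _ "snd a"]) simp
  qed
  then show ?thesis by auto
qed

definition shift_closed :: "(real \<times> real) set \<Rightarrow> bool" where
  "shift_closed A \<longleftrightarrow> (\<forall>x y. \<forall>k::int. (x, y) \<in> A \<longrightarrow> (x + of_int k * pi, y + of_int k * pi) \<in> A)"

lemma periodic_covered: assumes "shift_closed A" shows "periodic (covered A)"
proof -
  have 1: "z + of_int k * pi \<in> covered A" if z: "z \<in> covered A" for z and k :: int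
  proof -
    obtain x y where xy: "(x, y) \<in> A" "x < z" "z < y" using z by (auto simp: covered_iff)
    then have "(x + of_int k * pi, y + of_int k * pi) \<in> A" using assms by (simp add: shift_closed_def)
    moreover have "x + of_int k * pi < z + of_int k * pi" "z + of_int k * pi < y + of_int k * pi" using xy by simp_all
    ultimately show ?thesis unfolding covered_iff by blast
  qed
  have "z \<in> covered A" if z: "z + of_int k * pi \<in> covered A" for z and k :: int
    using 1[OF z, of "- k"] by simp
  with 1 show ?thesis unfolding periodic_def by blast
qed

text \<open>Compactness in the form of a supremum argument, over the right ends t that a single arc
  reaches from a point left of a. An arc around the supremum s overlaps such an arc; since they do
  not cross, one of the two contains both a and s.\<close>

lemma laminar_compact:
  assumes lam: "\<And>x y x' y'. (x, y) \<in> A \<Longrightarrow> (x', y') \<in> A \<Longrightarrow> \<not> crosses x y x' y'"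
    and ab: "a \<le> b" "{a..b} \<subseteq> covered A"
  shows "\<exists>x y. (x, y) \<in> A \<and> x < a \<and> b < y"
proof (rule ccontr)
  assume n: "\<not> ?thesis"
  define S where "S = {t. a \<le> t \<and> t \<le> b \<and> (\<exists>x y. (x, y) \<in> A \<and> x < a \<and> t < y)}"
  have "a \<in> covered A" using ab by auto
  then have aS: "a \<in> S" using ab(1) unfolding S_def covered_iff by simp
  have bdd: "bdd_above S" by (rule bdd_aboveI[of _ b]) (auto simp: S_def)
  define s where "s = Sup S"
  have "t \<le> b" if "t \<in> S" for t using that by (simp add: S_def)
  then have s: "a \<le> s" "s \<le> b" unfolding s_def using cSup_upper[OF aS bdd] cSup_least[of S b] aS by blast+
  then have "s \<in> covered A" using ab by auto
  then obtain c d where cd: "(c, d) \<in> A" "c < s" "s < d" unfolding covered_iff by blast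
  obtain t where t: "t \<in> S" "c < t" using less_cSupD[of S c] aS cd(2) unfolding s_def by blast
  obtain x y where xy: "(x, y) \<in> A" "x < a" "t < y" using t(1) unfolding S_def by blast
  have "\<exists>x y. (x, y) \<in> A \<and> x < a \<and> s < y"
  proof (cases "d \<le> y")
    case True
    then show ?thesis using xy cd by (intro exI[of _ x] exI[of _ y]) simp
  next
    case False
    then have "c \<le> x" using lam[OF xy(1) cd(1)] t(2) xy(3) unfolding crosses_def by linarith
    then show ?thesis using xy cd by (intro exI[of _ c] exI[of _ d]) simp
  qed
  then obtain v w where vw: "(v, w) \<in> A" "v < a" "s < w" by blast
  have wb: "w \<le> b" using n vw(1,2) not_le by blast
  \<comment> \<open>The arc (v, w) reaches strictly beyond s, and w \<le> b by assumption, so the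
    midpoint is an element of S larger than its supremum.\<close>
  have "(s + w) / 2 \<in> S" unfolding S_def
    by (intro CollectI conjI exI[of _ v] exI[of _ w]) (use vw s wb in simp_all)
  from cSup_upper[OF this bdd] show False using vw by (simp add: s_def)
qed

text \<open>Here \<open>A\<close> consists of the lifts to the real line of a set of arcs, and \<open>Z\<close> of the lifts of a set
  of points with signs.\<close>

definition noncrossing :: "(real \<times> real) set \<Rightarrow> (bool \<times> real) set \<Rightarrow> bool" where
  "noncrossing A Z \<longleftrightarrow> (\<forall>x y x' y'. (x, y) \<in> A \<longrightarrow> (x', y') \<in> A \<longrightarrow> \<not> crosses x y x' y') \<and>
     (\<forall>e z. (e, z) \<in> Z \<longrightarrow> z \<notin> covered A) \<and>
     (\<forall>e z e' z'. (e, z) \<in> Z \<longrightarrow> (e', z') \<in> Z \<longrightarrow> e = e' \<or> circ z = circ z')"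

definition uncrossed :: "(real \<times> real) set \<Rightarrow> real \<Rightarrow> real \<Rightarrow> bool" where
  "uncrossed A x y \<longleftrightarrow> (\<forall>x' y'. (x', y') \<in> A \<longrightarrow> \<not> crosses x y x' y' \<and> \<not> crosses x' y' x y)"

definition point_free :: "(bool \<times> real) set \<Rightarrow> real \<Rightarrow> real \<Rightarrow> bool" where
  "point_free Z x y \<longleftrightarrow> (\<forall>e z. (e, z) \<in> Z \<longrightarrow> \<not> (x < z \<and> z < y))"

definition sign_compatible :: "(bool \<times> real) set \<Rightarrow> bool \<Rightarrow> real \<Rightarrow> bool" where
  "sign_compatible Z e z \<longleftrightarrow> (\<forall>e' z'. (e', z') \<in> Z \<longrightarrow> e = e' \<or> circ z = circ z')"

text \<open>Maximality in terms of lifts, see \<open>lamination_iff\<close>. It suffices to test one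
  further arc or signed point at a time, because compatibility is a condition on pairs.\<close>

definition saturated :: "(real \<times> real) set \<Rightarrow> (bool \<times> real) set \<Rightarrow> bool" where
  "saturated A Z \<longleftrightarrow> (\<forall>x y. x < y \<and> y < x + pi \<and> uncrossed A x y \<and> point_free Z x y \<longrightarrow> (x, y) \<in> A) \<and>
     (\<forall>e z. z \<notin> covered A \<and> sign_compatible Z e z \<longrightarrow> (e, z) \<in> Z)"

lemma covered_ne_UNIV:
  assumes "noncrossing A Z" "\<And>x y. (x, y) \<in> A \<Longrightarrow> y < x + pi" shows "\<exists>w. w \<notin> covered A"
proof (rule ccontr)
  assume "\<not> ?thesis"
  then have sub: "{0..pi} \<subseteq> covered A" by auto
  have lam: "\<And>x y x' y'. (x, y) \<in> A \<Longrightarrow> (x', y') \<in> A \<Longrightarrow> \<not> crosses x y x' y'"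
    using conjunct1[OF assms(1)[unfolded noncrossing_def]] by blast
  obtain x y where "(x, y) \<in> A" "x < 0" "pi < y"
    using laminar_compact[OF lam pi_ge_zero sub] by blast
  then show False using assms(2)[of x y] by simp
qed

lemma uncrossed_endpoints: "x \<notin> covered A \<Longrightarrow> y \<notin> covered A \<Longrightarrow> uncrossed A x y"
  unfolding uncrossed_def covered_iff crosses_def by fastforce

text \<open>If one sign occurs, maximality puts it at all uncovered points. If both occur, they sit
  at the same point p, and so does every other singular object; a third uncovered point would leave
  room for a further arc.\<close>

lemma sing_dichotomy:
  assumes ok: "noncrossing A Z" and mx: "saturated A Z" and t: "shift_closed A"
    and proper: "\<And>x y. (x, y) \<in> A \<Longrightarrow> x < y \<and> y < x + pi"
    and Zc: "\<And>e z z'. (e, z) \<in> Z \<Longrightarrow> circ z = circ z' \<Longrightarrow> (e, z') \<in> Z"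
  shows "(\<exists>e. Z = {(e, z) |z. z \<notin> covered A} \<and> (\<exists>z w. z \<notin> covered A \<and> w \<notin> covered A \<and> circ z \<noteq> circ w)) \<or>
    (\<exists>p. p \<notin> covered A \<and> Z = {(e, z) |e z. circ z = circ p} \<and> card (circ ` (- covered A)) \<le> 2 \<and> finite (circ ` (- covered A)))"
proof -
  let ?W = "covered A"
  note per = periodic_circ[OF periodic_covered[OF t]]
  obtain w0 where w0: "w0 \<notin> ?W" using covered_ne_UNIV[OF ok] proper by blast
  have mZ: "(e, z) \<in> Z" if "z \<notin> ?W" "sign_compatible Z e z" for e z using mx that by (auto simp: saturated_def)
  have ZW: "z \<notin> ?W" if "(e, z) \<in> Z" for e z using ok that by (auto simp: noncrossing_def)
  have same: "e = e' \<or> circ z = circ z'" if "(e, z) \<in> Z" "(e', z') \<in> Z" for e z e' z'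
    using ok that unfolding noncrossing_def by blast
  have "\<exists>e z. (e, z) \<in> Z"
  proof (rule ccontr)
    assume n: "\<nexists>e z. (e, z) \<in> Z"
    then have "sign_compatible Z True w0" by (auto simp: sign_compatible_def)
    then show False using mZ w0 n by blast
  qed
  then obtain e p where ep: "(e, p) \<in> Z" by blast
  have pW: "p \<notin> ?W" using ZW ep by blast
  show ?thesis
  proof (cases "\<exists>w. (\<not> e, w) \<in> Z")
    case False
    then have one: "e' = e" if "(e', z) \<in> Z" for e' z using that by (cases "e' = e") auto
    have all: "Z = {(e, z) |z. z \<notin> ?W}"
    proof (intro set_eqI iffI)
      fix c assume c: "c \<in> Z"
      then have "(fst c, snd c) \<in> Z" by simp
      then have "fst c = e" "snd c \<notin> ?W" using one ZW by blast+
      then show "c \<in> {(e, z) |z. z \<notin> ?W}" by (intro CollectI exI[of _ "snd c"]) (simp add: prod_eq_iff)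
    next
      fix c assume "c \<in> {(e, z) |z. z \<notin> ?W}"
      then obtain z where z: "c = (e, z)" "z \<notin> ?W" by blast
      have "sign_compatible Z e z" unfolding sign_compatible_def using one by blast
      then show "c \<in> Z" using mZ z by simp
    qed
    \<comment> \<open>If p were the only occupied point of the circle, the object of opposite sign
      at p could be added; hence a second uncovered point exists.\<close>
    have "\<not> sign_compatible Z (\<not> e) p" using mZ[OF pW] False by blast
    then obtain z where "(e, z) \<in> Z" "circ p \<noteq> circ z" using one unfolding sign_compatible_def by blast
    then show ?thesis using all pW ZW by blast
  next
    case True
    then obtain w where w: "(\<not> e, w) \<in> Z" by blast
    then have wp: "circ w = circ p" using same[OF ep w] by auto
    then have w': "(\<not> e, p) \<in> Z" using Zc w by blast
    have all: "circ z = circ p" if "(e', z) \<in> Z" for e' z using same[OF that ep] same[OF that w'] by auto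
    then have Zeq: "Z = {(e, z) |e z. circ z = circ p}"
    proof (intro set_eqI iffI)
      fix c :: "bool \<times> real" assume c: "c \<in> Z"
      then have "(fst c, snd c) \<in> Z" by simp
      then have "circ (snd c) = circ p" by (rule all)
      then show "c \<in> {(e, z) |e z. circ z = circ p}"
        by (intro CollectI exI[of _ "fst c"] exI[of _ "snd c"]) simp
    next
      fix c :: "bool \<times> real" assume "c \<in> {(e, z) |e z. circ z = circ p}"
      then obtain e' :: bool and z where z: "c = (e', z)" "circ z = circ p" by blast
      have "(e', p) \<in> Z" using ep w' by (cases "e' = e") auto
      then show "c \<in> Z" using Zc z by simp
    qed
    have two: "circ q = circ r" if q: "q \<notin> ?W" "circ q \<noteq> circ p" and r: "r \<notin> ?W" "circ r \<noteq> circ p" for q r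
    proof (rule ccontr)
      assume ne: "circ q \<noteq> circ r"
      have lift: "\<exists>q'. circ q' = circ q \<and> p < q' \<and> q' < p + pi" if "circ q \<noteq> circ p" for q
      proof -
        obtain k :: int where k: "p \<le> q + of_int k * pi" "q + of_int k * pi < p + pi" using shift_into by blast
        then show ?thesis using that by (intro exI[of _ "q + of_int k * pi"]) (auto simp: less_le)
      qed
      \<comment> \<open>All singular objects sit at translates of p, and none of these lies strictly
        between p and p + pi. So the arc (p, r), which joins uncovered points, could be added, but
        it would cover q.\<close>
      have main: False if q: "circ q \<noteq> circ p" "q \<notin> ?W" "p < q" and r: "r \<notin> ?W" "q < r" "r < p + pi" for q r
      proof -
        have "uncrossed A p r" by (rule uncrossed_endpoints[OF pW r(1)])
        moreover have "point_free Z p r" unfolding point_free_def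
        proof (intro allI impI notI)
          fix e z assume "(e, z) \<in> Z" and z: "p < z \<and> z < r"
          then have "circ p = circ z" using all by metis
          then obtain k :: int where k: "z = p + of_int k * pi" using circ_eq_iff by blast
          have "\<bar>of_int k * pi\<bar> < pi" using z r unfolding k by linarith
          then have "k = 0" by (rule int_pi_eq_zero)
          then show False using k z by simp
        qed
        ultimately have "(p, r) \<in> A" using mx q r unfolding saturated_def by auto
        then show False using q r covered_iff by blast
      qed
      obtain q' where q': "circ q' = circ q" "p < q'" "q' < p + pi" using lift q by blast
      obtain r' where r': "circ r' = circ r" "p < r'" "r' < p + pi" using lift r by blast
      have "q' \<notin> ?W" "r' \<notin> ?W" using per q' r' q r by blast+
      moreover have "q' \<noteq> r'" using ne q' r' by auto
      ultimately show False using main[of q' r'] main[of r' q'] q' r' q r by (cases "q' < r'") auto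
    qed
    have "\<exists>c. circ ` (- ?W) \<subseteq> {circ p, c}"
    proof (cases "\<exists>q. q \<notin> ?W \<and> circ q \<noteq> circ p")
      case True
      then obtain q where "q \<notin> ?W" "circ q \<noteq> circ p" by blast
      then have "circ ` (- ?W) \<subseteq> {circ p, circ q}" using two by auto
      then show ?thesis by blast
    qed auto
    then obtain c where c: "circ ` (- ?W) \<subseteq> {circ p, c}" by blast
    have "card (circ ` (- ?W)) \<le> card {circ p, c}" by (rule card_mono[OF _ c]) simp
    also have "\<dots> \<le> 2" by (simp add: card_insert_if)
    finally show ?thesis using Zeq pW finite_subset[OF c] by blast
  qed
qed

section \<open>Laminations\<close>

lemma crosses_shift: "crosses (a + of_int k * pi) (c + of_int k * pi) (a' + of_int k * pi) (c' + of_int k * pi) \<longleftrightarrow> crosses a c a' c'"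
  by (simp add: crosses_def)

lemma not_crosses_shift_self:
  assumes "y < x + pi" shows "\<not> crosses x y (x + of_int k * pi) (y + of_int k * pi)"
proof
  assume c: "crosses x y (x + of_int k * pi) (y + of_int k * pi)"
  then have "\<bar>of_int k * pi\<bar> < pi" using assms unfolding crosses_def by linarith
  then have "k = 0" by (rule int_pi_eq_zero)
  then show False using c by (simp add: crosses_def)
qed

lemma noncrossingD:
  assumes "noncrossing A Z"
  shows "(x, y) \<in> A \<Longrightarrow> (x', y') \<in> A \<Longrightarrow> \<not> crosses x y x' y'"
    "(e, z) \<in> Z \<Longrightarrow> z \<notin> covered A"
    "(e, z) \<in> Z \<Longrightarrow> (e', z') \<in> Z \<Longrightarrow> e = e' \<or> circ z = circ z'"
  using conjunct1[OF assms[unfolded noncrossing_def]] conjunct1[OF conjunct2[OF assms[unfolded noncrossing_def]]]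
    conjunct2[OF conjunct2[OF assms[unfolded noncrossing_def]]] by blast+

lemma saturatedD:
  assumes "saturated A Z"
  shows "x < y \<Longrightarrow> y < x + pi \<Longrightarrow> uncrossed A x y \<Longrightarrow> point_free Z x y \<Longrightarrow> (x, y) \<in> A"
    "z \<notin> covered A \<Longrightarrow> sign_compatible Z e z \<Longrightarrow> (e, z) \<in> Z"
  using conjunct1[OF assms[unfolded saturated_def], rule_format, of x y] conjunct2[OF assms[unfolded saturated_def], rule_format, of z e] by simp_all

context frob_family
begin

lemma iso_reflexive: "X \<in> P.EOb \<Longrightarrow> iso X X"
  unfolding Cpsi_SC by (rule P.iso_refl)

lemma arc_unique:
  assumes "arc X x y" "arc X x' y'" shows "\<exists>k::int. x' = x + of_int k * pi \<and> y' = y + of_int k * pi"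
  using arc_iso_iff[OF assms] iso_reflexive assms by (auto simp: arc_def)

lemma sng_unique: assumes "sng X e z" "sng X e' z'" shows "e = e'" "circ z = circ z'"
  using sng_iso_iff[OF assms] iso_reflexive assms by (auto simp: sng_def)

lemma shift_closed_arcs_of: "shift_closed (arcs_of L)"
  unfolding shift_closed_def using arcs_of_shift by blast

lemma arcs_of_mono: "L \<subseteq> L' \<Longrightarrow> arcs_of L \<subseteq> arcs_of L'" and points_of_mono: "L \<subseteq> L' \<Longrightarrow> points_of L \<subseteq> points_of L'"
  unfolding arcs_of_def points_of_def by blast+

lemma arcs_of_I: "X \<in> L \<Longrightarrow> arc X x y \<Longrightarrow> (x, y) \<in> arcs_of L" and points_of_I: "X \<in> L \<Longrightarrow> sng X e z \<Longrightarrow> (e, z) \<in> points_of L"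
  unfolding arcs_of_def points_of_def by blast+

lemma arcs_of_E: assumes "(x, y) \<in> arcs_of L" obtains X where "X \<in> L" "arc X x y"
  using assms unfolding arcs_of_def by blast

lemma points_of_E: assumes "(e, z) \<in> points_of L" obtains X where "X \<in> L" "sng X e z"
  using assms unfolding points_of_def by blast

lemma compatible_arcs_I:
  assumes "arc X x y" "uncrossed (arcs_of L) x y" "X' \<in> L" "arc X' x' y'"
  shows "compatible u E X X'" "compatible u E X' X"
proof -
  have n: "\<not> crosses x y (x' + of_int k * pi) (y' + of_int k * pi) \<and> \<not> crosses (x' + of_int k * pi) (y' + of_int k * pi) x y" for k :: int
    using assms(2) arcs_of_shift[OF arcs_of_I[OF assms(3,4)]] unfolding uncrossed_def by blast
  then show "compatible u E X X'" using compatible_arc_arc[OF assms(1,4)] by blast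
  have "\<not> crosses x' y' (x + of_int k * pi) (y + of_int k * pi) \<and> \<not> crosses (x + of_int k * pi) (y + of_int k * pi) x' y'" for k :: int
    using n[of "- k"] crosses_shift[of "x' - of_int k * pi" k "y' - of_int k * pi" x y] crosses_shift[of x k y "x' - of_int k * pi" "y' - of_int k * pi"]
    by simp
  then show "compatible u E X' X" using compatible_arc_arc[OF assms(4,1)] by blast
qed

lemma compatible_arc_sng_I:
  assumes "arc X x y" "sng Y e z" "\<And>z'. circ z = circ z' \<Longrightarrow> \<not> (x < z' \<and> z' < y)"
  shows "compatible u E X Y" "compatible u E Y X"
proof -
  have "\<not> (x < z + of_int k * pi \<and> z + of_int k * pi < y)" for k :: int
    by (rule assms(3)) simp
  then show "compatible u E X Y" "compatible u E Y X" using compatible_arc_sng[OF assms(1,2)] by blast+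
qed

text \<open>For distinct members this translates compatibility. \<open>noncrossing\<close> also
  compares the lifts of one member with each other; these never cross, as the arc is shorter than
  pi.\<close>

lemma compatible_family_iff:
  "compatible_family u E L \<longleftrightarrow> (\<forall>X\<in>L. (\<exists>x y. arc X x y) \<or> (\<exists>e z. sng X e z)) \<and>
     (\<forall>X\<in>L. \<forall>Y\<in>L. X \<noteq> Y \<longrightarrow> \<not> iso X Y) \<and> noncrossing (arcs_of L) (points_of L)"
proof
  assume c: "compatible_family u E L"
  then have cl: "\<forall>X\<in>L. (\<exists>x y. arc X x y) \<or> (\<exists>e z. sng X e z)"
    unfolding compatible_family_def indecomposable_arc_sng by blast
  have pw: "compatible u E X Y" "\<not> iso X Y" if "X \<in> L" "Y \<in> L" "X \<noteq> Y" for X Y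
    using c that unfolding compatible_family_def pairwise_def by blast+
  have "noncrossing (arcs_of L) (points_of L)"
    unfolding noncrossing_def
  proof (intro conjI allI impI)
    fix x y x' y' assume "(x, y) \<in> arcs_of L" "(x', y') \<in> arcs_of L"
    then obtain X X' where X: "X \<in> L" "arc X x y" "X' \<in> L" "arc X' x' y'" by (elim arcs_of_E)
    show "\<not> crosses x y x' y'"
    proof (cases "X = X'")
      case True
      then obtain k :: int where k: "x' = x + of_int k * pi" "y' = y + of_int k * pi" using arc_unique X by blast
      have "y < x + pi" using X by (simp add: arc_def)
      then show ?thesis unfolding k by (rule not_crosses_shift_self)
    next
      case False
      then have "compatible u E X X'" using pw X by blast
      then have "\<not> crosses x y (x' + of_int 0 * pi) (y' + of_int 0 * pi)" using compatible_arc_arc[OF X(2,4)] by blast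
      then show ?thesis by simp
    qed
  next
    fix e z assume "(e, z) \<in> points_of L"
    then obtain Y where Y: "Y \<in> L" "sng Y e z" by (elim points_of_E)
    show "z \<notin> covered (arcs_of L)"
    proof
      assume "z \<in> covered (arcs_of L)"
      then obtain x y where xy: "(x, y) \<in> arcs_of L" "x < z" "z < y" unfolding covered_iff by blast
      then obtain X where X: "X \<in> L" "arc X x y" by (elim arcs_of_E)
      then have "X \<noteq> Y" using arc_not_sng Y by blast
      then have "compatible u E X Y" using pw X Y by blast
      then have "\<not> (x < z + of_int 0 * pi \<and> z + of_int 0 * pi < y)" using compatible_arc_sng(1)[OF X(2) Y(2)] by blast
      then show False using xy by simp
    qed
  next
    fix e z e' z' assume "(e, z) \<in> points_of L" "(e', z') \<in> points_of L"
    then obtain X Y where X: "X \<in> L" "sng X e z" "Y \<in> L" "sng Y e' z'" by (elim points_of_E)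
    show "e = e' \<or> circ z = circ z'"
    proof (cases "X = Y")
      case True then show ?thesis using sng_unique X by blast
    next
      case False
      then show ?thesis using pw(1)[OF X(1,3)] compatible_sng_sng[OF X(2,4)] by blast
    qed
  qed
  then show "(\<forall>X\<in>L. (\<exists>x y. arc X x y) \<or> (\<exists>e z. sng X e z)) \<and>
     (\<forall>X\<in>L. \<forall>Y\<in>L. X \<noteq> Y \<longrightarrow> \<not> iso X Y) \<and> noncrossing (arcs_of L) (points_of L)" using cl pw(2) by blast
next
  assume "(\<forall>X\<in>L. (\<exists>x y. arc X x y) \<or> (\<exists>e z. sng X e z)) \<and>
     (\<forall>X\<in>L. \<forall>Y\<in>L. X \<noteq> Y \<longrightarrow> \<not> iso X Y) \<and> noncrossing (arcs_of L) (points_of L)"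
  then have cl: "\<And>X. X \<in> L \<Longrightarrow> (\<exists>x y. arc X x y) \<or> (\<exists>e z. sng X e z)"
    and ni: "\<And>X Y. X \<in> L \<Longrightarrow> Y \<in> L \<Longrightarrow> X \<noteq> Y \<Longrightarrow> \<not> iso X Y" and ok: "noncrossing (arcs_of L) (points_of L)" by blast+
  have as: "compatible u E X Y" "compatible u E Y X" if X: "X \<in> L" "arc X x y" and Y: "Y \<in> L" "sng Y e z" for X Y x y e z
  proof -
    have "\<not> (x < z' \<and> z' < y)" if zz: "circ z = circ z'" for z'
      using noncrossingD(2)[OF ok points_of_circ[OF points_of_I[OF Y] zz]] arcs_of_I[OF X] unfolding covered_iff by blast
    then show "compatible u E X Y" "compatible u E Y X" using compatible_arc_sng_I[OF X(2) Y(2)] by blast+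
  qed
  have "compatible u E X Y" if X: "X \<in> L" and Y: "Y \<in> L" for X Y
    using cl[OF X] cl[OF Y]
  proof (elim disjE exE)
    fix x y x' y' assume a: "arc X x y" "arc Y x' y'"
    have "uncrossed (arcs_of L) x y" unfolding uncrossed_def using noncrossingD(1)[OF ok] arcs_of_I[OF X a(1)] by blast
    then show ?thesis using compatible_arcs_I(1)[OF a(1) _ Y a(2)] by blast
  next
    fix e z e' z' assume a: "sng X e z" "sng Y e' z'"
    then show ?thesis using compatible_sng_sng[OF a] noncrossingD(3)[OF ok points_of_I[OF X a(1)] points_of_I[OF Y a(2)]] by blast
  qed (use as X Y in blast)+
  then show "compatible_family u E L"
    unfolding compatible_family_def indecomposable_arc_sng pairwise_def using cl ni by blast
qed

lemma compatible_familyD: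
  assumes "compatible_family u E L"
  shows "X \<in> L \<Longrightarrow> (\<exists>x y. arc X x y) \<or> (\<exists>e z. sng X e z)"
    "X \<in> L \<Longrightarrow> Y \<in> L \<Longrightarrow> X \<noteq> Y \<Longrightarrow> \<not> iso X Y" "noncrossing (arcs_of L) (points_of L)"
  using conjunct1[OF assms[unfolded compatible_family_iff], rule_format, of X]
    conjunct1[OF conjunct2[OF assms[unfolded compatible_family_iff]], rule_format, of X Y]
    conjunct2[OF conjunct2[OF assms[unfolded compatible_family_iff]]] by simp_all

lemma sublaminationD:
  assumes "sublamination u E I T"
  shows "circle_interval I" "compatible_family u E T" "T \<subseteq> regular_objects_in u E I"
    "compatible_family u E T' \<Longrightarrow> T' \<subseteq> regular_objects_in u E I \<Longrightarrow> T \<subseteq> T' \<Longrightarrow> T' = T"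
  using assms[unfolded sublamination_def] by simp_all

lemma compatible_family_subset: "compatible_family u E L \<Longrightarrow> L' \<subseteq> L \<Longrightarrow> compatible_family u E L'"
  unfolding compatible_family_def using pairwise_subset by blast

section \<open>Adding single objects; maximality as saturation\<close>

lemma insert_compatible:
  assumes L: "compatible_family u E L" and ind: "indecomposable (Cpsi u E pi) X"
    and "\<And>Y. Y \<in> L \<Longrightarrow> compatible u E X Y \<and> compatible u E Y X \<and> \<not> iso X Y \<and> \<not> iso Y X"
  shows "compatible_family u E (insert X L)"
  using assms unfolding compatible_family_def pairwise_insert by blast

lemma insert_arc:
  assumes L: "compatible_family u E L" and xy: "x < y" "y < x + pi" and no: "uncrossed (arcs_of L) x y" "point_free (points_of L) x y"
    and new: "(x, y) \<notin> arcs_of L"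
  shows "compatible_family u E (insert (SE x y) L)" "SE x y \<notin> L"
proof -
  have a: "arc (SE x y) x y" using SE_arc xy by blast
  show "SE x y \<notin> L" using arcs_of_I[OF _ a] new by blast
  show "compatible_family u E (insert (SE x y) L)"
  proof (rule insert_compatible[OF L])
    show "indecomposable (Cpsi u E pi) (SE x y)" using a indecomposable_arc_sng by blast
    fix Y assume Y: "Y \<in> L"
    then have "(\<exists>x y. arc Y x y) \<or> (\<exists>e z. sng Y e z)" using L unfolding compatible_family_iff by blast
    then show "compatible u E (SE x y) Y \<and> compatible u E Y (SE x y) \<and> \<not> iso (SE x y) Y \<and> \<not> iso Y (SE x y)"
    proof (elim disjE exE)
      fix x' y' assume Y': "arc Y x' y'"
      have "\<not> iso Y (SE x y)"
      proof
        assume "iso Y (SE x y)"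
        then have "arc Y x y" using Y' xy by (simp add: arc_def)
        then show False using arcs_of_I Y new by blast
      qed
      moreover have "Y \<in> P.EOb" using Y' by (simp add: arc_def)
      then have "\<not> iso (SE x y) Y" using iso_symmetric[OF SE_EOb[OF xy]] \<open>\<not> iso Y (SE x y)\<close> by blast
      ultimately show ?thesis using compatible_arcs_I[OF a no(1) Y Y'] by blast
    next
      fix e z assume s: "sng Y e z"
      have "\<not> (x < z' \<and> z' < y)" if "circ z = circ z'" for z'
        using no(2) points_of_circ[OF points_of_I[OF Y s] that] unfolding point_free_def by blast
      then show ?thesis using compatible_arc_sng_I[OF a s] arc_sng_not_iso[OF a s] by blast
    qed
  qed
qed

lemma insert_sng:
  assumes L: "compatible_family u E L" and no: "z \<notin> covered (arcs_of L)" "sign_compatible (points_of L) e z" and new: "(e, z) \<notin> points_of L"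
  shows "compatible_family u E (insert (Z_obj e z) L)" "Z_obj e z \<notin> L"
proof -
  note s = Z_sng[of e z]
  show "Z_obj e z \<notin> L" using points_of_I[OF _ s] new by blast
  show "compatible_family u E (insert (Z_obj e z) L)"
  proof (rule insert_compatible[OF L])
    show "indecomposable (Cpsi u E pi) (Z_obj e z)" using s indecomposable_arc_sng by blast
    fix Y assume Y: "Y \<in> L"
    then have "(\<exists>x y. arc Y x y) \<or> (\<exists>e z. sng Y e z)" using L unfolding compatible_family_iff by blast
    then show "compatible u E (Z_obj e z) Y \<and> compatible u E Y (Z_obj e z) \<and> \<not> iso (Z_obj e z) Y \<and> \<not> iso Y (Z_obj e z)"
    proof (elim disjE exE)
      fix x y assume a: "arc Y x y"
      have "\<not> (x < z' \<and> z' < y)" if zz: "circ z = circ z'" for z'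
      proof
        assume "x < z' \<and> z' < y"
        then have "z' \<in> covered (arcs_of L)" using arcs_of_I[OF Y a] unfolding covered_iff by blast
        then show False using no(1) periodic_circ[OF periodic_covered[OF shift_closed_arcs_of] zz] by blast
      qed
      then show ?thesis using compatible_arc_sng_I[OF a s] arc_sng_not_iso[OF a s] by blast
    next
      fix e' z' assume s': "sng Y e' z'"
      have or: "e = e' \<or> circ z = circ z'" using no(2) points_of_I[OF Y s'] unfolding sign_compatible_def by blast
      have "\<not> (e = e' \<and> circ z = circ z')"
      proof
        assume "e = e' \<and> circ z = circ z'"
        then have "(e, z) \<in> points_of L" using points_of_circ[OF points_of_I[OF Y s'], of z] by simp
        then show False using new by blast
      qed
      then show ?thesis
        using or compatible_sng_sng[OF s s'] compatible_sng_sng[OF s' s] sng_iso_iff[OF s s'] sng_iso_iff[OF s' s] by auto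
    qed
  qed
qed

text \<open>A missing arc or point is realized by SE or \<open>Z_obj\<close> and could be added.
  Conversely, an object X of a larger family contributes an arc or a point that saturation already
  finds in L, so X is isomorphic to a member of L and cannot be a new one.\<close>

lemma lamination_iff: "lamination u E L \<longleftrightarrow> compatible_family u E L \<and> saturated (arcs_of L) (points_of L)"
proof
  assume l: "lamination u E L"
  then have c: "compatible_family u E L" by (simp add: lamination_def)
  have mx: "X \<in> L" if "compatible_family u E (insert X L)" for X
  proof -
    have "insert X L = L" using conjunct2[OF l[unfolded lamination_def], rule_format, of "insert X L"] that by auto
    then show ?thesis by blast
  qed
  have "saturated (arcs_of L) (points_of L)"
    unfolding saturated_def
  proof (intro conjI allI impI)
    fix x y assume xy: "x < y \<and> y < x + pi \<and> uncrossed (arcs_of L) x y \<and> point_free (points_of L) x y"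
    then have n: "uncrossed (arcs_of L) x y" "point_free (points_of L) x y" "x < y" "y < x + pi" by simp_all
    show "(x, y) \<in> arcs_of L"
    proof (rule ccontr)
      assume "(x, y) \<notin> arcs_of L"
      from insert_arc[OF c n(3,4,1,2) this] mx[of "SE x y"] show False by simp
    qed
  next
    fix e z assume "z \<notin> covered (arcs_of L) \<and> sign_compatible (points_of L) e z"
    then have n: "z \<notin> covered (arcs_of L)" "sign_compatible (points_of L) e z" by simp_all
    show "(e, z) \<in> points_of L"
    proof (rule ccontr)
      assume "(e, z) \<notin> points_of L"
      from insert_sng[OF c n this] mx[of "Z_obj e z"] show False by simp
    qed
  qed
  with c show "compatible_family u E L \<and> saturated (arcs_of L) (points_of L)" by blast
next
  assume a: "compatible_family u E L \<and> saturated (arcs_of L) (points_of L)"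
  have "L' = L" if L': "compatible_family u E L'" "L \<subseteq> L'" for L'
  proof (rule ccontr)
    assume "L' \<noteq> L"
    then obtain X where X: "X \<in> L'" "X \<notin> L" using L' by blast
    have ni: "\<not> iso X Y" if "Y \<in> L" for Y
      using compatible_familyD(2)[OF L'(1) X(1), of Y] L'(2) X(2) that by auto
    note ok = compatible_familyD(3)[OF L'(1)]
    from compatible_familyD(1)[OF L'(1) X(1)] show False
    proof (elim disjE exE)
      fix x y assume x: "arc X x y"
      then have xy: "x < y" "y < x + pi" by (auto simp: arc_def)
      have "uncrossed (arcs_of L) x y"
        unfolding uncrossed_def using noncrossingD(1)[OF ok arcs_of_I[OF X(1) x]] noncrossingD(1)[OF ok _ arcs_of_I[OF X(1) x]] subsetD[OF arcs_of_mono[OF L'(2)]] by simp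
      moreover have "point_free (points_of L) x y"
        unfolding point_free_def using noncrossingD(2)[OF ok subsetD[OF points_of_mono[OF L'(2)]], unfolded covered_iff] arcs_of_I[OF X(1) x] by blast
      ultimately have "(x, y) \<in> arcs_of L" using saturatedD(1)[OF conjunct2[OF a]] xy by simp
      then obtain Y where Y: "Y \<in> L" "arc Y x y" by (elim arcs_of_E)
      have "iso X Y" using arc_iso_iff[OF x Y(2)] by (intro iffD2[OF arc_iso_iff[OF x Y(2)]] exI[of _ 0]) simp
      then show False using ni Y by blast
    next
      fix e z assume z: "sng X e z"
      have "z \<notin> covered (arcs_of L)"
        using noncrossingD(2)[OF ok points_of_I[OF X(1) z]] arcs_of_mono[OF L'(2)] unfolding covered_iff by blast
      moreover have "sign_compatible (points_of L) e z"
        unfolding sign_compatible_def using noncrossingD(3)[OF ok points_of_I[OF X(1) z]] points_of_mono[OF L'(2)] by blast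
      ultimately have "(e, z) \<in> points_of L" using saturatedD(2)[OF conjunct2[OF a]] by simp
      then obtain Y where Y: "Y \<in> L" "sng Y e z" by (elim points_of_E)
      then show False using ni sng_iso_iff[OF z Y(2)] by blast
    qed
  qed
  then show "lamination u E L" unfolding lamination_def using conjunct1[OF a] by simp
qed

lemma regular_objects_in_arc: "arc X x y \<Longrightarrow> X \<in> regular_objects_in u E I \<longleftrightarrow> {x<..<y} \<subseteq> circ -` I"
proof -
  assume a: "arc X x y"
  then have "regular u E X" using regular_arc by blast
  then show ?thesis unfolding regular_objects_in_def supp_arc[OF a] circ_image_subset[symmetric]
    using supp_arc[OF a] by simp
qed

lemma regular_objects_in_iff:
  "X \<in> regular_objects_in u E I \<longleftrightarrow> (\<exists>x y. arc X x y \<and> {x<..<y} \<subseteq> circ -` I)"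
proof
  assume X: "X \<in> regular_objects_in u E I"
  then have "regular u E X" by (simp add: regular_objects_in_def)
  then obtain x y where x: "arc X x y" using regular_arc by blast
  then have "{x<..<y} \<subseteq> circ -` I" using regular_objects_in_arc X by blast
  with x show "\<exists>x y. arc X x y \<and> {x<..<y} \<subseteq> circ -` I" by blast
next
  assume "\<exists>x y. arc X x y \<and> {x<..<y} \<subseteq> circ -` I"
  then show "X \<in> regular_objects_in u E I" using regular_objects_in_arc by blast
qed

lemma points_of_regular: "T \<subseteq> regular_objects_in u E I \<Longrightarrow> points_of T = {}"
proof -
  assume T: "T \<subseteq> regular_objects_in u E I"
  have "\<not> sng X e z" if "X \<in> T" for X e z using T that regular_objects_in_iff arc_not_sng by blast
  then show ?thesis unfolding points_of_def by blast
qed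

text \<open>The analogue of \<open>lamination_iff\<close> for regular objects supported in I; since
  no points are present, only crossings with arcs have to be avoided.\<close>

lemma sublamination_iff:
  "sublamination u E I T \<longleftrightarrow> circle_interval I \<and> compatible_family u E T \<and> T \<subseteq> regular_objects_in u E I \<and>
     (\<forall>x y. x < y \<and> y < x + pi \<and> {x<..<y} \<subseteq> circ -` I \<and> uncrossed (arcs_of T) x y \<longrightarrow> (x, y) \<in> arcs_of T)"
proof
  assume s: "sublamination u E I T"
  note c = sublaminationD(2)[OF s] and r = sublaminationD(3)[OF s] and mx = sublaminationD(4)[OF s]
  have "(x, y) \<in> arcs_of T" if xy: "x < y" "y < x + pi" "{x<..<y} \<subseteq> circ -` I" "uncrossed (arcs_of T) x y" for x y
  proof (rule ccontr)
    assume n: "(x, y) \<notin> arcs_of T"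
    have "point_free (points_of T) x y" unfolding point_free_def using points_of_regular[OF r] by blast
    note i = insert_arc[OF c xy(1,2,4) this n]
    have "SE x y \<in> regular_objects_in u E I" using regular_objects_in_arc[OF SE_arc[OF xy(1,2)]] xy(3) by blast
    then have "insert (SE x y) T = T" using mx[OF i(1)] r by (simp add: subset_insertI)
    then show False using i(2) by blast
  qed
  then show "circle_interval I \<and> compatible_family u E T \<and> T \<subseteq> regular_objects_in u E I \<and>
     (\<forall>x y. x < y \<and> y < x + pi \<and> {x<..<y} \<subseteq> circ -` I \<and> uncrossed (arcs_of T) x y \<longrightarrow> (x, y) \<in> arcs_of T)"
    using sublaminationD(1)[OF s] c r by simp
next
  assume a: "circle_interval I \<and> compatible_family u E T \<and> T \<subseteq> regular_objects_in u E I \<and>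
     (\<forall>x y. x < y \<and> y < x + pi \<and> {x<..<y} \<subseteq> circ -` I \<and> uncrossed (arcs_of T) x y \<longrightarrow> (x, y) \<in> arcs_of T)"
  have "T' = T" if T': "compatible_family u E T'" "T' \<subseteq> regular_objects_in u E I" "T \<subseteq> T'" for T'
  proof (rule ccontr)
    assume "T' \<noteq> T"
    then obtain X where X: "X \<in> T'" "X \<notin> T" using T' by blast
    note ok = compatible_familyD(3)[OF T'(1)]
    obtain x y where x: "arc X x y" "{x<..<y} \<subseteq> circ -` I" using regular_objects_in_iff[THEN iffD1, OF subsetD[OF T'(2) X(1)]] by blast
    then have xy: "x < y" "y < x + pi" by (auto simp: arc_def)
    have "uncrossed (arcs_of T) x y"
      unfolding uncrossed_def using noncrossingD(1)[OF ok arcs_of_I[OF X(1) x(1)]] noncrossingD(1)[OF ok _ arcs_of_I[OF X(1) x(1)]] subsetD[OF arcs_of_mono[OF T'(3)]] by simp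
    then have "(x, y) \<in> arcs_of T" using a xy x by simp
    then obtain Y where Y: "Y \<in> T" "arc Y x y" by (elim arcs_of_E)
    have "iso X Y" by (intro iffD2[OF arc_iso_iff[OF x(1) Y(2)]] exI[of _ 0]) simp
    then show False using compatible_familyD(2)[OF T'(1) X(1), of Y] T'(3) X(2) Y(1) by auto
  qed
  then show "sublamination u E I T" unfolding sublamination_def using a by simp
qed

section \<open>Supports and the three cases for singular objects\<close>

lemma reg_support_covered: "reg_support u E L = circ ` covered (arcs_of L)"
proof (intro set_eqI iffI)
  fix c assume "c \<in> reg_support u E L"
  then obtain X where X: "X \<in> L" "regular u E X" "c \<in> supp u E X" by (auto simp: reg_support_def)
  then obtain x y where x: "arc X x y" using regular_arc by blast
  then obtain z where z: "x < z" "z < y" "c = circ z" using X supp_arc by auto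
  then have "z \<in> covered (arcs_of L)" using arcs_of_I[OF X(1) x] unfolding covered_iff by blast
  then show "c \<in> circ ` covered (arcs_of L)" using z by blast
next
  fix c assume "c \<in> circ ` covered (arcs_of L)"
  then obtain z x y where z: "c = circ z" "(x, y) \<in> arcs_of L" "x < z" "z < y" unfolding covered_def by blast
  then obtain X where X: "X \<in> L" "arc X x y" by (elim arcs_of_E)
  have "c \<in> supp u E X" using supp_arc[OF X(2)] z by auto
  then show "c \<in> reg_support u E L" using X regular_arc unfolding reg_support_def by blast
qed

lemma vimage_circ_periodic: assumes "periodic W" shows "circ -` (circ ` W) = W"
proof (intro set_eqI iffI)
  fix z assume "z \<in> circ -` (circ ` W)"
  then obtain w where "w \<in> W" "circ z = circ w" by blast
  then show "z \<in> W" using periodic_circ[OF assms] by blast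
qed blast

lemma vimage_reg_support: "circ -` reg_support u E L = covered (arcs_of L)"
  unfolding reg_support_covered by (rule vimage_circ_periodic[OF periodic_covered[OF shift_closed_arcs_of]])

lemma complement_circ: assumes "periodic W" shows "topspace S1 - circ ` W = circ ` (- W)"
proof (intro set_eqI iffI)
  fix c assume "c \<in> topspace S1 - circ ` W"
  then obtain z where "c = circ z" "z \<notin> W" unfolding topspace_S1 by blast
  then show "c \<in> circ ` (- W)" by blast
next
  fix c assume "c \<in> circ ` (- W)"
  then obtain z where z: "c = circ z" "z \<notin> W" by blast
  then have "c \<notin> circ ` W" using periodic_circ[OF assms] by blast
  then show "c \<in> topspace S1 - circ ` W" using z unfolding topspace_S1 by blast
qed

lemma sng_point: "singular_at u E e p X \<Longrightarrow> circ z = p \<Longrightarrow> sng X e z"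
  unfolding singular_at_sng using sng_circ by blast

text \<open>The dichotomy sorted by the number of uncovered points: a single sign everywhere comes
  with at least two of them, a pair at one point with at most two. With exactly two points both
  alternatives are possible.\<close>

lemma singular_cases_intro:
  assumes c: "compatible_family u E L" and W: "periodic W"
    and dich: "(\<exists>e. points_of L = {(e, z) |z. z \<notin> W} \<and> (\<exists>z w. z \<notin> W \<and> w \<notin> W \<and> circ z \<noteq> circ w)) \<or>
      (\<exists>p. p \<notin> W \<and> points_of L = {(e, z) |e z. circ z = circ p} \<and> card (circ ` (- W)) \<le> 2 \<and> finite (circ ` (- W)))"
  shows "singular_cases u E (circ ` (- W)) (singular_part u E L)"
proof -
  let ?P = "circ ` (- W)" and ?T = "singular_part u E L"
  have T: "X \<in> ?T \<longleftrightarrow> X \<in> L \<and> (\<exists>e z. sng X e z)" for X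
    unfolding singular_part_def singular_at_sng by blast
  have uniq: "X = Y" if "X \<in> L" "Y \<in> L" "sng X e z" "sng Y e z'" "circ z = circ z'" for X Y e z z'
    using c that sng_iso_iff unfolding compatible_family_iff by blast
  from dich show ?thesis
  proof
    assume "\<exists>e. points_of L = {(e, z) |z. z \<notin> W} \<and> (\<exists>z w. z \<notin> W \<and> w \<notin> W \<and> circ z \<noteq> circ w)"
    then obtain e z0 w0 where Z: "points_of L = {(e, z) |z. z \<notin> W}" and zw: "z0 \<notin> W" "w0 \<notin> W" "circ z0 \<noteq> circ w0" by blast
    have sgn: "e' = e \<and> z \<notin> W" if "X \<in> L" "sng X e' z" for X e' z
    proof -
      have "(e', z) \<in> {(e, z) |z. z \<notin> W}" using points_of_I[OF that] Z by simp
      then show ?thesis by blast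
    qed
    have exi: "\<exists>X\<in>L. sng X e z" if "z \<notin> W" for z
    proof -
      have "(e, z) \<in> points_of L" using Z that by blast
      then show ?thesis by (elim points_of_E) blast
    qed
    have two: "circ z0 \<in> ?P" "circ w0 \<in> ?P" using zw by auto
    show ?thesis
      unfolding singular_cases_def
    proof (intro conjI allI impI)
      fix x assume "?P = {x}"
      then show "singular_pair_at u E x ?T" using two zw by auto
    next
      fix x y assume xy: "?P = {x, y} \<and> x \<noteq> y"
      then have "x \<in> ?P" "y \<in> ?P" by blast+
      then obtain x' y' where x': "x = circ x'" "x' \<notin> W" "y = circ y'" "y' \<notin> W" by blast
      obtain A B where AB: "A \<in> L" "sng A e x'" "B \<in> L" "sng B e y'" using exi x' by blast
      have "?T = {A, B}"
      proof (intro set_eqI iffI)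
        fix X assume "X \<in> ?T"
        then obtain e' z where X: "X \<in> L" "sng X e' z" using T by blast
        then have e': "e' = e" "z \<notin> W" using sgn by blast+
        then have "circ z = x \<or> circ z = y" using xy by blast
        then show "X \<in> {A, B}" using uniq X AB e' x' by blast
      next
        fix X assume "X \<in> {A, B}" then show "X \<in> ?T" using AB T by blast
      qed
      moreover have "singular_at u E e x A" "singular_at u E e y B" using AB x' singular_at_sng by blast+
      ultimately show "(\<exists>e A B. singular_at u E e x A \<and> singular_at u E e y B \<and> ?T = {A, B}) \<or>
        singular_pair_at u E x ?T \<or> singular_pair_at u E y ?T" by blast
    next
      show "\<forall>p\<in>?P. \<exists>!X. X \<in> ?T \<and> (\<exists>e. singular_at u E e p X)"
      proof
        fix p assume "p \<in> ?P"
        then obtain z where z: "p = circ z" "z \<notin> W" by blast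
        then obtain X where X: "X \<in> L" "sng X e z" using exi by blast
        show "\<exists>!X. X \<in> ?T \<and> (\<exists>e. singular_at u E e p X)"
        proof (rule ex1I[of _ X])
          show "X \<in> ?T \<and> (\<exists>e. singular_at u E e p X)" using X T z singular_at_sng by blast
          fix Y assume "Y \<in> ?T \<and> (\<exists>e. singular_at u E e p Y)"
          then obtain e' z' where Y: "Y \<in> L" "p = circ z'" "sng Y e' z'" using T singular_at_sng by blast
          then have "e' = e" using sgn by blast
          then show "Y = X" using uniq[OF Y(1) X(1)] Y X z by simp
        qed
      qed
    next
      show "\<exists>e. \<forall>X\<in>?T. \<exists>p\<in>?P. singular_at u E e p X"
      proof (intro exI[of _ e] ballI)
        fix X assume "X \<in> ?T"
        then obtain e' z where X: "X \<in> L" "sng X e' z" using T by blast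
        then have "e' = e" "z \<notin> W" using sgn by blast+
        then show "\<exists>p\<in>?P. singular_at u E e p X" using X singular_at_sng by blast
      qed
    qed
  next
    assume "\<exists>p. p \<notin> W \<and> points_of L = {(e, z) |e z. circ z = circ p} \<and> card ?P \<le> 2 \<and> finite ?P"
    then obtain p where p: "p \<notin> W" and Z: "points_of L = {(e, z) |e z. circ z = circ p}" and P2: "card ?P \<le> 2" "finite ?P" by blast
    have exi: "\<exists>X\<in>L. sng X e p" for e
    proof -
      have "(e, p) \<in> points_of L" using Z by blast
      then show ?thesis by (elim points_of_E) blast
    qed
    obtain A B where AB: "A \<in> L" "sng A True p" "B \<in> L" "sng B False p" using exi by blast
    have "?T = {A, B}"
    proof (intro set_eqI iffI)
      fix X assume "X \<in> ?T"
      then obtain e z where X: "X \<in> L" "sng X e z" using T by blast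
      then have "(e, z) \<in> {(e, z) |e z. circ z = circ p}" using points_of_I[OF X] Z by simp
      then have "circ z = circ p" by blast
      then show "X \<in> {A, B}" using uniq[of X A True z p] uniq[of X B False z p] X AB by (cases e) auto
    next
      fix X assume "X \<in> {A, B}" then show "X \<in> ?T" using AB T by blast
    qed
    then have pair: "singular_pair_at u E (circ p) ?T"
      unfolding singular_pair_at_def singular_at_sng using AB by blast
    have pP: "circ p \<in> ?P" using p by blast
    have n: "\<not> (\<exists>x\<in>?P. \<exists>y\<in>?P. \<exists>z\<in>?P. x \<noteq> y \<and> y \<noteq> z \<and> x \<noteq> z)"
    proof
      assume "\<exists>x\<in>?P. \<exists>y\<in>?P. \<exists>z\<in>?P. x \<noteq> y \<and> y \<noteq> z \<and> x \<noteq> z"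
      then obtain x y z where s: "{x, y, z} \<subseteq> ?P" and d: "x \<noteq> y" "y \<noteq> z" "x \<noteq> z" by blast
      have "card {x, y, z} = 3" using d by simp
      moreover have "card {x, y, z} \<le> card ?P" by (rule card_mono[OF P2(2) s])
      ultimately show False using P2 by simp
    qed
    have c1: "singular_pair_at u E x ?T" if "?P = {x}" for x using pair pP that by simp
    have c2: "singular_pair_at u E x ?T \<or> singular_pair_at u E y ?T" if "?P = {x, y}" for x y using pair pP that by auto
    show ?thesis unfolding singular_cases_def
    proof (intro conjI allI impI)
      show "singular_pair_at u E x ?T" if "?P = {x}" for x by (rule c1[OF that])
      show "(\<exists>e A B. singular_at u E e x A \<and> singular_at u E e y B \<and> ?T = {A, B}) \<or>
        singular_pair_at u E x ?T \<or> singular_pair_at u E y ?T" if "?P = {x, y} \<and> x \<noteq> y" for x y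
        by (rule disjI2[OF c2[OF conjunct1[OF that]]])
    qed (erule notE[OF n])+
  qed
qed

lemma singular_pair_points_of:
  assumes "singular_pair_at u E (circ p) T"
  shows "points_of T = {(e, z) |e z. circ z = circ p}" "\<forall>X\<in>T. \<exists>e z. sng X e z" "\<forall>X\<in>T. \<forall>Y\<in>T. X \<noteq> Y \<longrightarrow> \<not> iso X Y"
proof -
  obtain A B where "singular_at u E True (circ p) A" "singular_at u E False (circ p) B" and T: "T = {A, B}"
    using assms unfolding singular_pair_at_def by blast
  then have AB: "sng A True p" "sng B False p" using sng_point by blast+
  show "\<forall>X\<in>T. \<exists>e z. sng X e z" using AB T by blast
  show "\<forall>X\<in>T. \<forall>Y\<in>T. X \<noteq> Y \<longrightarrow> \<not> iso X Y"
    unfolding T using sng_iso_iff[OF AB] sng_iso_iff[OF AB(2,1)] by blast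
  show "points_of T = {(e, z) |e z. circ z = circ p}"
  proof (intro set_eqI iffI)
    fix c :: "bool \<times> real" assume "c \<in> points_of T"
    then have "(fst c, snd c) \<in> points_of T" by simp
    then obtain X where "X \<in> T" "sng X (fst c) (snd c)" by (elim points_of_E)
    then have "circ (snd c) = circ p" using T AB sng_unique(2) by blast
    then show "c \<in> {(e, z) |e z. circ z = circ p}" by (intro CollectI exI[of _ "fst c"] exI[of _ "snd c"]) simp
  next
    fix c :: "bool \<times> real" assume "c \<in> {(e, z) |e z. circ z = circ p}"
    then obtain e z where c: "c = (e, z)" "circ z = circ p" by blast
    have "(e, p) \<in> points_of T" using points_of_I[of A T] points_of_I[of B T] AB T by (cases e) auto
    then show "c \<in> points_of T" using points_of_circ c by simp
  qed
qed

text \<open>In the opposite direction each case determines \<open>points_of T\<close>. The point w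
  ensures that the complement is not empty, so that one of the three cases applies.\<close>

lemma singular_cases_elim:
  assumes sc: "singular_cases u E (circ ` (- W)) T" and W: "periodic W" and w: "w \<notin> W"
  shows "\<forall>X\<in>T. \<exists>e z. sng X e z" "\<forall>X\<in>T. \<forall>Y\<in>T. X \<noteq> Y \<longrightarrow> \<not> iso X Y"
    "(\<exists>e. points_of T = {(e, z) |z. z \<notin> W} \<and> (\<exists>z w. z \<notin> W \<and> w \<notin> W \<and> circ z \<noteq> circ w)) \<or>
      (\<exists>p q. points_of T = {(e, z) |e z. circ z = circ p} \<and> circ ` (- W) = {circ p, circ q})"
proof -
  let ?P = "circ ` (- W)"
  have mem: "circ z \<in> ?P \<longleftrightarrow> z \<notin> W" for z
  proof
    assume "circ z \<in> ?P"
    then obtain w where "w \<notin> W" "circ z = circ w" by blast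
    then show "z \<notin> W" using periodic_circ[OF W] by blast
  qed blast
  have "(\<forall>X\<in>T. \<exists>e z. sng X e z) \<and> (\<forall>X\<in>T. \<forall>Y\<in>T. X \<noteq> Y \<longrightarrow> \<not> iso X Y) \<and>
    ((\<exists>e. points_of T = {(e, z) |z. z \<notin> W} \<and> (\<exists>z w. z \<notin> W \<and> w \<notin> W \<and> circ z \<noteq> circ w)) \<or>
      (\<exists>p q. points_of T = {(e, z) |e z. circ z = circ p} \<and> circ ` (- W) = {circ p, circ q}))"
  proof (cases "\<exists>x\<in>?P. \<exists>y\<in>?P. \<exists>z\<in>?P. x \<noteq> y \<and> y \<noteq> z \<and> x \<noteq> z")
    case True
    have u1: "\<forall>p\<in>?P. \<exists>!X. X \<in> T \<and> (\<exists>e. singular_at u E e p X)"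
      and "\<exists>e. \<forall>X\<in>T. \<exists>p\<in>?P. singular_at u E e p X"
      using conjunct2[OF conjunct2[OF sc[unfolded singular_cases_def]], rule_format, OF True] by blast+
    then obtain e where e: "\<forall>X\<in>T. \<exists>p\<in>?P. singular_at u E e p X" by blast
    have e': "\<exists>z. z \<notin> W \<and> sng X e z" if "X \<in> T" for X
      using e that unfolding singular_at_sng by (metis mem)
    have Z: "points_of T = {(e, z) |z. z \<notin> W}"
    proof (intro set_eqI iffI)
      fix c assume "c \<in> points_of T"
      then have "(fst c, snd c) \<in> points_of T" by simp
      then obtain X where X: "X \<in> T" "sng X (fst c) (snd c)" by (elim points_of_E)
      obtain z where z: "z \<notin> W" "sng X e z" using e' X by blast
      have "fst c = e" "circ (snd c) = circ z" using sng_unique[OF X(2) z(2)] by auto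
      then have "fst c = e" "snd c \<notin> W" using z(1) periodic_circ[OF W] by blast+
      then show "c \<in> {(e, z) |z. z \<notin> W}" by (intro CollectI exI[of _ "snd c"]) (simp add: prod_eq_iff)
    next
      fix c assume "c \<in> {(e, z) |z. z \<notin> W}"
      then obtain z where z: "c = (e, z)" "z \<notin> W" by blast
      then obtain X e1 where X: "X \<in> T" "singular_at u E e1 (circ z) X" using u1 by blast
      then have "sng X e1 z" using sng_point by blast
      moreover from this have "e1 = e" using e' X sng_unique(1) by blast
      ultimately show "c \<in> points_of T" using z points_of_I X by blast
    qed
    have ni: "\<not> iso X Y" if XY: "X \<in> T" "Y \<in> T" "X \<noteq> Y" for X Y
    proof
      assume i: "iso X Y"
      obtain z where z: "z \<notin> W" "sng X e z" using e' XY by blast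
      obtain z' where z': "z' \<notin> W" "sng Y e z'" using e' XY by blast
      have "circ z = circ z'" using sng_iso_iff[OF z(2) z'(2)] i by blast
      then have "singular_at u E e (circ z) X" "singular_at u E e (circ z) Y" using z z' unfolding singular_at_sng by blast+
      then show False using u1 XY z mem by blast
    qed
    obtain z w where "z \<notin> W" "w \<notin> W" "circ z \<noteq> circ w" using True by blast
    then have "\<exists>z w. z \<notin> W \<and> w \<notin> W \<and> circ z \<noteq> circ w" by blast
    moreover have "\<forall>X\<in>T. \<exists>e z. sng X e z" using e' by blast
    moreover have "\<forall>X\<in>T. \<forall>Y\<in>T. X \<noteq> Y \<longrightarrow> \<not> iso X Y" using ni by blast
    ultimately show ?thesis using Z by (intro conjI disjI1 exI[of _ e])
  next
    case False
    have wP: "circ w \<in> ?P" using w by blast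
    show ?thesis
    proof (cases "?P = {circ w}")
      case True
      then have "singular_pair_at u E (circ w) T" using conjunct1[OF sc[unfolded singular_cases_def]] by blast
      note s = singular_pair_points_of[OF this]
      show ?thesis by (intro conjI disjI2 exI[of _ w] s) (simp add: True)
    next
      case ne: False
      then obtain v where v: "v \<notin> W" "circ v \<noteq> circ w" using wP by blast
      have vP: "circ v \<in> ?P" using v by blast
      have P: "?P = {circ w, circ v}"
      proof (intro set_eqI iffI)
        fix c assume c: "c \<in> ?P"
        show "c \<in> {circ w, circ v}"
        proof (rule ccontr)
          assume "c \<notin> {circ w, circ v}"
          then have "circ w \<noteq> circ v" "circ v \<noteq> c" "circ w \<noteq> c" using v by auto
          then show False using False wP vP c by metis
        qed
      qed (use wP vP in blast)
      have vw: "circ w \<noteq> circ v" using v by metis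
      consider (a) e A B where "singular_at u E e (circ w) A" "singular_at u E e (circ v) B" "T = {A, B}"
        | (b) "singular_pair_at u E (circ w) T" | (c) "singular_pair_at u E (circ v) T"
        using conjunct1[OF conjunct2[OF sc[unfolded singular_cases_def]], rule_format, OF conjI[OF P vw]] by metis
      then show ?thesis
      proof cases
        case a
        then have AB: "sng A e w" "sng B e v" using sng_point by blast+
        have ni: "\<forall>X\<in>T. \<forall>Y\<in>T. X \<noteq> Y \<longrightarrow> \<not> iso X Y"
          unfolding a(3) using sng_iso_iff[OF AB] sng_iso_iff[OF AB(2,1)] v by auto
        have "points_of T = {(e, z) |z. z \<notin> W}"
        proof (intro set_eqI iffI)
          fix c assume "c \<in> points_of T"
          then have "(fst c, snd c) \<in> points_of T" by simp
          then obtain X where X: "X \<in> T" "sng X (fst c) (snd c)" by (elim points_of_E)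
          then have "fst c = e \<and> (circ (snd c) = circ w \<or> circ (snd c) = circ v)"
            using a(3) AB sng_unique by blast
          then have "fst c = e" "snd c \<notin> W" using w v periodic_circ[OF W] by blast+
          then show "c \<in> {(e, z) |z. z \<notin> W}" by (intro CollectI exI[of _ "snd c"]) (simp add: prod_eq_iff)
        next
          fix c assume "c \<in> {(e, z) |z. z \<notin> W}"
          then obtain z where z: "c = (e, z)" "z \<notin> W" by blast
          then have "circ z = circ w \<or> circ z = circ v" using mem P by blast
          moreover have "(e, w) \<in> points_of T" "(e, v) \<in> points_of T" using points_of_I AB a(3) by blast+
          ultimately show "c \<in> points_of T" using points_of_circ z by metis
        qed
        moreover have "\<exists>z w. z \<notin> W \<and> w \<notin> W \<and> circ z \<noteq> circ w" using w v by blast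
        moreover have "\<forall>X\<in>T. \<exists>e z. sng X e z" using AB a(3) by blast
        ultimately show ?thesis using ni by (intro conjI disjI1 exI[of _ e])
      next
        case b
        note s = singular_pair_points_of[OF this]
        show ?thesis by (intro conjI disjI2 exI[of _ w] exI[of _ v] s P)
      next
        case c
        note s = singular_pair_points_of[OF this]
        show ?thesis by (intro conjI disjI2 exI[of _ v] exI[of _ w] s P[unfolded insert_commute[of "circ w"]])
      qed
    qed
  qed
  from conjunct1[OF this] conjunct1[OF conjunct2[OF this]] conjunct2[OF conjunct2[OF this]]
  show "\<forall>X\<in>T. \<exists>e z. sng X e z" "\<forall>X\<in>T. \<forall>Y\<in>T. X \<noteq> Y \<longrightarrow> \<not> iso X Y"
    "(\<exists>e. points_of T = {(e, z) |z. z \<notin> W} \<and> (\<exists>z w. z \<notin> W \<and> w \<notin> W \<and> circ z \<noteq> circ w)) \<or>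
      (\<exists>p q. points_of T = {(e, z) |e z. circ z = circ p} \<and> circ ` (- W) = {circ p, circ q})" .
qed

end

section \<open>Realizing a prescribed support\<close>

lemma circ_near: assumes "circ v = circ w" "\<bar>v - w\<bar> < pi" shows "v = w"
proof -
  obtain k :: int where k: "w = v + of_int k * pi" using assms(1) circ_eq_iff by blast
  have "\<bar>of_int k * pi\<bar> < pi" using assms(2) unfolding k by simp
  then have "k = 0" by (rule int_pi_eq_zero)
  then show ?thesis using k by simp
qed

text \<open>The arc is connected and lies in U, so it is contained in one component; meeting I in
  the point m, it is contained in I.\<close>

lemma components_S1_absorb:
  assumes U: "openin S1 U" and I: "I \<in> components_S1 U" and xy: "{x<..<y} \<subseteq> circ -` U"
    and m: "x < m" "m < y" "circ m \<in> I"
  shows "{x<..<y} \<subseteq> circ -` I"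
proof -
  have con: "connectedin S1 (circ ` {x<..<y})" by (rule connectedin_circ_image) simp
  have mm: "circ m \<in> circ ` {x<..<y}" using m by simp
  then have ne: "circ ` {x<..<y} \<noteq> {}" by blast
  obtain I' where I': "I' \<in> components_S1 U" "circ ` {x<..<y} \<subseteq> I'"
    using components_S1_superset[OF U con ne] xy circ_image_subset by blast
  then have "circ m \<in> I \<inter> I'" using mm m by blast
  then have "I' = I" using components_S1_disjoint[OF I I'(1)] by blast
  then show ?thesis using I' circ_image_subset by blast
qed

lemma covered_mono: "A \<subseteq> B \<Longrightarrow> covered A \<subseteq> covered B"
  unfolding covered_def by blast

lemma uncrossed_mono: "A \<subseteq> B \<Longrightarrow> uncrossed B x y \<Longrightarrow> uncrossed A x y"
  unfolding uncrossed_def by blast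

lemma crosses_common: "crosses x y x' y' \<Longrightarrow> \<exists>m. x < m \<and> m < y \<and> x' < m \<and> m < y'"
  by (intro exI[of _ "(x' + y) / 2"]) (auto simp: crosses_def)

text \<open>A gap shorter than \<open>pi\<close> is itself an arc; a gap of length \<open>pi\<close> is exhausted by nested arcs.\<close>

definition gap_arcs :: "real set \<Rightarrow> (real \<times> real) set" where
  "gap_arcs W = {(x, y). x < y \<and> y < x + pi \<and> (x \<notin> W \<and> y \<notin> W \<and> {x<..<y} \<subseteq> W \<or>
     (\<exists>p t. p \<notin> W \<and> {p<..<p + pi} \<subseteq> W \<and> 0 < t \<and> x = p + t \<and> y = p + pi - t))}"

lemma gap_arcs_subset: "(x, y) \<in> gap_arcs W \<Longrightarrow> {x<..<y} \<subseteq> W"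
proof -
  assume "(x, y) \<in> gap_arcs W"
  then consider "{x<..<y} \<subseteq> W" | p t where "{p<..<p + pi} \<subseteq> W" "0 < t" "x = p + t" "y = p + pi - t"
    unfolding gap_arcs_def by blast
  then show ?thesis
  proof cases
    case 2
    then have "{x<..<y} \<subseteq> {p<..<p + pi}" by auto
    then show ?thesis using 2(1) by blast
  qed
qed

lemma covered_gap_arcs:
  assumes W: "open W" "periodic W" and w: "w \<notin> W"
  shows "covered (gap_arcs W) = W"
proof (intro set_eqI iffI)
  fix z assume "z \<in> covered (gap_arcs W)"
  then obtain x y where xy: "(x, y) \<in> gap_arcs W" "x < z" "z < y" unfolding covered_iff by blast
  then show "z \<in> W" using gap_arcs_subset[OF xy(1)] by auto
next
  fix z assume z: "z \<in> W"
  obtain p q where pq: "p < z" "z < q" "q \<le> p + pi" "p \<notin> W" "q \<notin> W" "{p<..<q} \<subseteq> W"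
    using periodic_gap[OF W z w] .
  show "z \<in> covered (gap_arcs W)"
  proof (cases "q = p + pi")
    case False
    then have "(p, q) \<in> gap_arcs W" using pq unfolding gap_arcs_def by simp
    then show ?thesis using pq unfolding covered_iff by blast
  next
    case True
    \<comment> \<open>The arc (p + t, p + pi - t) is shorter than pi and still contains z, because t
      is at most half the distance from z to either end of the gap.\<close>
    define t where "t = min (z - p) (q - z) / 2"
    have "2 * t \<le> z - p" "2 * t \<le> q - z" using pq by (simp_all add: t_def)
    moreover have t0: "0 < t" using pq by (simp add: t_def)
    ultimately have t: "0 < t" "p + t < z" "z < p + pi - t" using True by simp_all
    have "(p + t, p + pi - t) \<in> gap_arcs W"
      unfolding gap_arcs_def using t pq True by simp (intro disjI2 exI[of _ p], simp)
    then show ?thesis using t unfolding covered_iff by blast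
  qed
qed

lemma shift_closed_gap_arcs: assumes W: "periodic W" shows "shift_closed (gap_arcs W)"
  unfolding shift_closed_def
proof (intro allI impI)
  fix x y and k :: int assume xy: "(x, y) \<in> gap_arcs W"
  have sh: "{x + of_int k * pi<..<y + of_int k * pi} \<subseteq> W" if "{x<..<y} \<subseteq> W" for x y
  proof
    fix z assume "z \<in> {x + of_int k * pi<..<y + of_int k * pi}"
    then have "z + of_int (- k) * pi \<in> {x<..<y}" by simp
    then have "z + of_int (- k) * pi \<in> W" using that by blast
    then show "z \<in> W" using periodicD[OF W] by blast
  qed
  from xy consider "x \<notin> W" "y \<notin> W" "{x<..<y} \<subseteq> W"
    | p t where "p \<notin> W" "{p<..<p + pi} \<subseteq> W" "0 < t" "x = p + t" "y = p + pi - t"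
    unfolding gap_arcs_def by blast
  then show "(x + of_int k * pi, y + of_int k * pi) \<in> gap_arcs W"
  proof cases
    case 1
    then show ?thesis using xy sh[of x y] periodicD[OF W] unfolding gap_arcs_def by simp
  next
    case 2
    have "\<exists>p t. p \<notin> W \<and> {p<..<p + pi} \<subseteq> W \<and> 0 < t \<and> x + of_int k * pi = p + t \<and> y + of_int k * pi = p + pi - t"
      by (intro exI[of _ "p + of_int k * pi"] exI[of _ t])
        (use 2 sh[of p "p + pi"] periodicD[OF W] in \<open>simp add: algebra_simps\<close>)
    then show ?thesis using xy unfolding gap_arcs_def by simp
  qed
qed

text \<open>A crossing puts an endpoint of each arc inside W, so both arcs come from gaps of length
  pi. Neither gap contains the left end of the other, so the gaps coincide, and the arcs are nested
  with the same centre, or they are disjoint.\<close>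

lemma not_crosses_gap_arcs:
  assumes "(x, y) \<in> gap_arcs W" "(x', y') \<in> gap_arcs W"
  shows "\<not> crosses x y x' y'"
proof
  assume c: "crosses x y x' y'"
  have x': "x' \<in> W" using gap_arcs_subset[OF assms(1)] c unfolding crosses_def by auto
  have y: "y \<in> W" using gap_arcs_subset[OF assms(2)] c unfolding crosses_def by auto
  obtain p t where p: "p \<notin> W" "{p<..<p + pi} \<subseteq> W" "0 < t" "x = p + t" "y = p + pi - t"
    using assms(1) y unfolding gap_arcs_def by blast
  obtain p' t' where p': "p' \<notin> W" "{p'<..<p' + pi} \<subseteq> W" "0 < t'" "x' = p' + t'" "y' = p' + pi - t'"
    using assms(2) x' unfolding gap_arcs_def by blast
  have "p' \<notin> {p<..<p + pi}" "p \<notin> {p'<..<p' + pi}" using p p' by blast+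
  then show False using c p p' unfolding crosses_def greaterThanLessThan_iff by linarith
qed

context frob_family
begin

text \<open>Each arc or point is represented by its lift starting in [0, pi), which selects exactly
  one object from every isomorphism class.\<close>

lemma realize:
  assumes A: "shift_closed A" "\<And>x y. (x, y) \<in> A \<Longrightarrow> x < y \<and> y < x + pi"
    and Z: "\<And>e z z'. (e, z) \<in> Z \<Longrightarrow> circ z = circ z' \<Longrightarrow> (e, z') \<in> Z"
    and ok: "noncrossing A Z"
  obtains L where "compatible_family u E L" "arcs_of L = A" "points_of L = Z"
proof -
  define LA where "LA = {SE x y :: 'r pobj |x y. (x, y) \<in> A \<and> 0 \<le> x \<and> x < pi}"
  define LZ where "LZ = {Z_obj e z :: 'r pobj |e z. (e, z) \<in> Z \<and> 0 \<le> z \<and> z < pi}"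
  let ?L = "LA \<union> LZ"
  have LA: "\<exists>x y. X = SE x y \<and> (x, y) \<in> A \<and> 0 \<le> x \<and> x < pi \<and> arc X x y" if "X \<in> LA" for X
    using that A(2) SE_arc unfolding LA_def by blast
  have LZ: "\<exists>e z. X = Z_obj e z \<and> (e, z) \<in> Z \<and> 0 \<le> z \<and> z < pi \<and> sng X e z" if "X \<in> LZ" for X
    using that Z_sng unfolding LZ_def by blast
  have cl: "(\<exists>x y. arc X x y) \<or> (\<exists>e z. sng X e z)" if "X \<in> ?L" for X
    using that LA[of X] LZ[of X] by blast
  have AL: "(x, y) \<in> arcs_of ?L \<longleftrightarrow> (x, y) \<in> A" for x y
  proof
    assume "(x, y) \<in> arcs_of ?L"
    then obtain X where X: "X \<in> ?L" "arc X x y" by (elim arcs_of_E)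
    then have "X \<in> LA" using LZ arc_not_sng by blast
    then obtain x' y' where X': "(x', y') \<in> A" "arc X x' y'" using LA by blast
    obtain k :: int where "x = x' + of_int k * pi" "y = y' + of_int k * pi" using arc_unique[OF X'(2) X(2)] by blast
    then show "(x, y) \<in> A" using A(1) X'(1) unfolding shift_closed_def by blast
  next
    assume xy: "(x, y) \<in> A"
    obtain k :: int where k: "0 \<le> x + of_int k * pi" "x + of_int k * pi < 0 + pi" using shift_into[of 0] by blast
    let ?x = "x + of_int k * pi" and ?y = "y + of_int k * pi"
    have in': "(?x, ?y) \<in> A" using A(1) xy unfolding shift_closed_def by blast
    then have "SE ?x ?y \<in> ?L" "arc (SE ?x ?y) ?x ?y" using k A(2)[OF in'] SE_arc unfolding LA_def by auto
    then have "(?x, ?y) \<in> arcs_of ?L" by (rule arcs_of_I)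
    from arcs_of_shift[OF this, of "- k"] show "(x, y) \<in> arcs_of ?L" by simp
  qed
  have ZL: "(e, z) \<in> points_of ?L \<longleftrightarrow> (e, z) \<in> Z" for e z
  proof
    assume "(e, z) \<in> points_of ?L"
    then obtain X where X: "X \<in> ?L" "sng X e z" by (elim points_of_E)
    then have "X \<in> LZ" using LA arc_not_sng by blast
    then obtain e' z' where X': "(e', z') \<in> Z" "sng X e' z'" using LZ by blast
    then show "(e, z) \<in> Z" using sng_unique[OF X'(2) X(2)] Z by simp
  next
    assume ez: "(e, z) \<in> Z"
    obtain k :: int where k: "0 \<le> z + of_int k * pi" "z + of_int k * pi < 0 + pi" using shift_into[of 0] by blast
    let ?z = "z + of_int k * pi"
    have "(e, ?z) \<in> Z" using Z[OF ez] by simp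
    then have "Z_obj e ?z \<in> ?L" using k unfolding LZ_def by auto
    then have "(e, ?z) \<in> points_of ?L" using Z_sng by (rule points_of_I)
    from points_of_circ[OF this, of z] show "(e, z) \<in> points_of ?L" by simp
  qed
  have ni: "\<not> iso X Y" if XY: "X \<in> ?L" "Y \<in> ?L" "X \<noteq> Y" for X Y
  proof
    assume i: "iso X Y"
    show False
    proof (cases "X \<in> LA")
      case XA: True
      then obtain x y where X: "X = SE x y" "0 \<le> x" "x < pi" "arc X x y" using LA by blast
      show False
      proof (cases "Y \<in> LA")
        case True
        then obtain x' y' where Y: "Y = SE x' y'" "0 \<le> x'" "x' < pi" "arc Y x' y'" using LA by blast
        obtain k :: int where k: "x' = x + of_int k * pi" "y' = y + of_int k * pi" using arc_iso_iff[OF X(4) Y(4)] i by blast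
        have "\<bar>of_int k * pi\<bar> < pi" using X Y unfolding k by linarith
        then have "k = 0" by (rule int_pi_eq_zero)
        then show False using k X Y XY(3) by simp
      next
        case False
        then obtain e z where "sng Y e z" using LZ XY by blast
        then show False using arc_sng_not_iso[OF X(4)] i by blast
      qed
    next
      case False
      then obtain e z where X: "X = Z_obj e z" "0 \<le> z" "z < pi" "sng X e z" using LZ XY by blast
      show False
      proof (cases "Y \<in> LA")
        case True
        then obtain x y where "arc Y x y" using LA by blast
        then show False using arc_sng_not_iso[OF _ X(4)] i by blast
      next
        case False
        then obtain e' z' where Y: "Y = Z_obj e' z'" "0 \<le> z'" "z' < pi" "sng Y e' z'" using LZ XY by blast
        have "e = e'" "circ z = circ z'" using sng_iso_iff[OF X(4) Y(4)] i by blast+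
        moreover have "z = z'" by (rule circ_near[OF \<open>circ z = circ z'\<close>]) (use X Y in linarith)
        ultimately show False using X Y XY(3) by simp
      qed
    qed
  qed
  have eq: "arcs_of ?L = A" "points_of ?L = Z" using AL ZL by (simp_all add: set_eq_iff split_paired_All)
  have "compatible_family u E ?L" unfolding compatible_family_iff eq using cl ni ok by blast
  then show thesis using that eq by blast
qed

text \<open>Zorn's lemma; compatibility and non-isomorphism concern pairs, and any two members of
  the union of a chain lie in one of its elements.\<close>

lemma lamination_extension:
  assumes L0: "compatible_family u E L0"
  obtains L where "lamination u E L" "L0 \<subseteq> L"
proof -
  let ?A = "{L. compatible_family u E L \<and> L0 \<subseteq> L}"
  have "\<exists>M\<in>?A. \<forall>X\<in>?A. M \<subseteq> X \<longrightarrow> X = M"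
  proof (rule subset_Zorn_nonempty)
    show "?A \<noteq> {}" using L0 by blast
    fix C assume C: "C \<noteq> {}" "subset.chain ?A C"
    have fam: "compatible_family u E L" "L0 \<subseteq> L" if "L \<in> C" for L
      using C(2) that unfolding subset.chain_def by blast+
    have "compatible_family u E (\<Union>C)"
      unfolding compatible_family_def pairwise_def
    proof (intro conjI ballI impI)
      fix X assume "X \<in> \<Union>C"
      then obtain L where L: "L \<in> C" "X \<in> L" by blast
      then show "indecomposable (Cpsi u E pi) X" using fam unfolding compatible_family_def by blast
    next
      fix X Y assume "X \<in> \<Union>C" "Y \<in> \<Union>C" and ne: "X \<noteq> Y"
      then obtain L L' where "L \<in> C" "X \<in> L" "L' \<in> C" "Y \<in> L'" by blast
      then obtain K where K: "K \<in> C" "X \<in> K" "Y \<in> K"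
        using C(2) unfolding subset_chain_def by blast
      have "pairwise (\<lambda>X Y. compatible u E X Y \<and> \<not> iso X Y) K"
        using fam(1)[OF K(1)] unfolding compatible_family_def by blast
      from pairwiseD[OF this K(2,3) ne]
      show "compatible u E X Y" "\<not> iso X Y" by blast+
    qed
    moreover have "L0 \<subseteq> \<Union>C" using C(1) fam(2) by blast
    ultimately show "\<Union>C \<in> ?A" by blast
  qed
  then obtain L where L: "L \<in> ?A" and mx: "\<forall>X\<in>?A. L \<subseteq> X \<longrightarrow> X = L" by (elim bexE)
  have "L' = L" if L': "compatible_family u E L'" "L \<subseteq> L'" for L'
  proof -
    have "L' \<in> ?A" using L L' by auto
    then show ?thesis using mx L'(2) by simp
  qed
  then have "lamination u E L" using L by (simp add: lamination_def)
  then show thesis using that L by simp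
qed

text \<open>Extending the arcs inside the gaps to a lamination might enlarge the support. The
  positive singular objects placed at all uncovered points prevent this, since no arc compatible
  with them covers such a point.\<close>

lemma lamination_with_support:
  assumes U: "openin S1 U" "U \<noteq> topspace S1"
  shows "\<exists>L. lamination u E L \<and> reg_support u E L = U"
proof -
  let ?W = "circ -` U" and ?Z = "{(True, z) |z. z \<notin> circ -` U}"
  have W: "open ?W" "periodic ?W" using U periodic_vimage by (auto simp: openin_S1)
  obtain w where w: "w \<notin> ?W" using not_top_lift[OF U] by blast
  note covered = covered_gap_arcs[OF W w]
  have ok: "noncrossing (gap_arcs ?W) ?Z"
    unfolding noncrossing_def covered using not_crosses_gap_arcs by simp
  obtain L0 where L0: "compatible_family u E L0" "arcs_of L0 = gap_arcs ?W" "points_of L0 = ?Z"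
  proof (rule realize[OF shift_closed_gap_arcs[OF W(2)] _ _ ok])
    show "x < y \<and> y < x + pi" if "(x, y) \<in> gap_arcs ?W" for x y using that unfolding gap_arcs_def by simp
    show "(e, z') \<in> ?Z" if "(e, z) \<in> ?Z" "circ z = circ z'" for e z z' using that by simp
  qed
  obtain L where L: "lamination u E L" "L0 \<subseteq> L" using lamination_extension[OF L0(1)] .
  have c: "compatible_family u E L" using L(1) by (simp add: lamination_def)
  have "covered (arcs_of L) = ?W"
  proof (intro set_eqI iffI)
    fix z assume z: "z \<in> covered (arcs_of L)"
    show "z \<in> ?W"
    proof (rule ccontr)
      assume "z \<notin> ?W"
      then have "(True, z) \<in> points_of L" using L0(3) points_of_mono[OF L(2)] by blast
      then show False using noncrossingD(2)[OF compatible_familyD(3)[OF c]] z by blast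
    qed
  next
    fix z assume "z \<in> ?W"
    then have "z \<in> covered (arcs_of L0)" unfolding L0(2) covered .
    then show "z \<in> covered (arcs_of L)" using covered_mono[OF arcs_of_mono[OF L(2)]] by blast
  qed
  then have "reg_support u E L = U" unfolding reg_support_covered using image_circ_vimage[OF U(1)] by simp
  then show ?thesis using L(1) by blast
qed

text \<open>For the sublaminations, maximality within one component has to be derived from
  maximality of L; arcs of other components and singular objects do not interfere with an arc in
  I.\<close>

lemma lamination_support:
  assumes L: "lamination u E L"
  shows "openin S1 (reg_support u E L)" "reg_support u E L \<noteq> topspace S1"
    "I \<in> components_S1 (reg_support u E L) \<Longrightarrow> sublamination u E I {X \<in> L. regular u E X \<and> supp u E X \<subseteq> I}"
    "X \<in> L \<Longrightarrow> regular u E X \<Longrightarrow> \<exists>I \<in> components_S1 (reg_support u E L). supp u E X \<subseteq> I"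
    "singular_cases u E (topspace S1 - reg_support u E L) (singular_part u E L)"
proof -
  let ?U = "reg_support u E L" and ?W = "covered (arcs_of L)"
  have c: "compatible_family u E L" and mx: "saturated (arcs_of L) (points_of L)" using L lamination_iff by blast+
  note ok = compatible_familyD(3)[OF c]
  note per = periodic_covered[OF shift_closed_arcs_of[of L]]
  note vi = vimage_reg_support[of L]
  show op: "openin S1 ?U" unfolding reg_support_covered by (rule open_circ_image[OF open_covered])
  show ne: "?U \<noteq> topspace S1"
  proof
    assume "?U = topspace S1"
    then have "?W = UNIV" using vi unfolding topspace_S1 by blast
    moreover have "\<exists>w. w \<notin> ?W" by (rule covered_ne_UNIV[OF ok]) (use arcs_of_proper in blast)
    ultimately show False by blast
  qed
  have arcU: "{x<..<y} \<subseteq> circ -` ?U" if "X \<in> L" "arc X x y" for X x y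
  proof
    fix z assume "z \<in> {x<..<y}"
    then have "z \<in> ?W" unfolding covered_iff using arcs_of_I[OF that] by auto
    then show "z \<in> circ -` ?U" unfolding vi .
  qed
  show "singular_cases u E (topspace S1 - ?U) (singular_part u E L)"
    unfolding reg_support_covered complement_circ[OF per]
    by (rule singular_cases_intro[OF c per]) (rule sing_dichotomy[OF ok mx shift_closed_arcs_of arcs_of_proper points_of_circ])
  show "\<exists>I \<in> components_S1 ?U. supp u E X \<subseteq> I" if X: "X \<in> L" "regular u E X"
  proof -
    obtain x y where x: "arc X x y" using X regular_arc by blast
    then have "x < y" by (simp add: arc_def)
    then have "circ ` {x<..<y} \<noteq> {}" by simp
    moreover have "connectedin S1 (circ ` {x<..<y})" by (rule connectedin_circ_image) simp
    ultimately show ?thesis unfolding supp_arc[OF x]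
      using components_S1_superset[OF op] arcU[OF X(1) x] circ_image_subset by metis
  qed
  show "sublamination u E I {X \<in> L. regular u E X \<and> supp u E X \<subseteq> I}" if I: "I \<in> components_S1 ?U"
  proof -
    let ?T = "{X \<in> L. regular u E X \<and> supp u E X \<subseteq> I}"
    have T: "X \<in> ?T \<longleftrightarrow> X \<in> L \<and> X \<in> regular_objects_in u E I" for X by (simp add: regular_objects_in_def)
    have IW: "circ -` I \<subseteq> ?W" using components_S1_subset[OF I] vi by blast
    have "(x, y) \<in> arcs_of ?T" if xy: "x < y" "y < x + pi" "{x<..<y} \<subseteq> circ -` I" and no: "uncrossed (arcs_of ?T) x y" for x y
    proof -
      \<comment> \<open>An arc of L that overlaps (x, y) meets the component I, so it lies in I;
        crossings with L are therefore crossings with the part of L in I.\<close>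
      have key: "(x', y') \<in> arcs_of ?T" if a: "(x', y') \<in> arcs_of L" and m: "x < m" "m < y" "x' < m" "m < y'" for x' y' m
      proof -
        obtain X where X: "X \<in> L" "arc X x' y'" using a by (elim arcs_of_E)
        have "circ m \<in> I" using xy(3) m by auto
        from components_S1_absorb[OF op I arcU[OF X] m(3,4) this]
        have "X \<in> ?T" using T X regular_objects_in_arc[OF X(2)] by blast
        then show ?thesis using X(2) by (rule arcs_of_I)
      qed
      have "uncrossed (arcs_of L) x y" unfolding uncrossed_def
      proof (intro allI impI conjI notI)
        fix x' y' assume a: "(x', y') \<in> arcs_of L" and cr: "crosses x y x' y'"
        have "(x', y') \<in> arcs_of ?T" using crosses_common[OF cr] key[OF a] by blast
        then show False using no cr unfolding uncrossed_def by blast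
      next
        fix x' y' assume a: "(x', y') \<in> arcs_of L" and cr: "crosses x' y' x y"
        have "(x', y') \<in> arcs_of ?T" using crosses_common[OF cr] key[OF a] by blast
        then show False using no cr unfolding uncrossed_def by blast
      qed
      moreover have "point_free (points_of L) x y" unfolding point_free_def
      proof (intro allI impI notI)
        fix e z assume z: "(e, z) \<in> points_of L" and "x < z \<and> z < y"
        then have "z \<in> {x<..<y}" by simp
        then have "z \<in> ?W" using xy(3) IW by blast
        then show False using noncrossingD(2)[OF ok z] by blast
      qed
      ultimately have "(x, y) \<in> arcs_of L" using saturatedD(1)[OF mx xy(1,2)] by blast
      then obtain X where X: "X \<in> L" "arc X x y" by (elim arcs_of_E)
      then have "X \<in> ?T" using T regular_objects_in_arc[OF X(2)] xy(3) by blast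
      then show ?thesis using X(2) by (rule arcs_of_I)
    qed
    moreover have "?T \<subseteq> regular_objects_in u E I" using T by blast
    moreover have "compatible_family u E ?T" by (rule compatible_family_subset[OF c]) simp
    ultimately show ?thesis
      unfolding sublamination_iff using components_S1_interval[OF op ne I] by simp
  qed
qed

text \<open>Arcs over different components are disjoint and the singular points lie outside U, so
  compatibility is immediate. For maximality, the singular objects keep further arcs inside U, and
  the arcs restrict further singular objects to the positions of the given ones. A gap of length pi
  is not itself an arc, which makes the two kinds of \<open>points_of T\<close> behave
  differently.\<close>

lemma lamination_of_sublaminations:
  assumes U: "openin S1 U" "U \<noteq> topspace S1"
    and sub: "\<And>I. I \<in> components_S1 U \<Longrightarrow> sublamination u E I (LL I)"
    and sc: "singular_cases u E (topspace S1 - U) T"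
  shows "lamination u E (T \<union> (\<Union>I \<in> components_S1 U. LL I))" (is "lamination u E ?L")
proof -
  let ?W = "circ -` U"
  have W: "open ?W" "periodic ?W" using U periodic_vimage by (auto simp: openin_S1)
  obtain w0 where w0: "w0 \<notin> ?W" using not_top_lift[OF U] by blast
  have "topspace S1 - U = circ ` (- ?W)"
    using complement_circ[OF W(2)] image_circ_vimage[OF U(1)] by simp
  then have sc': "singular_cases u E (circ ` (- ?W)) T" using sc by simp
  note Ts = singular_cases_elim(1)[OF sc' W(2) w0] and Tn = singular_cases_elim(2)[OF sc' W(2) w0]
    and Tc = singular_cases_elim(3)[OF sc' W(2) w0]
  have Larc: "\<exists>x y. arc X x y" if "X \<in> LL I" "I \<in> components_S1 U" for X I
    using subsetD[OF sublaminationD(3)[OF sub[OF that(2)]] that(1)] regular_objects_in_iff by blast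
  have arcI: "{x<..<y} \<subseteq> circ -` I" if "X \<in> LL I" "I \<in> components_S1 U" "arc X x y" for X I x y
    using subsetD[OF sublaminationD(3)[OF sub[OF that(2)]] that(1)] regular_objects_in_arc[OF that(3)] by blast
  have AI: "{x<..<y} \<subseteq> circ -` I" if "(x, y) \<in> arcs_of (LL I)" "I \<in> components_S1 U" for x y I
    using that(1) arcI[OF _ that(2)] by (elim arcs_of_E)
  have IW: "circ -` I \<subseteq> ?W" if "I \<in> components_S1 U" for I using components_S1_subset[OF that] by blast
  have AL: "\<exists>I\<in>components_S1 U. (x, y) \<in> arcs_of (LL I)" if a: "(x, y) \<in> arcs_of ?L" for x y
  proof -
    obtain X where X: "X \<in> ?L" "arc X x y" using a by (elim arcs_of_E)
    then have "X \<notin> T" using Ts arc_not_sng by blast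
    then obtain I where "I \<in> components_S1 U" "X \<in> LL I" using X by blast
    then show ?thesis using arcs_of_I[OF _ X(2)] by blast
  qed
  have arcs_of_sub: "arcs_of (LL I) \<subseteq> arcs_of ?L" if "I \<in> components_S1 U" for I
    by (rule arcs_of_mono) (use that in blast)
  have ZL: "points_of ?L = points_of T"
  proof
    show "points_of T \<subseteq> points_of ?L" by (rule points_of_mono) blast
    show "points_of ?L \<subseteq> points_of T"
    proof
      fix c assume "c \<in> points_of ?L"
      then have "(fst c, snd c) \<in> points_of ?L" by simp
      then obtain X where X: "X \<in> ?L" "sng X (fst c) (snd c)" by (elim points_of_E)
      have "X \<in> T"
      proof (rule ccontr)
        assume "X \<notin> T"
        then obtain I where "I \<in> components_S1 U" "X \<in> LL I" using X(1) by blast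
        then show False using Larc X(2) arc_not_sng by blast
      qed
      from points_of_I[OF this X(2)] show "c \<in> points_of T" by simp
    qed
  qed
  have WL: "covered (arcs_of ?L) \<subseteq> ?W"
  proof
    fix z assume "z \<in> covered (arcs_of ?L)"
    then obtain x y where "(x, y) \<in> arcs_of ?L" and z: "x < z" "z < y" unfolding covered_iff by blast
    then obtain I where I: "I \<in> components_S1 U" "(x, y) \<in> arcs_of (LL I)" using AL by blast
    have "z \<in> circ -` I" using AI[OF I(2,1)] z by auto
    then show "z \<in> ?W" using IW[OF I(1)] by blast
  qed
  have same: "I = I'" if "I \<in> components_S1 U" "I' \<in> components_S1 U" "(x, y) \<in> arcs_of (LL I)" "(x', y') \<in> arcs_of (LL I')"
    "x < m" "m < y" "x' < m" "m < y'" for I I' x y x' y' m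
  proof -
    have "circ m \<in> I" "circ m \<in> I'" using AI[OF that(3,1)] AI[OF that(4,2)] that(5-8) by auto
    then show ?thesis using components_S1_disjoint[OF that(1,2)] by blast
  qed
  have ZW: "z \<notin> ?W" if "(e, z) \<in> points_of T" for e z
    using Tc
  proof (elim disjE exE conjE)
    fix e' assume "points_of T = {(e', z) |z. z \<notin> ?W}"
    then have "(e, z) \<in> {(e', z) |z. z \<notin> ?W}" using that by simp
    then show ?thesis by blast
  next
    fix p q assume "points_of T = {(e, z) |e z. circ z = circ p}" and P: "circ ` (- ?W) = {circ p, circ q}"
    then have "(e, z) \<in> {(e, z) |e z. circ z = circ p}" using that by simp
    then have "circ z = circ p" by blast
    moreover have "circ p \<in> circ ` (- ?W)" using P by blast
    ultimately show ?thesis by auto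
  qed
  have c: "compatible_family u E ?L"
    unfolding compatible_family_iff ZL
  proof (intro conjI ballI impI)
    fix X assume "X \<in> ?L"
    then show "(\<exists>x y. arc X x y) \<or> (\<exists>e z. sng X e z)" using Ts Larc by blast
  next
    fix X Y assume X: "X \<in> ?L" and Y: "Y \<in> ?L" and ne: "X \<noteq> Y"
    show "\<not> iso X Y"
    proof (cases "X \<in> T")
      case XT: True
      then obtain e z where s: "sng X e z" using Ts by blast
      show ?thesis
      proof (cases "Y \<in> T")
        case True then show ?thesis using Tn XT ne by blast
      next
        case False
        then obtain x y where "arc Y x y" using Larc Y by blast
        then show ?thesis using arc_sng_not_iso s by blast
      qed
    next
      case False
      then obtain I where I: "I \<in> components_S1 U" "X \<in> LL I" using X by blast
      then obtain x y where a: "arc X x y" using Larc by blast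
      show ?thesis
      proof (cases "Y \<in> T")
        case True
        then obtain e z where "sng Y e z" using Ts by blast
        then show ?thesis using arc_sng_not_iso a by blast
      next
        case False
        then obtain I' where I': "I' \<in> components_S1 U" "Y \<in> LL I'" using Y by blast
        then obtain x' y' where a': "arc Y x' y'" using Larc by blast
        show ?thesis
        proof
          assume i: "iso X Y"
          then obtain k :: int where k: "x' = x + of_int k * pi" "y' = y + of_int k * pi" using arc_iso_iff[OF a a'] by blast
          have "arc Y x y" using arc_shift[OF a', of "- k"] k by simp
          then have "(x, y) \<in> arcs_of (LL I)" "(x, y) \<in> arcs_of (LL I')" using arcs_of_I a I I' by blast+
          moreover have "x < y" using a by (simp add: arc_def)
          ultimately have "I = I'" using same[OF I(1) I'(1), of x y x y "(x + y) / 2"] by simp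
          then show False using compatible_familyD(2)[OF sublaminationD(2)[OF sub[OF I(1)]] I(2), of Y] I' ne i by simp
        qed
      qed
    qed
  next
    show "noncrossing (arcs_of ?L) (points_of T)"
      unfolding noncrossing_def
    proof (intro conjI allI impI)
      fix x y x' y' assume "(x, y) \<in> arcs_of ?L" "(x', y') \<in> arcs_of ?L"
      then obtain I I' where I: "I \<in> components_S1 U" "(x, y) \<in> arcs_of (LL I)" and I': "I' \<in> components_S1 U" "(x', y') \<in> arcs_of (LL I')"
        using AL by meson
      show "\<not> crosses x y x' y'"
      proof
        assume cr: "crosses x y x' y'"
        then obtain m where m: "x < m" "m < y" "x' < m" "m < y'" using crosses_common by blast
        have "I = I'" by (rule same[OF I(1) I'(1) I(2) I'(2) m])
        then show False
          using noncrossingD(1)[OF compatible_familyD(3)[OF sublaminationD(2)[OF sub[OF I(1)]]] I(2)] I'(2) cr by simp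
      qed
    next
      fix e z assume "(e, z) \<in> points_of T"
      then show "z \<notin> covered (arcs_of ?L)" using ZW WL by blast
    next
      fix e z e' z' assume z: "(e, z) \<in> points_of T" "(e', z') \<in> points_of T"
      show "e = e' \<or> circ z = circ z'"
        using Tc
      proof (elim disjE exE conjE)
        fix e1 assume Z: "points_of T = {(e1, z) |z. z \<notin> ?W}"
        have "(e, z) \<in> {(e1, z) |z. z \<notin> ?W}" "(e', z') \<in> {(e1, z) |z. z \<notin> ?W}" using z Z by simp_all
        then show ?thesis by blast
      next
        fix p assume Z: "points_of T = {(e, z) |e z. circ z = circ p}"
        have "(e, z) \<in> {(e, z) |e z. circ z = circ p}" "(e', z') \<in> {(e, z) |e z. circ z = circ p}" using z Z by simp_all
        then have "circ z = circ p" "circ z' = circ p" by blast+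
        then show ?thesis by simp
      qed
    qed
  qed
  \<comment> \<open>A gap shorter than pi joins two uncovered points, so nothing crosses it and it
    belongs to the sublamination of its component.\<close>
  have full: "(a, d) \<in> arcs_of ?L" if ad: "a < d" "d < a + pi" "a \<notin> ?W" "d \<notin> ?W" "{a<..<d} \<subseteq> ?W" for a d
  proof -
    let ?I = "circ ` {a<..<d}"
    have I: "?I \<in> components_S1 U" by (rule components_S1_gap[OF U(1) ad(1,3,4,5)])
    have "a \<notin> covered (arcs_of ?L)" "d \<notin> covered (arcs_of ?L)" using WL ad by blast+
    then have "uncrossed (arcs_of ?L) a d" by (rule uncrossed_endpoints)
    then have "uncrossed (arcs_of (LL ?I)) a d" by (rule uncrossed_mono[OF arcs_of_sub[OF I]])
    moreover have "{a<..<d} \<subseteq> circ -` ?I" by blast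
    ultimately have "(a, d) \<in> arcs_of (LL ?I)"
      using sub[OF I, unfolded sublamination_iff] ad by simp
    then show ?thesis using arcs_of_sub[OF I] by blast
  qed
  have inside: "(x, y) \<in> arcs_of ?L" if xy: "x < y" "y < x + pi" "{x<..<y} \<subseteq> ?W" "uncrossed (arcs_of ?L) x y" for x y
  proof -
    have "circ ` {x<..<y} \<noteq> {}" using xy(1) by simp
    moreover have "connectedin S1 (circ ` {x<..<y})" by (rule connectedin_circ_image) simp
    ultimately obtain I where I: "I \<in> components_S1 U" "circ ` {x<..<y} \<subseteq> I"
      using components_S1_superset[OF U(1)] xy(3) circ_image_subset by metis
    have "{x<..<y} \<subseteq> circ -` I" using I(2) circ_image_subset by blast
    moreover have "uncrossed (arcs_of (LL I)) x y" by (rule uncrossed_mono[OF arcs_of_sub[OF I(1)] xy(4)])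
    ultimately have "(x, y) \<in> arcs_of (LL I)"
      using sub[OF I(1), unfolded sublamination_iff] xy by simp
    then show ?thesis using arcs_of_sub[OF I(1)] by blast
  qed
  have mx: "saturated (arcs_of ?L) (points_of T)"
    using Tc
  proof (elim disjE exE conjE)
    fix e z1 z2 assume Z: "points_of T = {(e, z) |z. z \<notin> ?W}" and z12: "z1 \<notin> ?W" "z2 \<notin> ?W" "circ z1 \<noteq> circ z2"
    have inZ: "(e, z) \<in> points_of T" if "z \<notin> ?W" for z using Z that by blast
    show ?thesis
      unfolding saturated_def
    proof (intro conjI allI impI)
      fix x y assume xy: "x < y \<and> y < x + pi \<and> uncrossed (arcs_of ?L) x y \<and> point_free (points_of T) x y"
      have "{x<..<y} \<subseteq> ?W"
      proof
        fix z assume z: "z \<in> {x<..<y}"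
        show "z \<in> ?W"
        proof (rule ccontr)
          assume "z \<notin> ?W"
          then have "(e, z) \<in> points_of T" by (rule inZ)
          then show False using xy z unfolding point_free_def by auto
        qed
      qed
      then show "(x, y) \<in> arcs_of ?L" using inside xy by simp
    next
      fix e' z assume z: "z \<notin> covered (arcs_of ?L) \<and> sign_compatible (points_of T) e' z"
      have "z \<notin> ?W"
      proof
        assume "z \<in> ?W"
        \<comment> \<open>The gap around z is shorter than pi, because a gap of length pi would
          leave a single point of the circle outside U. Hence the gap itself is an arc and covers
          z.\<close>
        then obtain p q where pq: "p < z" "z < q" "q \<le> p + pi" "p \<notin> ?W" "q \<notin> ?W" "{p<..<q} \<subseteq> ?W"
          using periodic_gap[OF W _ w0] by metis
        have "q < p + pi"
        proof (rule ccontr)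
          assume "\<not> q < p + pi"
          then have "q = p + pi" using pq by simp
          then have sub: "{p<..<p + pi} \<subseteq> ?W" using pq(6) by simp
          have one: "circ v = circ p" if "v \<notin> ?W" for v
          proof -
            obtain k :: int where k: "p \<le> v + of_int k * pi" "v + of_int k * pi < p + pi" using shift_into by blast
            have "v + of_int k * pi \<notin> ?W" using periodicD[OF W(2)] that by blast
            then have "v + of_int k * pi \<notin> {p<..<p + pi}" using sub by blast
            then have "v + of_int k * pi = p" using k by auto
            then show ?thesis using circ_shift by metis
          qed
          show False using one[OF z12(1)] one[OF z12(2)] z12(3) by simp
        qed
        then have "(p, q) \<in> arcs_of ?L" using full pq by simp
        then have "z \<in> covered (arcs_of ?L)" unfolding covered_iff using pq by blast
        then show False using z by blast
      qed
      \<comment> \<open>Two different points carry the sign e, and z differs from one of them on the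
        circle; compatibility with the object there forces the sign.\<close>
      moreover have "e' = e"
        using z inZ[OF z12(1)] inZ[OF z12(2)] z12(3) unfolding sign_compatible_def by metis
      ultimately show "(e', z) \<in> points_of T" using inZ by blast
    qed
  next
    fix p q assume Z: "points_of T = {(e, z) |e z. circ z = circ p}" and P: "circ ` (- ?W) = {circ p, circ q}"
    have inZ: "(e, z) \<in> points_of T" if "circ z = circ p" for e z using Z that by blast
    have two: "circ v = circ p \<or> circ v = circ q" if "v \<notin> ?W" for v using P that by blast
    have pW: "v \<notin> ?W" if "circ v = circ p" for v using ZW[OF inZ[OF that]] .
    show ?thesis
      unfolding saturated_def
    proof (intro conjI allI impI)
      fix e z assume z: "z \<notin> covered (arcs_of ?L) \<and> sign_compatible (points_of T) e z"
      \<comment> \<open>Both signs occur at p, so the new object is tested against the opposite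
        sign, which leaves only the point p.\<close>
      then have "e = (\<not> e) \<or> circ z = circ p" using inZ[of p "\<not> e"] unfolding sign_compatible_def by blast
      then show "(e, z) \<in> points_of T" using inZ by blast
    next
      fix x y assume xy: "x < y \<and> y < x + pi \<and> uncrossed (arcs_of ?L) x y \<and> point_free (points_of T) x y"
      have nP: "circ v \<noteq> circ p" if "x < v" "v < y" for v
        using xy inZ[of v True] that unfolding point_free_def by blast
      have "{x<..<y} \<subseteq> ?W"
      proof
        fix w assume "w \<in> {x<..<y}"
        then have w: "x < w" "w < y" by auto
        show "w \<in> ?W"
        proof (rule ccontr)
          assume wW: "w \<notin> ?W"
          have wp: "circ w \<noteq> circ p" using nP w by blast
          then have wq: "circ w = circ q" using two[OF wW] by blast
          obtain k :: int where k: "w - pi \<le> p + of_int k * pi" "p + of_int k * pi < w - pi + pi" using shift_into by blast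
          define p0 where "p0 = p + of_int k * pi"
          have cp: "circ p0 = circ p" "circ (p0 + pi) = circ p"
            using circ_shift[of p k] circ_shift[of p "k + 1"] by (simp_all add: p0_def algebra_simps)
          have "w \<noteq> p0 + pi" using cp wp by metis
          then have p0: "p0 < w" "w < p0 + pi" using k by (simp_all add: p0_def)
          have gap: "v \<in> ?W" if "p0 < v" "v < p0 + pi" "v \<noteq> w" for v
          proof (rule ccontr)
            assume "v \<notin> ?W"
            then have "circ v = circ p0 \<or> circ v = circ w" using two cp wq by auto
            then show False
            proof
              assume "circ v = circ p0"
              then have "v = p0" by (rule circ_near) (use that in linarith)
              then show False using that by simp
            next
              assume "circ v = circ w"
              then have "v = w" by (rule circ_near) (use that p0 in linarith)
              then show False using that by simp
            qed
          qed
          have "{p0<..<w} \<subseteq> ?W" "{w<..<p0 + pi} \<subseteq> ?W" using gap p0 by auto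
          then have "(p0, w) \<in> arcs_of ?L" "(w, p0 + pi) \<in> arcs_of ?L"
            using full[of p0 w] full[of w "p0 + pi"] p0 pW cp wW by auto
          \<comment> \<open>The gaps on both sides of w are arcs. An arc around w that crosses
            neither of them and contains neither p0 nor p0 + pi would have to be (p0, p0 + pi),
            which has length pi.\<close>
          then have "\<not> crosses p0 w x y" "\<not> crosses x y w (p0 + pi)" using xy unfolding uncrossed_def by blast+
          moreover have "\<not> (x < p0 \<and> p0 < y)" "\<not> (x < p0 + pi \<and> p0 + pi < y)" using nP cp by blast+
          ultimately show False using xy w p0 unfolding crosses_def by linarith
        qed
      qed
      then show "(x, y) \<in> arcs_of ?L" using inside xy by simp
    qed
  qed
  show ?thesis unfolding lamination_iff ZL using c mx by blast
qed

end

theorem theorem2p4p6: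
  fixes u :: "'r::idom" and E :: "real \<Rightarrow> ('r fmor \<times> 'r fmor) set"
  assumes "dvr_uniformizer u"
    and "\<not> u dvd 2"
    and "\<And>b. 0 < b \<Longrightarrow> b \<le> pi \<Longrightarrow> F_exact u b (E b)"
  shows
    "(\<forall>L. lamination u E L \<longrightarrow>
        openin S1 (reg_support u E L) \<and> reg_support u E L \<noteq> topspace S1 \<and>
        (\<forall>I \<in> components_S1 (reg_support u E L).
           sublamination u E I {X \<in> L. regular u E X \<and> supp u E X \<subseteq> I}) \<and>
        (\<forall>X \<in> L. regular u E X \<longrightarrow>
           (\<exists>I \<in> components_S1 (reg_support u E L). supp u E X \<subseteq> I)) \<and>
        singular_cases u E (topspace S1 - reg_support u E L) (singular_part u E L)) \<and>
     (\<forall>U. openin S1 U \<and> U \<noteq> topspace S1 \<longrightarrow>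
        (\<exists>L. lamination u E L \<and> reg_support u E L = U)) \<and>
     (\<forall>U \<L> T. openin S1 U \<and> U \<noteq> topspace S1 \<and>
        (\<forall>I \<in> components_S1 U. sublamination u E I (\<L> I)) \<and>
        singular_cases u E (topspace S1 - U) T \<longrightarrow>
        lamination u E (T \<union> (\<Union>I \<in> components_S1 U. \<L> I)))"
proof -
  interpret frob_family u E by unfold_locales (use assms in blast)+
  show ?thesis
  proof (intro conjI allI impI ballI)
    fix L assume L: "lamination u E L"
    show "openin S1 (reg_support u E L)" "reg_support u E L \<noteq> topspace S1"
      "singular_cases u E (topspace S1 - reg_support u E L) (singular_part u E L)"
      using lamination_support(1,2,5)[OF L] .
    show "sublamination u E I {X \<in> L. regular u E X \<and> supp u E X \<subseteq> I}" if "I \<in> components_S1 (reg_support u E L)" for I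
      using lamination_support(3)[OF L that] .
    show "\<exists>I \<in> components_S1 (reg_support u E L). supp u E X \<subseteq> I" if "X \<in> L" "regular u E X" for X
      using lamination_support(4)[OF L that] .
  next
    fix U assume U: "openin S1 U \<and> U \<noteq> topspace S1"
    show "\<exists>L. lamination u E L \<and> reg_support u E L = U"
      by (rule lamination_with_support[OF conjunct1[OF U] conjunct2[OF U]])
  next
    fix U \<L> T
    assume a: "openin S1 U \<and> U \<noteq> topspace S1 \<and>
        (\<forall>I \<in> components_S1 U. sublamination u E I (\<L> I)) \<and>
        singular_cases u E (topspace S1 - U) T"
    show "lamination u E (T \<union> (\<Union>I \<in> components_S1 U. \<L> I))"
      by (rule lamination_of_sublaminations) (use a in simp_all)
  qed
qed

end
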